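(* Let $\beta\in\,]0,1[$ and let $Z^\beta$ be the closure of $R^\beta(A^\beta)$ in $(B_0^*,B_1^* )^\beta$, with the norm of $(B_0^*,B_1^* )^\beta$. If $Z^\beta$ is weakly locally uniformly convex (weakly LUR), then $A^\theta=A_\theta$ for every $\theta\in\,]0,1[$.
   Context: Let $(A_0,A_1)$ be a complex interpolation couple of Banach spaces with $A_0\cap A_1$ dense in both $A_0$ and $A_1$. Then $(A_0+A_1)^*=A_0^*\cap A_1^*$ and $(A_0\cap A_1)^*=A_0^*+A_1^*$. Let $S=\{z\in\mathbb C:0\le \operatorname{Re} z\le 1\}$. For a couple $\overline{C}=(C_0,C_1)$, $\mathcal F(\overline C)$ is the space of bounded continuous $F:S\to C_0+C_1$, holomorphic in the interior, such that $\tau\mapsto F(j+i\tau)$ is continuous into $C_j$ and tends to $0$ in $C_j$ as $|\tau|\to\infty$ ($j=0,1$). Its norm is $\|F\|_{\mathcal F}=\max_j\sup_\tau\|F(j+i\tau)\|_{C_j}$. The space $C_\theta=\{F(\theta):F\in\mathcal F(\overline C)\}$ carries the quotient norm $\inf\{\|F\|_{\mathcal F}:F(\theta)=c\}$. $\mathcal G(\overline C)$ is the space of continuous $g:S\to C_0+C_1$, holomorphic in the interior, satisfying: $(1+|z|)^{-1}\|g(z)\|_{C_0+C_1}$ is bounded; $g(j+i\tau)-g(j+i\tau')\in C_j$; and $\|\dot g\|_{Q\mathcal G}=\max_j\sup_{\tau\neq\tau'}\|(g(j+i\tau)-g(j+i\tau'))/(\tau-\tau')\|_{C_j}<\infty$.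 The space $C^\theta=\{g'(\theta):g\in\mathcal G(\overline C)\}$ carries the norm $\inf\{\|\dot g\|_{Q\mathcal G}:g'(\theta)=c\}$. It is known that $A_\theta$ is isometrically a subspace of $A^\theta$. $B_j$ denotes the closure of $A_0^*\cap A_1^*$ in $A_j^*$ ($j=0,1$). Then $B_0^*+B_1^*=(B_0\cap B_1)^*=(A_0+A_1)^{**}$. For $a\in A^\theta\subset A_0+A_1$, $R^\theta(a)$ denotes the image of $a$ under the canonical embedding of $A_0+A_1$ into its bidual $B_0^*+B_1^*$. This gives an injective contraction $R^\theta:A^\theta\to(B_0^*,B_1^* )^\theta$. A Banach space $X$ is weakly LUR if, for every $x\in X$ and every sequence $(x_n)$ in $X$ with $\|x_n\|^2/2+\|x\|^2/2-\|(x_n+x)/2\|^2\to0$, one has $x_n\to x$ weakly. *)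

theory Defs
  imports "HOL-Analysis.Analysis" "HOL-Library.Function_Algebras"
begin

class cvec = ab_group_add +
  fixes scaleC :: "complex \<Rightarrow> 'a \<Rightarrow> 'a"  (infixr \<open>*\<^sub>C\<close> 75)
  assumes scaleC_add_right: "a *\<^sub>C (x + y) = a *\<^sub>C x + a *\<^sub>C y"
    and scaleC_add_left: "(a + b) *\<^sub>C x = a *\<^sub>C x + b *\<^sub>C x"
    and scaleC_scaleC: "a *\<^sub>C (b *\<^sub>C x) = (a * b) *\<^sub>C x"
    and scaleC_one: "1 *\<^sub>C x = x"

instantiation complex :: cvec
begin
definition scaleC_complex :: "complex \<Rightarrow> complex \<Rightarrow> complex" where
  "scaleC_complex a x = a * x"
instance by standard (auto simp: scaleC_complex_def algebra_simps)
end

instantiation "fun" :: (type, cvec) cvec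
begin
definition scaleC_fun :: "complex \<Rightarrow> ('a \<Rightarrow> 'b) \<Rightarrow> 'a \<Rightarrow> 'b" where
  "scaleC_fun a f = (\<lambda>x. a *\<^sub>C f x)"
instance by standard
  (auto simp: scaleC_fun_def fun_eq_iff scaleC_add_right scaleC_add_left scaleC_scaleC scaleC_one)
end

definition csubspace :: "'a::cvec set \<Rightarrow> bool" where
  "csubspace A \<longleftrightarrow> 0 \<in> A \<and> (\<forall>x\<in>A. \<forall>y\<in>A. x + y \<in> A) \<and> (\<forall>c. \<forall>x\<in>A. c *\<^sub>C x \<in> A)"

definition is_norm_on :: "'a::cvec set \<Rightarrow> ('a \<Rightarrow> real) \<Rightarrow> bool" where
  "is_norm_on A N \<longleftrightarrow> (\<forall>x\<in>A. 0 \<le> N x \<and> (N x = 0 \<longleftrightarrow> x = 0))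
     \<and> (\<forall>x\<in>A. \<forall>y\<in>A. N (x + y) \<le> N x + N y)
     \<and> (\<forall>c. \<forall>x\<in>A. N (c *\<^sub>C x) = cmod c * N x)"

definition banach_on :: "'a::cvec set \<Rightarrow> ('a \<Rightarrow> real) \<Rightarrow> bool" where
  "banach_on A N \<longleftrightarrow> csubspace A \<and> is_norm_on A N \<and>
     (\<forall>X. (\<forall>n. X n \<in> A) \<longrightarrow> (\<forall>e>0. \<exists>M. \<forall>m\<ge>M. \<forall>n\<ge>M. N (X m - X n) < e)
          \<longrightarrow> (\<exists>x\<in>A. (\<lambda>n. N (X n - x)) \<longlonglongrightarrow> 0))"

definition ncl :: "'a::cvec set \<Rightarrow> ('a \<Rightarrow> real) \<Rightarrow> 'a set \<Rightarrow> 'a set" where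
  "ncl U N E = {x \<in> U. \<forall>e>0. \<exists>y\<in>E. N (x - y) < e}"

definition ndense :: "'a::cvec set \<Rightarrow> ('a \<Rightarrow> real) \<Rightarrow> 'a set \<Rightarrow> bool" where
  "ndense U N E \<longleftrightarrow> E \<subseteq> U \<and> ncl U N E = U"

definition csum :: "'a::cvec set \<Rightarrow> 'a set \<Rightarrow> 'a set" where
  "csum C0 C1 = {a + b | a b. a \<in> C0 \<and> b \<in> C1}"

definition sumnorm :: "'a::cvec set \<Rightarrow> ('a \<Rightarrow> real) \<Rightarrow> 'a set \<Rightarrow> ('a \<Rightarrow> real) \<Rightarrow> 'a \<Rightarrow> real" where
  "sumnorm C0 M0 C1 M1 x = Inf {M0 a + M1 b | a b. a \<in> C0 \<and> b \<in> C1 \<and> x = a + b}"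

text \<open>A (compatible) Banach couple: two Banach spaces inside a common complex vector
  space such that the natural quotient seminorm on the sum is a norm (equivalently,
  both embed continuously into a common Hausdorff topological vector space).\<close>
definition banach_couple :: "'a::cvec set \<Rightarrow> ('a \<Rightarrow> real) \<Rightarrow> 'a set \<Rightarrow> ('a \<Rightarrow> real) \<Rightarrow> bool" where
  "banach_couple C0 M0 C1 M1 \<longleftrightarrow> banach_on C0 M0 \<and> banach_on C1 M1 \<and>
     (\<forall>x\<in>csum C0 C1. sumnorm C0 M0 C1 M1 x = 0 \<longrightarrow> x = 0)"

definition clinear_on :: "'a::cvec set \<Rightarrow> ('a \<Rightarrow> complex) \<Rightarrow> bool" where
  "clinear_on D f \<longleftrightarrow> (\<forall>x\<in>D. \<forall>y\<in>D. f (x + y) = f x + f y) \<and> (\<forall>c. \<forall>x\<in>D. f (c *\<^sub>C x) = c * f x)"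

text \<open>Bounded linear functionals on the (dense) subspace D w.r.t. the norm N, normalised to
  vanish outside D. When D is dense in a Banach space (U,N), this is (isometrically, via
  restriction) the dual space of U.\<close>
definition dual_on :: "'a::cvec set \<Rightarrow> ('a \<Rightarrow> real) \<Rightarrow> ('a \<Rightarrow> complex) set" where
  "dual_on D N = {f. (\<forall>x. x \<notin> D \<longrightarrow> f x = 0) \<and> clinear_on D f \<and> (\<exists>C. \<forall>x\<in>D. cmod (f x) \<le> C * N x)}"

definition dnorm :: "'a::cvec set \<Rightarrow> ('a \<Rightarrow> real) \<Rightarrow> ('a \<Rightarrow> complex) \<Rightarrow> real" where
  "dnorm D N f = Sup {cmod (f x) | x. x \<in> D \<and> N x \<le> 1}"

definition strip :: "complex set" where
  "strip = {z. 0 \<le> Re z \<and> Re z \<le> 1}"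

definition has_nderiv :: "('a::cvec \<Rightarrow> real) \<Rightarrow> (complex \<Rightarrow> 'a) \<Rightarrow> complex \<Rightarrow> 'a \<Rightarrow> bool" where
  "has_nderiv N g z d \<longleftrightarrow> ((\<lambda>h. N (g (z + h) - g z - h *\<^sub>C d) / cmod h) \<longlongrightarrow> 0) (at 0)"

definition ncont_on :: "('a::cvec \<Rightarrow> real) \<Rightarrow> 'b::metric_space set \<Rightarrow> ('b \<Rightarrow> 'a) \<Rightarrow> bool" where
  "ncont_on N T g \<longleftrightarrow> (\<forall>z\<in>T. ((\<lambda>w. N (g w - g z)) \<longlongrightarrow> 0) (at z within T))"

definition bnd :: "nat \<Rightarrow> real \<Rightarrow> complex" where "bnd j \<tau> = (of_nat j :: complex) + \<i> * of_real \<tau>"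

definition Fspace :: "'a::cvec set \<Rightarrow> ('a \<Rightarrow> real) \<Rightarrow> 'a set \<Rightarrow> ('a \<Rightarrow> real) \<Rightarrow> (complex \<Rightarrow> 'a) set" where
  "Fspace C0 M0 C1 M1 = {F.
     (\<forall>z\<in>strip. F z \<in> csum C0 C1) \<and>
     (\<exists>K. \<forall>z\<in>strip. sumnorm C0 M0 C1 M1 (F z) \<le> K) \<and>
     ncont_on (sumnorm C0 M0 C1 M1) strip F \<and>
     (\<forall>z. 0 < Re z \<and> Re z < 1 \<longrightarrow> (\<exists>d\<in>csum C0 C1. has_nderiv (sumnorm C0 M0 C1 M1) F z d)) \<and>
     (\<forall>\<tau>. F (bnd 0 \<tau>) \<in> C0 \<and> F (bnd 1 \<tau>) \<in> C1) \<and>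
     ncont_on M0 UNIV (\<lambda>\<tau>. F (bnd 0 \<tau>)) \<and> ncont_on M1 UNIV (\<lambda>\<tau>. F (bnd 1 \<tau>)) \<and>
     ((\<lambda>\<tau>. M0 (F (bnd 0 \<tau>))) \<longlongrightarrow> 0) at_infinity \<and>
     ((\<lambda>\<tau>. M1 (F (bnd 1 \<tau>))) \<longlongrightarrow> 0) at_infinity}"

definition lower :: "'a::cvec set \<Rightarrow> ('a \<Rightarrow> real) \<Rightarrow> 'a set \<Rightarrow> ('a \<Rightarrow> real) \<Rightarrow> real \<Rightarrow> 'a set" where
  "lower C0 M0 C1 M1 \<theta> = {F (of_real \<theta>) | F. F \<in> Fspace C0 M0 C1 M1}"

definition Gspace :: "'a::cvec set \<Rightarrow> ('a \<Rightarrow> real) \<Rightarrow> 'a set \<Rightarrow> ('a \<Rightarrow> real) \<Rightarrow> (complex \<Rightarrow> 'a) set" where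
  "Gspace C0 M0 C1 M1 = {g.
     (\<forall>z\<in>strip. g z \<in> csum C0 C1) \<and>
     ncont_on (sumnorm C0 M0 C1 M1) strip g \<and>
     (\<forall>z. 0 < Re z \<and> Re z < 1 \<longrightarrow> (\<exists>d\<in>csum C0 C1. has_nderiv (sumnorm C0 M0 C1 M1) g z d)) \<and>
     (\<exists>K. \<forall>z\<in>strip. sumnorm C0 M0 C1 M1 (g z) \<le> K * (1 + cmod z)) \<and>
     (\<forall>\<tau> \<tau>'. g (bnd 0 \<tau>) - g (bnd 0 \<tau>') \<in> C0 \<and> g (bnd 1 \<tau>) - g (bnd 1 \<tau>') \<in> C1) \<and>
     (\<exists>L. \<forall>\<tau> \<tau>'. \<tau> \<noteq> \<tau>' \<longrightarrow>
         M0 ((1 / of_real (\<tau> - \<tau>')) *\<^sub>C (g (bnd 0 \<tau>) - g (bnd 0 \<tau>'))) \<le> L \<and>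
         M1 ((1 / of_real (\<tau> - \<tau>')) *\<^sub>C (g (bnd 1 \<tau>) - g (bnd 1 \<tau>'))) \<le> L)}"

definition Gnorm :: "'a::cvec set \<Rightarrow> ('a \<Rightarrow> real) \<Rightarrow> 'a set \<Rightarrow> ('a \<Rightarrow> real) \<Rightarrow> (complex \<Rightarrow> 'a) \<Rightarrow> real" where
  "Gnorm C0 M0 C1 M1 g = Sup
     ({M0 ((1 / of_real (\<tau> - \<tau>')) *\<^sub>C (g (bnd 0 \<tau>) - g (bnd 0 \<tau>'))) | \<tau> \<tau>'. \<tau> \<noteq> \<tau>'} \<union>
      {M1 ((1 / of_real (\<tau> - \<tau>')) *\<^sub>C (g (bnd 1 \<tau>) - g (bnd 1 \<tau>'))) | \<tau> \<tau>'. \<tau> \<noteq> \<tau>'})"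

definition gderiv :: "'a::cvec set \<Rightarrow> ('a \<Rightarrow> real) \<Rightarrow> 'a set \<Rightarrow> ('a \<Rightarrow> real) \<Rightarrow> (complex \<Rightarrow> 'a) \<Rightarrow> complex \<Rightarrow> 'a" where
  "gderiv C0 M0 C1 M1 g z = (THE d. d \<in> csum C0 C1 \<and> has_nderiv (sumnorm C0 M0 C1 M1) g z d)"

definition upper :: "'a::cvec set \<Rightarrow> ('a \<Rightarrow> real) \<Rightarrow> 'a set \<Rightarrow> ('a \<Rightarrow> real) \<Rightarrow> real \<Rightarrow> 'a set" where
  "upper C0 M0 C1 M1 \<theta> = {gderiv C0 M0 C1 M1 g (of_real \<theta>) | g. g \<in> Gspace C0 M0 C1 M1}"

definition upper_norm :: "'a::cvec set \<Rightarrow> ('a \<Rightarrow> real) \<Rightarrow> 'a set \<Rightarrow> ('a \<Rightarrow> real) \<Rightarrow> real \<Rightarrow> 'a \<Rightarrow> real" where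
  "upper_norm C0 M0 C1 M1 \<theta> c =
     Inf {Gnorm C0 M0 C1 M1 g | g. g \<in> Gspace C0 M0 C1 M1 \<and> gderiv C0 M0 C1 M1 g (of_real \<theta>) = c}"

text \<open>A_j^* represented on D = A0 \<inter> A1; B_j = closure of A_0^* \<inter> A_1^* in A_j^*.\<close>
definition Bsp :: "'a::cvec set \<Rightarrow> ('a \<Rightarrow> real) \<Rightarrow> 'a set \<Rightarrow> ('a \<Rightarrow> real) \<Rightarrow> nat \<Rightarrow> ('a \<Rightarrow> complex) set" where
  "Bsp A0 N0 A1 N1 j =
     (let D = A0 \<inter> A1; Nj = (if j = 0 then N0 else N1)
      in ncl (dual_on D Nj) (dnorm D Nj) (dual_on D N0 \<inter> dual_on D N1))"

definition Bnorm :: "'a::cvec set \<Rightarrow> ('a \<Rightarrow> real) \<Rightarrow> 'a set \<Rightarrow> ('a \<Rightarrow> real) \<Rightarrow> nat \<Rightarrow> ('a \<Rightarrow> complex) \<Rightarrow> real" where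
  "Bnorm A0 N0 A1 N1 j = dnorm (A0 \<inter> A1) (if j = 0 then N0 else N1)"

text \<open>B_j^* represented on B0 \<inter> B1 (dense in B_j).\<close>
definition Bdual :: "'a::cvec set \<Rightarrow> ('a \<Rightarrow> real) \<Rightarrow> 'a set \<Rightarrow> ('a \<Rightarrow> real) \<Rightarrow> nat \<Rightarrow> (('a \<Rightarrow> complex) \<Rightarrow> complex) set" where
  "Bdual A0 N0 A1 N1 j =
     dual_on (Bsp A0 N0 A1 N1 0 \<inter> Bsp A0 N0 A1 N1 1) (Bnorm A0 N0 A1 N1 j)"

definition Bdnorm :: "'a::cvec set \<Rightarrow> ('a \<Rightarrow> real) \<Rightarrow> 'a set \<Rightarrow> ('a \<Rightarrow> real) \<Rightarrow> nat \<Rightarrow> (('a \<Rightarrow> complex) \<Rightarrow> complex) \<Rightarrow> real" where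
  "Bdnorm A0 N0 A1 N1 j =
     dnorm (Bsp A0 N0 A1 N1 0 \<inter> Bsp A0 N0 A1 N1 1) (Bnorm A0 N0 A1 N1 j)"

text \<open>Value of a functional phi (given on A0 \<inter> A1, continuous for the sum norm) at a point
  a of A0 + A1, obtained by continuous extension.\<close>
definition extval :: "'a::cvec set \<Rightarrow> ('a \<Rightarrow> real) \<Rightarrow> 'a set \<Rightarrow> ('a \<Rightarrow> real) \<Rightarrow> ('a \<Rightarrow> complex) \<Rightarrow> 'a \<Rightarrow> complex" where
  "extval A0 N0 A1 N1 \<phi> a = (THE c. \<forall>e>0. \<exists>\<delta>>0. \<forall>d\<in>A0 \<inter> A1.
       sumnorm A0 N0 A1 N1 (a - d) < \<delta> \<longrightarrow> cmod (\<phi> d - c) < e)"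

text \<open>Canonical embedding of A0 + A1 into its bidual B_0^* + B_1^* = (B0 \<inter> B1)^*.\<close>
definition Rmap :: "'a::cvec set \<Rightarrow> ('a \<Rightarrow> real) \<Rightarrow> 'a set \<Rightarrow> ('a \<Rightarrow> real) \<Rightarrow> 'a \<Rightarrow> (('a \<Rightarrow> complex) \<Rightarrow> complex)" where
  "Rmap A0 N0 A1 N1 a = (\<lambda>\<phi>. if \<phi> \<in> Bsp A0 N0 A1 N1 0 \<inter> Bsp A0 N0 A1 N1 1
                               then extval A0 N0 A1 N1 \<phi> a else 0)"

definition weakly_conv :: "'a::cvec set \<Rightarrow> ('a \<Rightarrow> real) \<Rightarrow> (nat \<Rightarrow> 'a) \<Rightarrow> 'a \<Rightarrow> bool" where
  "weakly_conv X N xs x \<longleftrightarrow> (\<forall>L. clinear_on X L \<and> (\<exists>C. \<forall>y\<in>X. cmod (L y) \<le> C * N y)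
      \<longrightarrow> (\<lambda>n. L (xs n)) \<longlonglongrightarrow> L x)"

definition weakly_LUR :: "'a::cvec set \<Rightarrow> ('a \<Rightarrow> real) \<Rightarrow> bool" where
  "weakly_LUR X N \<longleftrightarrow> (\<forall>x\<in>X. \<forall>xs. (\<forall>n. xs n \<in> X) \<longrightarrow>
      (\<lambda>n. (N (xs n))\<^sup>2 / 2 + (N x)\<^sup>2 / 2 - (N ((1/2) *\<^sub>C (xs n + x)))\<^sup>2) \<longlonglongrightarrow> 0
      \<longrightarrow> weakly_conv X N xs x)"

end

theory Submission
  imports Defs "HOL-Complex_Analysis.Complex_Analysis" "HOL-Real_Asymp.Real_Asymp"
begin

text \<open>Let \<open>g \<in> \<G>(A)\<close>. The difference quotients of \<open>g\<close> in the direction \<open>\<i>\<close>, multiplied by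
  \<open>exp ((z - \<theta>)\<^sup>2)\<close>, lie in \<open>\<F>(A)\<close> and converge to \<open>g' \<theta>\<close> at \<open>\<theta>\<close>, so it is enough that they are
  Cauchy in the quotient norm at \<open>\<theta>\<close>.

  If they were not, Hahn-Banach would give functionals on bounded boundary functions that annihilate
  all \<open>F \<in> \<F>(A)\<close> with \<open>F \<theta> = 0\<close>. Smoothing such a functional by a Gaussian turns it into an analytic
  kernel \<open>K\<close> with values in \<open>A\<^sub>0\<^sup>* \<inter> A\<^sub>1\<^sup>*\<close>, whose boundary values are integrable in the respective
  dual norms and which still detects the distance at \<open>\<theta>\<close>. Pairing the differences of quotients with
  these kernels gives a locally bounded sequence of scalar analytic functions, which by Montel's
  theorem tends to \<open>0\<close> everywhere once it tends to \<open>0\<close> on a dense subset of the line \<open>Re z = \<beta>\<close>.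

  On that line the weak LUR hypothesis applies to \<open>v t = R (g' (\<beta> + \<i> t))\<close>. The norms
  \<open>\<parallel>v t - s\<parallel>\<close> are lower semicontinuous in \<open>t\<close>, so by Baire's theorem countably many of them have
  a dense set of common continuity points \<open>t\<close>. Weak LUR puts \<open>v t\<close> in the closed span of the
  values of \<open>v\<close> at rational points, hence \<open>v\<close> is norm continuous at these \<open>t\<close>, and the difference
  quotients converge there.\<close>

subsection \<open>Complex Hahn-Banach theorem\<close>

text \<open>The Lipschitz boundary values of \<open>g\<close> need not be differentiable in norm, so
  membership in the lower space cannot be read off boundary derivatives; the difference quotients
  are merely bounded. The obstacle is to carry norm convergence from the line
  \<open>Re z = \<beta>\<close> to the point \<open>\<theta>\<close>. Kernels do this: since their
  boundary integrals are at most \<open>1\<close>, a pairing is bounded by the boundary norms of the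
  paired function and the distance to the two lines, with the same constant for all kernels. A
  normal family argument therefore works although the kernel changes with each pair of quotients.
  Functionals live on arbitrary bounded boundary functions because these can be cut off to one line,
  which \<open>Fspace\<close> does not permit; annihilation then links the two pieces. The bidual
  enters because balls in the upper space of a dual couple are weak-star closed. This gives both the
  lower semicontinuity along the line and the meaning of averages of \<open>v\<close>, which is only
  known to be weak-star continuous. A Cauchy property is enough at the end, since
  \<open>Fspace\<close> is complete.\<close>

interpretation cvec: module "scaleC :: complex => 'a::cvec => 'a"
  by standard (simp_all add: scaleC_add_right scaleC_add_left scaleC_scaleC scaleC_one)

lemma csubspace_0: "csubspace V ==> 0 \<in> V"
  and csubspace_add: "csubspace V ==> x \<in> V ==> y \<in> V ==> x + y \<in> V"
  and csubspace_scale: "csubspace V ==> x \<in> V ==> c *\<^sub>C x \<in> V"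
  by (simp_all add: csubspace_def)

lemma csubspace_neg: "csubspace V ==> x \<in> V ==> - x \<in> V"
  using csubspace_scale[of V x "-1"] by simp

lemma csubspace_diff: "csubspace V ==> x \<in> V ==> y \<in> V ==> x - y \<in> V"
  using csubspace_add[of V x "-y"] csubspace_neg[of V y] by simp

lemma csubspace_sum: "csubspace V ==> (!!i. i \<in> I ==> f i \<in> V) ==> sum f I \<in> V"
  by (induction I rule: infinite_finite_induct) (auto simp: csubspace_0 csubspace_add)

definition seminorm_on :: "'a::cvec set => ('a => real) => bool" where
  "seminorm_on V p \<longleftrightarrow> (\<forall>x\<in>V. 0 <= p x) \<and> (\<forall>x\<in>V. \<forall>y\<in>V. p (x + y) <= p x + p y)
     \<and> (\<forall>c. \<forall>x\<in>V. p (c *\<^sub>C x) = cmod c * p x)"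

definition sublinear_on :: "'a::cvec set => ('a => real) => bool" where
  "sublinear_on V q \<longleftrightarrow> (\<forall>x\<in>V. \<forall>y\<in>V. q (x + y) <= q x + q y)
     \<and> (\<forall>r\<ge>0. \<forall>x\<in>V. q (of_real r *\<^sub>C x) = r * q x)"

lemma sublinear_0: assumes "csubspace V" "sublinear_on V q" shows "q 0 = 0"
proof -
  have "q (of_real 0 *\<^sub>C 0) = 0 * q 0"
    using assms csubspace_0 unfolding sublinear_on_def by blast
  then show ?thesis by simp
qed

lemma sublinear_neg: assumes "csubspace V" "sublinear_on V q" "x \<in> V" shows "- q (- x) <= q x"
proof -
  have "q (x + - x) <= q x + q (- x)"
    using assms csubspace_neg unfolding sublinear_on_def by blast
  then show ?thesis using sublinear_0[OF assms(1,2)] by simp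
qed

text \<open>Lowering \<open>q\<close> along the ray through \<open>y\<close> replaces the usual
  extension from a line: a linear functional below the result is at most \<open>- q y\<close> at
  \<open>- y\<close>, and so takes exactly the value \<open>q y\<close> at \<open>y\<close>.\<close>

definition tilt :: "('a::cvec => real) => 'a => 'a => real" where
  "tilt q y x = (INF t\<in>{0..}. q (x + of_real t *\<^sub>C y) - t * q y)"

lemma tilt:
  assumes V: "csubspace V" and q: "sublinear_on V q" and y: "y \<in> V"
  shows "sublinear_on V (tilt q y)" "!!x. x \<in> V ==> tilt q y x <= q x" "tilt q y (- y) <= - q y"
proof -
  have sub: "q (x + z) <= q x + q z" if "x \<in> V" "z \<in> V" for x z
    using q that unfolding sublinear_on_def by blast
  have hom: "q (of_real r *\<^sub>C x) = r * q x" if "r >= 0" "x \<in> V" for r x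
    using q that unfolding sublinear_on_def by blast
  have inV: "x + of_real t *\<^sub>C y \<in> V" if "x \<in> V" for x t
    using V y that by (simp add: csubspace_add csubspace_scale)
  have lb: "- q (- x) <= q (x + of_real t *\<^sub>C y) - t * q y" if "x \<in> V" "t >= 0" for x t
  proof -
    have "q ((x + of_real t *\<^sub>C y) + - x) <= q (x + of_real t *\<^sub>C y) + q (- x)"
      using sub inV V that csubspace_neg by blast
    then show ?thesis using hom[OF that(2) y] by simp
  qed
  have bdd: "bdd_below ((%t. q (x + of_real t *\<^sub>C y) - t * q y) ` {0..})" if "x \<in> V" for x
    by (rule bdd_belowI[of _ "- q (- x)"]) (use lb[OF that] in auto)
  have le: "tilt q y x <= q (x + of_real t *\<^sub>C y) - t * q y" if "x \<in> V" "t >= 0" for x t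
    unfolding tilt_def by (rule cINF_lower[OF bdd[OF that(1)]]) (use that in auto)
  have ge: "c <= tilt q y x" if "!!t. t >= 0 ==> c <= q (x + of_real t *\<^sub>C y) - t * q y" for c x
    unfolding tilt_def by (rule cINF_greatest) (use that in auto)
  show le0: "tilt q y x <= q x" if "x \<in> V" for x
    using le[OF that, of 0] by simp
  show "tilt q y (- y) <= - q y"
    using le[OF csubspace_neg[OF V y], of 1] sublinear_0[OF V q] by simp
  have add: "tilt q y (x + z) <= tilt q y x + tilt q y z" if x: "x \<in> V" and z: "z \<in> V" for x z
  proof -
    have 1: "tilt q y (x + z) - (q (z + of_real s *\<^sub>C y) - s * q y) <= tilt q y x" if "s >= 0" for s
    proof (rule ge)
      fix t :: real assume t: "t >= 0"
      have "(x + of_real t *\<^sub>C y) + (z + of_real s *\<^sub>C y) = (x + z) + of_real (t + s) *\<^sub>C y"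
        by (simp add: scaleC_add_left)
      then have "q ((x + z) + of_real (t + s) *\<^sub>C y) <= q (x + of_real t *\<^sub>C y) + q (z + of_real s *\<^sub>C y)"
        using sub[OF inV[OF x] inV[OF z]] by metis
      moreover have "tilt q y (x + z) <= q ((x + z) + of_real (t + s) *\<^sub>C y) - (t + s) * q y"
        using le V x z t that csubspace_add by (metis add_nonneg_nonneg)
      ultimately show "tilt q y (x + z) - (q (z + of_real s *\<^sub>C y) - s * q y) <= q (x + of_real t *\<^sub>C y) - t * q y"
        by (simp add: algebra_simps)
    qed
    have "tilt q y (x + z) - tilt q y x <= tilt q y z"
      by (rule ge) (use 1 in \<open>auto simp: algebra_simps\<close>)
    then show ?thesis by simp
  qed
  have homt: "tilt q y (of_real r *\<^sub>C x) = r * tilt q y x" if r: "r >= 0" and x: "x \<in> V" for r x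
  proof (cases "r = 0")
    case True
    have "0 <= tilt q y 0"
      by (rule ge) (use hom y in auto)
    then have "tilt q y 0 = 0" using le0[of 0] csubspace_0[OF V] sublinear_0[OF V q] by simp
    then show ?thesis using True by simp
  next
    case False
    then have r: "r > 0" using r by simp
    have eq: "of_real r *\<^sub>C x + of_real (r * t) *\<^sub>C y = of_real r *\<^sub>C (x + of_real t *\<^sub>C y)" for t
      by (simp add: scaleC_add_right scaleC_scaleC)
    have "tilt q y (of_real r *\<^sub>C x) / r <= tilt q y x"
    proof (rule ge)
      fix t :: real assume t: "t >= 0"
      have "tilt q y (of_real r *\<^sub>C x) <= q (of_real r *\<^sub>C x + of_real (r * t) *\<^sub>C y) - (r * t) * q y"
        using le[OF csubspace_scale[OF V x], of "r * t" "of_real r"] r t by simp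
      also have "\<dots> = r * (q (x + of_real t *\<^sub>C y) - t * q y)"
        unfolding eq using hom[of r "x + of_real t *\<^sub>C y"] r inV[OF x] by (simp add: algebra_simps)
      finally show "tilt q y (of_real r *\<^sub>C x) / r <= q (x + of_real t *\<^sub>C y) - t * q y"
        using r by (simp add: pos_divide_le_eq mult.commute)
    qed
    moreover have "r * tilt q y x <= tilt q y (of_real r *\<^sub>C x)"
    proof (rule ge)
      fix t :: real assume t: "t >= 0"
      have "r * tilt q y x <= r * (q (x + of_real (t/r) *\<^sub>C y) - (t/r) * q y)"
        using le[OF x, of "t/r"] r t by (intro mult_left_mono) auto
      also have "\<dots> = q (of_real r *\<^sub>C x + of_real (r * (t/r)) *\<^sub>C y) - t * q y"
        unfolding eq using hom[OF _ inV[OF x], of r "t/r"] r by (simp add: algebra_simps)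
      finally show "r * tilt q y x <= q (of_real r *\<^sub>C x + of_real t *\<^sub>C y) - t * q y"
        using r by simp
    qed
    ultimately show ?thesis using r by (simp add: pos_divide_le_eq mult.commute)
  qed
  show "sublinear_on V (tilt q y)"
    unfolding sublinear_on_def using add homt by blast
qed

text \<open>Zorn's lemma gives a minimal sublinear functional below \<open>p\<close>. Minimality
  makes it equal to each of its own tilts, hence odd, and an odd sublinear functional is real
  linear.\<close>

lemma minimal_sublinear:
  assumes V: "csubspace V" and p: "sublinear_on V p"
  obtains f where "!!x. x \<in> V ==> f x <= p x"
    "!!x y. x \<in> V ==> y \<in> V ==> f (x + y) = f x + f y"
    "!!r x. x \<in> V ==> f (of_real r *\<^sub>C x) = r * f x"
proof -
  \<comment> \<open>The value \<open>0\<close> outside \<open>V\<close> keeps infima over chains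
    bounded below there; inside \<open>V\<close> the bound is \<open>- p (- x)\<close>.\<close>
  define A where "A = {q. sublinear_on V q \<and> (\<forall>x\<in>V. q x <= p x) \<and> (\<forall>x. x \<notin> V \<longrightarrow> q x = 0)}"
  \<comment> \<open>The order is reversed, so a maximal element in the sense of Zorn's lemma is a
    minimal functional.\<close>
  define P where "P = (%q q' :: 'a => real. \<forall>x. q' x <= q x)"
  have restr: "sublinear_on V (%x. if x \<in> V then q x else 0)" if "sublinear_on V q" for q
    using that V unfolding sublinear_on_def by (simp add: csubspace_add csubspace_scale)
  have "\<exists>m\<in>A. \<forall>a\<in>A. P m a \<longrightarrow> a = m"
  proof (rule predicate_Zorn)
    show "partial_order_on A (relation_of P A)"
      by (rule partial_order_on_relation_ofI) (auto simp: P_def fun_eq_iff intro: order_trans antisym)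
  next
    fix C assume C: "C \<in> Chains (relation_of P A)"
    have CA: "C \<subseteq> A" and tot: "!!a b. a \<in> C ==> b \<in> C ==> P a b \<or> P b a"
      using C unfolding Chains_def relation_of_def by auto
    show "\<exists>u\<in>A. \<forall>a\<in>C. P a u"
    proof (cases "C = {}")
      case True
      have "(%x. if x \<in> V then p x else 0) \<in> A" unfolding A_def using restr[OF p] by auto
      then show ?thesis using True by auto
    next
      case False
      define u where "u = (%x. INF q\<in>C. q x)"
      have bdd: "bdd_below ((%q. q x) ` C)" for x
      proof (cases "x \<in> V")
        case True
        have "- p (- x) <= q x" if "q \<in> C" for q
        proof -
          have "q \<in> A" using that CA by auto
          then have "- q (- x) <= q x" "q (- x) <= p (- x)"
            using sublinear_neg[OF V _ True] V True csubspace_neg unfolding A_def by auto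
          then show ?thesis by linarith
        qed
        then show ?thesis by (auto intro!: bdd_belowI[of _ "- p (- x)"])
      next
        case False
        then have "q x = 0" if "q \<in> C" for q using that CA unfolding A_def by auto
        then show ?thesis by (intro bdd_belowI2[of _ 0]) fastforce
      qed
      have le: "u x <= q x" if "q \<in> C" for q x
        unfolding u_def by (rule cINF_lower[OF bdd that])
      have ge: "c <= u x" if "!!q. q \<in> C ==> c <= q x" for c x
        unfolding u_def by (rule cINF_greatest) (use False that in auto)
      have sl: "sublinear_on V q" if "q \<in> C" for q using that CA unfolding A_def by auto
      have add: "u (x + y) <= u x + u y" if x: "x \<in> V" and y: "y \<in> V" for x y
      proof -
        have 1: "u (x + y) - q' y <= u x" if q': "q' \<in> C" for q'
        proof (rule ge)
          fix q assume q: "q \<in> C"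
          \<comment> \<open>The smaller of two members of the chain serves both points at
            once.\<close>
          have "\<exists>r\<in>C. r x <= q x \<and> r y <= q' y"
            using tot[OF q q'] q q' unfolding P_def by blast
          then obtain r where r: "r \<in> C" "r x <= q x" "r y <= q' y" by blast
          have "u (x + y) <= r (x + y)" using le r by blast
          also have "\<dots> <= r x + r y" using sl[OF r(1)] x y unfolding sublinear_on_def by blast
          finally show "u (x + y) - q' y <= q x" using r by linarith
        qed
        have "u (x + y) - u x <= u y" by (rule ge) (use 1 in \<open>auto simp: algebra_simps\<close>)
        then show ?thesis by simp
      qed
      have hom: "u (of_real r *\<^sub>C x) = r * u x" if r: "r >= 0" and x: "x \<in> V" for r x
      proof -
        have e: "q (of_real r *\<^sub>C x) = r * q x" if "q \<in> C" for q
          using sl[OF that] r x unfolding sublinear_on_def by blast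
        show ?thesis
        proof (cases "r = 0")
          case r0: True
          have "(%q. q (of_real r *\<^sub>C x)) ` C = (%q. 0) ` C"
            by (rule image_cong[OF refl], subst e, assumption, simp only: r0 mult_zero_left)
          then show ?thesis using r0 \<open>C \<noteq> {}\<close> unfolding u_def by simp
        next
          case False
          then have r: "r > 0" using r by simp
          have "r * u x <= u (of_real r *\<^sub>C x)"
            by (rule ge, subst e, assumption, rule mult_left_mono, rule le) (use r in auto)
          moreover have "u (of_real r *\<^sub>C x) / r <= u x"
          proof (rule ge)
            fix q assume q: "q \<in> C"
            show "u (of_real r *\<^sub>C x) / r <= q x"
              using le[OF q, of "of_real r *\<^sub>C x"] e[OF q] r by (simp add: pos_divide_le_eq mult.commute)
          qed
          ultimately show ?thesis using r by (simp add: pos_divide_le_eq mult.commute)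
        qed
      qed
      obtain q0 where q0: "q0 \<in> C" using False by auto
      have "u \<in> A"
        unfolding A_def sublinear_on_def
      proof (safe)
        fix x assume "x \<in> V"
        have "q0 x <= p x" using \<open>x \<in> V\<close> q0 CA unfolding A_def by blast
        then show "u x <= p x" using le[OF q0, of x] by linarith
      next
        fix x assume "x \<notin> V"
        then have z: "q x = 0" if "q \<in> C" for q using that CA unfolding A_def by auto
        have "(%q. q x) ` C = (%q. 0) ` C" by (rule image_cong[OF refl z])
        then show "u x = 0" unfolding u_def using False by simp
      qed (use add hom in auto)
      then show ?thesis using le unfolding P_def by blast
    qed
  qed
  then obtain m where mA: "m \<in> A" and min: "!!a. a \<in> A ==> P m a ==> a = m" by blast
  have m: "sublinear_on V m" and mp: "!!x. x \<in> V ==> m x <= p x" and m0: "!!x. x \<notin> V ==> m x = 0"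
    using mA unfolding A_def by auto
  have neg: "m (- y) <= - m y" if y: "y \<in> V" for y
  proof -
    define t where "t = (%x. if x \<in> V then tilt m y x else 0)"
    have "t \<in> A" unfolding A_def t_def
      using restr[OF tilt(1)[OF V m y]] tilt(2)[OF V m y] mp by (auto intro: order_trans)
    moreover have "P m t" unfolding P_def t_def using tilt(2)[OF V m y] m0 by auto
    ultimately have "t = m" using min by blast
    then have "m (- y) = t (- y)" by simp
    then show ?thesis using tilt(3)[OF V m y] csubspace_neg[OF V y] by (simp add: t_def)
  qed
  have neq: "m (- y) = - m y" if "y \<in> V" for y
    using neg[OF that] sublinear_neg[OF V m that] by linarith
  have add: "m (x + y) = m x + m y" if x: "x \<in> V" and y: "y \<in> V" for x y
  proof -
    have "m (x + y) <= m x + m y" using m x y unfolding sublinear_on_def by blast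
    moreover have "m (- x + - y) <= m (- x) + m (- y)"
      using m csubspace_neg[OF V x] csubspace_neg[OF V y] unfolding sublinear_on_def by blast
    moreover have "m (- x + - y) = - m (x + y)"
      using neq[OF csubspace_add[OF V x y]] by simp
    ultimately show ?thesis using neq x y by simp
  qed
  have hom: "m (of_real r *\<^sub>C x) = r * m x" if x: "x \<in> V" for r x
  proof (cases "r >= 0")
    case True
    then show ?thesis using m x unfolding sublinear_on_def by blast
  next
    case False
    have "m (of_real (- r) *\<^sub>C x) = - r * m x" using m x False unfolding sublinear_on_def
      by (metis linorder_not_le neg_0_le_iff_le order_less_imp_le)
    moreover have "m (of_real (- r) *\<^sub>C x) = - m (of_real r *\<^sub>C x)"
      using neq[OF csubspace_scale[OF V x, of "of_real r"]] by simp
    ultimately show ?thesis by simp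
  qed
  show ?thesis using that[of m] mp add hom by blast
qed

lemma clinear_onD:
  assumes "clinear_on V L"
  shows "x \<in> V ==> y \<in> V ==> L (x + y) = L x + L y" "x \<in> V ==> L (c *\<^sub>C x) = c * L x"
  using assms unfolding clinear_on_def by auto

lemma clinear_on_0: "csubspace V ==> clinear_on V L ==> L 0 = 0"
  using clinear_onD(2)[of V L 0 0] csubspace_0[of V] by simp

lemma clinear_on_neg: "clinear_on V L ==> x \<in> V ==> L (- x) = - L x"
  using clinear_onD(2)[of V L x "-1"] by simp

lemma clinear_on_diff: "csubspace V ==> clinear_on V L ==> x \<in> V ==> y \<in> V ==> L (x - y) = L x - L y"
  using clinear_onD(1)[of V L x "-y"] clinear_on_neg[of V L y] csubspace_neg[of V y] by simp

lemma clinear_on_sum: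
  assumes "csubspace V" "clinear_on V L" "!!i. i \<in> I ==> f i \<in> V"
  shows "L (sum f I) = (\<Sum>i\<in>I. L (f i))"
  using assms(3)
proof (induction I rule: infinite_finite_induct)
  case (insert i I)
  then show ?case using clinear_onD(1)[OF assms(2), of "f i" "sum f I"] csubspace_sum[OF assms(1), of I f]
    by simp
qed (use clinear_on_0[OF assms(1,2)] in auto)

lemma seminorm_diff_commute:
  assumes "csubspace V" "seminorm_on V p" "x \<in> V" "y \<in> V"
  shows "p (x - y) = p (y - x)"
proof -
  have "p ((-1) *\<^sub>C (y - x)) = cmod (-1) * p (y - x)"
    using assms csubspace_diff unfolding seminorm_on_def by blast
  then show ?thesis by simp
qed

lemma seminorm_0: assumes "csubspace V" "seminorm_on V p" shows "p 0 = 0"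
proof -
  have "p (0 *\<^sub>C 0) = cmod 0 * p 0"
    using assms csubspace_0 unfolding seminorm_on_def by blast
  then show ?thesis by simp
qed

text \<open>The quotient seminorm modulo \<open>M\<close>. A functional dominated by it vanishes on
  \<open>M\<close>, which builds annihilation into the Hahn-Banach theorem.\<close>

lemma dist_seminorm:
  assumes V: "csubspace V" and p: "seminorm_on V p" and M: "csubspace M" "M \<subseteq> V"
  defines "q \<equiv> %x. INF m\<in>M. p (x - m)"
  shows "seminorm_on V q" "!!x. x \<in> V ==> q x <= p x" "!!m. m \<in> M ==> q m = 0"
    "!!x d. (!!m. m \<in> M ==> d <= p (x - m)) ==> d <= q x"
proof -
  have M0: "0 \<in> M" using M csubspace_0 by blast
  have pos: "0 <= p x" if "x \<in> V" for x using p that unfolding seminorm_on_def by blast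
  have tri: "p (x + y) <= p x + p y" if "x \<in> V" "y \<in> V" for x y using p that unfolding seminorm_on_def by blast
  have hom: "p (c *\<^sub>C x) = cmod c * p x" if "x \<in> V" for c x using p that unfolding seminorm_on_def by blast
  have dV: "x - m \<in> V" if "x \<in> V" "m \<in> M" for x m using V M that csubspace_diff by blast
  have le: "q x <= p (x - m)" if "x \<in> V" "m \<in> M" for x m
    unfolding q_def by (rule cINF_lower[OF bdd_belowI[of _ 0]]) (use that pos dV in auto)
  show ge: "d <= q x" if "!!m. m \<in> M ==> d <= p (x - m)" for d x
    unfolding q_def by (rule cINF_greatest) (use M0 that in auto)
  show "q x <= p x" if "x \<in> V" for x using le[OF that M0] by simp
  have qpos: "0 <= q x" if "x \<in> V" for x by (rule ge) (use pos dV that in auto)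
  show "q m = 0" if "m \<in> M" for m
    using le[of m m] qpos[of m] that M seminorm_0[OF V p] by auto
  have add: "q (x + y) <= q x + q y" if x: "x \<in> V" and y: "y \<in> V" for x y
  proof -
    have 1: "q (x + y) - p (y - m') <= q x" if m': "m' \<in> M" for m'
    proof (rule ge)
      fix m assume m: "m \<in> M"
      have "q (x + y) <= p ((x + y) - (m + m'))"
        using le V M x y m m' csubspace_add by blast
      also have "\<dots> = p ((x - m) + (y - m'))" by (simp add: algebra_simps)
      also have "\<dots> <= p (x - m) + p (y - m')" using tri dV x y m m' by blast
      finally show "q (x + y) - p (y - m') <= p (x - m)" by simp
    qed
    have "q (x + y) - q x <= q y" by (rule ge) (use 1 in \<open>auto simp: algebra_simps\<close>)
    then show ?thesis by simp
  qed
  have half: "cmod c * q x <= q (c *\<^sub>C x)" if x: "x \<in> V" for c x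
  proof (cases "c = 0")
    case True then show ?thesis using qpos csubspace_0[OF V] by simp
  next
    case False
    show ?thesis
    proof (rule ge)
      fix m assume m: "m \<in> M"
      have "cmod c * q x <= cmod c * p (x - (1/c) *\<^sub>C m)"
        using le[OF x, of "(1/c) *\<^sub>C m"] M m csubspace_scale by (intro mult_left_mono) auto
      also have "\<dots> = p (c *\<^sub>C (x - (1/c) *\<^sub>C m))" using hom[OF dV[OF x csubspace_scale[OF M(1) m]]] by simp
      also have "c *\<^sub>C (x - (1/c) *\<^sub>C m) = c *\<^sub>C x - m"
        using False by (simp add: cvec.scale_right_diff_distrib scaleC_scaleC scaleC_one)
      finally show "cmod c * q x <= p (c *\<^sub>C x - m)" .
    qed
  qed
  have "q (c *\<^sub>C x) = cmod c * q x" if x: "x \<in> V" for c x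
  proof (cases "c = 0")
    case True
    have "q 0 = 0" using le[of 0 0] qpos[of 0] V M0 csubspace_0 seminorm_0[OF V p] by fastforce
    then show ?thesis using True by simp
  next
    case False
    have "cmod (1/c) * q (c *\<^sub>C x) <= q ((1/c) *\<^sub>C c *\<^sub>C x)"
      using half V x csubspace_scale by blast
    then have "q (c *\<^sub>C x) <= cmod c * q x"
      using False by (simp add: scaleC_scaleC scaleC_one norm_divide field_simps)
    then show ?thesis using half[OF x, of c] by simp
  qed
  then show "seminorm_on V q" unfolding seminorm_on_def using qpos add by blast
qed

text \<open>A real linear functional below the tilted quotient seminorm attains the full distance at
  \<open>x0\<close>. Complexification keeps the bound, and a final scaling by a factor in [0,1]
  lowers the value to the prescribed \<open>d\<close>.\<close>

theorem hahn_banach_dist: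
  assumes V: "csubspace V" and p: "seminorm_on V p" and M: "csubspace M" "M \<subseteq> V"
    and x0: "x0 \<in> V" and d: "0 <= d" "!!m. m \<in> M ==> d <= p (x0 - m)"
  obtains L where "clinear_on V L" "!!x. x \<in> V ==> cmod (L x) <= p x"
    "!!m. m \<in> M ==> L m = 0" "L x0 = of_real d"
proof (cases "d = 0")
  case True
  show ?thesis using p by (intro that[of "%_. 0"]) (auto simp: clinear_on_def seminorm_on_def True)
next
  case False
  define q where "q x = (INF m\<in>M. p (x - m))" for x
  note D = dist_seminorm[OF V p M, folded q_def]
  have q: "sublinear_on V q" using D(1) unfolding seminorm_on_def sublinear_on_def by auto
  have nx: "- x0 \<in> V" using V x0 csubspace_neg by blast
  obtain f where f: "!!x. x \<in> V ==> f x <= tilt q x0 x"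
    and fadd: "!!x y. x \<in> V ==> y \<in> V ==> f (x + y) = f x + f y"
    and fhom: "!!r x. x \<in> V ==> f (of_real r *\<^sub>C x) = r * f x"
    using minimal_sublinear[OF V tilt(1)[OF V q x0]] by blast
  have fq: "f x <= q x" if "x \<in> V" for x using f[OF that] tilt(2)[OF V q x0 that] by linarith
  have "f (- x0) <= - q x0" using f[OF nx] tilt(3)[OF V q x0] by linarith
  moreover have "f (- x0) = - f x0" using fhom[OF x0, of "-1"] by simp
  ultimately have fx0: "f x0 = q x0" using fq[OF x0] by linarith
  \<comment> \<open>The complex functional with real part \<open>f\<close>; rotating a value onto
    the positive axis transfers the bound from the real part to the modulus.\<close>
  define L where "L = (%x. Complex (f x) (- f (\<i> *\<^sub>C x)))"
  have iV: "\<i> *\<^sub>C x \<in> V" if "x \<in> V" for x using V that csubspace_scale by blast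
  have Ladd: "L (x + y) = L x + L y" if "x \<in> V" "y \<in> V" for x y
    unfolding L_def using fadd that iV by (simp add: scaleC_add_right complex_eq_iff)
  have Lhom: "L (c *\<^sub>C x) = c * L x" if x: "x \<in> V" for c x
  proof -
    have c: "c = of_real (Re c) + of_real (Im c) * \<i>" by (simp add: complex_eq_iff)
    have 1: "f (c *\<^sub>C x) = Re c * f x + Im c * f (\<i> *\<^sub>C x)" if x: "x \<in> V" for x c
    proof -
      have c: "c = of_real (Re c) + of_real (Im c) * \<i>" by (simp add: complex_eq_iff)
      have "f (c *\<^sub>C x) = f (of_real (Re c) *\<^sub>C x + of_real (Im c) *\<^sub>C (\<i> *\<^sub>C x))"
        by (subst c) (simp only: scaleC_add_left scaleC_scaleC)
      also have "\<dots> = Re c * f x + Im c * f (\<i> *\<^sub>C x)"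
        using fadd[of "of_real (Re c) *\<^sub>C x" "of_real (Im c) *\<^sub>C (\<i> *\<^sub>C x)"] csubspace_scale[OF V x] csubspace_scale[OF V iV[OF x]] fhom[OF x] fhom[OF iV[OF x]]
        by (simp del: cvec.scale_scale)
      finally show ?thesis .
    qed
    have 2: "f (\<i> *\<^sub>C c *\<^sub>C x) = - Im c * f x + Re c * f (\<i> *\<^sub>C x)"
      using 1[OF x, of "\<i> * c"] by (simp add: scaleC_scaleC)
    show ?thesis unfolding L_def using 1[OF x, of c] 2 by (simp add: complex_eq_iff algebra_simps)
  qed
  have Lq: "cmod (L x) <= q x" if x: "x \<in> V" for x
  proof (cases "L x = 0")
    case True
    then show ?thesis using D(1) x unfolding seminorm_on_def by simp
  next
    case False
    define c where "c = cnj (L x) / of_real (cmod (L x))"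
    have nc: "cmod c = 1" using False by (simp add: c_def norm_divide)
    have "c * L x = of_real (cmod (L x))"
      using False by (simp add: c_def field_simps complex_norm_square[symmetric] power2_eq_square)
    then have "cmod (L x) = Re (L (c *\<^sub>C x))" using Lhom[OF x] by simp
    also have "\<dots> = f (c *\<^sub>C x)" by (simp add: L_def)
    also have "\<dots> <= q (c *\<^sub>C x)" using fq V x csubspace_scale by blast
    also have "\<dots> = q x" using D(1) x nc unfolding seminorm_on_def by simp
    finally show ?thesis .
  qed
  have dq: "d <= q x0" by (rule D(4)) (use d in auto)
  have q0: "q x0 > 0" using dq d False by linarith
  \<comment> \<open>The real part already exhausts the bound \<open>q x0\<close>, which leaves no
    room for an imaginary part.\<close>
  have Lx0: "L x0 = of_real (q x0)"
  proof -
    have "(Re (L x0))\<^sup>2 + (Im (L x0))\<^sup>2 <= (q x0)\<^sup>2"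
      using Lq[OF x0] q0 by (metis cmod_power2 norm_ge_zero power_mono)
    moreover have "Re (L x0) = q x0" using fx0 by (simp add: L_def)
    ultimately show ?thesis by (simp add: complex_eq_iff)
  qed
  define r where "r = d / q x0"
  have r: "0 <= r" "r <= 1" using dq d q0 by (auto simp: r_def)
  show ?thesis
  proof (rule that[of "%x. of_real r * L x"])
    show "clinear_on V (%x. of_real r * L x)"
      unfolding clinear_on_def using Ladd Lhom by (simp add: algebra_simps)
    fix x assume x: "x \<in> V"
    have "cmod (of_real r * L x) <= 1 * cmod (L x)"
      using r by (simp add: norm_mult mult_left_le_one_le)
    then show "cmod (of_real r * L x) <= p x" using Lq[OF x] D(2)[OF x] by linarith
  next
    fix m assume "m \<in> M"
    then have "cmod (L m) <= 0" using Lq[of m] D(3)[of m] M by auto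
    then show "of_real r * L m = 0" by simp
  next
    show "of_real r * L x0 = of_real d" using Lx0 q0 by (simp add: r_def)
  qed
qed

corollary hahn_banach_norming:
  assumes V: "csubspace V" and p: "seminorm_on V p" and x0: "x0 \<in> V"
  obtains L where "clinear_on V L" "!!x. x \<in> V ==> cmod (L x) <= p x" "L x0 = of_real (p x0)"
proof (rule hahn_banach_dist[OF V p _ _ x0, of "{0}" "p x0"])
  show "csubspace {0}" by (simp add: csubspace_def)
qed (use V p x0 csubspace_0 in \<open>auto simp: seminorm_on_def\<close>)

text \<open>Normalise a point with \<open>f x0 = 1\<close>. The bound on \<open>f\<close> puts it at
  distance at least \<open>1\<close> from the kernel of \<open>f\<close>, so the distance form with
  \<open>d = 1\<close> supplies the extension.\<close>

corollary hahn_banach_extend: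
  assumes V: "csubspace V" and p: "seminorm_on V p" and S: "csubspace S" "S \<subseteq> V"
    and f: "clinear_on S f" "!!x. x \<in> S ==> cmod (f x) <= p x"
  obtains L where "clinear_on V L" "!!x. x \<in> V ==> cmod (L x) <= p x" "!!x. x \<in> S ==> L x = f x"
proof (cases "\<forall>x\<in>S. f x = 0")
  case True
  show ?thesis using p True by (intro that[of "%_. 0"]) (auto simp: clinear_on_def seminorm_on_def)
next
  case False
  then obtain x1 where x1: "x1 \<in> S" "f x1 \<noteq> 0" by blast
  define x0 where "x0 = (1 / f x1) *\<^sub>C x1"
  have x0: "x0 \<in> S" "f x0 = 1" using x1 S csubspace_scale clinear_onD(2)[OF f(1)] by (auto simp: x0_def)
  define M where "M = {x \<in> S. f x = 0}"
  have M: "csubspace M" unfolding csubspace_def M_def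
    using S clinear_onD[OF f(1)] clinear_on_0[OF S(1) f(1)] csubspace_0 csubspace_add csubspace_scale by auto
  obtain L where L: "clinear_on V L" "!!x. x \<in> V ==> cmod (L x) <= p x" "!!m. m \<in> M ==> L m = 0" "L x0 = of_real 1"
  proof (rule hahn_banach_dist[OF V p M])
    fix m assume "m \<in> M"
    then have m: "m \<in> S" "f m = 0" unfolding M_def by auto
    have "f (x0 - m) = 1" using clinear_on_diff[OF S(1) f(1) x0(1) m(1)] x0 m by simp
    then show "1 <= p (x0 - m)" using f(2)[of "x0 - m"] S x0 m csubspace_diff by fastforce
  qed (use S x0 M_def in auto)
  show ?thesis
  proof (rule that[OF L(1,2)])
    fix x assume x: "x \<in> S"
    have fx: "f x *\<^sub>C x0 \<in> S" using x0 S csubspace_scale by blast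
    have "x - f x *\<^sub>C x0 \<in> M"
      unfolding M_def using x fx S csubspace_diff clinear_on_diff[OF S(1) f(1) x fx] clinear_onD(2)[OF f(1) x0(1)] x0
      by auto
    then have "L (x - f x *\<^sub>C x0) = 0" using L(3) by blast
    moreover have "L (x - f x *\<^sub>C x0) = L x - f x * L x0"
      using clinear_on_diff[OF V L(1), of x "f x *\<^sub>C x0"] x fx S(2) clinear_onD(2)[OF L(1), of x0 "f x"] x0(1)
      by (simp add: subset_iff)
    ultimately show "L x = f x" using L(4) by simp
  qed
qed

subsection \<open>Analytic functions on the strip\<close>

definition ostrip :: "complex set" where "ostrip = {z. 0 < Re z \<and> Re z < 1}"

lemma open_ostrip: "open ostrip"
  unfolding ostrip_def using open_Int[OF open_halfspace_Re_gt[of 0] open_halfspace_Re_lt[of 1]]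
  by (simp add: Collect_conj_eq)

lemma convex_strip: "convex strip"
  unfolding strip_def using convex_Int[OF convex_halfspace_Re_ge[of 0] convex_halfspace_Re_le[of 1]]
  by (simp add: Collect_conj_eq)

lemma convex_ostrip: "convex ostrip"
  unfolding ostrip_def using convex_Int[OF convex_halfspace_Re_gt[of 0] convex_halfspace_Re_lt[of 1]]
  by (simp add: Collect_conj_eq)

lemma ostrip_subset_strip: "ostrip \<subseteq> strip"
  by (auto simp: ostrip_def strip_def)

lemma interior_strip_subset: "interior strip \<subseteq> ostrip"
proof
  fix z assume "z \<in> interior strip"
  then obtain e where e: "e > 0" "ball z e \<subseteq> strip" by (auto simp: mem_interior)
  have "z + of_real (e/2) \<in> ball z e" "z - of_real (e/2) \<in> ball z e"
    using e by (auto simp: dist_norm norm_divide)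
  then have "z + of_real (e/2) \<in> strip" "z - of_real (e/2) \<in> strip" using e by auto
  then show "z \<in> ostrip" using e by (auto simp: strip_def ostrip_def)
qed

lemma bnd_simps [simp]: "Re (bnd 0 t) = 0" "Re (bnd 1 t) = 1" "Im (bnd j t) = t" "Re (bnd (Suc 0) t) = 1"
  by (auto simp: bnd_def)

lemma bnd_strip [simp]: "bnd 0 t \<in> strip" "bnd 1 t \<in> strip" "bnd (Suc 0) t \<in> strip"
  by (auto simp: strip_def)

lemma strip_boundary_cases:
  assumes "z \<in> strip"
  obtains "z = bnd 0 (Im z)" | "z = bnd 1 (Im z)" | "z \<in> ostrip"
proof -
  have "Re z = 0 \<or> Re z = 1 \<or> z \<in> ostrip" using assms by (auto simp: strip_def ostrip_def)
  moreover have "Re z = 0 ==> z = bnd 0 (Im z)" "Re z = 1 ==> z = bnd 1 (Im z)"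
    by (simp_all add: complex_eq_iff)
  ultimately show thesis using that by blast
qed

lemma norm_exp_mult_square: "cmod (exp (of_real e * w\<^sup>2)) = exp (e * ((Re w)\<^sup>2 - (Im w)\<^sup>2))"
  by (simp add: norm_exp_eq_Re Re_power2)

text \<open>The factor exp(e z^2) beats linear growth on the horizontal sides of a tall rectangle
  and costs at most the factor \<open>exp e\<close> on the strip. Apply the maximum principle there
  and let \<open>e\<close> tend to \<open>0\<close>.\<close>

theorem strip_phragmen_lindelof:
  fixes f :: "complex => complex"
  assumes cont: "continuous_on strip f" and hol: "f holomorphic_on ostrip"
    and gr: "!!z. z \<in> strip ==> cmod (f z) <= K * (1 + cmod z)"
    and b: "!!t. cmod (f (bnd 0 t)) <= M" "!!t. cmod (f (bnd 1 t)) <= M"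
    and z: "z \<in> strip"
  shows "cmod (f z) <= M"
proof -
  have M0: "0 <= M" using b(1)[of 0] norm_ge_zero order_trans by blast
  have key: "cmod (f z * exp (of_real e * z\<^sup>2)) <= exp e * (M + e)" if e: "e > 0" for e
  proof -
    \<comment> \<open>The height \<open>Y\<close> is taken so large that the horizontal sides
      contribute less than \<open>e\<close>.\<close>
    have "((%Y. \<bar>K\<bar> * (2 + Y) * exp (- e * Y\<^sup>2)) \<longlongrightarrow> 0) at_top" using e by real_asymp
    then have "eventually (%Y. \<bar>K\<bar> * (2 + Y) * exp (- e * Y\<^sup>2) < e) at_top"
      using e order_tendstoD(2) by blast
    then have "eventually (%Y. \<bar>K\<bar> * (2 + Y) * exp (- e * Y\<^sup>2) < e \<and> Y > \<bar>Im z\<bar>) at_top"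
      using eventually_gt_at_top eventually_conj by blast
    then obtain Y where Y: "\<bar>K\<bar> * (2 + Y) * exp (- e * Y\<^sup>2) < e" "Y > \<bar>Im z\<bar>"
      using eventually_happens'[OF trivial_limit_at_top_linorder] by blast
    define S where "S = cbox (Complex 0 (-Y)) (Complex 1 Y)"
    have Sin: "w \<in> S \<longleftrightarrow> 0 <= Re w \<and> Re w <= 1 \<and> \<bar>Im w\<bar> <= Y" for w
      unfolding S_def by (auto simp: in_cbox_complex_iff)
    have SS: "S \<subseteq> strip" using Sin by (auto simp: strip_def)
    have ib: "interior S = box (Complex 0 (-Y)) (Complex 1 Y)" unfolding S_def by simp
    have io: "interior S \<subseteq> ostrip" unfolding ib by (auto simp: in_box_complex_iff ostrip_def)
    show ?thesis
    proof (rule maximum_modulus_frontier[where S = S and f = "%z. f z * exp (of_real e * z\<^sup>2)"])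
      show "(%z. f z * exp (of_real e * z\<^sup>2)) holomorphic_on interior S"
        by (intro holomorphic_intros holomorphic_on_subset[OF hol io])
      have "closure S = S" unfolding S_def by simp
      then show "continuous_on (closure S) (%z. f z * exp (of_real e * z\<^sup>2))"
        using continuous_on_subset[OF cont SS] by (auto intro!: continuous_intros)
      show "bounded S" unfolding S_def by simp
      show "z \<in> S" using z Y Sin by (auto simp: strip_def)
    next
      fix w assume "w \<in> frontier S"
      then have w: "w \<in> S" "w \<notin> interior S" unfolding frontier_def S_def by auto
      have ew: "cmod (exp (of_real e * w\<^sup>2)) <= exp e * exp (- e * (Im w)\<^sup>2)"
      proof -
        have "(Re w)\<^sup>2 <= 1" using w Sin by (simp add: abs_square_le_1)
        then have "e * ((Re w)\<^sup>2 - (Im w)\<^sup>2) <= e + - e * (Im w)\<^sup>2"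
          using e by (simp add: algebra_simps)
        then show ?thesis unfolding norm_exp_mult_square by (simp only: exp_add[symmetric] exp_le_cancel_iff)
      qed
      consider "w = bnd 0 (Im w)" | "w = bnd 1 (Im w)" | "\<bar>Im w\<bar> = Y"
      proof -
        have "Re w = 0 \<or> Re w = 1 \<or> \<bar>Im w\<bar> = Y"
          using w Sin unfolding ib in_box_complex_iff by force
        moreover have "Re w = 0 ==> w = bnd 0 (Im w)" "Re w = 1 ==> w = bnd 1 (Im w)"
          by (simp_all add: complex_eq_iff)
        ultimately show thesis using that by blast
      qed
      then have "cmod (f w) * (exp e * exp (- e * (Im w)\<^sup>2)) <= exp e * (M + e)"
      proof cases
        case 3
        have "cmod w <= 1 + Y" using cmod_le[of w] w(1) Sin 3 by auto
        moreover have "cmod (f w) <= \<bar>K\<bar> * (1 + cmod w)"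
          using gr[of w] w SS by (smt (verit) abs_ge_self mult_right_mono norm_ge_zero subsetD)
        ultimately have "cmod (f w) <= \<bar>K\<bar> * (2 + Y)"
          by (smt (verit) abs_ge_zero mult_left_mono)
        moreover have "(Im w)\<^sup>2 = Y\<^sup>2" using 3 by (metis power2_abs)
        ultimately have "cmod (f w) * exp (- e * (Im w)\<^sup>2) <= \<bar>K\<bar> * (2 + Y) * exp (- e * Y\<^sup>2)"
          by (simp add: mult_right_mono)
        also have "\<dots> <= M + e" using Y M0 by linarith
        finally have "exp e * (cmod (f w) * exp (- e * (Im w)\<^sup>2)) <= exp e * (M + e)" by simp
        then show ?thesis by (simp only: ac_simps)
      next
        case 1
        have "cmod (f w) <= M" using b(1)[of "Im w"] 1 by simp
        then have "cmod (f w) * (exp e * exp (- e * (Im w)\<^sup>2)) <= (M + e) * (exp e * 1)"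
          using e M0 by (intro mult_mono) auto
        then show ?thesis by (simp add: mult.commute)
      next
        case 2
        have "cmod (f w) <= M" using b(2)[of "Im w"] 2 by simp
        then have "cmod (f w) * (exp e * exp (- e * (Im w)\<^sup>2)) <= (M + e) * (exp e * 1)"
          using e M0 by (intro mult_mono) auto
        then show ?thesis by (simp add: mult.commute)
      qed
      moreover have "cmod (f w * exp (of_real e * w\<^sup>2)) <= cmod (f w) * (exp e * exp (- e * (Im w)\<^sup>2))"
        unfolding norm_mult by (intro mult_left_mono ew) simp
      ultimately show "cmod (f w * exp (of_real e * w\<^sup>2)) <= exp e * (M + e)" by linarith
    qed
  qed
  have a: "((%e. cmod (f z * exp (of_real e * z\<^sup>2))) \<longlongrightarrow> cmod (f z * exp (of_real 0 * z\<^sup>2))) (at_right 0)"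
    by (intro tendsto_intros)
  have b: "((%e. exp e * (M + e)) \<longlongrightarrow> exp 0 * (M + 0)) (at_right 0)"
    by (intro tendsto_intros)
  have "cmod (f z * exp (of_real 0 * z\<^sup>2)) <= exp 0 * (M + 0)"
    by (rule tendsto_le[OF trivial_limit_at_right_real b a]) (auto simp: eventually_at_filter key)
  then show ?thesis by simp
qed

text \<open>Cauchy's formula on a rectangle of height \<open>2 * T\<close>, for a function that is
  only continuous up to the sides. The horizontal sides have length \<open>1\<close> and distance at
  least \<open>T - \<bar>Im z0\<bar>\<close> from \<open>z0\<close>, which gives the error
  term.\<close>

theorem strip_cauchy_formula:
  fixes f :: "complex => complex"
  assumes cont: "continuous_on strip f" and hol: "f holomorphic_on ostrip"
    and bd: "!!z. z \<in> strip ==> cmod (f z) <= B"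
    and z0: "z0 \<in> ostrip" and T: "T > \<bar>Im z0\<bar>"
  shows "cmod (2 * pi * f z0 - (integral {-T..T} (%s. f (bnd 1 s) / (bnd 1 s - z0))
      - integral {-T..T} (%s. f (bnd 0 s) / (bnd 0 s - z0)))) <= 2 * B / (T - \<bar>Im z0\<bar>)"
proof -
  define a b c d where "a = Complex 0 (-T)" and "b = Complex 1 (-T)" and "c = Complex 1 T" and "d = Complex 0 T"
  define S where "S = cbox a c"
  have T0: "T > 0" using T by linarith
  have Sin: "w \<in> S \<longleftrightarrow> 0 <= Re w \<and> Re w <= 1 \<and> \<bar>Im w\<bar> <= T" for w
    unfolding S_def a_def c_def by (auto simp: in_cbox_complex_iff)
  have SS: "S \<subseteq> strip" using Sin by (auto simp: strip_def)
  have cS: "convex S" unfolding S_def by (rule convex_box)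
  have ib: "interior S = box a c" unfolding S_def by simp
  have io: "interior S \<subseteq> ostrip" unfolding ib a_def c_def by (auto simp: in_box_complex_iff ostrip_def)
  have zS: "z0 \<in> box a c" using z0 T unfolding a_def c_def ostrip_def by (auto simp: in_box_complex_iff)
  define q where "q = (%w. f w / (w - z0))"
  have rp: "rectpath a c = linepath a b +++ linepath b c +++ linepath c d +++ linepath d a"
    unfolding rectpath_def Let_def a_def b_def c_def d_def by simp
  have pim: "path_image (rectpath a c) \<subseteq> S - {z0}"
    using path_image_rectpath_cbox_minus_box[of a c] zS T0 unfolding S_def
    by (auto simp: a_def c_def)
  have "((%w. f w / (w - z0)) has_contour_integral (2*pi * \<i> * winding_number (rectpath a c) z0 * f z0)) (rectpath a c)"
  proof (rule Cauchy_integral_formula_weak[where k = "{}" and f = f and z = z0, OF cS])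
    show "continuous_on S f" using continuous_on_subset[OF cont SS] .
    show "f field_differentiable at x" if "x \<in> interior S - {}" for x
      using hol io that open_ostrip holomorphic_on_imp_differentiable_at by blast
  qed (use zS ib pim in auto)
  then have I: "contour_integral (rectpath a c) q = 2 * pi * \<i> * f z0"
    unfolding q_def using winding_number_rectpath[OF zS] contour_integral_unique by fastforce
  have seg: "path_image (linepath a b) \<subseteq> S - {z0}" "path_image (linepath b c) \<subseteq> S - {z0}"
     "path_image (linepath c d) \<subseteq> S - {z0}" "path_image (linepath d a) \<subseteq> S - {z0}"
    using pim unfolding rp by (auto simp: path_image_join)
  have cq: "continuous_on (S - {z0}) q"
    unfolding q_def by (intro continuous_intros continuous_on_subset[OF cont]) (use SS in auto)
  have ci: "q contour_integrable_on linepath u v" if "path_image (linepath u v) \<subseteq> S - {z0}" for u v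
    using contour_integrable_continuous_linepath continuous_on_subset[OF cq that] by simp
  have sum: "contour_integral (rectpath a c) q = contour_integral (linepath a b) q + (contour_integral (linepath b c) q
      + (contour_integral (linepath c d) q + contour_integral (linepath d a) q))"
    unfolding rp using ci seg by (simp add: contour_integral_join contour_integrable_joinI valid_path_join)
  have B0: "B >= 0" using bd[of "bnd 0 0"] norm_ge_zero order_trans bnd_strip(1) by blast
  have hb: "cmod (q w) <= B / (T - \<bar>Im z0\<bar>)" if "w \<in> S" "\<bar>Im w\<bar> = T" for w
  proof -
    have "T - \<bar>Im z0\<bar> <= \<bar>Im (w - z0)\<bar>" using that(2) by auto
    also have "\<dots> <= cmod (w - z0)" by (rule abs_Im_le_cmod)
    finally have "T - \<bar>Im z0\<bar> <= cmod (w - z0)" .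
    then show ?thesis unfolding q_def norm_divide using bd[of w] that(1) SS T B0
      by (intro frac_le) auto
  qed
  have h1: "cmod (contour_integral (linepath a b) q) <= B / (T - \<bar>Im z0\<bar>) * cmod (b - a)"
  proof (rule contour_integral_bound_linepath[OF ci[OF seg(1)]])
    fix x assume x: "x \<in> closed_segment a b"
    then have "x \<in> S" using seg(1) by auto
    moreover have "Im x = - T" using x unfolding closed_segment_def a_def b_def by (clarsimp simp: left_diff_distrib)
    ultimately show "cmod (q x) <= B / (T - \<bar>Im z0\<bar>)" using hb T0 by auto
  qed (use B0 T in auto)
  have h2: "cmod (contour_integral (linepath c d) q) <= B / (T - \<bar>Im z0\<bar>) * cmod (d - c)"
  proof (rule contour_integral_bound_linepath[OF ci[OF seg(3)]])
    fix x assume x: "x \<in> closed_segment c d"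
    then have "x \<in> S" using seg(3) by auto
    moreover have "Im x = T" using x unfolding closed_segment_def c_def d_def by (clarsimp simp: left_diff_distrib)
    ultimately show "cmod (q x) <= B / (T - \<bar>Im z0\<bar>)" using hb T0 by auto
  qed (use B0 T in auto)
  have n1: "cmod (b - a) = 1" "cmod (d - c) = 1"
    by (auto simp: a_def b_def c_def d_def cmod_def)
  have cx: "Complex 0 x = bnd 0 x" "Complex 1 x = bnd 1 x" for x by (auto simp: complex_eq_iff)
  have v1: "contour_integral (linepath b c) q = \<i> * integral {-T..T} (%s. q (bnd 1 s))"
    using contour_integral_linepath_same_Re[of b 1 c "-T" T q] T0 unfolding cx by (simp add: b_def c_def)
  \<comment> \<open>The left side is traversed downwards, hence the minus sign.\<close>
  have v2: "contour_integral (linepath d a) q = - \<i> * integral {-T..T} (%s. q (bnd 0 s))"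
    using contour_integral_linepath_same_Re[of a 0 d "-T" T q] T0 contour_integral_reverse_linepath[of a d q]
      continuous_on_subset[OF cq] seg(4) unfolding cx by (simp add: a_def d_def closed_segment_commute)
  have "\<i> * (2 * pi * f z0 - (integral {-T..T} (%s. q (bnd 1 s)) - integral {-T..T} (%s. q (bnd 0 s))))
     = contour_integral (linepath a b) q + contour_integral (linepath c d) q"
    using I unfolding sum v1 v2 by (simp add: algebra_simps)
  then have "cmod (2 * pi * f z0 - (integral {-T..T} (%s. q (bnd 1 s)) - integral {-T..T} (%s. q (bnd 0 s))))
     = cmod (contour_integral (linepath a b) q + contour_integral (linepath c d) q)"
    by (metis norm_mult norm_ii mult_1)
  also have "\<dots> <= B / (T - \<bar>Im z0\<bar>) + B / (T - \<bar>Im z0\<bar>)"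
    using h1 h2 n1 by (intro norm_triangle_le add_mono) auto
  finally show ?thesis unfolding q_def by simp
qed

text \<open>On the two vertical lines the Cauchy kernel is at most \<open>1 / Re z0\<close> and
  \<open>1 / (1 - Re z0)\<close>. The sup bound \<open>B\<close> makes the horizontal sides vanish
  as \<open>T\<close> grows, so the final estimate depends on boundary integrals alone.\<close>

lemma strip_L1_bound:
  fixes f :: "complex => complex"
  assumes cont: "continuous_on strip f" and hol: "f holomorphic_on ostrip"
    and bd: "!!z. z \<in> strip ==> cmod (f z) <= B" and z0: "z0 \<in> ostrip"
    and k: "continuous_on UNIV k0" "continuous_on UNIV k1"
    and le: "!!s. cmod (f (bnd 0 s)) <= k0 s" "!!s. cmod (f (bnd 1 s)) <= k1 s"
    and int: "!!T. T >= 0 ==> integral {-T..T} k0 <= M" "!!T. T >= 0 ==> integral {-T..T} k1 <= M"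
  shows "cmod (f z0) <= M * (1 / Re z0 + 1 / (1 - Re z0))"
proof -
  have x: "0 < Re z0" "Re z0 < 1" using z0 by (auto simp: ostrip_def)
  have i0: "cmod (integral {-T..T} (%s. f (bnd 0 s) / (bnd 0 s - z0))) <= M * (1 / Re z0)" if "T >= 0" for T
  proof -
    have "continuous_on {-T..T} (%s. f (bnd 0 s))"
      by (rule continuous_on_compose2[OF cont]) (auto simp: bnd_def strip_def intro!: continuous_intros)
    moreover have nz: "bnd 0 s - z0 \<noteq> 0" for s using x by (auto simp: complex_eq_iff)
    ultimately have c: "continuous_on {-T..T} (%s. f (bnd 0 s) / (bnd 0 s - z0))"
      by (intro continuous_intros) (auto simp: bnd_def intro!: continuous_intros)
    have "cmod (integral {-T..T} (%s. f (bnd 0 s) / (bnd 0 s - z0))) <= integral {-T..T} (%s. k0 s * (1 / Re z0))"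
    proof (rule integral_norm_bound_integral)
      show "(%s. f (bnd 0 s) / (bnd 0 s - z0)) integrable_on {-T..T}" using c by (rule integrable_continuous_interval)
      show "(%s. k0 s * (1 / Re z0)) integrable_on {-T..T}"
        by (intro integrable_continuous_interval continuous_intros continuous_on_subset[OF k(1)]) auto
      fix s
      have "Re z0 <= cmod (bnd 0 s - z0)" using abs_Re_le_cmod[of "bnd 0 s - z0"] x by simp
      then show "cmod (f (bnd 0 s) / (bnd 0 s - z0)) <= k0 s * (1 / Re z0)"
        using le(1)[of s] x unfolding norm_divide times_divide_eq_right mult_1_right
          by (intro frac_le) (auto intro: order_trans[OF norm_ge_zero])
    qed
    also have "\<dots> = integral {-T..T} k0 * (1 / Re z0)" by simp
    also have "\<dots> <= M * (1 / Re z0)" using int(1)[OF that] x by (intro mult_right_mono) auto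
    finally show ?thesis .
  qed
  have i1: "cmod (integral {-T..T} (%s. f (bnd 1 s) / (bnd 1 s - z0))) <= M * (1 / (1 - Re z0))" if "T >= 0" for T
  proof -
    have "continuous_on {-T..T} (%s. f (bnd 1 s))"
      by (rule continuous_on_compose2[OF cont]) (auto simp: bnd_def strip_def intro!: continuous_intros)
    moreover have nz: "bnd 1 s - z0 \<noteq> 0" for s using x by (auto simp: complex_eq_iff)
    ultimately have c: "continuous_on {-T..T} (%s. f (bnd 1 s) / (bnd 1 s - z0))"
      by (intro continuous_intros) (auto simp: bnd_def intro!: continuous_intros)
    have "cmod (integral {-T..T} (%s. f (bnd 1 s) / (bnd 1 s - z0))) <= integral {-T..T} (%s. k1 s * (1 / (1 - Re z0)))"
    proof (rule integral_norm_bound_integral)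
      show "(%s. f (bnd 1 s) / (bnd 1 s - z0)) integrable_on {-T..T}" using c by (rule integrable_continuous_interval)
      show "(%s. k1 s * (1 / (1 - Re z0))) integrable_on {-T..T}"
        by (intro integrable_continuous_interval continuous_intros continuous_on_subset[OF k(2)]) auto
      fix s
      have "1 - Re z0 <= cmod (bnd 1 s - z0)" using abs_Re_le_cmod[of "bnd 1 s - z0"] x by simp
      then show "cmod (f (bnd 1 s) / (bnd 1 s - z0)) <= k1 s * (1 / (1 - Re z0))"
        using le(2)[of s] x unfolding norm_divide times_divide_eq_right mult_1_right
          by (intro frac_le) (auto intro: order_trans[OF norm_ge_zero])
    qed
    also have "\<dots> = integral {-T..T} k1 * (1 / (1 - Re z0))" by simp
    also have "\<dots> <= M * (1 / (1 - Re z0))" using int(2)[OF that] x by (intro mult_right_mono) auto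
    finally show ?thesis .
  qed
  have ev: "2 * pi * cmod (f z0) <= M * (1 / Re z0 + 1 / (1 - Re z0)) + 2 * B / (T - \<bar>Im z0\<bar>)" if "T > \<bar>Im z0\<bar>" for T
  proof -
    have "cmod (2 * pi * f z0) <= cmod (2 * pi * f z0 - (integral {-T..T} (%s. f (bnd 1 s) / (bnd 1 s - z0))
      - integral {-T..T} (%s. f (bnd 0 s) / (bnd 0 s - z0)))) + (cmod (integral {-T..T} (%s. f (bnd 1 s) / (bnd 1 s - z0)))
      + cmod (integral {-T..T} (%s. f (bnd 0 s) / (bnd 0 s - z0))))"
      using norm_triangle_sub norm_triangle_ineq4 by (smt (verit))
    also have "\<dots> <= 2 * B / (T - \<bar>Im z0\<bar>) + (M * (1 / (1 - Re z0)) + M * (1 / Re z0))"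
      using strip_cauchy_formula[OF cont hol bd z0 that] i0[of T] i1[of T] that by (intro add_mono) auto
    finally show ?thesis by (simp add: norm_mult algebra_simps)
  qed
  have "((%T. M * (1 / Re z0 + 1 / (1 - Re z0)) + 2 * B / (T - \<bar>Im z0\<bar>)) \<longlongrightarrow> M * (1 / Re z0 + 1 / (1 - Re z0)) + 0) at_top"
    by (intro tendsto_add tendsto_const) real_asymp
  then have "2 * pi * cmod (f z0) <= M * (1 / Re z0 + 1 / (1 - Re z0)) + 0"
    by (rule tendsto_le[OF trivial_limit_at_top_linorder _ tendsto_const])
       (rule eventually_mono[OF eventually_gt_at_top[of "\<bar>Im z0\<bar>"] ev])
  \<comment> \<open>The factor 1 / (2 pi) of Cauchy's formula is given away.\<close>
  moreover have "1 * cmod (f z0) <= 2 * pi * cmod (f z0)"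
    using pi_gt3 by (intro mult_right_mono) auto
  ultimately show ?thesis by simp
qed

text \<open>Cauchy's inequality on discs of radius \<open>r / 2\<close> bounds the second derivative
  by 2 B / (r/2)^2, whence the \<open>8\<close>. The constants depend on \<open>B\<close> and
  \<open>r\<close> alone, so the estimates pass through norming functionals and pointwise
  limits.\<close>

lemma taylor_second_order:
  fixes f :: "complex => complex"
  assumes hol: "f holomorphic_on S" and S: "open S" "cball z r \<subseteq> S" and r: "r > 0"
    and B: "!!w. w \<in> cball z r ==> cmod (f w) <= B"
  shows "cmod (deriv f z) <= B / r"
    "cmod k <= r / 2 ==> cmod (f (z + k) - f z - k * deriv f z) <= 8 * B / r\<^sup>2 * (cmod k)\<^sup>2"
proof -
  have hb: "f holomorphic_on ball z r" using holomorphic_on_subset[OF hol] S ball_subset_cball by blast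
  have cb: "continuous_on (cball z r) f"
    using holomorphic_on_imp_continuous_on holomorphic_on_subset[OF hol S(2)] by blast
  have sph: "cmod (f x) <= B" if "cmod (z - x) = r" for x using B that by (simp add: dist_norm)
  show "cmod (deriv f z) <= B / r" using Cauchy_inequality[OF hb cb r sph, of 1] by simp
  show "cmod (f (z + k) - f z - k * deriv f z) <= 8 * B / r\<^sup>2 * (cmod k)\<^sup>2" if k: "cmod k <= r / 2"
  proof -
    have sub: "cball w (r/2) \<subseteq> cball z r" if "w \<in> cball z (r/2)" for w
    proof
      fix x assume "x \<in> cball w (r/2)"
      then show "x \<in> cball z r" using that dist_triangle[of z x w] by auto
    qed
    have der: "((deriv ^^ i) f has_field_derivative (deriv ^^ Suc i) f x) (at x within cball z (r/2))"
      if "x \<in> cball z (r/2)" for i x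
    proof -
      have "x \<in> S" using that S r by auto
      moreover have "(deriv ^^ i) f holomorphic_on S" using hol S(1) by (intro holomorphic_higher_deriv)
      ultimately show ?thesis using S(1) holomorphic_derivI has_field_derivative_at_within by fastforce
    qed
    have "cmod ((deriv ^^ 0) f (z + k) - (\<Sum>i\<le>1. (deriv ^^ i) f z * (z + k - z) ^ i / fact i))
       <= (8 * B / r\<^sup>2) * cmod (z + k - z) ^ Suc 1 / fact 1"
    proof (rule field_Taylor[of "cball z (r/2)" 1 "%i. (deriv ^^ i) f"])
      fix x assume x: "x \<in> cball z (r/2)"
      have "cmod ((deriv ^^ 2) f x) <= fact 2 * B / (r/2)^2"
      proof (rule Cauchy_inequality)
        show "continuous_on (cball x (r / 2)) f" using continuous_on_subset[OF cb sub[OF x]] .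
        show "f holomorphic_on ball x (r / 2)"
          using holomorphic_on_subset[OF hol] S(2) sub[OF x] ball_subset_cball by (meson subset_trans)
        fix w assume "cmod (x - w) = r / 2"
        then have "w \<in> cball x (r/2)" by (simp add: dist_norm)
        then show "cmod (f w) <= B" using B sub[OF x] by blast
      qed (use r in auto)
      then show "cmod ((deriv ^^ Suc 1) f x) <= 8 * B / r\<^sup>2"
        by (simp add: power2_eq_square numeral_2_eq_2)
    qed (use der k r in \<open>auto simp: dist_norm\<close>)
    then show ?thesis by (simp add: algebra_simps power2_eq_square)
  qed
qed

section \<open>Riemann sums and a normalised Gaussian primitive\<close>

text \<open>The error is expressed by the oscillation \<open>e\<close>, so one \<open>m\<close>
  serves a whole family of integrands with a common modulus of continuity.\<close>

lemma riemann_sum_bound: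
  fixes f :: "real => 'a::banach" and m :: nat
  assumes cont: "continuous_on {a..b} f" and ab: "a <= b" and m: "m > 0"
    and osc: "!!x y. x \<in> {a..b} ==> y \<in> {a..b} ==> \<bar>x - y\<bar> <= (b - a) / m ==> norm (f x - f y) <= e"
  shows "norm ((\<Sum>k<m. ((b - a) / real m) *\<^sub>R f (a + real k * ((b - a) / real m))) - integral {a..b} f) <= e * (b - a)"
proof -
  define h where "h = (b - a) / m"
  have h: "0 <= h" "m * h = b - a" using ab m by (auto simp: h_def)
  have le: "a + n * h <= b" if "n <= m" for n :: nat
    using mult_right_mono[of "real n" m h] h that by auto
  have ge: "a <= a + n * h" for n :: nat using h by simp
  have int: "f integrable_on {c..d}" if "a <= c" "d <= b" for c d
    using integrable_continuous_interval[OF continuous_on_subset[OF cont]] that by auto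
  have "norm ((\<Sum>k<n. h *\<^sub>R f (a + real k * h)) - integral {a..a + n * h} f) <= e * (n * h)" if "n <= m" for n :: nat
    using that
  proof (induction n)
    case (Suc n)
    define c d where "c = a + n * h" and "d = a + Suc n * h"
    have cd: "a <= c" "c <= d" "d <= b" "d - c = h"
      using le[OF Suc.prems] ge[of n] h unfolding c_def d_def by (auto simp: algebra_simps)
    have "integral {a..d} f = integral {a..c} f + integral {c..d} f"
      using Henstock_Kurzweil_Integration.integral_combine[OF cd(1,2) int[of a d]] cd by auto
    moreover have "norm (h *\<^sub>R f c - integral {c..d} f) <= e * h"
    proof -
      have "h *\<^sub>R f c - integral {c..d} f = integral {c..d} (%x. f c - f x)"
        using cd int[of c d] by (subst integral_diff) auto
      also have "norm \<dots> <= e * (d - c)"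
      proof (rule integral_bound[OF cd(2)])
        show "continuous_on {c..d} (%x. f c - f x)"
          by (intro continuous_intros continuous_on_subset[OF cont]) (use cd in auto)
        show "norm (f c - f t) <= e" if "t \<in> {c..d}" for t
          using osc[of c t] that cd unfolding h_def by auto
      qed
      finally show ?thesis using cd by simp
    qed
    moreover have "norm ((\<Sum>k<n. h *\<^sub>R f (a + real k * h)) - integral {a..c} f) <= e * (n * h)"
      unfolding c_def using Suc by simp
    ultimately have "norm (((\<Sum>k<n. h *\<^sub>R f (a + real k * h)) - integral {a..c} f) + (h *\<^sub>R f c - integral {c..d} f)) <= e * (n * h) + e * h"
      by (intro norm_triangle_mono)
    moreover have "(\<Sum>k<Suc n. h *\<^sub>R f (a + real k * h)) - integral {a..d} f
       = ((\<Sum>k<n. h *\<^sub>R f (a + real k * h)) - integral {a..c} f) + (h *\<^sub>R f c - integral {c..d} f)"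
      using \<open>integral {a..d} f = _\<close> by (simp add: c_def)
    moreover have "e * (n * h) + e * h = e * (Suc n * h)" by (simp add: algebra_simps)
    ultimately show ?case unfolding d_def by (simp only:)
  qed simp
  from this[of m] show ?thesis using h unfolding h_def by simp
qed

lemma riemann_sum_tendsto:
  fixes f :: "real => 'a::banach"
  assumes cont: "continuous_on {a..b} f" and ab: "a <= b"
  shows "(%m::nat. \<Sum>k<m. ((b - a) / real m) *\<^sub>R f (a + real k * ((b - a) / real m))) \<longlonglongrightarrow> integral {a..b} f"
proof (rule LIMSEQ_I)
  fix r :: real assume r: "r > 0"
  define e where "e = r / (b - a + 1)"
  have e: "e > 0" "e * (b - a) < r" using r ab by (auto simp: e_def field_simps)
  have "uniformly_continuous_on {a..b} f" using cont compact_uniformly_continuous by blast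
  then obtain d where d: "d > 0" "!!x y. x \<in> {a..b} ==> y \<in> {a..b} ==> dist x y < d ==> dist (f x) (f y) < e"
    using e unfolding uniformly_continuous_on_def by metis
  have "(%m. (b - a) / real m) \<longlonglongrightarrow> 0" by real_asymp
  then have "eventually (%m. (b - a) / real m < d) sequentially" using d order_tendstoD(2) by blast
  then obtain M where M: "!!m. m >= M ==> (b - a) / real m < d" unfolding eventually_sequentially by blast
  have "norm ((\<Sum>k<m. ((b - a) / real m) *\<^sub>R f (a + real k * ((b - a) / real m))) - integral {a..b} f) < r" if m: "m >= M + 1" for m :: nat
  proof -
    have "norm ((\<Sum>k<m. ((b - a) / real m) *\<^sub>R f (a + real k * ((b - a) / real m))) - integral {a..b} f) <= e * (b - a)"
    proof (rule riemann_sum_bound[OF cont ab])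
      fix x y assume "x \<in> {a..b}" "y \<in> {a..b}" "\<bar>x - y\<bar> <= (b - a) / m"
      then show "norm (f x - f y) <= e" using d(2)[of x y] M[of m] m by (auto simp: dist_norm)
    qed (use m in auto)
    then show ?thesis using e by linarith
  qed
  then show "\<exists>no. \<forall>m\<ge>no. norm ((\<Sum>k<m. ((b - a) / real m) *\<^sub>R f (a + real k * ((b - a) / real m))) - integral {a..b} f) < r" by blast
qed

text \<open>Comparison with \<open>arctan\<close>, whose derivative dominates the Gaussian, shows
  that a primitive is bounded, so it has limits at both ends and can be normalised. The constant
  \<open>c\<close> is the reciprocal of the total mass, left unevaluated.\<close>

lemma gaussian_primitive:
  obtains \<Phi> :: "real => real" and c :: real where "c > 0" "mono \<Phi>"
    "!!x. (\<Phi> has_real_derivative c * exp (- x\<^sup>2)) (at x)" "(\<Phi> \<longlongrightarrow> 0) at_bot" "(\<Phi> \<longlongrightarrow> 1) at_top"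
proof -
  have hol: "(%z::complex. exp (- z\<^sup>2)) holomorphic_on UNIV" by (intro holomorphic_intros)
  have "\<exists>P. \<forall>z::complex. (P has_field_derivative exp (- z\<^sup>2)) (at z)"
    by (rule holomorphic_convex_primitive'[OF convex_UNIV open_UNIV hol]) auto
  then obtain P where P: "!!z::complex. (P has_field_derivative exp (- z\<^sup>2)) (at z)" by blast
  \<comment> \<open>A real primitive is obtained by restricting an entire one to the real
    axis.\<close>
  define E where "E = (%x. Re (P (of_real x)))"
  have E: "(E has_real_derivative exp (- x\<^sup>2)) (at x)" for x
  proof -
    have "((%x. P (of_real x)) has_vector_derivative exp (- (of_real x)\<^sup>2)) (at x)"
      using has_vector_derivative_real_field[OF P] by simp
    then have "((%x. Re (P (of_real x))) has_vector_derivative Re (exp (- (of_real x)\<^sup>2))) (at x)"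
      by (rule bounded_linear.has_vector_derivative[OF bounded_linear_Re])
    then show ?thesis
      unfolding E_def has_real_derivative_iff_has_vector_derivative
      by (simp add: Re_exp)
  qed
  have mono: "E x <= E y" if "x <= y" for x y
    by (rule DERIV_nonneg_imp_nondecreasing[OF that]) (use E in force)
  have strict: "E 0 < E 1"
    by (rule DERIV_pos_imp_increasing[of 0 1]) (use E in force)+
  have mono2: "arctan x - E x <= arctan y - E y" if "x <= y" for x y
  proof (rule DERIV_nonneg_imp_nondecreasing[OF that])
    fix t :: real
    have "exp (t\<^sup>2) >= 1 + t\<^sup>2" by (rule exp_ge_add_one_self)
    then have "exp (- t\<^sup>2) <= inverse (1 + t\<^sup>2)"
      unfolding exp_minus by (intro le_imp_inverse_le) (auto simp: add_pos_nonneg)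
    then show "\<exists>y. ((%a. arctan a - E a) has_real_derivative y) (at t) \<and> 0 <= y"
      using DERIV_diff[OF DERIV_arctan E] by fastforce
  qed
  have bd: "\<bar>E x - E 0\<bar> <= 4" for x
  proof (cases "x >= 0")
    case True
    then show ?thesis using mono[of 0 x] mono2[of 0 x] arctan_bounded[of x] pi_less_4 by auto
  next
    case False
    then show ?thesis using mono[of x 0] mono2[of x 0] arctan_bounded[of x] pi_less_4 by auto
  qed
  define U L where "U = (SUP x. E x)" and "L = (INF x. E x)"
  have ba: "bdd_above (range E)" by (rule bdd_aboveI2[of _ _ "E 0 + 4"]) (use bd in \<open>smt (verit)\<close>)
  have bb: "bdd_below (range E)" by (rule bdd_belowI2[of _ "E 0 - 4"]) (use bd in \<open>smt (verit)\<close>)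
  have leU: "E x <= U" for x unfolding U_def by (rule cSUP_upper[OF _ ba]) auto
  have leL: "L <= E x" for x unfolding L_def by (rule cINF_lower[OF bb]) auto
  have tU: "(E \<longlongrightarrow> U) at_top"
  proof (rule increasing_tendsto)
    fix x assume "x < U"
    then obtain n where n: "x < E n" unfolding U_def using less_cSUP_iff[OF _ ba] by auto
    show "eventually (%y. x < E y) at_top"
      by (rule eventually_mono[OF eventually_ge_at_top[of n]], rule less_le_trans[OF n mono])
  qed (use leU in auto)
  have tL: "(E \<longlongrightarrow> L) at_bot"
  proof (rule decreasing_tendsto)
    fix x assume "L < x"
    then obtain n where n: "E n < x" unfolding L_def using cINF_less_iff[OF _ bb] by auto
    show "eventually (%y. E y < x) at_bot"
      by (rule eventually_mono[OF eventually_le_at_bot[of n]], rule le_less_trans[OF mono n])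
  qed (use leL in auto)
  have UL: "L < U" using strict leU[of 1] leL[of 0] by linarith
  show thesis
  proof (rule that[of "1 / (U - L)" "%x. (E x - L) / (U - L)"])
    show "mono (%x. (E x - L) / (U - L))" using mono UL by (auto simp: mono_def divide_right_mono)
    show "((%x. (E x - L) / (U - L)) has_real_derivative 1 / (U - L) * exp (- x\<^sup>2)) (at x)" for x
      using UL by (auto intro!: derivative_eq_intros E)
    show "((%x. (E x - L) / (U - L)) \<longlongrightarrow> 0) at_bot"
      using UL by (auto intro!: tendsto_eq_intros tL)
    show "((%x. (E x - L) / (U - L)) \<longlongrightarrow> 1) at_top"
      using UL by (auto intro!: tendsto_eq_intros tU)
  qed (use UL in auto)
qed

section \<open>Compactness: normal families and cluster points\<close>

text \<open>The bound is locally uniform, so Montel's theorem gives a limit along a subsequence. It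
  vanishes at the points of the line \<open>Re z = \<beta>\<close> over \<open>T\<close>; these
  accumulate at \<open>\<beta>\<close>, so it vanishes identically.\<close>

lemma strip_normal_family:
  fixes f :: "nat => complex => complex"
  assumes hol: "!!n. f n holomorphic_on ostrip"
    and bd: "!!n z. z \<in> ostrip ==> cmod (f n z) <= C * (1 / Re z + 1 / (1 - Re z))"
    and \<beta>: "0 < \<beta>" "\<beta> < 1" and T: "closure T = UNIV"
    and lim: "!!t. t \<in> T ==> (%n. f n (of_real \<beta> + \<i> * of_real t)) \<longlonglongrightarrow> 0"
    and z: "z \<in> ostrip"
  obtains r :: "nat => nat" where "strict_mono r" "(%n. f (r n) z) \<longlonglongrightarrow> 0"
proof -
  obtain g r where g: "g holomorphic_on ostrip" "strict_mono (r :: nat => nat)"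
    "!!x. x \<in> ostrip ==> ((%n. f (r n) x) \<longlongrightarrow> g x) sequentially"
  proof (rule Montel[OF open_ostrip, of "range f" f])
    fix K assume K: "compact K" "K \<subseteq> ostrip"
    have "continuous_on K (%z. C * (1 / Re z + 1 / (1 - Re z)))"
      using K(2) by (intro continuous_intros) (auto simp: ostrip_def)
    then have "bounded ((%z. C * (1 / Re z + 1 / (1 - Re z))) ` K)"
      using K(1) compact_continuous_image compact_imp_bounded by blast
    then obtain B where "\<forall>z\<in>K. \<bar>C * (1 / Re z + 1 / (1 - Re z))\<bar> <= B"
      unfolding bounded_iff by auto
    then have "cmod (f n z) <= B" if "z \<in> K" for n z
      using bd[of z n] K(2) that by (meson abs_ge_self order_trans subsetD)
    then show "\<exists>B. \<forall>h\<in>range f. \<forall>z\<in>K. norm (h z) <= B" by blast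
  qed (use hol in auto)
  define U where "U = (%t::real. of_real \<beta> + \<i> * of_real t) ` T"
  have "g z = 0"
  proof (rule analytic_continuation[OF g(1) open_ostrip, of U "of_real \<beta>"])
    show "connected ostrip" using convex_ostrip convex_connected by blast
    show "U \<subseteq> ostrip" using \<beta> by (auto simp: U_def ostrip_def)
    show "complex_of_real \<beta> \<in> ostrip" using \<beta> by (auto simp: ostrip_def)
    show "complex_of_real \<beta> islimpt U"
      unfolding islimpt_approachable
    proof (intro allI impI)
      fix e :: real assume e: "e > 0"
      have "e/2 \<in> closure T" using T by auto
      then obtain t where t: "t \<in> T" "dist t (e/2) < e/2"
        using e unfolding closure_approachable by (metis half_gt_zero)
      then have "t > 0" "t < e" unfolding dist_real_def by linarith+
      then show "\<exists>x'\<in>U. x' \<noteq> complex_of_real \<beta> \<and> dist x' (complex_of_real \<beta>) < e"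
        using t(1) unfolding U_def by (intro bexI[of _ "of_real \<beta> + \<i> * of_real t"]) (auto simp: dist_norm norm_mult)
    qed
    show "g w = 0" if w: "w \<in> U" for w
    proof -
      obtain t where t: "t \<in> T" "w = of_real \<beta> + \<i> * of_real t" using w by (auto simp: U_def)
      have "w \<in> ostrip" using t \<beta> by (auto simp: ostrip_def)
      moreover have "(%n. f (r n) w) \<longlonglongrightarrow> 0"
        using LIMSEQ_subseq_LIMSEQ[OF lim[OF t(1)] g(2)] t(2) by (simp add: o_def)
      ultimately show ?thesis using g(3) LIMSEQ_unique by blast
    qed
  qed (use z in auto)
  then show ?thesis using that g(2) g(3)[OF z] by simp
qed

text \<open>Tychonoff's theorem for a product of discs. The index set may be uncountable, so a
  filter finer than \<open>sequentially\<close> takes the place of a subsequence; ordinary limits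
  persist along it.\<close>

lemma pointwise_cluster_point:
  fixes c :: "'i => nat => complex"
  assumes bd: "!!i n. cmod (c i n) <= r i"
  obtains G l where "G <= sequentially" "G \<noteq> bot" "!!i. (c i \<longlongrightarrow> l i) G"
proof -
  define u where "u = (%n i. c i n)"
  define U where "U = PiE UNIV (%i. cball (0::complex) (r i))"
  have "compactin (product_topology (%i. euclidean) UNIV) U"
    unfolding U_def by (subst compactin_PiE) auto
  then have "compact U" by (simp add: euclidean_product_topology)
  moreover have "eventually (%x. x \<in> U) (filtermap u sequentially)"
    unfolding eventually_filtermap U_def u_def by (intro always_eventually allI) (simp add: PiE_iff bd)
  moreover have "filtermap u sequentially \<noteq> bot" by (simp add: filtermap_bot_iff)
  ultimately obtain l where l: "inf (nhds l) (filtermap u sequentially) \<noteq> bot"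
    unfolding compact_filter by blast
  \<comment> \<open>The indices are filtered by pulling back the neighbourhoods of the cluster point
    along \<open>u\<close>.\<close>
  define G where "G = inf sequentially (filtercomap u (nhds l))"
  have "G \<noteq> bot"
  proof
    assume "G = bot"
    then have "eventually (%_. False) G" by simp
    then obtain P Q where PQ: "eventually P sequentially" "eventually Q (filtercomap u (nhds l))" "!!n. P n ==> Q n ==> False"
      unfolding G_def eventually_inf by blast
    obtain Q' where Q': "eventually Q' (nhds l)" "!!n. Q' (u n) ==> Q n"
      using PQ(2) unfolding eventually_filtercomap by blast
    have "eventually (%x. \<not> Q' x) (filtermap u sequentially)"
      unfolding eventually_filtermap using PQ(1) by eventually_elim (use PQ(3) Q'(2) in blast)
    then have "eventually (%_. False) (inf (nhds l) (filtermap u sequentially))"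
      unfolding eventually_inf using Q'(1) by blast
    then show False using l by (simp add: eventually_False)
  qed
  moreover have "(u \<longlongrightarrow> l) G"
    unfolding G_def filterlim_def using filtermap_filtercomap filtermap_mono inf_le2 by (metis order_trans)
  then have "((%n. u n i) \<longlongrightarrow> l i) G" for i
    using continuous_on_tendsto_compose[OF continuous_on_product_coordinates[of i]] by auto
  ultimately show thesis using that[of G l] by (auto simp: G_def u_def)
qed

section \<open>Functions on the strip with values in a normed subspace\<close>

text \<open>Carrier and norm are locale parameters because one ambient type carries several norms:
  the same theory is applied to the spaces of the couple, to their sum and intersection, and to
  spaces of functionals.\<close>

locale cnorm =
  fixes C :: "'a::cvec set" and N :: "'a => real"
  assumes sub: "csubspace C" and nrm: "is_norm_on C N"
begin

lemmas mem_0 = csubspace_0[OF sub] and mem_add = csubspace_add[OF sub] and mem_scale = csubspace_scale[OF sub]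
  and mem_diff = csubspace_diff[OF sub] and mem_neg = csubspace_neg[OF sub] and mem_sum = csubspace_sum[OF sub]

lemma N_nonneg: "x \<in> C ==> 0 <= N x"
  and N_eq_0: "x \<in> C ==> N x = 0 ==> x = 0"
  and N_tri: "x \<in> C ==> y \<in> C ==> N (x + y) <= N x + N y"
  and N_scale: "x \<in> C ==> N (c *\<^sub>C x) = cmod c * N x"
  using nrm unfolding is_norm_on_def by auto

lemma N_0: "N 0 = 0"
  using nrm mem_0 unfolding is_norm_on_def by blast

lemma semi: "seminorm_on C N"
  unfolding seminorm_on_def using N_nonneg N_tri N_scale by blast

lemma N_neg: "x \<in> C ==> N (- x) = N x"
  using N_scale[of x "-1"] by simp

lemma N_minus: "x \<in> C ==> y \<in> C ==> N (x - y) <= N x + N y"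
  using N_tri[of x "- y"] N_neg[of y] mem_neg[of y] by simp

lemma N_comm: "x \<in> C ==> y \<in> C ==> N (x - y) = N (y - x)"
  using N_neg[of "x - y"] mem_diff[of x y] by simp

lemma N_via: "x \<in> C ==> y \<in> C ==> z \<in> C ==> N (x - z) <= N (x - y) + N (y - z)"
  using N_tri[of "x - y" "y - z"] mem_diff by simp

lemma N_le_add: "x \<in> C ==> y \<in> C ==> N x <= N y + N (x - y)"
  using N_tri[of y "x - y"] mem_diff by simp

lemma N_sum: "(!!i. i \<in> I ==> f i \<in> C) ==> N (sum f I) <= (\<Sum>i\<in>I. N (f i))"
proof (induction I rule: infinite_finite_induct)
  case (insert i I)
  then show ?case using N_tri[of "f i" "sum f I"] mem_sum[of I f] by fastforce
qed (auto simp: N_0)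

definition bfun :: "real => ('a => complex) => bool" where
  "bfun K L \<longleftrightarrow> clinear_on C L \<and> (\<forall>x\<in>C. cmod (L x) <= K * N x)"

lemma bfunD:
  assumes "bfun K L"
  shows "clinear_on C L" "x \<in> C ==> cmod (L x) <= K * N x"
  using assms unfolding bfun_def by auto

lemma bfun_diff: "bfun K L ==> x \<in> C ==> y \<in> C ==> L (x - y) = L x - L y"
  using clinear_on_diff[OF sub bfunD(1)] .

lemma bfun_scale: "bfun K L ==> x \<in> C ==> L (c *\<^sub>C x) = c * L x"
  using clinear_onD(2)[OF bfunD(1)] .

text \<open>Norming functionals turn a norm estimate into scalar ones; the vector-valued maximum
  principle, Taylor estimates and Lipschitz bounds are obtained in this way.\<close>

lemma N_le_functional:
  assumes x: "x \<in> C" and le: "!!L. bfun 1 L ==> cmod (L x) <= M"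
  shows "N x <= M"
proof -
  obtain L where "clinear_on C L" "!!y. y \<in> C ==> cmod (L y) <= N y" "L x = of_real (N x)"
    using hahn_banach_norming[OF sub semi x] by blast
  then show ?thesis using le[of L] N_nonneg[OF x] by (simp add: bfun_def)
qed

lemma functional_eqI:
  assumes x: "x \<in> C" "y \<in> C" and eq: "!!L. bfun 1 L ==> L x = L y"
  shows "x = y"
proof -
  have "N (x - y) <= 0"
    by (rule N_le_functional[OF mem_diff[OF x]]) (simp add: bfun_diff[OF _ x] eq)
  then show ?thesis using N_nonneg[OF mem_diff[OF x]] N_eq_0[OF mem_diff[OF x]] by simp
qed

lemma nderiv_unique:
  assumes "has_nderiv N f z d" "has_nderiv N f z d'" "d \<in> C" "d' \<in> C"
    and f: "eventually (%h. f (z + h) \<in> C) (at 0)" "f z \<in> C"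
  shows "d = d'"
proof -
  let ?q = "%d h. N (f (z + h) - f z - h *\<^sub>C d) / cmod h"
  have "((%h. ?q d h + ?q d' h) \<longlongrightarrow> 0 + 0) (at 0)"
    using assms(1,2) unfolding has_nderiv_def by (intro tendsto_add)
  moreover have "eventually (%h. N (d - d') <= ?q d h + ?q d' h) (at 0)"
    using f(1) eventually_neq_at_within[of 0 0 UNIV]
  proof eventually_elim
    case (elim h)
    define A where "A = f (z + h) - f z"
    have A: "A \<in> C" using elim f by (auto simp: A_def mem_diff)
    have "cmod h * N (d - d') = N (h *\<^sub>C (d - d'))" using N_scale mem_diff assms by simp
    also have "h *\<^sub>C (d - d') = (A - h *\<^sub>C d') - (A - h *\<^sub>C d)" by (simp add: cvec.scale_right_diff_distrib)
    also have "N \<dots> <= N (A - h *\<^sub>C d') + N (A - h *\<^sub>C d)"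
      by (intro N_minus mem_diff A mem_scale assms)
    finally show ?case using elim by (simp add: A_def field_simps)
  qed
  ultimately have "N (d - d') <= 0 + 0"
    by (intro tendsto_le[OF _ _ tendsto_const]) auto
  then show ?thesis using N_nonneg N_eq_0 mem_diff assms by (metis add_0 antisym eq_iff_diff_eq_0)
qed

text \<open>A second order remainder bound survives limits of functions, which a derivative given as
  a limit in \<open>h\<close> does not do by itself; so the derivatives of limit functions are
  verified through it.\<close>

lemma nderiv_from_quadratic:
  assumes q: "!!k. cmod k <= r ==> N (f (z + k) - f z - k *\<^sub>C d) <= c * (cmod k)\<^sup>2" and r: "r > 0"
    and f: "!!k. cmod k <= r ==> f (z + k) \<in> C" and d: "d \<in> C"
  shows "has_nderiv N f z d"
  unfolding has_nderiv_def
proof (rule Lim_null_comparison)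
  have fz: "f z \<in> C" using f[of 0] r by simp
  have "eventually (%h::complex. cmod h < r) (at 0)"
    using r by (auto simp: eventually_at dist_norm intro!: exI[of _ r])
  then show "eventually (%h. norm (N (f (z + h) - f z - h *\<^sub>C d) / cmod h) <= c * cmod h) (at 0)"
    using eventually_neq_at_within[of 0 0 UNIV]
  proof eventually_elim
    case (elim h)
    have "0 <= N (f (z + h) - f z - h *\<^sub>C d)" by (intro N_nonneg mem_diff mem_scale f fz d) (use elim in auto)
    then have "norm (N (f (z + h) - f z - h *\<^sub>C d) / cmod h) = N (f (z + h) - f z - h *\<^sub>C d) / cmod h" by simp
    also have "\<dots> <= (c * (cmod h)\<^sup>2) / cmod h" by (intro divide_right_mono q) (use elim in auto)
    also have "\<dots> = c * cmod h" by (simp add: power2_eq_square)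
    finally show ?case .
  qed
  show "((%h. c * cmod h) \<longlongrightarrow> 0) (at 0)" by (auto intro!: tendsto_eq_intros)
qed

text \<open>The conditions that \<open>Fspace\<close> and \<open>Gspace\<close> share, relative to
  the sum norm. The same notion serves for kernels with values in a space of functionals.\<close>

definition hol_strip :: "(complex => 'a) => bool" where
  "hol_strip f \<longleftrightarrow> (\<forall>z\<in>strip. f z \<in> C) \<and> ncont_on N strip f \<and> (\<forall>z\<in>ostrip. \<exists>d\<in>C. has_nderiv N f z d)"

lemma hol_stripD:
  assumes "hol_strip f"
  shows "z \<in> strip ==> f z \<in> C" "ncont_on N strip f" "z \<in> ostrip ==> \<exists>d\<in>C. has_nderiv N f z d"
  using assms unfolding hol_strip_def by auto

lemma eventually_ostrip: assumes "z \<in> ostrip" shows "eventually (%h. z + h \<in> ostrip) (at 0)"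
proof -
  obtain e where "e > 0" "ball z e \<subseteq> ostrip" using open_ostrip assms open_contains_ball by blast
  then show ?thesis
    by (auto simp: eventually_at dist_norm subset_iff intro!: exI[of _ e])
qed

lemma functional_continuous:
  assumes f: "ncont_on N T f" "!!z. z \<in> T ==> f z \<in> C"
    and L: "bfun K L"
  shows "continuous_on T (%z. L (f z))"
  unfolding continuous_on
proof
  fix z assume z: "z \<in> T"
  have "((%w. L (f w) - L (f z)) \<longlongrightarrow> 0) (at z within T)"
  proof (rule Lim_null_comparison)
    show "eventually (%w. norm (L (f w) - L (f z)) <= K * N (f w - f z)) (at z within T)"
      unfolding eventually_at_filter
      using bfunD(2)[OF L mem_diff] bfun_diff[OF L] f(2) z by (intro always_eventually) fastforce
    have "((%w. N (f w - f z)) \<longlongrightarrow> 0) (at z within T)" using f(1) z unfolding ncont_on_def by blast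
    then show "((%w. K * N (f w - f z)) \<longlongrightarrow> 0) (at z within T)" by (auto intro!: tendsto_eq_intros)
  qed
  then show "((%z. L (f z)) \<longlongrightarrow> L (f z)) (at z within T)" by (simp add: LIM_zero_iff)
qed

lemma functional_derivative:
  assumes f: "!!z. z \<in> strip ==> f z \<in> C" and z: "z \<in> ostrip" and d: "d \<in> C" "has_nderiv N f z d"
    and L: "bfun K L"
  shows "((%z. L (f z)) has_field_derivative L d) (at z)"
proof -
  have fz: "f z \<in> C" using f z ostrip_subset_strip by blast
  have "((%h. (L (f (z + h)) - L (f z)) / h - L d) \<longlongrightarrow> 0) (at 0)"
  proof (rule Lim_null_comparison)
    show "eventually (%h. norm ((L (f (z + h)) - L (f z)) / h - L d) <= K * (N (f (z + h) - f z - h *\<^sub>C d) / cmod h)) (at 0)"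
      using eventually_ostrip[OF z] eventually_neq_at_within[of 0 0 UNIV]
    proof eventually_elim
      case (elim h)
      have fh: "f (z + h) \<in> C" using f elim ostrip_subset_strip by blast
      have mm: "f (z + h) - f z \<in> C" "h *\<^sub>C d \<in> C" "f (z + h) - f z - h *\<^sub>C d \<in> C"
        by (intro mem_diff mem_scale fh fz d)+
      have e: "L (f (z + h) - f z - h *\<^sub>C d) = L (f (z + h)) - L (f z) - h * L d"
        using bfun_diff[OF L] mm fh fz bfun_scale[OF L d(1)] by simp
      have "norm ((L (f (z + h)) - L (f z)) / h - L d) = cmod (L (f (z + h) - f z - h *\<^sub>C d)) / cmod h"
        unfolding e using elim by (simp add: norm_divide[symmetric] field_simps)
      also have "\<dots> <= K * N (f (z + h) - f z - h *\<^sub>C d) / cmod h"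
        by (intro divide_right_mono bfunD(2)[OF L] mm) auto
      finally show ?case by simp
    qed
    show "((%h. K * (N (f (z + h) - f z - h *\<^sub>C d) / cmod h)) \<longlongrightarrow> 0) (at 0)"
      using tendsto_mult_left[OF d(2)[unfolded has_nderiv_def], of K] by simp
  qed
  then show ?thesis unfolding DERIV_def by (simp add: LIM_zero_iff)
qed

lemma hol_strip_functional:
  assumes f: "hol_strip f" and L: "bfun K L"
  shows "continuous_on strip (%z. L (f z))" "(%z. L (f z)) holomorphic_on ostrip"
    "z \<in> ostrip ==> d \<in> C ==> has_nderiv N f z d ==> deriv (%z. L (f z)) z = L d"
proof -
  have fC: "!!z. z \<in> strip ==> f z \<in> C" using hol_stripD(1)[OF f] .
  have D: "((%z. L (f z)) has_field_derivative L d) (at z)" if "z \<in> ostrip" "d \<in> C" "has_nderiv N f z d" for z d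
    by (rule functional_derivative[OF fC that L])
  show "continuous_on strip (%z. L (f z))"
    using functional_continuous[OF hol_stripD(2)[OF f] hol_stripD(1)[OF f] L] .
  show "(%z. L (f z)) holomorphic_on ostrip"
    unfolding holomorphic_on_open[OF open_ostrip] using D hol_stripD(3)[OF f] by blast
  show "z \<in> ostrip ==> d \<in> C ==> has_nderiv N f z d ==> deriv (%z. L (f z)) z = L d"
    using D DERIV_imp_deriv by blast
qed

lemma hol_strip_phragmen_lindelof:
  assumes f: "hol_strip f" and gr: "!!z. z \<in> strip ==> N (f z) <= K * (1 + cmod z)"
    and b: "!!t. N (f (bnd 0 t)) <= M" "!!t. N (f (bnd 1 t)) <= M" and z: "z \<in> strip"
  shows "N (f z) <= M"
proof (rule N_le_functional[OF hol_stripD(1)[OF f z]])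
  fix L assume L: "bfun 1 L"
  have L2: "cmod (L y) <= N y" if "y \<in> C" for y using bfunD(2)[OF L that] by simp
  note fC = hol_stripD(1)[OF f]
  show "cmod (L (f z)) <= M"
  proof (rule strip_phragmen_lindelof[OF hol_strip_functional(1,2)[OF f L], of K M z])
    show "cmod (L (f w)) <= K * (1 + cmod w)" if "w \<in> strip" for w
      using order_trans[OF L2[OF fC[OF that]] gr[OF that]] .
    show "cmod (L (f (bnd 0 t))) <= M" for t using order_trans[OF L2[OF fC] b(1)] by simp
    show "cmod (L (f (bnd 1 t))) <= M" for t using order_trans[OF L2[OF fC] b(2)] by (metis bnd_strip(2))
  qed (use z in auto)
qed

lemma hol_strip_taylor:
  assumes f: "hol_strip f" and z: "cball z r \<subseteq> ostrip" and r: "r > 0"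
    and B: "!!w. w \<in> cball z r ==> N (f w) <= B" and d: "d \<in> C" "has_nderiv N f z d"
  shows "N d <= B / r"
    "cmod k <= r / 2 ==> N (f (z + k) - f z - k *\<^sub>C d) <= 8 * B / r\<^sup>2 * (cmod k)\<^sup>2"
proof -
  have zo: "z \<in> ostrip" using z r by auto
  have C: "f w \<in> C" if "w \<in> cball z r" for w using hol_stripD(1)[OF f] that z ostrip_subset_strip by blast
  have T: "cmod (L d) <= B / r"
    "cmod k <= r / 2 ==> cmod (L (f (z + k)) - L (f z) - k * L d) <= 8 * B / r\<^sup>2 * (cmod k)\<^sup>2"
    if L: "bfun 1 L" for L k
  proof -
    note H = hol_strip_functional[OF f L]
    have "cmod (L (f w)) <= B" if "w \<in> cball z r" for w
      using bfunD(2)[OF L C[OF that]] B[OF that] by linarith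
    note T = taylor_second_order[OF H(2) open_ostrip z r this, unfolded H(3)[OF zo d]]
    show "cmod (L d) <= B / r" by (rule T)
    show "cmod k <= r / 2 ==> cmod (L (f (z + k)) - L (f z) - k * L d) <= 8 * B / r\<^sup>2 * (cmod k)\<^sup>2"
      by (rule T)
  qed
  show "N d <= B / r" by (rule N_le_functional[OF d(1)]) (rule T)
  show "N (f (z + k) - f z - k *\<^sub>C d) <= 8 * B / r\<^sup>2 * (cmod k)\<^sup>2" if k: "cmod k <= r / 2"
  proof (rule N_le_functional)
    have fk: "f (z + k) \<in> C" "f z \<in> C" using C r k by (auto simp: dist_norm)
    have mm: "f (z + k) - f z \<in> C" "k *\<^sub>C d \<in> C" by (intro mem_diff mem_scale fk d)+
    then show "f (z + k) - f z - k *\<^sub>C d \<in> C" by (rule mem_diff)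
    fix L assume L: "bfun 1 L"
    have "L (f (z + k) - f z - k *\<^sub>C d) = L (f (z + k)) - L (f z) - k * L d"
      using bfun_diff[OF L] mm fk bfun_scale[OF L d(1)] by simp
    then show "cmod (L (f (z + k) - f z - k *\<^sub>C d)) <= 8 * B / r\<^sup>2 * (cmod k)\<^sup>2" using T(2)[OF L k] by simp
  qed
qed

lemma ncont_on_mult:
  assumes f: "ncont_on N T f" "!!z. z \<in> T ==> f z \<in> C" and u: "continuous_on T u"
  shows "ncont_on N T (%z. u z *\<^sub>C f z)"
  unfolding ncont_on_def
proof
  fix z assume z: "z \<in> T"
  have uz: "(u \<longlongrightarrow> u z) (at z within T)" using u z by (auto simp: continuous_on)
  have fz: "((%w. N (f w - f z)) \<longlongrightarrow> 0) (at z within T)" using f(1) z unfolding ncont_on_def by blast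
  show "((%w. N (u w *\<^sub>C f w - u z *\<^sub>C f z)) \<longlongrightarrow> 0) (at z within T)"
  proof (rule Lim_null_comparison)
    show "eventually (%w. norm (N (u w *\<^sub>C f w - u z *\<^sub>C f z)) <= cmod (u w) * N (f w - f z) + cmod (u w - u z) * N (f z)) (at z within T)"
      unfolding eventually_at_filter
    proof (intro always_eventually allI impI)
      fix w assume w: "w \<in> T"
      have e: "u w *\<^sub>C f w - u z *\<^sub>C f z = u w *\<^sub>C (f w - f z) + (u w - u z) *\<^sub>C f z"
        by (simp add: cvec.scale_right_diff_distrib cvec.scale_left_diff_distrib)
      have mm: "f w - f z \<in> C" "u w *\<^sub>C (f w - f z) \<in> C" "(u w - u z) *\<^sub>C f z \<in> C"
        using f(2) w z by (auto intro: mem_diff mem_scale)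
      then show "norm (N (u w *\<^sub>C f w - u z *\<^sub>C f z)) <= cmod (u w) * N (f w - f z) + cmod (u w - u z) * N (f z)"
        unfolding e using N_tri[OF mm(2,3)] N_nonneg[OF mem_add[OF mm(2,3)]] N_scale[OF mm(1)] N_scale[OF f(2)[OF z]] by simp
    qed
    have "((%w. cmod (u w) * N (f w - f z) + cmod (u w - u z) * N (f z)) \<longlongrightarrow> cmod (u z) * 0 + cmod (u z - u z) * N (f z)) (at z within T)"
      by (intro tendsto_intros uz fz)
    then show "((%w. cmod (u w) * N (f w - f z) + cmod (u w - u z) * N (f z)) \<longlongrightarrow> 0) (at z within T)" by simp
  qed
qed

lemma ncont_on_add:
  assumes f: "ncont_on N T f" "!!z. z \<in> T ==> f z \<in> C" and g: "ncont_on N T g" "!!z. z \<in> T ==> g z \<in> C"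
  shows "ncont_on N T (%z. f z + g z)"
  unfolding ncont_on_def
proof
  fix z assume z: "z \<in> T"
  show "((%w. N (f w + g w - (f z + g z))) \<longlongrightarrow> 0) (at z within T)"
  proof (rule Lim_null_comparison)
    show "eventually (%w. norm (N (f w + g w - (f z + g z))) <= N (f w - f z) + N (g w - g z)) (at z within T)"
      unfolding eventually_at_filter
    proof (intro always_eventually allI impI)
      fix w assume w: "w \<in> T"
      have e: "f w + g w - (f z + g z) = (f w - f z) + (g w - g z)" by simp
      have mm: "f w - f z \<in> C" "g w - g z \<in> C" using f(2) g(2) w z by (auto intro: mem_diff)
      show "norm (N (f w + g w - (f z + g z))) <= N (f w - f z) + N (g w - g z)"
        unfolding e using N_tri[OF mm] N_nonneg[OF mem_add[OF mm]] by simp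
    qed
    show "((%w. N (f w - f z) + N (g w - g z)) \<longlongrightarrow> 0) (at z within T)"
      using f(1) g(1) z unfolding ncont_on_def by (auto intro!: tendsto_eq_intros)
  qed
qed

lemma ncont_on_const: "a \<in> C ==> ncont_on N T (%z. a)"
  unfolding ncont_on_def by (simp add: N_0)

lemma ncont_on_norm:
  assumes f: "ncont_on N T f" "!!z. z \<in> T ==> f z \<in> C"
  shows "continuous_on T (%z. N (f z))"
  unfolding continuous_on
proof
  fix z assume z: "z \<in> T"
  have "((%w. N (f w) - N (f z)) \<longlongrightarrow> 0) (at z within T)"
  proof (rule Lim_null_comparison)
    show "eventually (%w. norm (N (f w) - N (f z)) <= N (f w - f z)) (at z within T)"
      unfolding eventually_at_filter
    proof (intro always_eventually allI impI)
      fix w assume w: "w \<in> T"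
      show "norm (N (f w) - N (f z)) <= N (f w - f z)"
        using N_le_add[OF f(2)[OF w] f(2)[OF z]] N_le_add[OF f(2)[OF z] f(2)[OF w]] N_comm[OF f(2)[OF w] f(2)[OF z]]
        by (simp add: abs_le_iff)
    qed
    show "((%w. N (f w - f z)) \<longlongrightarrow> 0) (at z within T)" using f(1) z unfolding ncont_on_def by blast
  qed
  then show "((%z. N (f z)) \<longlongrightarrow> N (f z)) (at z within T)" by (simp add: LIM_zero_iff)
qed

lemma ncont_on_compose:
  assumes "ncont_on N T f" "continuous_on S g" "!!s. s \<in> S ==> g s \<in> T" "!!z. z \<in> T ==> f z \<in> C"
  shows "ncont_on N S (%s. f (g s))"
  unfolding ncont_on_def
proof
  fix s assume s: "s \<in> S"
  have "continuous_on T (%w. N (f w - f (g s)))"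
  proof -
    have "ncont_on N T (%w. f w + - f (g s))"
      by (rule ncont_on_add[OF assms(1) _ ncont_on_const]) (use assms s mem_neg in auto)
    then show ?thesis using ncont_on_norm[of T "%w. f w + - f (g s)"] assms s mem_diff by simp
  qed
  then have "continuous_on S (%s'. N (f (g s') - f (g s)))"
    by (rule continuous_on_compose2[OF _ assms(2)]) (use assms(3) in auto)
  then have "((%s'. N (f (g s') - f (g s))) \<longlongrightarrow> N (f (g s) - f (g s))) (at s within S)"
    using s unfolding continuous_on by blast
  then show "((%s'. N (f (g s') - f (g s))) \<longlongrightarrow> 0) (at s within S)" by (simp add: N_0)
qed

lemma has_nderiv_add:
  assumes "has_nderiv N f z d" "has_nderiv N g z e" "z \<in> ostrip" "d \<in> C" "e \<in> C"
    "!!w. w \<in> strip ==> f w \<in> C" "!!w. w \<in> strip ==> g w \<in> C"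
  shows "has_nderiv N (%z. f z + g z) z (d + e)"
  unfolding has_nderiv_def
proof (rule Lim_null_comparison)
  have zs: "z \<in> strip" using assms(3) ostrip_subset_strip by blast
  show "eventually (%h. norm (N (f (z + h) + g (z + h) - (f z + g z) - h *\<^sub>C (d + e)) / cmod h)
     <= N (f (z + h) - f z - h *\<^sub>C d) / cmod h + N (g (z + h) - g z - h *\<^sub>C e) / cmod h) (at 0)"
    using eventually_ostrip[OF assms(3)]
  proof eventually_elim
    case (elim h)
    then have hs: "z + h \<in> strip" using ostrip_subset_strip by blast
    have mm: "f (z + h) - f z - h *\<^sub>C d \<in> C" "g (z + h) - g z - h *\<^sub>C e \<in> C"
      by (intro mem_diff mem_scale assms hs zs)+
    have e: "f (z + h) + g (z + h) - (f z + g z) - h *\<^sub>C (d + e) = (f (z + h) - f z - h *\<^sub>C d) + (g (z + h) - g z - h *\<^sub>C e)"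
      by (simp add: scaleC_add_right)
    show ?case unfolding e add_divide_distrib[symmetric]
      using N_tri[OF mm] N_nonneg[OF mem_add[OF mm]] by (simp add: divide_right_mono)
  qed
  show "((%h. N (f (z + h) - f z - h *\<^sub>C d) / cmod h + N (g (z + h) - g z - h *\<^sub>C e) / cmod h) \<longlongrightarrow> 0) (at 0)"
    using tendsto_add[OF assms(1,2)[unfolded has_nderiv_def]] by simp
qed

lemma has_nderiv_mult:
  assumes f: "has_nderiv N f z d" and z: "z \<in> ostrip" and d: "d \<in> C" and fC: "!!w. w \<in> strip ==> f w \<in> C"
    and u: "(u has_field_derivative u') (at z)"
  shows "has_nderiv N (%z. u z *\<^sub>C f z) z (u' *\<^sub>C f z + u z *\<^sub>C d)"
  unfolding has_nderiv_def
proof (rule Lim_null_comparison)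
  have zs: "z \<in> strip" using z ostrip_subset_strip by blast
  let ?R = "%h. cmod (u (z + h)) * (N (f (z + h) - f z - h *\<^sub>C d) / cmod h) + cmod (u (z + h) - u z) * N d
      + cmod ((u (z + h) - u z) / h - u') * N (f z)"
  show "eventually (%h. norm (N (u (z + h) *\<^sub>C f (z + h) - u z *\<^sub>C f z - h *\<^sub>C (u' *\<^sub>C f z + u z *\<^sub>C d)) / cmod h) <= ?R h) (at 0)"
    using eventually_ostrip[OF z] eventually_neq_at_within[of 0 0 UNIV]
  proof eventually_elim
    case (elim h)
    then have hs: "z + h \<in> strip" using ostrip_subset_strip by blast
    define A where "A = f (z + h) - f z - h *\<^sub>C d"
    have A: "A \<in> C" unfolding A_def by (intro mem_diff mem_scale fC hs zs d)
    have ex: "u (z + h) *\<^sub>C f (z + h) - u z *\<^sub>C f z - h *\<^sub>C (u' *\<^sub>C f z + u z *\<^sub>C d)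
       = u (z + h) *\<^sub>C A + ((u (z + h) - u z) * h) *\<^sub>C d + (u (z + h) - u z - h * u') *\<^sub>C f z"
      unfolding A_def by (simp add: scaleC_add_right scaleC_scaleC cvec.scale_right_diff_distrib
        cvec.scale_left_diff_distrib algebra_simps)
    have mm: "u (z + h) *\<^sub>C A \<in> C" "((u (z + h) - u z) * h) *\<^sub>C d \<in> C" "(u (z + h) - u z - h * u') *\<^sub>C f z \<in> C"
      by (intro mem_scale A d fC zs)+
    have eq: "(u (z + h) - u z - h * u') = ((u (z + h) - u z) / h - u') * h" using elim by (simp add: field_simps)
    have "N (u (z + h) *\<^sub>C A + ((u (z + h) - u z) * h) *\<^sub>C d + (u (z + h) - u z - h * u') *\<^sub>C f z)
      <= cmod (u (z + h)) * N A + cmod ((u (z + h) - u z) * h) * N d + cmod (u (z + h) - u z - h * u') * N (f z)"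
      using N_tri[OF mem_add[OF mm(1,2)] mm(3)] N_tri[OF mm(1,2)] N_scale[OF A] N_scale[OF d] N_scale[OF fC[OF zs]] by simp
    also have "\<dots> = cmod h * ?R h"
      unfolding eq norm_mult A_def[symmetric] using elim by (simp add: algebra_simps)
    finally show ?case unfolding ex
      using N_nonneg[OF mem_add[OF mem_add[OF mm(1,2)] mm(3)]] elim by (simp add: divide_le_eq mult.commute)
  qed
  have u0: "((%h. u (z + h)) \<longlongrightarrow> u z) (at 0)" using DERIV_isCont[OF u] by (simp add: isCont_iff)
  have u1: "((%h. (u (z + h) - u z) / h) \<longlongrightarrow> u') (at 0)" using u unfolding DERIV_def .
  have "(?R \<longlongrightarrow> cmod (u z) * 0 + cmod (u z - u z) * N d + cmod (u' - u') * N (f z)) (at 0)"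
    using f unfolding has_nderiv_def by (intro tendsto_intros u0 u1)
  then show "(?R \<longlongrightarrow> 0) (at 0)" by simp
qed

lemma hol_strip_mult:
  assumes f: "hol_strip f" and u: "continuous_on strip u" "u holomorphic_on ostrip"
  shows "hol_strip (%z. u z *\<^sub>C f z)"
  unfolding hol_strip_def
proof (intro conjI ballI)
  fix z
  show "z \<in> strip ==> u z *\<^sub>C f z \<in> C" using hol_stripD(1)[OF f] mem_scale by blast
  assume z: "z \<in> ostrip"
  obtain d where d: "d \<in> C" "has_nderiv N f z d" using hol_stripD(3)[OF f z] by blast
  obtain u' where u': "(u has_field_derivative u') (at z)"
    using u(2) z unfolding holomorphic_on_open[OF open_ostrip] by blast
  have "u' *\<^sub>C f z + u z *\<^sub>C d \<in> C"
    using hol_stripD(1)[OF f] z ostrip_subset_strip d by (intro mem_add mem_scale) auto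
  then show "\<exists>d\<in>C. has_nderiv N (%z. u z *\<^sub>C f z) z d"
    using has_nderiv_mult[OF d(2) z d(1) hol_stripD(1)[OF f] u'] by blast
qed (use ncont_on_mult[OF hol_stripD(2,1)[OF f] u(1)] in auto)

lemma hol_strip_add:
  assumes f: "hol_strip f" and g: "hol_strip g"
  shows "hol_strip (%z. f z + g z)"
  unfolding hol_strip_def
proof (intro conjI ballI)
  fix z
  show "z \<in> strip ==> f z + g z \<in> C" using hol_stripD(1)[OF f] hol_stripD(1)[OF g] mem_add by blast
  assume z: "z \<in> ostrip"
  obtain d e where de: "d \<in> C" "has_nderiv N f z d" "e \<in> C" "has_nderiv N g z e"
    using hol_stripD(3)[OF f z] hol_stripD(3)[OF g z] by blast
  have "has_nderiv N (%z. f z + g z) z (d + e)"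
    by (rule has_nderiv_add[OF de(2,4) z de(1,3)]) (simp_all add: hol_stripD(1)[OF f] hol_stripD(1)[OF g])
  then show "\<exists>d\<in>C. has_nderiv N (%z. f z + g z) z d" using mem_add[OF de(1,3)] by blast
qed (use ncont_on_add[OF hol_stripD(2,1)[OF f] hol_stripD(2,1)[OF g]] in auto)

lemma hol_strip_const: "a \<in> C ==> hol_strip (%z. a)"
  unfolding hol_strip_def
  by (auto simp: ncont_on_const has_nderiv_def N_0 intro!: bexI[of _ 0] mem_0)

lemma hol_strip_scale: "hol_strip f ==> hol_strip (%z. c *\<^sub>C f z)"
  by (rule hol_strip_mult) auto

lemma hol_strip_diff: "hol_strip f ==> hol_strip g ==> hol_strip (%z. f z - g z)"
  using hol_strip_add[of f "%z. (-1) *\<^sub>C g z"] hol_strip_scale[of g "-1"] by simp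

lemma has_nderiv_shift: "has_nderiv N (%z. f (z + c)) z d \<longleftrightarrow> has_nderiv N f (z + c) d"
  unfolding has_nderiv_def by (simp add: algebra_simps)

lemma hol_strip_shift:
  assumes f: "hol_strip f"
  shows "hol_strip (%z. f (z + \<i> * of_real t))"
  unfolding hol_strip_def
proof (intro conjI ballI)
  have s: "z + \<i> * of_real t \<in> strip" if "z \<in> strip" for z using that by (auto simp: strip_def)
  show "z \<in> strip ==> f (z + \<i> * of_real t) \<in> C" for z using hol_stripD(1)[OF f] s by blast
  show "ncont_on N strip (%z. f (z + \<i> * of_real t))"
    by (rule ncont_on_compose[OF hol_stripD(2)[OF f]]) (use s hol_stripD(1)[OF f] in \<open>auto intro!: continuous_intros\<close>)
  fix z assume "z \<in> ostrip"
  then have "z + \<i> * of_real t \<in> ostrip" by (auto simp: ostrip_def)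
  then show "\<exists>d\<in>C. has_nderiv N (%z. f (z + \<i> * of_real t)) z d"
    using hol_stripD(3)[OF f] unfolding has_nderiv_shift by blast
qed

end

subsection \<open>Interpolation couples\<close>

lemma banach_onD:
  assumes "banach_on C N"
  shows "cnorm C N"
    "(!!n. X n \<in> C) ==> (!!e. e > 0 ==> \<exists>M. \<forall>m\<ge>M. \<forall>n\<ge>M. N (X m - X n) < e) ==> \<exists>x\<in>C. (%n. N (X n - x)) \<longlonglongrightarrow> 0"
  using assms unfolding banach_on_def cnorm_def by blast+

section \<open>Limits and geometric series in the abstract norm\<close>

context cnorm begin

lemma N_tendsto_dist:
  assumes "!!n. X n \<in> C" "x \<in> C" "y \<in> C" "(%n. N (X n - x)) \<longlonglongrightarrow> 0"
  shows "(%n. N (X n - y)) \<longlonglongrightarrow> N (x - y)"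
proof -
  have "(%n. N (X n - y) - N (x - y)) \<longlonglongrightarrow> 0"
  proof (rule Lim_null_comparison[OF always_eventually[OF allI] assms(4)])
    fix n
    show "norm (N (X n - y) - N (x - y)) <= N (X n - x)"
      using N_via[OF assms(1)[of n] assms(2,3)] N_via[OF assms(2) assms(1)[of n] assms(3)] N_comm[OF assms(1)[of n] assms(2)]
      by (simp add: abs_le_iff)
  qed
  then show ?thesis by (simp add: LIM_zero_iff)
qed

lemma N_tendsto:
  assumes "!!n. X n \<in> C" "x \<in> C" "(%n. N (X n - x)) \<longlonglongrightarrow> 0"
  shows "(%n. N (X n)) \<longlonglongrightarrow> N x"
  using N_tendsto_dist[OF assms(1,2) mem_0 assms(3)] by simp

lemma N_limit_unique:
  assumes "!!n. X n \<in> C" "x \<in> C" "y \<in> C" "(%n. N (X n - x)) \<longlonglongrightarrow> 0" "(%n. N (X n - y)) \<longlonglongrightarrow> 0"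
  shows "x = y"
proof -
  have "N (x - y) = 0" using N_tendsto_dist[OF assms(1-4)] assms(5) LIMSEQ_unique by blast
  then show ?thesis using N_eq_0[OF mem_diff[OF assms(2,3)]] by simp
qed

lemma geometric_sum_diff:
  fixes m n :: nat
  assumes x: "!!k. x k \<in> C" "!!k. N (x k) <= c * (1/2)^k" and mn: "m <= n" and c: "c >= 0"
  shows "N ((\<Sum>k<n. x k) - (\<Sum>k<m. x k)) <= 2 * c * (1/2)^m"
proof -
  have "(\<Sum>k<n. x k) - (\<Sum>k<m. x k) = (\<Sum>k=m..<n. x k)"
    using sum_diff_nat_ivl[of 0 m n x] mn by (simp add: atLeast0LessThan)
  then have "N ((\<Sum>k<n. x k) - (\<Sum>k<m. x k)) <= (\<Sum>k=m..<n. N (x k))"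
    using N_sum[of "{m..<n}" x] x(1) by simp
  also have "\<dots> <= (\<Sum>k=m..<n. c * (1/2)^k)" by (intro sum_mono x(2))
  also have "\<dots> <= 2 * c * (1/2)^m - 2 * c * (1/2)^n"
    using mn by (induction rule: dec_induct) auto
  also have "\<dots> <= 2 * c * (1/2)^m" using c by simp
  finally show ?thesis .
qed

text \<open>The explicit rate is part of the conclusion: where \<open>c\<close> is independent of a
  parameter, it gives uniform convergence of a series of functions.\<close>

lemma geometric_series:
  assumes B: "banach_on C N" and x: "!!k. x k \<in> C" "!!k. N (x k) <= c * (1/2)^k"
  obtains s where "s \<in> C" "!!n. N ((\<Sum>k<n. x k) - s) <= 2 * c * (1/2)^n"
proof -
  have c: "c >= 0" using order_trans[OF N_nonneg[OF x(1)] x(2), of 0] by simp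
  have S: "(\<Sum>k<n. x k) \<in> C" for n using x by (auto intro: mem_sum)
  have d: "N ((\<Sum>k<n. x k) - (\<Sum>k<m. x k)) <= 2 * c * (1/2)^min m n" for m n :: nat
    using geometric_sum_diff[of x c m n] geometric_sum_diff[of x c n m] x c N_comm[OF S S, of n m]
    by (cases "m <= n") (auto simp: min_def)
  have lim: "(%n. 2 * c * (1/2)^n) \<longlonglongrightarrow> 0" by real_asymp
  have "\<exists>s\<in>C. (%n. N ((\<Sum>k<n. x k) - s)) \<longlonglongrightarrow> 0"
  proof (rule banach_onD(2)[OF B S])
    fix e :: real assume "e > 0"
    then have "eventually (%n. 2 * c * (1/2)^n < e) sequentially" using lim order_tendstoD(2) by blast
    then obtain M where M: "!!n. n >= M ==> 2 * c * (1/2)^n < e" unfolding eventually_sequentially by blast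
    have "N ((\<Sum>k<m. x k) - (\<Sum>k<n. x k)) < e" if "m >= M" "n >= M" for m n
      using d[of m n] M[of "min n m"] that by simp
    then show "\<exists>M. \<forall>m\<ge>M. \<forall>n\<ge>M. N ((\<Sum>k<m. x k) - (\<Sum>k<n. x k)) < e" by blast
  qed
  then obtain s where s: "s \<in> C" "(%n. N ((\<Sum>k<n. x k) - s)) \<longlonglongrightarrow> 0" by blast
  show thesis
  proof (rule that[OF s(1)])
    fix m
    have "(%n. N ((\<Sum>k<n. x k) - (\<Sum>k<m. x k))) \<longlonglongrightarrow> N (s - (\<Sum>k<m. x k))"
      by (rule N_tendsto_dist[OF S s(1) S s(2)])
    moreover have "eventually (%n. N ((\<Sum>k<n. x k) - (\<Sum>k<m. x k)) <= 2 * c * (1/2)^m) sequentially"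
      using eventually_ge_at_top[of m]
    proof eventually_elim
      case (elim n)
      then show ?case using d[where m = m and n = n] by (simp add: min_absorb1)
    qed
    ultimately have "N (s - (\<Sum>k<m. x k)) <= 2 * c * (1/2)^m"
      using tendsto_upperbound by (metis trivial_limit_sequentially)
    then show "N ((\<Sum>k<m. x k) - s) <= 2 * c * (1/2)^m" using N_comm[OF S s(1)] by simp
  qed
qed

lemma ncont_on_uniform_limit:
  assumes f: "!!n. ncont_on N T (f n)" "!!n z. z \<in> T ==> f n z \<in> C" "!!z. z \<in> T ==> g z \<in> C"
    and le: "!!n z. z \<in> T ==> N (f n z - g z) <= \<epsilon> n" and \<epsilon>: "\<epsilon> \<longlonglongrightarrow> 0"
  shows "ncont_on N T g"
  unfolding ncont_on_def
proof
  fix z assume z: "z \<in> T"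
  show "((%w. N (g w - g z)) \<longlongrightarrow> 0) (at z within T)"
  proof (rule tendstoI)
    fix e :: real assume e: "e > 0"
    then have "eventually (%n. \<epsilon> n < e/4) sequentially" using order_tendstoD(2)[OF \<epsilon>, of "e/4"] by simp
    then obtain n where n: "\<epsilon> n < e/4" using eventually_happens'[OF trivial_limit_sequentially] by blast
    have "((%w. N (f n w - f n z)) \<longlongrightarrow> 0) (at z within T)" using f(1) z unfolding ncont_on_def by blast
    then have "eventually (%w. N (f n w - f n z) < e/4) (at z within T)" using order_tendstoD(2) e by (metis divide_pos_pos zero_less_numeral)
    moreover have "eventually (%w. w \<in> T) (at z within T)" by (simp add: eventually_at_filter)
    ultimately show "eventually (%w. dist (N (g w - g z)) 0 < e) (at z within T)"
    proof eventually_elim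
      case (elim w)
      note c = f(2)[OF elim(2), of n] f(2)[OF z, of n] f(3)[OF elim(2)] f(3)[OF z]
      have "N (g w - g z) <= N (g w - f n w) + (N (f n w - f n z) + N (f n z - g z))"
        using N_via[OF c(3,1,4)] N_via[OF c(1,2,4)] by linarith
      also have "N (g w - f n w) = N (f n w - g w)" by (rule N_comm[OF c(3,1)])
      finally have "N (g w - g z) < e" using le[OF elim(2), of n] le[OF z, of n] elim(1) n e by linarith
      then show ?case using N_nonneg[OF mem_diff[OF c(3,4)]] by simp
    qed
  qed
qed

text \<open>Cauchy's estimate makes the derivatives \<open>d k\<close> geometrically small, so they
  have a sum. The quadratic remainder bound for the partial sums is uniform in \<open>n\<close> and
  passes to the limit.\<close>

lemma hol_strip_series:
  assumes B: "banach_on C N" and f: "!!k. hol_strip (f k)" "!!k z. z \<in> strip ==> N (f k z) <= c * (1/2)^k"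
    and g: "!!z. z \<in> strip ==> g z \<in> C" "!!n z. z \<in> strip ==> N ((\<Sum>k<n. f k z) - g z) <= 2 * c * (1/2)^n"
  shows "hol_strip g"
proof -
  have lim: "(%n. 2 * c * (1/2)^n) \<longlonglongrightarrow> 0" by real_asymp
  have hs: "hol_strip (%z. \<Sum>k<n. f k z)" for n
    by (induction n) (auto intro: hol_strip_const mem_0 hol_strip_add f(1))
  have c0: "c >= 0" using order_trans[OF N_nonneg[OF hol_stripD(1)[OF f(1)]] f(2), of "bnd 0 0" 0] by simp
  have Sb: "N (\<Sum>k<n. f k z) <= 2 * c" if z: "z \<in> strip" for n z
    using geometric_sum_diff[of "%k. f k z" c 0 n] hol_stripD(1)[OF f(1) z] f(2)[OF z] c0 by simp
  show ?thesis
    unfolding hol_strip_def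
  proof (intro conjI ballI)
    show "z \<in> strip ==> g z \<in> C" for z by (rule g)
    show "ncont_on N strip g"
      by (rule ncont_on_uniform_limit[OF hol_stripD(2)[OF hs] hol_stripD(1)[OF hs] g lim])
    fix z assume z: "z \<in> ostrip"
    obtain e where e: "e > 0" "ball z e \<subseteq> ostrip" using open_ostrip z open_contains_ball by blast
    define r where "r = e / 2"
    have r: "r > 0" "cball z r \<subseteq> ostrip" using e by (auto simp: r_def subset_iff)
    have "\<exists>d. \<forall>k. d k \<in> C \<and> has_nderiv N (f k) z (d k)"
      using hol_stripD(3)[OF f(1) z] by metis
    then obtain d where d: "!!k. d k \<in> C" "!!k. has_nderiv N (f k) z (d k)" by blast
    have dsum: "has_nderiv N (%z. \<Sum>k<n. f k z) z (\<Sum>k<n. d k)" for n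
    proof (induction n)
      case 0 then show ?case by (simp add: has_nderiv_def N_0)
    next
      case (Suc n)
      have "has_nderiv N (%z. (\<Sum>k<n. f k z) + f n z) z ((\<Sum>k<n. d k) + d n)"
        by (rule has_nderiv_add[OF Suc d(2) z _ d(1)]) (auto intro: mem_sum d hol_stripD(1)[OF f(1)])
      then show ?case by simp
    qed
    have "N (d k) <= c * (1/2)^k / r" for k
      by (rule hol_strip_taylor(1)[OF f(1) r(2,1) _ d]) (use f(2) r(2) ostrip_subset_strip in blast)
    then have dk: "N (d k) <= (c / r) * (1/2)^k" for k by (simp add: mult.commute)
    obtain D where D: "D \<in> C" "!!n. N ((\<Sum>k<n. d k) - D) <= 2 * (c / r) * (1/2)^n"
      using geometric_series[of d "c / r", OF B d(1) dk] by blast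
    have "has_nderiv N g z D"
    proof (rule nderiv_from_quadratic[where r = "r / 2" and c = "8 * (2 * c) / r\<^sup>2"])
      fix k :: complex assume k: "cmod k <= r / 2"
      have zk: "z + k \<in> strip" "z \<in> strip"
        using k r z ostrip_subset_strip by (auto simp: dist_norm subset_iff)
      show gk: "g (z + k) \<in> C" by (rule g[OF zk(1)])
      note gz = g(1)[OF zk(2)]
      define S where "S = (%n. \<Sum>j<n. f j (z + k))"
      define S' where "S' = (%n. \<Sum>j<n. f j z)"
      define E where "E = (%n. \<Sum>j<n. d j)"
      have mC: "S n \<in> C" "S' n \<in> C" "E n \<in> C" for n
        unfolding S_def S'_def E_def using hol_stripD(1)[OF hs] zk d by (auto intro: mem_sum)
      have T: "N (S n - S' n - k *\<^sub>C E n) <= 8 * (2 * c) / r\<^sup>2 * (cmod k)\<^sup>2" for n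
        unfolding S_def S'_def E_def
        by (rule hol_strip_taylor(2)[OF hs r(2,1) _ mem_sum[OF d(1)] dsum k], rule Sb)
           (use r(2) ostrip_subset_strip in blast)
      have XC: "S n - S' n - k *\<^sub>C E n \<in> C" for n by (intro mem_diff mem_scale mC)
      have YC: "g (z + k) - g z - k *\<^sub>C D \<in> C" by (intro mem_diff mem_scale gk gz D)
      have "(%n. N ((S n - S' n - k *\<^sub>C E n) - (g (z + k) - g z - k *\<^sub>C D))) \<longlonglongrightarrow> 0"
      proof (rule Lim_null_comparison[OF always_eventually[OF allI]])
        fix n
        have e: "(S n - S' n - k *\<^sub>C E n) - (g (z + k) - g z - k *\<^sub>C D)
           = (S n - g (z + k)) - (S' n - g z) - k *\<^sub>C (E n - D)"
          by (simp add: cvec.scale_right_diff_distrib)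
        have m: "S n - g (z + k) \<in> C" "S' n - g z \<in> C" "E n - D \<in> C" "k *\<^sub>C (E n - D) \<in> C"
          by (intro mem_diff mem_scale mC gk gz D)+
        have "N ((S n - g (z + k)) - (S' n - g z) - k *\<^sub>C (E n - D)) <= N (S n - g (z + k)) + N (S' n - g z) + cmod k * N (E n - D)"
          using N_minus[OF mem_diff[OF m(1,2)] m(4)] N_minus[OF m(1,2)] N_scale[OF m(3)] by simp
        also have "\<dots> <= 2 * c * (1/2)^n + 2 * c * (1/2)^n + cmod k * (2 * (c / r) * (1/2)^n)"
          unfolding S_def S'_def E_def by (intro add_mono mult_left_mono g D zk) auto
        finally show "norm (N ((S n - S' n - k *\<^sub>C E n) - (g (z + k) - g z - k *\<^sub>C D)))
           <= 2 * c * (1/2)^n + 2 * c * (1/2)^n + cmod k * (2 * (c / r) * (1/2)^n)"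
          unfolding e using N_nonneg[OF mem_diff[OF mem_diff[OF m(1,2)] m(4)]] by simp
      next
        show "(%n. 2 * c * (1/2)^n + 2 * c * (1/2)^n + cmod k * (2 * (c / r) * (1/2)^n)) \<longlonglongrightarrow> 0"
          by real_asymp
      qed
      from N_tendsto[OF XC YC this] show "N (g (z + k) - g z - k *\<^sub>C D) <= 8 * (2 * c) / r\<^sup>2 * (cmod k)\<^sup>2"
        by (rule tendsto_upperbound) (use T in auto)
    qed (use r D in auto)
    then show "\<exists>d\<in>C. has_nderiv N g z d" using D(1) by blast
  qed
qed

end

text \<open>The denominator \<open>r + 1\<close> keeps the share of the error meaningful when
  \<open>r = 0\<close>.\<close>

lemma scale_epsilon:
  fixes r :: real
  assumes "r >= 0" "e >= 0"
  shows "r * (y + e / (r + 1)) <= r * y + e"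
proof -
  have "r * (e / (r + 1)) = e * (r / (r + 1))" by simp
  also have "\<dots> <= e * 1" using assms by (intro mult_left_mono) auto
  finally show ?thesis by (simp add: distrib_left)
qed

lemma csumI: "a \<in> C0 ==> b \<in> C1 ==> a + b \<in> csum C0 C1"
  unfolding csum_def by blast

section \<open>The sum of a couple\<close>

text \<open>Completeness is postponed to \<open>bcouple\<close>: the given couple is complete, while
  the dual couple enters as a normed couple only.\<close>

locale ncouple =
  fixes C0 :: "'a::cvec set" and M0 :: "'a => real" and C1 :: "'a set" and M1 :: "'a => real"
  assumes couple0: "cnorm C0 M0" and couple1: "cnorm C1 M1"
    and hausdorff: "!!x. x \<in> csum C0 C1 ==> sumnorm C0 M0 C1 M1 x = 0 ==> x = 0"
begin

sublocale c0: cnorm C0 M0 by (rule couple0)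
sublocale c1: cnorm C1 M1 by (rule couple1)

abbreviation S where "S \<equiv> csum C0 C1"
abbreviation SN where "SN \<equiv> sumnorm C0 M0 C1 M1"

lemma sumnorm_le: "a \<in> C0 ==> b \<in> C1 ==> SN (a + b) <= M0 a + M1 b"
  unfolding sumnorm_def
  by (rule cInf_lower) (auto intro!: bdd_belowI[of _ 0] add_nonneg_nonneg c0.N_nonneg c1.N_nonneg)

lemma sumnorm_decomp:
  assumes "x \<in> S" "e > 0"
  obtains a b where "a \<in> C0" "b \<in> C1" "x = a + b" "M0 a + M1 b < SN x + e"
proof -
  let ?A = "{M0 a + M1 b | a b. a \<in> C0 \<and> b \<in> C1 \<and> x = a + b}"
  have "?A \<noteq> {}" using assms(1) unfolding csum_def by blast
  then have "\<exists>y\<in>?A. y < SN x + e"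
    using cInf_lessD[of ?A "SN x + e"] assms(2) unfolding sumnorm_def by auto
  then show thesis using that by blast
qed

lemma S0: "a \<in> C0 ==> a \<in> S" using csumI[OF _ c1.mem_0] by fastforce
lemma S1: "a \<in> C1 ==> a \<in> S" using csumI[OF c0.mem_0] by fastforce
lemma SN0: "a \<in> C0 ==> SN a <= M0 a" using sumnorm_le[OF _ c1.mem_0, of a] c1.N_0 by simp
lemma SN1: "a \<in> C1 ==> SN a <= M1 a" using sumnorm_le[OF c0.mem_0, of a] c0.N_0 by simp

lemma sumnorm_nonneg: "x \<in> S ==> 0 <= SN x"
  unfolding sumnorm_def
  by (rule cInf_greatest) (auto simp: csum_def intro!: add_nonneg_nonneg c0.N_nonneg c1.N_nonneg)

lemma csubspace_csum: "csubspace S"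
  unfolding csubspace_def
proof (intro conjI ballI allI)
  show "0 \<in> S" using S0[OF c0.mem_0] .
next
  fix x y assume "x \<in> S" "y \<in> S"
  then obtain a b a' b' where "a \<in> C0" "b \<in> C1" "x = a + b" "a' \<in> C0" "b' \<in> C1" "y = a' + b'"
    unfolding csum_def by blast
  then have "x + y = (a + a') + (b + b')" "a + a' \<in> C0" "b + b' \<in> C1"
    using c0.mem_add c1.mem_add by (auto simp: algebra_simps)
  then show "x + y \<in> S" using csumI by metis
next
  fix c x assume "x \<in> S"
  then obtain a b where "a \<in> C0" "b \<in> C1" "x = a + b" unfolding csum_def by blast
  then have "c *\<^sub>C x = c *\<^sub>C a + c *\<^sub>C b" "c *\<^sub>C a \<in> C0" "c *\<^sub>C b \<in> C1"
    using c0.mem_scale c1.mem_scale by (auto simp: scaleC_add_right)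
  then show "c *\<^sub>C x \<in> S" using csumI by metis
qed

lemma is_norm_sumnorm: "is_norm_on S SN"
proof -
  have tri: "SN (x + y) <= SN x + SN y" if xy: "x \<in> S" "y \<in> S" for x y
  proof (rule field_le_epsilon)
    fix e :: real assume "e > 0"
    then have e: "e / 2 > 0" by simp
    obtain a b where ab: "a \<in> C0" "b \<in> C1" "x = a + b" "M0 a + M1 b < SN x + e/2"
      using sumnorm_decomp[OF xy(1) e] .
    obtain a' b' where ab': "a' \<in> C0" "b' \<in> C1" "y = a' + b'" "M0 a' + M1 b' < SN y + e/2"
      using sumnorm_decomp[OF xy(2) e] .
    have "x + y = (a + a') + (b + b')" using ab ab' by (simp add: algebra_simps)
    then have "SN (x + y) <= M0 (a + a') + M1 (b + b')"
      using sumnorm_le[OF c0.mem_add[OF ab(1) ab'(1)] c1.mem_add[OF ab(2) ab'(2)]] by simp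
    also have "\<dots> <= (M0 a + M0 a') + (M1 b + M1 b')"
      by (intro add_mono c0.N_tri c1.N_tri ab ab')
    finally show "SN (x + y) <= SN x + SN y + e" using ab ab' by linarith
  qed
  have hom1: "SN (c *\<^sub>C x) <= cmod c * SN x" if xS: "x \<in> S" for c x
  proof (rule field_le_epsilon)
    fix e :: real assume e: "e > 0"
    then have e': "e / (cmod c + 1) > 0" by (simp add: add_nonneg_pos)
    obtain a b where ab: "a \<in> C0" "b \<in> C1" "x = a + b" "M0 a + M1 b < SN x + e / (cmod c + 1)"
      using sumnorm_decomp[OF xS e'] .
    have "SN (c *\<^sub>C x) <= M0 (c *\<^sub>C a) + M1 (c *\<^sub>C b)"
      using sumnorm_le[OF c0.mem_scale[OF ab(1)] c1.mem_scale[OF ab(2)]] ab(3) by (simp add: scaleC_add_right)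
    also have "\<dots> = cmod c * (M0 a + M1 b)" using c0.N_scale[OF ab(1)] c1.N_scale[OF ab(2)] by (simp add: algebra_simps)
    also have "\<dots> <= cmod c * (SN x + e / (cmod c + 1))" using ab by (intro mult_left_mono) auto
    also have "\<dots> <= cmod c * SN x + e"
      using e by (intro scale_epsilon) auto
    finally show "SN (c *\<^sub>C x) <= cmod c * SN x + e" .
  qed
  have z: "SN 0 = 0" using SN0[OF c0.mem_0] c0.N_0 sumnorm_nonneg[OF S0[OF c0.mem_0]] by simp
  have hom: "SN (c *\<^sub>C x) = cmod c * SN x" if x: "x \<in> S" for c x
  proof (cases "c = 0")
    case False
    have "SN ((1/c) *\<^sub>C c *\<^sub>C x) <= cmod (1/c) * SN (c *\<^sub>C x)"
      by (rule hom1) (use csubspace_scale[OF csubspace_csum x] in auto)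
    then have "cmod c * SN x <= SN (c *\<^sub>C x)" using False by (simp add: norm_divide field_simps)
    then show ?thesis using hom1[OF x, of c] by simp
  qed (simp add: z)
  show ?thesis unfolding is_norm_on_def using sumnorm_nonneg z hausdorff tri hom by auto
qed

sublocale s: cnorm S SN by (rule cnorm.intro[OF csubspace_csum is_norm_sumnorm])

section \<open>The space G and its Lipschitz seminorm\<close>

abbreviation G where "G \<equiv> Gspace C0 M0 C1 M1"
abbreviation GN where "GN \<equiv> Gnorm C0 M0 C1 M1"
abbreviation Gd where "Gd \<equiv> gderiv C0 M0 C1 M1"

text \<open>The quotient conditions of \<open>Gspace\<close> multiplied out: they then hold for
  equal arguments too and can be added, scaled and passed to limits without division.\<close>

definition lip_on_boundary :: "(complex => 'a) => real => bool" where
  "lip_on_boundary g L \<longleftrightarrow> (\<forall>t t'. g (bnd 0 t) - g (bnd 0 t') \<in> C0 \<and> g (bnd 1 t) - g (bnd 1 t') \<in> C1 \<and>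
      M0 (g (bnd 0 t) - g (bnd 0 t')) <= L * \<bar>t - t'\<bar> \<and> M1 (g (bnd 1 t) - g (bnd 1 t')) <= L * \<bar>t - t'\<bar>)"

lemma quotient_norm:
  assumes "t \<noteq> t'"
  shows "x \<in> C0 ==> M0 ((1 / complex_of_real (t - t')) *\<^sub>C x) = M0 x / \<bar>t - t'\<bar>"
    "x \<in> C1 ==> M1 ((1 / complex_of_real (t - t')) *\<^sub>C x) = M1 x / \<bar>t - t'\<bar>"
proof -
  have "cmod (1 / complex_of_real (t - t')) = 1 / \<bar>t - t'\<bar>"
    by (metis norm_divide norm_of_real norm_one)
  then show "x \<in> C0 ==> M0 ((1 / complex_of_real (t - t')) *\<^sub>C x) = M0 x / \<bar>t - t'\<bar>"
    "x \<in> C1 ==> M1 ((1 / complex_of_real (t - t')) *\<^sub>C x) = M1 x / \<bar>t - t'\<bar>"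
    using c0.N_scale c1.N_scale by auto
qed

lemma G_iff:
  "g \<in> G \<longleftrightarrow> s.hol_strip g \<and> (\<exists>K. \<forall>z\<in>strip. SN (g z) <= K * (1 + cmod z)) \<and> (\<exists>L. lip_on_boundary g L)"
  (is "_ \<longleftrightarrow> ?R")
proof
  assume g: "g \<in> G"
  then obtain L where L: "!!t t'. t \<noteq> t' ==>
      M0 ((1 / complex_of_real (t - t')) *\<^sub>C (g (bnd 0 t) - g (bnd 0 t'))) <= L \<and>
      M1 ((1 / complex_of_real (t - t')) *\<^sub>C (g (bnd 1 t) - g (bnd 1 t'))) <= L"
    unfolding Gspace_def by blast
  have m: "g (bnd 0 t) - g (bnd 0 t') \<in> C0 \<and> g (bnd 1 t) - g (bnd 1 t') \<in> C1" for t t'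
    using g unfolding Gspace_def by blast
  have "lip_on_boundary g L"
    unfolding lip_on_boundary_def
  proof (intro allI)
    fix t t'
    show "g (bnd 0 t) - g (bnd 0 t') \<in> C0 \<and> g (bnd 1 t) - g (bnd 1 t') \<in> C1 \<and>
      M0 (g (bnd 0 t) - g (bnd 0 t')) <= L * \<bar>t - t'\<bar> \<and> M1 (g (bnd 1 t) - g (bnd 1 t')) <= L * \<bar>t - t'\<bar>"
      using m[of t t'] L[of t t'] quotient_norm[of t t'] c0.N_0 c1.N_0
      by (cases "t = t'") (auto simp: divide_le_eq)
  qed
  then show ?R using g unfolding Gspace_def s.hol_strip_def ostrip_def by blast
next
  assume R: ?R
  then obtain L where L: "lip_on_boundary g L" by blast
  have "\<forall>t t'. t \<noteq> t' \<longrightarrow>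
      M0 ((1 / complex_of_real (t - t')) *\<^sub>C (g (bnd 0 t) - g (bnd 0 t'))) <= L \<and>
      M1 ((1 / complex_of_real (t - t')) *\<^sub>C (g (bnd 1 t) - g (bnd 1 t'))) <= L"
  proof (intro allI impI)
    fix t t' :: real assume "t \<noteq> t'"
    then show "M0 ((1 / complex_of_real (t - t')) *\<^sub>C (g (bnd 0 t) - g (bnd 0 t'))) <= L \<and>
      M1 ((1 / complex_of_real (t - t')) *\<^sub>C (g (bnd 1 t) - g (bnd 1 t'))) <= L"
      using L quotient_norm[of t t'] unfolding lip_on_boundary_def by (simp add: divide_le_eq)
  qed
  moreover have "\<forall>t t'. g (bnd 0 t) - g (bnd 0 t') \<in> C0 \<and> g (bnd 1 t) - g (bnd 1 t') \<in> C1"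
    using L unfolding lip_on_boundary_def by blast
  ultimately show "g \<in> G" using R unfolding Gspace_def s.hol_strip_def ostrip_def by blast
qed

lemma G_hol: "g \<in> G ==> s.hol_strip g" using G_iff by blast

lemma G_growth: "g \<in> G ==> \<exists>K. \<forall>z\<in>strip. SN (g z) <= K * (1 + cmod z)" using G_iff by blast

lemma G_mem: "g \<in> G ==> z \<in> strip ==> g z \<in> S" using s.hol_stripD(1)[OF G_hol] .

lemma Gnorm_le:
  assumes "lip_on_boundary g L"
  shows "GN g <= L"
proof -
  let ?A = "{M0 ((1 / complex_of_real (t - t')) *\<^sub>C (g (bnd 0 t) - g (bnd 0 t'))) | t t'. t \<noteq> t'}"
  let ?B = "{M1 ((1 / complex_of_real (t - t')) *\<^sub>C (g (bnd 1 t) - g (bnd 1 t'))) | t t'. t \<noteq> t'}"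
  have "M0 ((1 / complex_of_real (0 - 1)) *\<^sub>C (g (bnd 0 0) - g (bnd 0 1))) \<in> ?A"
    using zero_neq_one by blast
  then have ne: "?A \<union> ?B \<noteq> {}" by blast
  show ?thesis
    unfolding Gnorm_def
  proof (rule cSup_least[OF ne])
    fix x assume "x \<in> ?A \<union> ?B"
    then show "x <= L"
      using assms quotient_norm unfolding lip_on_boundary_def by (auto simp: divide_le_eq)
  qed
qed

lemma Gnorm_lip:
  assumes "g \<in> G"
  shows "lip_on_boundary g (GN g)"
proof -
  obtain L where L: "lip_on_boundary g L" using assms G_iff by blast
  let ?A = "{M0 ((1 / complex_of_real (t - t')) *\<^sub>C (g (bnd 0 t) - g (bnd 0 t'))) | t t'. t \<noteq> t'}"
  let ?B = "{M1 ((1 / complex_of_real (t - t')) *\<^sub>C (g (bnd 1 t) - g (bnd 1 t'))) | t t'. t \<noteq> t'}"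
  have bdd: "bdd_above (?A \<union> ?B)"
    by (rule bdd_aboveI[of _ L]) (use L quotient_norm in \<open>auto simp: divide_le_eq lip_on_boundary_def\<close>)
  have A: "x \<in> ?A ==> x <= GN g" and B: "x \<in> ?B ==> x <= GN g" for x
    unfolding Gnorm_def by (rule cSup_upper[OF _ bdd]; blast)+
  show ?thesis
    unfolding lip_on_boundary_def
  proof (intro allI)
    fix t t'
    have m: "g (bnd 0 t) - g (bnd 0 t') \<in> C0" "g (bnd 1 t) - g (bnd 1 t') \<in> C1"
      using L unfolding lip_on_boundary_def by blast+
    show "g (bnd 0 t) - g (bnd 0 t') \<in> C0 \<and> g (bnd 1 t) - g (bnd 1 t') \<in> C1 \<and>
      M0 (g (bnd 0 t) - g (bnd 0 t')) <= GN g * \<bar>t - t'\<bar> \<and> M1 (g (bnd 1 t) - g (bnd 1 t')) <= GN g * \<bar>t - t'\<bar>"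
    proof (cases "t = t'")
      case False
      have "M0 (g (bnd 0 t) - g (bnd 0 t')) / \<bar>t - t'\<bar> <= GN g"
        unfolding quotient_norm(1)[OF False m(1), symmetric] by (rule A) (use False in blast)
      moreover have "M1 (g (bnd 1 t) - g (bnd 1 t')) / \<bar>t - t'\<bar> <= GN g"
        unfolding quotient_norm(2)[OF False m(2), symmetric] by (rule B) (use False in blast)
      ultimately show ?thesis using m False by (simp add: divide_le_eq)
    qed (use m c0.N_0 c1.N_0 in auto)
  qed
qed

lemma Gnorm_nonneg: assumes "g \<in> G" shows "0 <= GN g"
proof -
  have "g (bnd 0 1) - g (bnd 0 0) \<in> C0" "M0 (g (bnd 0 1) - g (bnd 0 0)) <= GN g * \<bar>1 - 0\<bar>"
    using Gnorm_lip[OF assms] unfolding lip_on_boundary_def by blast+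
  then show ?thesis using c0.N_nonneg by fastforce
qed

lemma GI:
  assumes "s.hol_strip g" "!!z. z \<in> strip ==> SN (g z) <= K * (1 + cmod z)" "lip_on_boundary g L"
  shows "g \<in> G" "GN g <= L"
  using assms Gnorm_le G_iff by blast+

lemma Gd:
  assumes "g \<in> G" "z \<in> ostrip"
  shows "Gd g z \<in> S" "has_nderiv SN g z (Gd g z)"
    "d \<in> S ==> has_nderiv SN g z d ==> Gd g z = d"
proof -
  obtain d0 where d0: "d0 \<in> S" "has_nderiv SN g z d0" using s.hol_stripD(3)[OF G_hol[OF assms(1)] assms(2)] by blast
  have ev: "eventually (%h. g (z + h) \<in> S) (at 0)"
    using s.eventually_ostrip[OF assms(2)] by (rule eventually_mono) (use G_mem[OF assms(1)] ostrip_subset_strip in blast)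
  have gz: "g z \<in> S" using G_mem[OF assms(1)] ostrip_subset_strip assms(2) by blast
  have u: "d = d0" if "d \<in> S" "has_nderiv SN g z d" for d
    by (rule s.nderiv_unique[OF that(2) d0(2) that(1) d0(1) ev gz])
  have e: "Gd g z = d0" unfolding gderiv_def by (rule the_equality, intro conjI d0, rule u) blast+
  show "Gd g z \<in> S" "has_nderiv SN g z (Gd g z)" "d \<in> S ==> has_nderiv SN g z d ==> Gd g z = d"
    unfolding e by (fact d0, fact d0, rule u[symmetric])
qed

text \<open>Vertical translations act on \<open>Gspace\<close> without increasing the seminorm. They
  reduce every point of a vertical line to the real point on it.\<close>

lemma G_shift:
  assumes g: "g \<in> G"
  shows "(%z. g (z + \<i> * of_real s)) \<in> G" "GN (%z. g (z + \<i> * of_real s)) <= GN g"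
    "z \<in> ostrip ==> Gd (%z. g (z + \<i> * of_real s)) z = Gd g (z + \<i> * of_real s)"
proof -
  obtain K where K: "!!z. z \<in> strip ==> SN (g z) <= K * (1 + cmod z)" using g G_iff by blast
  have sh: "bnd 0 t + \<i> * of_real s = bnd 0 (t + s)" "bnd 1 t + \<i> * of_real s = bnd 1 (t + s)" for t
    by (auto simp: bnd_def algebra_simps)
  have "lip_on_boundary (%z. g (z + \<i> * of_real s)) (GN g)"
    unfolding lip_on_boundary_def sh
  proof (intro allI)
    fix t t'
    have "\<bar>(t + s) - (t' + s)\<bar> = \<bar>t - t'\<bar>" by simp
    then show "g (bnd 0 (t + s)) - g (bnd 0 (t' + s)) \<in> C0 \<and> g (bnd 1 (t + s)) - g (bnd 1 (t' + s)) \<in> C1 \<and>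
      M0 (g (bnd 0 (t + s)) - g (bnd 0 (t' + s))) <= GN g * \<bar>t - t'\<bar> \<and>
      M1 (g (bnd 1 (t + s)) - g (bnd 1 (t' + s))) <= GN g * \<bar>t - t'\<bar>"
      using Gnorm_lip[OF g] unfolding lip_on_boundary_def by metis
  qed
  moreover have "SN (g (z + \<i> * of_real s)) <= (\<bar>K\<bar> * (1 + \<bar>s\<bar>)) * (1 + cmod z)" if z: "z \<in> strip" for z
  proof -
    have "z + \<i> * of_real s \<in> strip" using z by (auto simp: strip_def)
    then have "SN (g (z + \<i> * of_real s)) <= \<bar>K\<bar> * (1 + cmod (z + \<i> * of_real s))"
      using K by (smt (verit) mult_right_mono norm_ge_zero)
    also have "\<dots> <= \<bar>K\<bar> * ((1 + \<bar>s\<bar>) * (1 + cmod z))"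
    proof (rule mult_left_mono)
      have "cmod (z + \<i> * of_real s) <= cmod z + \<bar>s\<bar>" using norm_triangle_ineq[of z "\<i> * of_real s"] by (simp add: norm_mult)
      moreover have "0 <= \<bar>s\<bar> * cmod z" by simp
      ultimately show "1 + cmod (z + \<i> * of_real s) <= (1 + \<bar>s\<bar>) * (1 + cmod z)"
        unfolding distrib_left distrib_right by linarith
    qed simp
    finally show ?thesis by (simp add: mult.assoc)
  qed
  ultimately show *: "(%z. g (z + \<i> * of_real s)) \<in> G" "GN (%z. g (z + \<i> * of_real s)) <= GN g"
    using GI[OF s.hol_strip_shift[OF G_hol[OF g]]] by blast+
  assume z: "z \<in> ostrip"
  then have z': "z + \<i> * of_real s \<in> ostrip" by (auto simp: ostrip_def)
  show "Gd (%z. g (z + \<i> * of_real s)) z = Gd g (z + \<i> * of_real s)"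
    by (rule Gd(3)[OF *(1) z Gd(1)[OF g z']]) (use Gd(2)[OF g z'] s.has_nderiv_shift in blast)
qed

lemma G_add:
  assumes f: "f \<in> G" and g: "g \<in> G"
  shows "(%z. f z + g z) \<in> G" "GN (%z. f z + g z) <= GN f + GN g"
    "z \<in> ostrip ==> Gd (%z. f z + g z) z = Gd f z + Gd g z"
proof -
  obtain K where K: "!!z. z \<in> strip ==> SN (f z) <= K * (1 + cmod z)" using f G_iff by blast
  obtain K' where K': "!!z. z \<in> strip ==> SN (g z) <= K' * (1 + cmod z)" using g G_iff by blast
  have "lip_on_boundary (%z. f z + g z) (GN f + GN g)"
    unfolding lip_on_boundary_def
  proof (intro allI)
    fix t t'
    have e: "f z + g z - (f w + g w) = (f z - f w) + (g z - g w)" for z w by simp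
    have a: "f (bnd 0 t) - f (bnd 0 t') \<in> C0" "f (bnd 1 t) - f (bnd 1 t') \<in> C1"
       "M0 (f (bnd 0 t) - f (bnd 0 t')) <= GN f * \<bar>t - t'\<bar>" "M1 (f (bnd 1 t) - f (bnd 1 t')) <= GN f * \<bar>t - t'\<bar>"
      using Gnorm_lip[OF f] unfolding lip_on_boundary_def by blast+
    have b: "g (bnd 0 t) - g (bnd 0 t') \<in> C0" "g (bnd 1 t) - g (bnd 1 t') \<in> C1"
       "M0 (g (bnd 0 t) - g (bnd 0 t')) <= GN g * \<bar>t - t'\<bar>" "M1 (g (bnd 1 t) - g (bnd 1 t')) <= GN g * \<bar>t - t'\<bar>"
      using Gnorm_lip[OF g] unfolding lip_on_boundary_def by blast+
    show "f (bnd 0 t) + g (bnd 0 t) - (f (bnd 0 t') + g (bnd 0 t')) \<in> C0 \<and>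
       f (bnd 1 t) + g (bnd 1 t) - (f (bnd 1 t') + g (bnd 1 t')) \<in> C1 \<and>
       M0 (f (bnd 0 t) + g (bnd 0 t) - (f (bnd 0 t') + g (bnd 0 t'))) <= (GN f + GN g) * \<bar>t - t'\<bar> \<and>
       M1 (f (bnd 1 t) + g (bnd 1 t) - (f (bnd 1 t') + g (bnd 1 t'))) <= (GN f + GN g) * \<bar>t - t'\<bar>"
      unfolding e distrib_right using a b c0.mem_add[OF a(1) b(1)] c1.mem_add[OF a(2) b(2)]
        c0.N_tri[OF a(1) b(1)] c1.N_tri[OF a(2) b(2)] by linarith
  qed
  moreover have "SN (f z + g z) <= (K + K') * (1 + cmod z)" if z: "z \<in> strip" for z
    using s.N_tri[OF G_mem[OF f z] G_mem[OF g z]] K[OF z] K'[OF z] unfolding distrib_right[of K K'] by linarith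
  ultimately show *: "(%z. f z + g z) \<in> G" "GN (%z. f z + g z) <= GN f + GN g"
    using GI[OF s.hol_strip_add[OF G_hol[OF f] G_hol[OF g]]] by blast+
  assume z: "z \<in> ostrip"
  show "Gd (%z. f z + g z) z = Gd f z + Gd g z"
  proof (rule Gd(3)[OF *(1) z s.mem_add[OF Gd(1)[OF f z] Gd(1)[OF g z]]])
    show "has_nderiv SN (%z. f z + g z) z (Gd f z + Gd g z)"
      by (rule s.has_nderiv_add[OF Gd(2)[OF f z] Gd(2)[OF g z] z Gd(1)[OF f z] Gd(1)[OF g z]])
         (simp_all add: G_mem f g)
  qed
qed

lemma G_scale:
  assumes g: "g \<in> G"
  shows "(%z. c *\<^sub>C g z) \<in> G" "GN (%z. c *\<^sub>C g z) <= cmod c * GN g"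
    "z \<in> ostrip ==> Gd (%z. c *\<^sub>C g z) z = c *\<^sub>C Gd g z"
proof -
  obtain K where K: "!!z. z \<in> strip ==> SN (g z) <= K * (1 + cmod z)" using g G_iff by blast
  have "lip_on_boundary (%z. c *\<^sub>C g z) (cmod c * GN g)"
    unfolding lip_on_boundary_def cvec.scale_right_diff_distrib[symmetric]
  proof (intro allI)
    fix t t'
    have b: "g (bnd 0 t) - g (bnd 0 t') \<in> C0" "g (bnd 1 t) - g (bnd 1 t') \<in> C1"
       "M0 (g (bnd 0 t) - g (bnd 0 t')) <= GN g * \<bar>t - t'\<bar>" "M1 (g (bnd 1 t) - g (bnd 1 t')) <= GN g * \<bar>t - t'\<bar>"
      using Gnorm_lip[OF g] unfolding lip_on_boundary_def by blast+
    show "c *\<^sub>C (g (bnd 0 t) - g (bnd 0 t')) \<in> C0 \<and> c *\<^sub>C (g (bnd 1 t) - g (bnd 1 t')) \<in> C1 \<and>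
       M0 (c *\<^sub>C (g (bnd 0 t) - g (bnd 0 t'))) <= (cmod c * GN g) * \<bar>t - t'\<bar> \<and>
       M1 (c *\<^sub>C (g (bnd 1 t) - g (bnd 1 t'))) <= (cmod c * GN g) * \<bar>t - t'\<bar>"
      unfolding c0.N_scale[OF b(1)] c1.N_scale[OF b(2)] mult.assoc
      using b(3,4) c0.mem_scale[OF b(1)] c1.mem_scale[OF b(2)] by (auto intro: mult_left_mono)
  qed
  moreover have "SN (c *\<^sub>C g z) <= (cmod c * K) * (1 + cmod z)" if z: "z \<in> strip" for z
    unfolding s.N_scale[OF G_mem[OF g z]] mult.assoc by (intro mult_left_mono K z) auto
  ultimately show *: "(%z. c *\<^sub>C g z) \<in> G" "GN (%z. c *\<^sub>C g z) <= cmod c * GN g"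
    using GI[OF s.hol_strip_scale[OF G_hol[OF g]]] by blast+
  assume z: "z \<in> ostrip"
  show "Gd (%z. c *\<^sub>C g z) z = c *\<^sub>C Gd g z"
  proof (rule Gd(3)[OF *(1) z s.mem_scale[OF Gd(1)[OF g z]]])
    have "has_nderiv SN (%z. c *\<^sub>C g z) z (0 *\<^sub>C g z + c *\<^sub>C Gd g z)"
      by (rule s.has_nderiv_mult[OF Gd(2)[OF g z] z Gd(1)[OF g z]]) (simp_all add: G_mem g)
    then show "has_nderiv SN (%z. c *\<^sub>C g z) z (c *\<^sub>C Gd g z)" by simp
  qed
qed

text \<open>The increment over a fixed imaginary step grows at most linearly and is bounded on both
  boundary lines by the Lipschitz condition, so the Phragmen-Lindelof principle applies to
  it.\<close>

lemma G_diff_imag: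
  assumes g: "g \<in> G" and z: "z \<in> strip"
  shows "SN (g (z + \<i> * of_real s) - g z) <= GN g * \<bar>s\<bar>"
proof -
  note gs = G_shift(1)[OF g, of s]
  obtain K where K: "!!z. z \<in> strip ==> SN (g z) <= K * (1 + cmod z)" using g G_iff by blast
  obtain K' where K': "!!z. z \<in> strip ==> SN (g (z + \<i> * of_real s)) <= K' * (1 + cmod z)" using G_growth[OF gs] by blast
  show ?thesis
  proof (rule s.hol_strip_phragmen_lindelof[OF _ _ _ _ z])
  show "s.hol_strip (%z. g (z + \<i> * of_real s) - g z)"
    by (rule s.hol_strip_diff[OF G_hol[OF gs] G_hol[OF g]])
  show "SN (g (w + \<i> * of_real s) - g w) <= (K + K') * (1 + cmod w)" if w: "w \<in> strip" for w
    using s.N_minus[OF G_mem[OF gs w] G_mem[OF g w]] K[OF w] K'[OF w] unfolding distrib_right[of K K'] by linarith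
  fix t
  have sh: "bnd 0 t + \<i> * of_real s = bnd 0 (t + s)" "bnd 1 t + \<i> * of_real s = bnd 1 (t + s)"
    by (auto simp: bnd_def algebra_simps)
  have b: "g (bnd 0 (t + s)) - g (bnd 0 t) \<in> C0" "g (bnd 1 (t + s)) - g (bnd 1 t) \<in> C1"
       "M0 (g (bnd 0 (t + s)) - g (bnd 0 t)) <= GN g * \<bar>t + s - t\<bar>" "M1 (g (bnd 1 (t + s)) - g (bnd 1 t)) <= GN g * \<bar>t + s - t\<bar>"
    using Gnorm_lip[OF g] unfolding lip_on_boundary_def by blast+
  show "SN (g (bnd 0 t + \<i> * of_real s) - g (bnd 0 t)) <= GN g * \<bar>s\<bar>"
    unfolding sh using SN0[OF b(1)] b(3) by simp
  show "SN (g (bnd 1 t + \<i> * of_real s) - g (bnd 1 t)) <= GN g * \<bar>s\<bar>"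
    unfolding sh using SN1[OF b(2)] b(4) by simp
  qed
qed

text \<open>The complex derivative can be computed along imaginary steps, where the increments are
  already bounded.\<close>

lemma Gd_bound:
  assumes g: "g \<in> G" and z: "z \<in> ostrip"
  shows "SN (Gd g z) <= GN g"
proof (rule s.N_le_functional[OF Gd(1)[OF g z]])
  fix L assume L: "s.bfun 1 L"
  have D: "((%z. L (g z)) has_field_derivative L (Gd g z)) (at z)"
    by (rule s.functional_derivative[OF _ z Gd(1,2)[OF g z] L]) (rule G_mem[OF g])
  have "((%n. \<i> * of_real (1 / Suc n)) \<longlongrightarrow> \<i> * of_real 0) sequentially"
    by (intro tendsto_intros LIMSEQ_Suc lim_1_over_n)
  then have "filterlim (%n. \<i> * of_real (1 / Suc n)) (at 0) sequentially"
    unfolding filterlim_at by (auto intro!: always_eventually simp del: of_nat_Suc)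
  then have "((%n. (L (g (z + \<i> * of_real (1 / Suc n))) - L (g z)) / (\<i> * of_real (1 / Suc n))) \<longlonglongrightarrow> L (Gd g z))"
    using D unfolding DERIV_def by (rule filterlim_compose[rotated])
  then have "(%n. cmod ((L (g (z + \<i> * of_real (1 / Suc n))) - L (g z)) / (\<i> * of_real (1 / Suc n)))) \<longlonglongrightarrow> cmod (L (Gd g z))"
    by (rule tendsto_norm)
  then show "cmod (L (Gd g z)) <= GN g"
  proof (rule tendsto_upperbound[OF _ always_eventually[OF allI]])
    fix n
    have zs: "z \<in> strip" "z + \<i> * of_real (1 / Suc n) \<in> strip"
      using z ostrip_subset_strip by (auto simp: ostrip_def strip_def)
    have "cmod (L (g (z + \<i> * of_real (1 / Suc n))) - L (g z)) <= GN g * \<bar>1 / Suc n\<bar>"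
      using s.bfunD(2)[OF L s.mem_diff[OF G_mem[OF g zs(2)] G_mem[OF g zs(1)]]]
        s.bfun_diff[OF L G_mem[OF g zs(2)] G_mem[OF g zs(1)]] G_diff_imag[OF g zs(1), of "1 / Suc n"] by simp
    then show "cmod ((L (g (z + \<i> * of_real (1 / Suc n))) - L (g z)) / (\<i> * of_real (1 / Suc n))) <= GN g"
      unfolding norm_divide norm_mult norm_ii norm_of_real mult_1_left by (simp add: pos_divide_le_eq pos_le_divide_eq del: of_nat_Suc)
  qed simp
qed

text \<open>The derivative bound gives the estimate on the open convex strip; continuity carries it
  to the boundary.\<close>

lemma G_lipschitz:
  assumes g: "g \<in> G" and z: "z \<in> strip" and w: "w \<in> strip"
  shows "SN (g z - g w) <= GN g * cmod (z - w)"
proof (rule s.N_le_functional[OF s.mem_diff[OF G_mem[OF g z] G_mem[OF g w]]])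
  fix L assume L: "s.bfun 1 L"
  have D: "((%z. L (g z)) has_field_derivative L (Gd g z)) (at z)" if "z \<in> ostrip" for z
    by (rule s.functional_derivative[OF _ that Gd(1,2)[OF g that] L]) (rule G_mem[OF g])
  have le: "cmod (L (g x) - L (g y)) <= GN g * cmod (x - y)" if "x \<in> ostrip" "y \<in> ostrip" for x y
  proof (rule field_differentiable_bound[OF convex_ostrip _ _ that])
    fix u assume u: "u \<in> ostrip"
    show "((%z. L (g z)) has_field_derivative L (Gd g u)) (at u within ostrip)"
      using D[OF u] has_field_derivative_at_within by blast
    show "cmod (L (Gd g u)) <= GN g"
      using s.bfunD(2)[OF L Gd(1)[OF g u]] Gd_bound[OF g u] by simp
  qed
  have cont: "continuous_on strip (%z. L (g z))" using s.hol_strip_functional(1)[OF G_hol[OF g] L] .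
  \<comment> \<open>Points pulled towards the centre \<open>1/2\<close>. The weight
    \<open>1 / Suc (Suc n)\<close> is strictly between \<open>0\<close> and \<open>1\<close>, so
    boundary points too are moved into the open strip.\<close>
  define p where "p = (%(z::complex) n. z + of_real (1 / Suc (Suc n)) * (1/2 - z))"
  have pin: "p z n \<in> ostrip" if "z \<in> strip" for z n
  proof -
    have e: "Re (p z n) = Re z + (1 / Suc (Suc n)) * (1/2 - Re z)"
      unfolding p_def by (simp only: plus_complex.simps Re_complex_of_real times_complex.simps minus_complex.simps) simp
    define h where "h = 1 / real (Suc (Suc n))"
    have h: "0 < h" "h < 1" by (auto simp: h_def)
    define X where "X = (1 - h) * Re z"
    have "Re (p z n) = X + h / 2" unfolding e h_def[symmetric] X_def by (simp add: algebra_simps)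
    moreover have "0 <= X" "X <= (1 - h) * 1"
      unfolding X_def using that h unfolding strip_def by (auto intro: mult_left_mono)
    ultimately have "0 < Re (p z n)" "Re (p z n) < 1" using h by auto
    then show ?thesis by (simp add: ostrip_def)
  qed
  have plim: "p z \<longlonglongrightarrow> z" for z
  proof -
    have "(%n. z + of_real (1 / Suc (Suc n)) * (1/2 - z)) \<longlonglongrightarrow> z + of_real 0 * (1/2 - z)"
      by (intro tendsto_intros LIMSEQ_Suc[of "%n. 1 / real (Suc n)"] LIMSEQ_Suc[OF lim_1_over_n])
    then show ?thesis by (simp add: p_def)
  qed
  have Lp: "(%n. L (g (p z n))) \<longlonglongrightarrow> L (g z)" if "z \<in> strip" for z
    by (rule continuous_on_tendsto_compose[OF cont plim that], rule always_eventually)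
       (use pin[OF that] ostrip_subset_strip in blast)
  have "(%n. cmod (L (g (p z n)) - L (g (p w n)))) \<longlonglongrightarrow> cmod (L (g z) - L (g w))"
    by (intro tendsto_intros Lp z w)
  moreover have "(%n. GN g * cmod (p z n - p w n)) \<longlonglongrightarrow> GN g * cmod (z - w)"
    by (intro tendsto_intros plim)
  ultimately have "cmod (L (g z) - L (g w)) <= GN g * cmod (z - w)"
    using le pin z w by (meson LIMSEQ_le)
  then show "cmod (L (g z - g w)) <= GN g * cmod (z - w)"
    using s.bfun_diff[OF L G_mem[OF g z] G_mem[OF g w]] by simp
qed

section \<open>The upper space and its seminorm\<close>

abbreviation Up where "Up \<equiv> upper C0 M0 C1 M1"
abbreviation UpN where "UpN \<equiv> upper_norm C0 M0 C1 M1"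

lemma upper_norm_le: "g \<in> G ==> UpN \<theta> (Gd g (of_real \<theta>)) <= GN g"
  unfolding upper_norm_def by (rule cInf_lower) (auto intro!: bdd_belowI[of _ 0] Gnorm_nonneg)

lemma upperI: "g \<in> G ==> Gd g (of_real \<theta>) \<in> Up \<theta>"
  unfolding upper_def by blast

lemma upper_approx:
  assumes "x \<in> Up \<theta>" "e > 0"
  obtains g where "g \<in> G" "Gd g (of_real \<theta>) = x" "GN g < UpN \<theta> x + e"
proof -
  let ?A = "{GN g | g. g \<in> G \<and> Gd g (of_real \<theta>) = x}"
  have "?A \<noteq> {}" using assms(1) unfolding upper_def by blast
  then have "\<exists>y\<in>?A. y < UpN \<theta> x + e"
    using cInf_lessD[of ?A "UpN \<theta> x + e"] assms(2) unfolding upper_norm_def by auto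
  then show thesis using that by blast
qed

lemma upper_norm_nonneg: "x \<in> Up \<theta> ==> 0 <= UpN \<theta> x"
  unfolding upper_norm_def upper_def by (rule cInf_greatest) (auto intro: Gnorm_nonneg)

lemma of_real_ostrip: "0 < \<theta> ==> \<theta> < 1 ==> complex_of_real \<theta> \<in> ostrip"
  by (simp add: ostrip_def)

lemma G_zero: "(%_. 0) \<in> G"
  by (rule GI(1)[OF s.hol_strip_const[OF s.mem_0], of 0 0])
     (auto simp: s.N_0 lip_on_boundary_def c0.N_0 c1.N_0 c0.mem_0 c1.mem_0)

lemma upper_seminorm:
  assumes \<theta>: "0 < \<theta>" "\<theta> < 1"
  shows "csubspace (Up \<theta>)" "seminorm_on (Up \<theta>) (UpN \<theta>)"
proof -
  note z = of_real_ostrip[OF \<theta>]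
  have "Gd (%_. 0) (of_real \<theta>) = 0"
    by (rule Gd(3)[OF G_zero z s.mem_0]) (simp add: has_nderiv_def s.N_0)
  then have 0: "0 \<in> Up \<theta>" using upperI[OF G_zero] by metis
  have sc: "c *\<^sub>C x \<in> Up \<theta>" "UpN \<theta> (c *\<^sub>C x) <= cmod c * UpN \<theta> x" if x: "x \<in> Up \<theta>" for c x
  proof -
    show 1: "c *\<^sub>C x \<in> Up \<theta>"
      using x G_scale(1,3) z upperI[OF G_scale(1)] unfolding upper_def by (smt (verit) mem_Collect_eq)
    show "UpN \<theta> (c *\<^sub>C x) <= cmod c * UpN \<theta> x"
    proof (rule field_le_epsilon)
      fix e :: real assume e: "e > 0"
      then have e': "e / (cmod c + 1) > 0" by (simp add: add_nonneg_pos)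
      obtain g where g: "g \<in> G" "Gd g (of_real \<theta>) = x" "GN g < UpN \<theta> x + e / (cmod c + 1)"
        using upper_approx[OF x e'] .
      have "UpN \<theta> (c *\<^sub>C x) <= cmod c * GN g"
        using upper_norm_le[OF G_scale(1)[OF g(1)], of \<theta> c] G_scale(2,3)[OF g(1), where c = c] z g(2) by fastforce
      also have "\<dots> <= cmod c * (UpN \<theta> x + e / (cmod c + 1))" using g by (intro mult_left_mono) auto
      also have "\<dots> <= cmod c * UpN \<theta> x + e" using e by (intro scale_epsilon) auto
      finally show "UpN \<theta> (c *\<^sub>C x) <= cmod c * UpN \<theta> x + e" .
    qed
  qed
  have ad: "x + y \<in> Up \<theta>" "UpN \<theta> (x + y) <= UpN \<theta> x + UpN \<theta> y" if x: "x \<in> Up \<theta>" and y: "y \<in> Up \<theta>" for x y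
  proof -
    have *: "x + y \<in> Up \<theta> \<and> UpN \<theta> (x + y) <= UpN \<theta> x + UpN \<theta> y + e" if "e > 0" for e
    proof -
      have e: "e / 2 > 0" using that by simp
      obtain g where g: "g \<in> G" "Gd g (of_real \<theta>) = x" "GN g < UpN \<theta> x + e / 2"
        using upper_approx[OF x e] .
      obtain f where f: "f \<in> G" "Gd f (of_real \<theta>) = y" "GN f < UpN \<theta> y + e / 2"
        using upper_approx[OF y e] .
      note A = G_add[OF g(1) f(1)]
      have d: "Gd (%z. g z + f z) (of_real \<theta>) = x + y" using A(3)[OF z] g f by simp
      show ?thesis using upperI[OF A(1), of \<theta>] upper_norm_le[OF A(1), of \<theta>] A(2) g(3) f(3) unfolding d by simp
    qed
    show "x + y \<in> Up \<theta>" using *[of 1] by simp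
    show "UpN \<theta> (x + y) <= UpN \<theta> x + UpN \<theta> y" by (rule field_le_epsilon) (use * in blast)
  qed
  show V: "csubspace (Up \<theta>)" unfolding csubspace_def using 0 sc ad by blast
  have n0: "UpN \<theta> 0 = 0" using sc(2)[OF 0, of 0] upper_norm_nonneg[OF 0] by simp
  have "UpN \<theta> (c *\<^sub>C x) = cmod c * UpN \<theta> x" if x: "x \<in> Up \<theta>" for c x
  proof (cases "c = 0")
    case False
    have "UpN \<theta> ((1/c) *\<^sub>C c *\<^sub>C x) <= cmod (1/c) * UpN \<theta> (c *\<^sub>C x)" by (rule sc(2)[OF sc(1)[OF x]])
    then have "cmod c * UpN \<theta> x <= UpN \<theta> (c *\<^sub>C x)" using False by (simp add: norm_divide field_simps)
    then show ?thesis using sc(2)[OF x, of c] by simp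
  qed (simp add: n0)
  then show "seminorm_on (Up \<theta>) (UpN \<theta>)"
    unfolding seminorm_on_def using upper_norm_nonneg ad by blast
qed

end

subsection \<open>Upper spaces of dual couples\<close>

text \<open>The algebraic half of \<open>dual_on\<close>. It survives pointwise limits; boundedness
  is added afterwards from estimates.\<close>

definition functional_on :: "'a::cvec set => ('a => complex) => bool" where
  "functional_on D f \<longleftrightarrow> (\<forall>x. x \<notin> D \<longrightarrow> f x = 0) \<and> clinear_on D f"

lemma dual_on_iff: "f \<in> dual_on D N \<longleftrightarrow> functional_on D f \<and> (\<exists>K. \<forall>x\<in>D. cmod (f x) <= K * N x)"
  unfolding dual_on_def functional_on_def by blast

lemma functional_on_0: "functional_on D 0"
  by (simp add: functional_on_def clinear_on_def)

lemma functional_on_add: "functional_on D f ==> functional_on D g ==> functional_on D (f + g)"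
  by (auto simp: functional_on_def clinear_on_def algebra_simps)

lemma functional_on_scale: "functional_on D f ==> functional_on D (c *\<^sub>C f)"
  by (auto simp: functional_on_def clinear_on_def scaleC_fun_def scaleC_complex_def algebra_simps)

lemma functional_on_diff: "functional_on D f ==> functional_on D g ==> functional_on D (f - g)"
  by (auto simp: functional_on_def clinear_on_def algebra_simps)

lemma scaleC_fun_apply: "(c *\<^sub>C f) x = c * f x" for f :: "'a => complex"
  by (simp add: scaleC_fun_def scaleC_complex_def)

context cnorm begin

lemma dnorm_bound:
  assumes f: "f \<in> dual_on C N" and x: "x \<in> C"
  shows "cmod (f x) <= dnorm C N f * N x"
proof (cases "N x = 0")
  case True
  then have "f x = 0" using N_eq_0[OF x] clinear_on_0[OF sub] f unfolding dual_on_def by blast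
  then show ?thesis using True by simp
next
  case False
  then have p: "N x > 0" using N_nonneg[OF x] by simp
  obtain K where K: "!!x. x \<in> C ==> cmod (f x) <= K * N x" using f unfolding dual_on_def by blast
  have "cmod (f y) <= \<bar>K\<bar>" if "y \<in> C" "N y <= 1" for y
  proof -
    have "cmod (f y) <= \<bar>K\<bar> * N y" using K[OF that(1)] N_nonneg[OF that(1)] by (smt (verit) mult_right_mono)
    also have "\<dots> <= \<bar>K\<bar> * 1" using that by (intro mult_left_mono) auto
    finally show ?thesis by simp
  qed
  then have bdd: "bdd_above {cmod (f x) | x. x \<in> C \<and> N x <= 1}" by (intro bdd_aboveI[of _ "\<bar>K\<bar>"]) auto
  define y where "y = (1 / of_real (N x)) *\<^sub>C x"
  have y: "y \<in> C" "N y = 1" using x p N_scale[OF x] by (auto simp: y_def mem_scale norm_divide)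
  have "cmod (f y) <= dnorm C N f"
    unfolding dnorm_def by (rule cSup_upper[OF _ bdd]) (use y in auto)
  moreover have "f y = f x / of_real (N x)"
    using f x unfolding dual_on_def clinear_on_def y_def by simp
  ultimately show ?thesis using p by (simp add: norm_divide pos_divide_le_eq)
qed

lemma dnorm_le:
  assumes "!!x. x \<in> C ==> cmod (f x) <= M * N x" "M >= 0"
  shows "dnorm C N f <= M"
  unfolding dnorm_def
proof (rule cSup_least)
  show "{cmod (f x) |x. x \<in> C \<and> N x <= 1} \<noteq> {}" using mem_0 N_0 by force
  fix y assume "y \<in> {cmod (f x) |x. x \<in> C \<and> N x <= 1}"
  then obtain x where x: "y = cmod (f x)" "x \<in> C" "N x <= 1" by blast
  have "M * N x <= M * 1" using x assms by (intro mult_left_mono) auto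
  then show "y <= M" using assms(1)[OF x(2)] x by simp
qed

lemma dnorm_nonneg: assumes "f \<in> dual_on C N" shows "0 <= dnorm C N f"
proof -
  obtain K where K: "!!x. x \<in> C ==> cmod (f x) <= K * N x" using assms unfolding dual_on_def by blast
  have "cmod (f x) <= \<bar>K\<bar>" if "x \<in> C" "N x <= 1" for x
  proof -
    have "cmod (f x) <= \<bar>K\<bar> * N x" using K[OF that(1)] N_nonneg[OF that(1)] by (smt (verit) mult_right_mono)
    also have "\<dots> <= \<bar>K\<bar> * 1" using that by (intro mult_left_mono) auto
    finally show ?thesis by simp
  qed
  then have bdd: "bdd_above {cmod (f x) | x. x \<in> C \<and> N x <= 1}" by (intro bdd_aboveI[of _ "\<bar>K\<bar>"]) auto
  have "cmod (f 0) <= dnorm C N f"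
    unfolding dnorm_def by (rule cSup_upper[OF _ bdd]) (use mem_0 N_0 in auto)
  then show ?thesis using norm_ge_zero order_trans by blast
qed

lemma cnorm_dual: "cnorm (dual_on C N) (dnorm C N)"
proof
  have add: "f + g \<in> dual_on C N \<and> dnorm C N (f + g) <= dnorm C N f + dnorm C N g"
    if fg: "f \<in> dual_on C N" "g \<in> dual_on C N" for f g
  proof -
    have b: "cmod ((f + g) x) <= (dnorm C N f + dnorm C N g) * N x" if "x \<in> C" for x
      using dnorm_bound[OF fg(1) that] dnorm_bound[OF fg(2) that] norm_triangle_ineq[of "f x" "g x"]
      by (simp add: distrib_right)
    then have "f + g \<in> dual_on C N" using fg functional_on_add unfolding dual_on_iff by blast
    moreover have "dnorm C N (f + g) <= dnorm C N f + dnorm C N g"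
      by (rule dnorm_le[OF b]) (use dnorm_nonneg[OF fg(1)] dnorm_nonneg[OF fg(2)] in auto)
    ultimately show ?thesis by blast
  qed
  have sc: "c *\<^sub>C f \<in> dual_on C N \<and> dnorm C N (c *\<^sub>C f) <= cmod c * dnorm C N f"
    if f: "f \<in> dual_on C N" for c f
  proof -
    have b: "cmod ((c *\<^sub>C f) x) <= (cmod c * dnorm C N f) * N x" if "x \<in> C" for x
      unfolding scaleC_fun_apply norm_mult mult.assoc
      by (intro mult_left_mono dnorm_bound[OF f that]) auto
    then have "c *\<^sub>C f \<in> dual_on C N" using f functional_on_scale unfolding dual_on_iff by blast
    moreover have "dnorm C N (c *\<^sub>C f) <= cmod c * dnorm C N f"
      by (rule dnorm_le[OF b]) (use dnorm_nonneg[OF f] in auto)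
    ultimately show ?thesis by blast
  qed
  have z: "0 \<in> dual_on C N" unfolding dual_on_iff using functional_on_0 by (auto intro!: exI[of _ 0])
  have nz: "dnorm C N 0 = 0" using dnorm_le[of 0 0] dnorm_nonneg[OF z] by simp
  show "csubspace (dual_on C N)" unfolding csubspace_def using z add sc by blast
  have eq0: "f = 0" if f: "f \<in> dual_on C N" "dnorm C N f = 0" for f
  proof
    fix x show "f x = 0 x"
      using dnorm_bound[OF f(1), of x] f unfolding dual_on_def by (cases "x \<in> C") auto
  qed
  have hom: "dnorm C N (c *\<^sub>C f) = cmod c * dnorm C N f" if f: "f \<in> dual_on C N" for c f
  proof (cases "c = 0")
    case False
    have "dnorm C N ((1/c) *\<^sub>C c *\<^sub>C f) <= cmod (1/c) * dnorm C N (c *\<^sub>C f)" using sc f by blast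
    then have "cmod c * dnorm C N f <= dnorm C N (c *\<^sub>C f)" using False by (simp add: norm_divide field_simps)
    then show ?thesis using sc[OF f, of c] by simp
  qed (simp add: nz)
  show "is_norm_on (dual_on C N) (dnorm C N)"
    unfolding is_norm_on_def using dnorm_nonneg eq0 nz add hom by blast
qed

lemma ncont_on_lipschitz:
  assumes C: "!!z. z \<in> T ==> f z \<in> C" and L: "!!z w. z \<in> T ==> w \<in> T ==> N (f w - f z) <= L * dist w z"
  shows "ncont_on N T f"
  unfolding ncont_on_def
proof
  fix z assume z: "z \<in> T"
  show "((%w. N (f w - f z)) \<longlongrightarrow> 0) (at z within T)"
  proof (rule Lim_null_comparison)
    show "eventually (%w. norm (N (f w - f z)) <= L * dist w z) (at z within T)"
      unfolding eventually_at_filter using L[OF z] N_nonneg[OF mem_diff[OF C C[OF z]]] by (intro always_eventually) auto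
    have "((%w. L * dist w z) \<longlongrightarrow> L * dist z z) (at z within T)" by (intro tendsto_intros)
    then show "((%w. L * dist w z) \<longlongrightarrow> 0) (at z within T)" by simp
  qed
qed

end

section \<open>Couples of duals over a common predual\<close>

text \<open>\<open>W\<close> stands for the intersection of B0 and B1 with the norms inherited from
  either, so \<open>X0\<close> and \<open>X1\<close> below represent the duals of B0 and B1. The
  intersection norm \<open>nn\<close> is dual to the sum norm of these duals.\<close>

locale predual =
  fixes W :: "'w::cvec set" and n0 n1 :: "'w => real"
  assumes w0: "cnorm W n0" and w1: "cnorm W n1"
begin

sublocale w0: cnorm W n0 by (rule w0)
sublocale w1: cnorm W n1 by (rule w1)

definition nn :: "'w => real" where "nn \<phi> = max (n0 \<phi>) (n1 \<phi>)"

abbreviation X0 where "X0 \<equiv> dual_on W n0"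
abbreviation X1 where "X1 \<equiv> dual_on W n1"
abbreviation m0 where "m0 \<equiv> dnorm W n0"
abbreviation m1 where "m1 \<equiv> dnorm W n1"

lemma nn_nonneg: "\<phi> \<in> W ==> 0 <= nn \<phi>"
  unfolding nn_def using w0.N_nonneg by (simp add: le_max_iff_disj)

text \<open>The easy half of the duality between sum and intersection: each component of a
  decomposition is bounded by its own norm, and the infimum is taken at the end.\<close>

lemma sum_bound:
  assumes x: "\<xi> \<in> csum X0 X1" and \<phi>: "\<phi> \<in> W"
  shows "cmod (\<xi> \<phi>) <= sumnorm X0 m0 X1 m1 \<xi> * nn \<phi>"
proof -
  have dec: "cmod (\<xi> \<phi>) <= (m0 a + m1 b) * nn \<phi>" if "a \<in> X0" "b \<in> X1" "\<xi> = a + b" for a b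
  proof -
    have "cmod (a \<phi>) <= m0 a * nn \<phi>"
      using w0.dnorm_bound[OF that(1) \<phi>] w0.dnorm_nonneg[OF that(1)] mult_left_mono[of "n0 \<phi>" "nn \<phi>" "m0 a"]
      by (simp add: nn_def)
    moreover have "cmod (b \<phi>) <= m1 b * nn \<phi>"
      using w1.dnorm_bound[OF that(2) \<phi>] w1.dnorm_nonneg[OF that(2)] mult_left_mono[of "n1 \<phi>" "nn \<phi>" "m1 b"]
      by (simp add: nn_def)
    moreover have "cmod (\<xi> \<phi>) <= cmod (a \<phi>) + cmod (b \<phi>)" using that norm_triangle_ineq by simp
    ultimately show ?thesis by (simp add: distrib_right)
  qed
  obtain a b where ab: "a \<in> X0" "b \<in> X1" "\<xi> = a + b" using x unfolding csum_def by blast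
  show ?thesis
  proof (cases "nn \<phi> = 0")
    case True
    then show ?thesis using dec[OF ab] by simp
  next
    case False
    then have p: "nn \<phi> > 0" using nn_nonneg[OF \<phi>] by simp
    have "cmod (\<xi> \<phi>) / nn \<phi> <= sumnorm X0 m0 X1 m1 \<xi>"
      unfolding sumnorm_def
    proof (rule cInf_greatest)
      fix y assume "y \<in> {m0 a + m1 b |a b. a \<in> X0 \<and> b \<in> X1 \<and> \<xi> = a + b}"
      then show "cmod (\<xi> \<phi>) / nn \<phi> <= y" using dec p by (auto simp: pos_divide_le_eq)
    qed (use ab in blast)
    then show ?thesis using p by (simp add: pos_divide_le_eq)
  qed
qed

lemma sum_functional: "\<xi> \<in> csum X0 X1 ==> functional_on W \<xi>"
  unfolding csum_def using functional_on_add dual_on_iff by blast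

sublocale x: ncouple X0 m0 X1 m1
proof
  show "csubspace X0" "is_norm_on X0 m0" "csubspace X1" "is_norm_on X1 m1"
    using w0.cnorm_dual w1.cnorm_dual unfolding cnorm_def by auto
  fix \<xi> assume \<xi>: "\<xi> \<in> csum X0 X1" "sumnorm X0 m0 X1 m1 \<xi> = 0"
  show "\<xi> = 0"
  proof
    fix \<phi> show "\<xi> \<phi> = 0 \<phi>"
      using sum_bound[OF \<xi>(1), of \<phi>] \<xi>(2) sum_functional[OF \<xi>(1)] unfolding functional_on_def
      by (cases "\<phi> \<in> W") auto
  qed
qed

text \<open>Duality of sum and intersection: extend the functional from the diagonal of
  \<open>W \<times> W\<close> (encoded as functions on \<open>bool\<close>) and read off its two components.\<close>

lemma sum_dual:
  assumes f: "functional_on W \<xi>" and M: "M >= 0" and b: "!!\<phi>. \<phi> \<in> W ==> cmod (\<xi> \<phi>) <= M * nn \<phi>"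
  shows "\<xi> \<in> x.S" "x.SN \<xi> <= M"
proof -
  define V where "V = {u :: bool => 'w. \<forall>j. u j \<in> W}"
  define p where "p = (%u. M * max (n0 (u True)) (n1 (u False)))"
  define dg where "dg = {u \<in> V. u True = u False}"
  have lin: "clinear_on W \<xi>" using f unfolding functional_on_def by blast
  have V: "csubspace V"
    unfolding csubspace_def V_def by (auto simp: scaleC_fun_def w0.mem_0 w0.mem_add w0.mem_scale)
  have p: "seminorm_on V p"
    unfolding seminorm_on_def
  proof (intro conjI ballI allI)
    fix u assume u: "u \<in> V"
    then have uW: "u True \<in> W" "u False \<in> W" unfolding V_def by auto
    show "0 <= p u" unfolding p_def using M w0.N_nonneg[OF uW(1)] by (simp add: le_max_iff_disj)
    show "p (c *\<^sub>C u) = cmod c * p u" for c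
    proof -
      have "max (cmod c * n0 (u True)) (cmod c * n1 (u False)) = cmod c * max (n0 (u True)) (n1 (u False))"
        by (simp add: max_mult_distrib_left)
      then show ?thesis
        unfolding p_def scaleC_fun_def w0.N_scale[OF uW(1)] w1.N_scale[OF uW(2)] by simp
    qed
    fix v assume v: "v \<in> V"
    then have vW: "v True \<in> W" "v False \<in> W" unfolding V_def by auto
    have "max (n0 (u True + v True)) (n1 (u False + v False)) <= max (n0 (u True)) (n1 (u False)) + max (n0 (v True)) (n1 (v False))"
      using w0.N_tri[OF uW(1) vW(1)] w1.N_tri[OF uW(2) vW(2)] by (auto simp: max_def)
    then show "p (u + v) <= p u + p v"
      unfolding p_def using M by (simp add: distrib_left[symmetric] mult_left_mono)
  qed
  have dg: "csubspace dg" "dg \<subseteq> V"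
    unfolding csubspace_def dg_def using V csubspace_0 csubspace_add csubspace_scale
    by (auto simp: scaleC_fun_def csubspace_def)
  obtain L where L: "clinear_on V L" "!!u. u \<in> V ==> cmod (L u) <= p u" "!!u. u \<in> dg ==> L u = \<xi> (u True)"
  proof (rule hahn_banach_extend[OF V p dg, of "%u. \<xi> (u True)"])
    show "clinear_on dg (%u. \<xi> (u True))"
      using lin unfolding clinear_on_def dg_def V_def by (auto simp: scaleC_fun_def)
    show "cmod (\<xi> (u True)) <= p u" if "u \<in> dg" for u
      using b[of "u True"] that unfolding dg_def V_def p_def nn_def by auto
  qed blast
  define l0 where "l0 = (%\<phi> j. if j then \<phi> else (0::'w))"
  define l1 where "l1 = (%\<phi> j. if j then (0::'w) else \<phi>)"
  have lV: "l0 \<phi> \<in> V" "l1 \<phi> \<in> V" if "\<phi> \<in> W" for \<phi>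
    using that w0.mem_0 unfolding V_def l0_def l1_def by auto
  have ladd: "l0 (\<phi> + \<psi>) = l0 \<phi> + l0 \<psi>" "l1 (\<phi> + \<psi>) = l1 \<phi> + l1 \<psi>" for \<phi> \<psi>
    by (auto simp: l0_def l1_def)
  have lsc: "l0 (c *\<^sub>C \<phi>) = c *\<^sub>C l0 \<phi>" "l1 (c *\<^sub>C \<phi>) = c *\<^sub>C l1 \<phi>" for c \<phi>
    by (auto simp: l0_def l1_def scaleC_fun_def)
  define a where "a = (%\<phi>. if \<phi> \<in> W then L (l0 \<phi>) else 0)"
  define c where "c = (%\<phi>. if \<phi> \<in> W then L (l1 \<phi>) else 0)"
  have fa: "functional_on W a" "functional_on W c"
    unfolding functional_on_def clinear_on_def a_def c_def
    using w0.mem_add w0.mem_scale lV clinear_onD[OF L(1)] by (auto simp: ladd lsc)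
  have ba: "cmod (a \<phi>) <= M * n0 \<phi>" "cmod (c \<phi>) <= M * n1 \<phi>" if "\<phi> \<in> W" for \<phi>
    using L(2)[OF lV(1)[OF that]] L(2)[OF lV(2)[OF that]] that w0.N_nonneg[OF that] w1.N_nonneg[OF that]
    unfolding a_def c_def p_def l0_def l1_def by (auto simp: w0.N_0 w1.N_0 max_def split: if_splits)
  have X: "a \<in> X0" "c \<in> X1" using fa ba unfolding dual_on_iff by blast+
  have sum: "\<xi> = a + c"
  proof
    fix \<phi>
    show "\<xi> \<phi> = (a + c) \<phi>"
    proof (cases "\<phi> \<in> W")
      case True
      have "l0 \<phi> + l1 \<phi> \<in> dg" using lV[OF True] csubspace_add[OF V] by (auto simp: dg_def l0_def l1_def)
      then have "L (l0 \<phi> + l1 \<phi>) = \<xi> \<phi>" using L(3) by (fastforce simp: l0_def l1_def)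
      then show ?thesis using True clinear_onD(1)[OF L(1) lV[OF True]] by (simp add: a_def c_def)
    next
      case False
      then show ?thesis using f unfolding functional_on_def a_def c_def by simp
    qed
  qed
  then show "\<xi> \<in> x.S" using csumI[OF X] by simp
  \<comment> \<open>With unimodular factors that make both values nonnegative, a single test on a
    pair bounds the sum of the two component norms, because the norm of a pair is a maximum.\<close>
  have both: "cmod (a \<phi>) + cmod (c \<psi>) <= M" if pp: "\<phi> \<in> W" "n0 \<phi> <= 1" "\<psi> \<in> W" "n1 \<psi> <= 1" for \<phi> \<psi>
  proof -
    define s where "s = (%z. if z = 0 then 1 else cnj z / of_real (cmod z))"
    have s: "cmod (s z) = 1" "s z * z = of_real (cmod z)" for z
      by (auto simp: s_def norm_divide complex_norm_square[symmetric] power2_eq_square field_simps)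
    define u where "u = s (a \<phi>) *\<^sub>C l0 \<phi> + s (c \<psi>) *\<^sub>C l1 \<psi>"
    have uV: "u \<in> V" unfolding u_def by (intro csubspace_add[OF V] csubspace_scale[OF V] lV pp)
    have "L u = s (a \<phi>) * a \<phi> + s (c \<psi>) * c \<psi>"
      unfolding u_def using clinear_onD[OF L(1)] csubspace_scale[OF V] lV pp by (simp add: a_def c_def)
    then have "cmod (a \<phi>) + cmod (c \<psi>) = cmod (L u)"
      using s by (simp flip: of_real_add)
    also have "\<dots> <= p u" using L(2)[OF uV] .
    also have "\<dots> <= M * 1"
      unfolding p_def
    proof (rule mult_left_mono[OF _ M])
      have "u True = s (a \<phi>) *\<^sub>C \<phi>" "u False = s (c \<psi>) *\<^sub>C \<psi>" by (simp_all add: u_def l0_def l1_def scaleC_fun_def)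
      then show "max (n0 (u True)) (n1 (u False)) <= 1"
        using w0.N_scale[OF pp(1)] w1.N_scale[OF pp(3)] s pp by simp
    qed
    finally show ?thesis by simp
  qed
  \<comment> \<open>The two suprema are taken one after the other, with the other test vector
    fixed.\<close>
  have "m1 c <= M - cmod (a \<phi>)" if pp: "\<phi> \<in> W" "n0 \<phi> <= 1" for \<phi>
    unfolding dnorm_def
  proof (rule cSup_least)
    show "{cmod (c x) |x. x \<in> W \<and> n1 x <= 1} \<noteq> {}" using w1.mem_0 w1.N_0 by force
  qed (use both[OF pp] in \<open>auto simp: algebra_simps\<close>)
  then have le: "cmod (a \<phi>) <= M - m1 c" if pp: "\<phi> \<in> W" "n0 \<phi> <= 1" for \<phi> using pp by (simp add: algebra_simps)
  have "m0 a <= M - m1 c"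
    unfolding dnorm_def[of _ n0]
  proof (rule cSup_least)
    show "{cmod (a x) |x. x \<in> W \<and> n0 x <= 1} \<noteq> {}" using w0.mem_0 w0.N_0 by force
  qed (use le in auto)
  then show "x.SN \<xi> <= M" using x.sumnorm_le[OF X] sum by simp
qed

lemma G_const:
  assumes "a \<in> x.S"
  shows "(%_. a) \<in> x.G" "x.GN (%_. a) <= 0" "z \<in> ostrip ==> x.Gd (%_. a) z = 0"
proof -
  have l: "x.lip_on_boundary (%_. a) 0"
    by (simp add: x.lip_on_boundary_def x.c0.N_0 x.c1.N_0 x.c0.mem_0 x.c1.mem_0)
  have "x.SN a <= x.SN a * (1 + cmod z)" for z
    using mult_left_mono[of 1 "1 + cmod z" "x.SN a"] x.sumnorm_nonneg[OF assms] by simp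
  then show 1: "(%_. a) \<in> x.G" "x.GN (%_. a) <= 0"
    using x.GI[OF x.s.hol_strip_const[OF assms] _ l] by blast+
  show "z \<in> ostrip ==> x.Gd (%_. a) z = 0"
    by (rule x.Gd(3)[OF 1(1) _ x.s.mem_0]) (simp_all add: has_nderiv_def x.s.N_0)
qed

section \<open>Weak-star closed balls in the upper space\<close>

text \<open>Nearly optimal representatives are Lipschitz with constants close to \<open>M\<close>,
  hence bounded at every point once normalised at \<open>0\<close>. A cluster point of their values
  and derivatives inherits all estimates, and \<open>sum_dual\<close> turns these back into norm
  bounds.\<close>

theorem upper_weak_star_closed:
  assumes \<theta>: "0 < \<theta>" "\<theta> < 1" and \<xi>n: "!!n. \<xi>n n \<in> x.Up \<theta>" "!!n. x.UpN \<theta> (\<xi>n n) <= M"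
    and lim: "!!\<phi>. \<phi> \<in> W ==> (%n::nat. \<xi>n n \<phi>) \<longlonglongrightarrow> \<xi> \<phi>" and supp: "!!\<phi>. \<phi> \<notin> W ==> \<xi> \<phi> = 0"
  shows "\<xi> \<in> x.Up \<theta>" "x.UpN \<theta> \<xi> <= M"
proof -
  note zo = x.of_real_ostrip[OF \<theta>]
  have M0: "0 <= M" using x.upper_norm_nonneg[OF \<xi>n(1)] \<xi>n(2) order_trans by blast
  have s0: "0 \<in> strip" by (simp add: strip_def)
  \<comment> \<open>Subtracting the constant \<open>g 0\<close> leaves the derivative unchanged and
    makes the Lipschitz bound a pointwise bound.\<close>
  have "\<exists>h. h \<in> x.G \<and> x.Gd h (of_real \<theta>) = \<xi>n n \<and> x.GN h <= M + 1 / Suc n \<and> h 0 = 0" for n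
  proof -
    obtain g where g: "g \<in> x.G" "x.Gd g (of_real \<theta>) = \<xi>n n" "x.GN g < x.UpN \<theta> (\<xi>n n) + 1 / Suc n"
      using x.upper_approx[OF \<xi>n(1)[of n], of "1 / Suc n"] by auto
    have a: "- g 0 \<in> x.S" using x.G_mem[OF g(1) s0] x.s.mem_neg by blast
    note A = x.G_add[OF g(1) G_const(1)[OF a]]
    show ?thesis
    proof (intro exI[of _ "%z. g z + - g 0"] conjI)
      show "x.GN (%z. g z + - g 0) <= M + 1 / Suc n"
        using A(2) G_const(2)[OF a] g(3) \<xi>n(2)[of n] by linarith
      show "x.Gd (%z. g z + - g 0) (of_real \<theta>) = \<xi>n n"
        using A(3)[OF zo] G_const(3)[OF a zo] g(2) by simp
    qed (use A(1) in auto)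
  qed
  then obtain h where h: "!!n. h n \<in> x.G" "!!n. x.Gd (h n) (of_real \<theta>) = \<xi>n n"
    "!!n. x.GN (h n) <= M + 1 / Suc n" "!!n. h n 0 = 0" by metis
  have hM: "x.GN (h n) <= M + 1" for n
    using h(3)[of n] by (rule order_trans) simp
  have lipn: "x.SN (h n z - h n w) <= (M + 1 / Suc n) * cmod (z - w)" if "z \<in> strip" "w \<in> strip" for n z w
    using order_trans[OF x.G_lipschitz[OF h(1) that] mult_right_mono[OF h(3)]] by simp
  have hSN: "x.SN (h n z) <= (M + 1) * cmod z" if "z \<in> strip" for n z
    using order_trans[OF x.G_lipschitz[OF h(1) that s0] mult_right_mono[OF hM]] h(4) by simp
  have hb: "cmod (h n z \<phi>) <= (M + 1) * cmod z * nn \<phi>" if "z \<in> strip" "\<phi> \<in> W" for n z \<phi>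
    using order_trans[OF sum_bound[OF x.G_mem[OF h(1) that(1)] that(2)] mult_right_mono[OF hSN[OF that(1)] nn_nonneg[OF that(2)]]] .
  have db: "cmod (x.Gd (h n) z \<phi>) <= (M + 1) * nn \<phi>" if "z \<in> ostrip" "\<phi> \<in> W" for n z \<phi>
    using order_trans[OF sum_bound[OF x.Gd(1)[OF h(1) that(1)] that(2)]
        mult_right_mono[OF order_trans[OF x.Gd_bound[OF h(1) that(1)] hM] nn_nonneg[OF that(2)]]] .
  \<comment> \<open>Values and derivatives are clustered along one filter: the Boolean selects
    between them, and \<open>0\<close> fills the indices outside their domains.\<close>
  define c where "c = (%(j, z, \<phi>) n. if \<phi> \<in> W then (if j \<and> z \<in> strip then h n z \<phi> else if \<not> j \<and> z \<in> ostrip then x.Gd (h n) z \<phi> else 0) else 0)"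
  obtain F l where F: "F <= sequentially" "F \<noteq> bot" "!!i. (c i \<longlongrightarrow> l i) F"
  proof (rule pointwise_cluster_point[of c "%(j, z, \<phi>). (M + 1) * (cmod z + 1) * \<bar>nn \<phi>\<bar>"])
    fix i :: "bool \<times> complex \<times> 'w" and n
    obtain j z \<phi> where i: "i = (j, z, \<phi>)" by (cases i)
    have "cmod (c (j, z, \<phi>) n) <= (M + 1) * (cmod z + 1) * \<bar>nn \<phi>\<bar>"
    proof (cases "\<phi> \<in> W")
      case True
      have n: "0 <= nn \<phi>" using nn_nonneg[OF True] .
      have 1: "(M + 1) * cmod z * nn \<phi> <= (M + 1) * (cmod z + 1) * nn \<phi>"
        by (intro mult_right_mono mult_left_mono) (use M0 n in auto)
      have 2: "(M + 1) * 1 * nn \<phi> <= (M + 1) * (cmod z + 1) * nn \<phi>"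
        by (intro mult_right_mono mult_left_mono) (use M0 n in auto)
      have 3: "0 <= (M + 1) * (cmod z + 1) * nn \<phi>" using M0 n by simp
      have "cmod (h n z \<phi>) <= (M + 1) * (cmod z + 1) * nn \<phi>" if "z \<in> strip"
        using order_trans[OF hb[OF that True] 1] .
      moreover have "cmod (x.Gd (h n) z \<phi>) <= (M + 1) * (cmod z + 1) * nn \<phi>" if "z \<in> ostrip"
        using order_trans[OF db[OF that True] 2[unfolded mult_1_right]] .
      ultimately show ?thesis using True 3 n unfolding c_def by (simp only: prod.case abs_of_nonneg norm_zero if_True if_False split: if_split) blast
    next
      case False
      then show ?thesis using M0 by (simp add: c_def)
    qed
    then show "cmod (c i n) <= (case i of (j, z, \<phi>) => (M + 1) * (cmod z + 1) * \<bar>nn \<phi>\<bar>)" by (simp add: i)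
  qed blast
  define H where "H = (%z \<phi>. l (True, z, \<phi>))"
  define D where "D = (%z \<phi>. l (False, z, \<phi>))"
  have Hl: "((%n. h n z \<phi>) \<longlongrightarrow> H z \<phi>) F" if "z \<in> strip" for z \<phi>
  proof -
    have "c (True, z, \<phi>) = (%n. h n z \<phi>)"
      using sum_functional[OF x.G_mem[OF h(1) that]] that by (auto simp: c_def functional_on_def)
    then show ?thesis using F(3)[of "(True, z, \<phi>)"] by (simp add: H_def)
  qed
  have Dl: "((%n. x.Gd (h n) z \<phi>) \<longlongrightarrow> D z \<phi>) F" if "z \<in> ostrip" for z \<phi>
  proof -
    have "c (False, z, \<phi>) = (%n. x.Gd (h n) z \<phi>)"
      using sum_functional[OF x.Gd(1)[OF h(1) that]] that by (auto simp: c_def functional_on_def)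
    then show ?thesis using F(3)[of "(False, z, \<phi>)"] by (simp add: D_def)
  qed
  have flim: "functional_on W f" if f: "!!n. functional_on W (fn n)" and lim: "!!\<phi>. ((%n. fn n \<phi>) \<longlongrightarrow> f \<phi>) F" for fn :: "nat => 'w => complex" and f
    unfolding functional_on_def clinear_on_def
  proof (intro conjI allI ballI impI)
    fix \<phi> assume "\<phi> \<notin> W"
    then have "(%n. fn n \<phi>) = (%n. 0)" using f unfolding functional_on_def by blast
    then show "f \<phi> = 0" using lim[of \<phi>] tendsto_unique[OF F(2) _ tendsto_const] by metis
  next
    fix \<phi> \<psi> assume "\<phi> \<in> W" "\<psi> \<in> W"
    then have "(%n. fn n (\<phi> + \<psi>)) = (%n. fn n \<phi> + fn n \<psi>)" using f unfolding functional_on_def clinear_on_def by blast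
    then show "f (\<phi> + \<psi>) = f \<phi> + f \<psi>"
      using lim[of "\<phi> + \<psi>"] tendsto_add[OF lim[of \<phi>] lim[of \<psi>]] tendsto_unique[OF F(2)] by metis
  next
    fix k \<phi> assume "\<phi> \<in> W"
    then have "(%n. fn n (k *\<^sub>C \<phi>)) = (%n. k * fn n \<phi>)" using f unfolding functional_on_def clinear_on_def by blast
    then show "f (k *\<^sub>C \<phi>) = k * f \<phi>"
      using lim[of "k *\<^sub>C \<phi>"] tendsto_mult_left[OF lim[of \<phi>], of k] tendsto_unique[OF F(2)] by metis
  qed
  have Hf: "functional_on W (H z)" if "z \<in> strip" for z
    by (rule flim[OF sum_functional[OF x.G_mem[OF h(1) that]] Hl[OF that]])
  have Df: "functional_on W (D z)" if "z \<in> ostrip" for z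
    by (rule flim[OF sum_functional[OF x.Gd(1)[OF h(1) that]] Dl[OF that]])
  \<comment> \<open>The bounds \<open>M + 1 / Suc n\<close> improve to \<open>M\<close> in the limit
    because \<open>F\<close> refines \<open>sequentially\<close>.\<close>
  have Ml: "((%n. (M + 1 / Suc n) * r * q) \<longlongrightarrow> (M + 0) * r * q) F" for r q
    by (intro tendsto_intros tendsto_mono[OF F(1)] LIMSEQ_Suc lim_1_over_n)
  have Hlip: "cmod ((H z - H w) \<phi>) <= (M * cmod (z - w)) * nn \<phi>" if zw: "z \<in> strip" "w \<in> strip" and \<phi>: "\<phi> \<in> W" for z w \<phi>
  proof -
    have "((%n. cmod (h n z \<phi> - h n w \<phi>)) \<longlongrightarrow> cmod (H z \<phi> - H w \<phi>)) F"
      by (intro tendsto_intros Hl zw)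
    moreover have "cmod (h n z \<phi> - h n w \<phi>) <= (M + 1 / Suc n) * cmod (z - w) * nn \<phi>" for n
      using order_trans[OF sum_bound[OF x.s.mem_diff[OF x.G_mem[OF h(1) zw(1)] x.G_mem[OF h(1) zw(2)]] \<phi>]
          mult_right_mono[OF lipn[OF zw] nn_nonneg[OF \<phi>]]] by simp
    ultimately have "cmod (H z \<phi> - H w \<phi>) <= (M + 0) * cmod (z - w) * nn \<phi>"
      by (intro tendsto_le[OF F(2) Ml] always_eventually) auto
    then show ?thesis by simp
  qed
  have lipb: "x.lip_on_boundary (h n) (M + 1 / Suc n)" for n
    using x.Gnorm_lip[OF h(1)[of n]] mult_right_mono[OF h(3)[of n] abs_ge_zero]
    unfolding x.lip_on_boundary_def by (meson order_trans)
  have Hl0: "cmod ((H (bnd 0 t) - H (bnd 0 t')) \<phi>) <= (M * \<bar>t - t'\<bar>) * n0 \<phi>" if \<phi>: "\<phi> \<in> W" for t t' \<phi>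
  proof -
    have "((%n. cmod (h n (bnd 0 t) \<phi> - h n (bnd 0 t') \<phi>)) \<longlongrightarrow> cmod (H (bnd 0 t) \<phi> - H (bnd 0 t') \<phi>)) F"
      by (intro tendsto_intros Hl) auto
    moreover have "cmod (h n (bnd 0 t) \<phi> - h n (bnd 0 t') \<phi>) <= (M + 1 / Suc n) * \<bar>t - t'\<bar> * n0 \<phi>" for n
    proof -
      have "h n (bnd 0 t) - h n (bnd 0 t') \<in> X0" "m0 (h n (bnd 0 t) - h n (bnd 0 t')) <= (M + 1 / Suc n) * \<bar>t - t'\<bar>"
        using lipb[of n] unfolding x.lip_on_boundary_def by blast+
      then show ?thesis using w0.dnorm_bound[OF _ \<phi>] mult_right_mono[OF _ w0.N_nonneg[OF \<phi>]] by fastforce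
    qed
    ultimately have "cmod (H (bnd 0 t) \<phi> - H (bnd 0 t') \<phi>) <= (M + 0) * \<bar>t - t'\<bar> * n0 \<phi>"
      by (intro tendsto_le[OF F(2) Ml] always_eventually) auto
    then show ?thesis by simp
  qed
  have Hl1: "cmod ((H (bnd 1 t) - H (bnd 1 t')) \<phi>) <= (M * \<bar>t - t'\<bar>) * n1 \<phi>" if \<phi>: "\<phi> \<in> W" for t t' \<phi>
  proof -
    have "((%n. cmod (h n (bnd 1 t) \<phi> - h n (bnd 1 t') \<phi>)) \<longlongrightarrow> cmod (H (bnd 1 t) \<phi> - H (bnd 1 t') \<phi>)) F"
      by (intro tendsto_intros Hl) auto
    moreover have "cmod (h n (bnd 1 t) \<phi> - h n (bnd 1 t') \<phi>) <= (M + 1 / Suc n) * \<bar>t - t'\<bar> * n1 \<phi>" for n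
    proof -
      have "h n (bnd 1 t) - h n (bnd 1 t') \<in> X1" "m1 (h n (bnd 1 t) - h n (bnd 1 t')) <= (M + 1 / Suc n) * \<bar>t - t'\<bar>"
        using lipb[of n] unfolding x.lip_on_boundary_def by blast+
      then show ?thesis using w1.dnorm_bound[OF _ \<phi>] mult_right_mono[OF _ w1.N_nonneg[OF \<phi>]] by fastforce
    qed
    ultimately have "cmod (H (bnd 1 t) \<phi> - H (bnd 1 t') \<phi>) <= (M + 0) * \<bar>t - t'\<bar> * n1 \<phi>"
      by (intro tendsto_le[OF F(2) Ml] always_eventually) auto
    then show ?thesis by simp
  qed
  have H0: "H 0 \<phi> = 0" for \<phi>
    using tendsto_unique[OF F(2) Hl[OF s0, of \<phi>], of 0] h(4) by simp
  have HS: "H z \<in> x.S" "x.SN (H z) <= M * cmod z" if z: "z \<in> strip" for z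
  proof -
    have "cmod (H z \<phi>) <= (M * cmod z) * nn \<phi>" if "\<phi> \<in> W" for \<phi>
      using Hlip[OF z s0 that] H0 by simp
    then show "H z \<in> x.S" "x.SN (H z) <= M * cmod z" using sum_dual[OF Hf[OF z], of "M * cmod z"] M0 by auto
  qed
  have HSl: "x.SN (H z - H w) <= M * cmod (z - w)" if "z \<in> strip" "w \<in> strip" for z w
    by (rule sum_dual(2)[OF functional_on_diff[OF Hf[OF that(1)] Hf[OF that(2)]] _ Hlip[OF that]]) (use M0 in simp)
  have DS: "D z \<in> x.S" if z: "z \<in> ostrip" for z
  proof (rule sum_dual(1)[OF Df[OF z], of "M + 1"])
    fix \<phi> assume \<phi>: "\<phi> \<in> W"
    show "cmod (D z \<phi>) <= (M + 1) * nn \<phi>"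
      by (rule tendsto_upperbound[OF tendsto_norm[OF Dl[OF z]] always_eventually[OF allI] F(2)]) (rule db[OF z \<phi>])
  qed (use M0 in simp)
  \<comment> \<open>The quadratic remainder bounds for the \<open>h n\<close> are uniform in
    \<open>n\<close>, so the limit of the derivatives is the derivative of the limit.\<close>
  have der: "has_nderiv x.SN H z (D z)" if z: "z \<in> ostrip" for z
  proof -
    obtain e where e: "e > 0" "ball z e \<subseteq> ostrip" using open_ostrip z open_contains_ball by blast
    define r where "r = e / 2"
    have r: "r > 0" "cball z r \<subseteq> ostrip" using e by (auto simp: r_def subset_iff)
    define B where "B = (M + 1) * (cmod z + r)"
    have B: "x.SN (h n w) <= B" if "w \<in> cball z r" for n w
    proof -
      have "w \<in> strip" using that r ostrip_subset_strip by blast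
      then have "x.SN (h n w) <= (M + 1) * cmod w" using hSN by blast
      also have "\<dots> <= B" unfolding B_def using that M0 norm_triangle_sub[of w z]
        by (intro mult_left_mono) (auto simp: dist_norm norm_minus_commute)
      finally show ?thesis .
    qed
    have B0: "0 <= B" using M0 r by (auto simp: B_def)
    show ?thesis
    proof (rule x.s.nderiv_from_quadratic[where r = "r / 2" and c = "8 * B / r\<^sup>2"])
      fix k :: complex assume k: "cmod k <= r / 2"
      have zk: "z + k \<in> strip" "z \<in> strip"
        using k r z ostrip_subset_strip by (auto simp: dist_norm subset_iff)
      show "H (z + k) \<in> x.S" using HS zk by blast
      show "x.SN (H (z + k) - H z - k *\<^sub>C D z) <= 8 * B / r\<^sup>2 * (cmod k)\<^sup>2"
      proof (rule sum_dual(2))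
        show "functional_on W (H (z + k) - H z - k *\<^sub>C D z)"
          by (intro functional_on_diff functional_on_scale Hf Df zk z)
        show "0 <= 8 * B / r\<^sup>2 * (cmod k)\<^sup>2" using B0 by simp
        fix \<phi> assume \<phi>: "\<phi> \<in> W"
        have a: "((%n. cmod (h n (z + k) \<phi> - h n z \<phi> - k * x.Gd (h n) z \<phi>)) \<longlongrightarrow> cmod (H (z + k) \<phi> - H z \<phi> - k * D z \<phi>)) F"
          by (intro tendsto_intros Hl Dl zk z)
        have b: "cmod (h n (z + k) \<phi> - h n z \<phi> - k * x.Gd (h n) z \<phi>) <= 8 * B / r\<^sup>2 * (cmod k)\<^sup>2 * nn \<phi>" for n
        proof -
          have T: "x.SN (h n (z + k) - h n z - k *\<^sub>C x.Gd (h n) z) <= 8 * B / r\<^sup>2 * (cmod k)\<^sup>2"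
            by (rule x.s.hol_strip_taylor(2)[OF x.G_hol[OF h(1)] r(2,1) B x.Gd(1,2)[OF h(1) z] k])
          have "h n (z + k) - h n z - k *\<^sub>C x.Gd (h n) z \<in> x.S"
            by (intro x.s.mem_diff x.s.mem_scale x.G_mem[OF h(1)] x.Gd(1)[OF h(1)] zk z)
          from order_trans[OF sum_bound[OF this \<phi>] mult_right_mono[OF T nn_nonneg[OF \<phi>]]]
          show ?thesis by (simp add: scaleC_fun_apply)
        qed
        have "cmod (H (z + k) \<phi> - H z \<phi> - k * D z \<phi>) <= 8 * B / r\<^sup>2 * (cmod k)\<^sup>2 * nn \<phi>"
          by (rule tendsto_upperbound[OF a always_eventually[OF allI[OF b]] F(2)])
        then show "cmod ((H (z + k) - H z - k *\<^sub>C D z) \<phi>) <= 8 * B / r\<^sup>2 * (cmod k)\<^sup>2 * nn \<phi>"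
          by (simp add: scaleC_fun_apply)
      qed
    qed (use r DS[OF z] in auto)
  qed
  have hol: "x.s.hol_strip H"
    unfolding x.s.hol_strip_def
  proof (intro conjI ballI)
    show "ncont_on x.SN strip H"
      by (rule x.s.ncont_on_lipschitz[OF HS(1)]) (use HSl in \<open>auto simp: dist_norm\<close>)
  qed (use HS der DS in blast)+
  have lip: "x.lip_on_boundary H M"
    unfolding x.lip_on_boundary_def
  proof (intro allI conjI)
    fix t t'
    have f: "functional_on W (H (bnd 0 t) - H (bnd 0 t'))" "functional_on W (H (bnd 1 t) - H (bnd 1 t'))"
      by (auto intro!: functional_on_diff Hf)
    show "H (bnd 0 t) - H (bnd 0 t') \<in> X0" "H (bnd 1 t) - H (bnd 1 t') \<in> X1"
      unfolding dual_on_iff using f Hl0 Hl1 by blast+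
    show "m0 (H (bnd 0 t) - H (bnd 0 t')) <= M * \<bar>t - t'\<bar>"
      by (rule w0.dnorm_le[OF Hl0]) (use M0 in auto)
    show "m1 (H (bnd 1 t) - H (bnd 1 t')) <= M * \<bar>t - t'\<bar>"
      by (rule w1.dnorm_le[OF Hl1]) (use M0 in auto)
  qed
  have gr: "x.SN (H z) <= M * (1 + cmod z)" if "z \<in> strip" for z
    using order_trans[OF HS(2)[OF that]] M0 by (simp add: distrib_left)
  have HG: "H \<in> x.G" "x.GN H <= M" using x.GI[OF hol gr lip] by auto
  have "x.Gd H (of_real \<theta>) = D (of_real \<theta>)"
    by (rule x.Gd(3)[OF HG(1) zo DS[OF zo] der[OF zo]])
  also have "\<dots> = \<xi>"
  proof
    fix \<phi>
    show "D (of_real \<theta>) \<phi> = \<xi> \<phi>"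
    proof (cases "\<phi> \<in> W")
      case True
      \<comment> \<open>The given sequence converges along the finer filter as well, so its limit is
        the cluster value.\<close>
      have "((%n. \<xi>n n \<phi>) \<longlongrightarrow> D (of_real \<theta>) \<phi>) F" using Dl[OF zo, of \<phi>] h(2) by simp
      then show ?thesis using tendsto_mono[OF F(1) lim[OF True]] tendsto_unique[OF F(2)] by blast
    next
      case False
      then show ?thesis using Df[OF zo] supp unfolding functional_on_def by simp
    qed
  qed
  finally have e: "x.Gd H (of_real \<theta>) = \<xi>" .
  show "\<xi> \<in> x.Up \<theta>" using x.upperI[OF HG(1), of \<theta>] e by simp
  show "x.UpN \<theta> \<xi> <= M" using x.upper_norm_le[OF HG(1), of \<theta>] HG(2) e by simp
qed

end

subsection \<open>The lower spaces\<close>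

lemma (in cnorm) geometric_series_ex:
  assumes "banach_on C N" "!!k. x k \<in> C" "!!k. N (x k) <= c * (1/2)^k"
  shows "\<exists>s. s \<in> C \<and> (\<forall>n. N ((\<Sum>k<n. x k) - s) <= 2 * c * (1/2)^n)"
  by (rule geometric_series[OF assms]) blast

section \<open>Completeness of the sum\<close>

locale bcouple = ncouple +
  assumes banach0: "banach_on C0 M0" and banach1: "banach_on C1 M1"
begin

text \<open>Taking partial sums of the thresholds \<open>q\<close> makes the indices monotone while
  each \<open>r k\<close> stays beyond \<open>q k\<close>.\<close>

lemma fast_subsequence:
  fixes d :: "'b => 'b => real" and X :: "nat => 'b"
  assumes cau: "!!e. e > 0 ==> \<exists>M. \<forall>m\<ge>M. \<forall>n\<ge>M. d (X m) (X n) < e"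
  obtains r :: "nat => nat" where "!!k n. n >= r k ==> d (X (r k)) (X n) < (1/2)^k" "!!k. r k <= r (Suc k)"
proof -
  have "\<forall>k::nat. \<exists>M. \<forall>m\<ge>M. \<forall>n\<ge>M. d (X m) (X n) < (1/2)^k" by (intro allI cau) simp
  then obtain q :: "nat => nat" where q: "!!k m n. m >= q k ==> n >= q k ==> d (X m) (X n) < (1/2)^k" by metis
  define r where "r = (%k. \<Sum>j\<le>k. q j)"
  have le: "q k <= r k" for k unfolding r_def by (rule member_le_sum) auto
  show thesis
  proof (rule that[of r])
    show "d (X (r k)) (X n) < (1/2)^k" if "n >= r k" for k n
      by (rule q) (use le[of k] that in linarith)+
    show "r k <= r (Suc k)" for k unfolding r_def by simp
  qed
qed

text \<open>Consecutive differences along a fast subsequence are decomposed almost optimally, so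
  that the two families of components can be summed separately in \<open>C0\<close> and in
  \<open>C1\<close>.\<close>

lemma banach_csum: "banach_on S SN"
  unfolding banach_on_def
proof (intro conjI allI impI csubspace_csum is_norm_sumnorm)
  fix X :: "nat => 'a" assume X: "\<forall>n. X n \<in> S" and cau: "\<forall>e>0. \<exists>M. \<forall>m\<ge>M. \<forall>n\<ge>M. SN (X m - X n) < e"
  obtain r where r: "!!k n. n >= r k ==> SN (X (r k) - X n) < (1/2)^k" "!!k. r k <= r (Suc k)"
    using fast_subsequence[of "%x y. SN (x - y)" X] cau by blast
  have "\<exists>a b. a \<in> C0 \<and> b \<in> C1 \<and> X (r (Suc k)) - X (r k) = a + b \<and> M0 a + M1 b < 2 * (1/2)^k" for k
  proof -
    have m: "X (r (Suc k)) - X (r k) \<in> S" using X s.mem_diff by blast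
    have "SN (X (r (Suc k)) - X (r k)) < (1/2)^k" using r(1)[OF r(2)[of k]] s.N_comm[of "X (r k)" "X (r (Suc k))"] X by simp
    moreover have "(0::real) < (1/2)^k" by simp
    ultimately show ?thesis using sumnorm_decomp[OF m, of "(1/2)^k"] by (smt (verit))
  qed
  then obtain a b where ab: "!!k. a k \<in> C0" "!!k. b k \<in> C1" "!!k. X (r (Suc k)) - X (r k) = a k + b k"
    "!!k. M0 (a k) + M1 (b k) < 2 * (1/2)^k" by metis
  have mab: "M0 (a k) <= 2 * (1/2)^k" "M1 (b k) <= 2 * (1/2)^k" for k
    using ab(4)[of k] c0.N_nonneg[OF ab(1)[of k]] c1.N_nonneg[OF ab(2)[of k]] by linarith+
  obtain sa where sa: "sa \<in> C0" "!!n. M0 ((\<Sum>k<n. a k) - sa) <= 2 * 2 * (1/2)^n"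
    using c0.geometric_series_ex[OF banach0 ab(1) mab(1)] by blast
  obtain sb where sb: "sb \<in> C1" "!!n. M1 ((\<Sum>k<n. b k) - sb) <= 2 * 2 * (1/2)^n"
    using c1.geometric_series_ex[OF banach1 ab(2) mab(2)] by blast
  note s = sa sb
  define x where "x = X (r 0) + (sa + sb)"
  have xS: "x \<in> S" unfolding x_def using X csumI[OF s(1,3)] s.mem_add by blast
  have sub: "SN (X (r n) - x) <= 8 * (1/2)^n" for n
  proof -
    have "X (r n) = X (r 0) + ((\<Sum>k<n. a k) + (\<Sum>k<n. b k))"
    proof (induction n)
      case (Suc n)
      have "X (r (Suc n)) = X (r n) + (a n + b n)" using ab(3)[of n] by (simp add: algebra_simps)
      then show ?case using Suc by (simp add: algebra_simps)
    qed simp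
    then have "X (r n) - x = ((\<Sum>k<n. a k) - sa) + ((\<Sum>k<n. b k) - sb)" by (simp add: x_def algebra_simps)
    then have "SN (X (r n) - x) <= M0 ((\<Sum>k<n. a k) - sa) + M1 ((\<Sum>k<n. b k) - sb)"
      using sumnorm_le[OF c0.mem_diff[OF c0.mem_sum s(1)] c1.mem_diff[OF c1.mem_sum s(3)], of "{..<n}" a "{..<n}" b] ab by simp
    then show ?thesis using s(2)[of n] s(4)[of n] by linarith
  qed
  have "(%n. SN (X n - x)) \<longlonglongrightarrow> 0"
  proof (rule LIMSEQ_I)
    fix e :: real assume e: "e > 0"
    have "(%n. 9 * (1/2)^n :: real) \<longlonglongrightarrow> 0" by real_asymp
    then have "eventually (%n. 9 * (1/2)^n < e) sequentially" using e order_tendstoD(2) by blast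
    then obtain k where k: "9 * (1/2)^k < e" using eventually_happens'[OF trivial_limit_sequentially] by blast
    have "norm (SN (X n - x) - 0) < e" if n: "n >= r k" for n
    proof -
      have "SN (X n - x) <= SN (X n - X (r k)) + SN (X (r k) - x)" using s.N_via X xS by blast
      also have "SN (X n - X (r k)) = SN (X (r k) - X n)" using s.N_comm X by blast
      finally have "SN (X n - x) < e" using r(1)[OF n] sub[of k] k by linarith
      then show ?thesis using s.N_nonneg[OF s.mem_diff[OF _ xS]] X by simp
    qed
    then show "\<exists>no. \<forall>n\<ge>no. norm (SN (X n - x) - 0) < e" by blast
  qed
  then show "\<exists>x\<in>S. (%n. SN (X n - x)) \<longlonglongrightarrow> 0" using xS by blast
qed

end

lemma bounded_of_tendsto_0:
  fixes f :: "real => real"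
  assumes "continuous_on UNIV f" "(f \<longlongrightarrow> 0) at_infinity"
  obtains K where "!!t. f t <= K"
proof -
  have "eventually (%t. f t < 1) at_infinity" using assms(2) order_tendstoD(2) by force
  then obtain b where b: "!!t. \<bar>t\<bar> >= b ==> f t < 1" unfolding eventually_at_infinity by auto
  have "compact (f ` {-b..b})" by (intro compact_continuous_image continuous_on_subset[OF assms(1)]) auto
  then have "bounded (f ` {-b..b})" by (rule compact_imp_bounded)
  then obtain B where B: "!!t. t \<in> {-b..b} ==> \<bar>f t\<bar> <= B" unfolding bounded_iff real_norm_def by blast
  have "f t <= max 1 B" for t
  proof (cases "\<bar>t\<bar> >= b")
    case False
    then have "\<bar>f t\<bar> <= B" by (intro B) auto
    then show ?thesis by simp
  qed (use b[of t] in auto)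
  then show thesis using that by blast
qed

lemma tendsto_0_uniform_limit:
  fixes f :: "real => real"
  assumes f: "!!t. 0 <= f t" "!!n t. f t <= g n t + \<epsilon> n" and g: "!!n. (g n \<longlongrightarrow> 0) at_infinity" and \<epsilon>: "\<epsilon> \<longlonglongrightarrow> 0"
  shows "(f \<longlongrightarrow> 0) at_infinity"
proof (rule tendstoI)
  fix e :: real assume e: "e > 0"
  then have "eventually (%n. \<epsilon> n < e/2) sequentially" using order_tendstoD(2)[OF \<epsilon>, of "e/2"] by simp
  then obtain n where n: "\<epsilon> n < e/2" using eventually_happens'[OF trivial_limit_sequentially] by blast
  have "eventually (%t. g n t < e/2) at_infinity" using order_tendstoD(2)[OF g, of "e/2"] e by simp
  then show "eventually (%t. dist (f t) 0 < e) at_infinity"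
  proof eventually_elim
    case (elim t)
    then have "f t < e" using f(2)[of t n] n by linarith
    then show ?case using f(1)[of t] by simp
  qed
qed

section \<open>Bounded boundary functions\<close>

context ncouple begin

text \<open>Functions on the whole plane of which only the values on the two boundary lines count,
  so \<open>bN\<close> is a seminorm. The space is closed under cutting off to one line, because
  boundedness is the only regularity demanded.\<close>

definition bV :: "(complex => 'a) set" where
  "bV = {u. (\<forall>t. u (bnd 0 t) \<in> C0 \<and> u (bnd 1 t) \<in> C1) \<and>
            (\<exists>K. \<forall>t. M0 (u (bnd 0 t)) <= K \<and> M1 (u (bnd 1 t)) <= K)}"

definition bN :: "(complex => 'a) => real" where
  "bN u = Sup ({M0 (u (bnd 0 t)) | t. True} \<union> {M1 (u (bnd 1 t)) | t. True})"

lemma bN_le: "(!!t. M0 (u (bnd 0 t)) <= K) ==> (!!t. M1 (u (bnd 1 t)) <= K) ==> bN u <= K"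
  unfolding bN_def by (rule cSup_least) auto

lemma bN_upper:
  assumes "u \<in> bV"
  shows "M0 (u (bnd 0 t)) <= bN u" "M1 (u (bnd 1 t)) <= bN u"
proof -
  obtain K where "!!t. M0 (u (bnd 0 t)) <= K" "!!t. M1 (u (bnd 1 t)) <= K" using assms unfolding bV_def by blast
  then have bdd: "bdd_above ({M0 (u (bnd 0 t)) | t. True} \<union> {M1 (u (bnd 1 t)) | t. True})"
    by (intro bdd_aboveI[of _ K]) auto
  show "M0 (u (bnd 0 t)) <= bN u" "M1 (u (bnd 1 t)) <= bN u"
    unfolding bN_def by (rule cSup_upper[OF _ bdd]; blast)+
qed

lemma bVD: "u \<in> bV ==> u (bnd 0 t) \<in> C0" "u \<in> bV ==> u (bnd 1 t) \<in> C1"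
  unfolding bV_def by auto

lemma bVI:
  assumes "!!t. u (bnd 0 t) \<in> C0" "!!t. u (bnd 1 t) \<in> C1" "!!t. M0 (u (bnd 0 t)) <= K" "!!t. M1 (u (bnd 1 t)) <= K"
  shows "u \<in> bV" "bN u <= K"
  using assms bN_le[of u K] unfolding bV_def by blast+

lemma bN_nonneg: "u \<in> bV ==> 0 <= bN u"
  using bN_upper(1)[of u 0] c0.N_nonneg[OF bVD(1)[of u 0]] by linarith

lemma bV_add:
  assumes "u \<in> bV" "v \<in> bV" shows "u + v \<in> bV" "bN (u + v) <= bN u + bN v"
  using bVI[of "u + v" "bN u + bN v"]
    order_trans[OF c0.N_tri[OF bVD(1)[OF assms(1)] bVD(1)[OF assms(2)]] add_mono[OF bN_upper(1)[OF assms(1)] bN_upper(1)[OF assms(2)]]]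
    order_trans[OF c1.N_tri[OF bVD(2)[OF assms(1)] bVD(2)[OF assms(2)]] add_mono[OF bN_upper(2)[OF assms(1)] bN_upper(2)[OF assms(2)]]]
    c0.mem_add[OF bVD(1)[OF assms(1)] bVD(1)[OF assms(2)]] c1.mem_add[OF bVD(2)[OF assms(1)] bVD(2)[OF assms(2)]]
  unfolding plus_fun_def by blast+

lemma bV_scale:
  assumes "u \<in> bV" shows "c *\<^sub>C u \<in> bV" "bN (c *\<^sub>C u) <= cmod c * bN u"
proof -
  have "M0 (c *\<^sub>C u (bnd 0 t)) <= cmod c * bN u" "M1 (c *\<^sub>C u (bnd 1 t)) <= cmod c * bN u" for t
    unfolding c0.N_scale[OF bVD(1)[OF assms]] c1.N_scale[OF bVD(2)[OF assms]]
    by (intro mult_left_mono bN_upper[OF assms] norm_ge_zero)+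
  then show "c *\<^sub>C u \<in> bV" "bN (c *\<^sub>C u) <= cmod c * bN u"
    using bVI[of "c *\<^sub>C u" "cmod c * bN u"] c0.mem_scale[OF bVD(1)[OF assms]] c1.mem_scale[OF bVD(2)[OF assms]]
    unfolding scaleC_fun_def by blast+
qed

lemma bV_0: "0 \<in> bV" "bN 0 = 0"
proof -
  show z: "0 \<in> bV" by (rule bVI[of 0 0]) (simp_all add: c0.mem_0 c1.mem_0 c0.N_0 c1.N_0)
  have "bN 0 <= 0" by (rule bVI[of 0 0]) (simp_all add: c0.mem_0 c1.mem_0 c0.N_0 c1.N_0)
  then show "bN 0 = 0" using bN_nonneg[OF z] by simp
qed

lemma csubspace_bV: "csubspace bV"
  unfolding csubspace_def using bV_add bV_scale bV_0 by blast

lemma seminorm_bV: "seminorm_on bV bN"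
proof -
  have "bN (c *\<^sub>C u) = cmod c * bN u" if u: "u \<in> bV" for c u
  proof (cases "c = 0")
    case False
    have "bN ((1/c) *\<^sub>C c *\<^sub>C u) <= cmod (1/c) * bN (c *\<^sub>C u)" by (rule bV_scale(2)[OF bV_scale(1)[OF u]])
    then have "cmod c * bN u <= bN (c *\<^sub>C u)" using False by (simp add: norm_divide field_simps)
    then show ?thesis using bV_scale(2)[OF u, of c] by simp
  qed (simp add: bV_0)
  then show ?thesis unfolding seminorm_on_def using bN_nonneg bV_add by blast
qed

section \<open>The space F\<close>

abbreviation Fs where "Fs \<equiv> Fspace C0 M0 C1 M1"

lemma Fs_iff:
  "F \<in> Fs \<longleftrightarrow> s.hol_strip F \<and> (\<exists>K. \<forall>z\<in>strip. SN (F z) <= K) \<and> (\<forall>t. F (bnd 0 t) \<in> C0 \<and> F (bnd 1 t) \<in> C1)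
    \<and> ncont_on M0 UNIV (%t. F (bnd 0 t)) \<and> ncont_on M1 UNIV (%t. F (bnd 1 t))
    \<and> ((%t. M0 (F (bnd 0 t))) \<longlongrightarrow> 0) at_infinity \<and> ((%t. M1 (F (bnd 1 t))) \<longlongrightarrow> 0) at_infinity"
  unfolding Fspace_def s.hol_strip_def ostrip_def by auto

lemma FsD:
  assumes "F \<in> Fs"
  shows "s.hol_strip F" "\<exists>K. \<forall>z\<in>strip. SN (F z) <= K" "F (bnd 0 t) \<in> C0" "F (bnd 1 t) \<in> C1"
    "ncont_on M0 UNIV (%t. F (bnd 0 t))" "ncont_on M1 UNIV (%t. F (bnd 1 t))"
    "((%t. M0 (F (bnd 0 t))) \<longlongrightarrow> 0) at_infinity" "((%t. M1 (F (bnd 1 t))) \<longlongrightarrow> 0) at_infinity"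
  using assms unfolding Fs_iff by blast+

lemma Fs_bV: assumes F: "F \<in> Fs" shows "F \<in> bV"
proof -
  obtain K where K: "!!t. M0 (F (bnd 0 t)) <= K"
    using bounded_of_tendsto_0[OF c0.ncont_on_norm[OF FsD(5)[OF F] FsD(3)[OF F]] FsD(7)[OF F]] by blast
  obtain K' where K': "!!t. M1 (F (bnd 1 t)) <= K'"
    using bounded_of_tendsto_0[OF c1.ncont_on_norm[OF FsD(6)[OF F] FsD(4)[OF F]] FsD(8)[OF F]] by blast
  show ?thesis
    by (rule bVI(1)[of F "max K K'"]) (use FsD(3,4)[OF F] K K' in \<open>auto simp: le_max_iff_disj\<close>)
qed

text \<open>The Phragmen-Lindelof principle replaces the qualitative bound \<open>K\<close> in the
  definition by the boundary seminorm.\<close>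

lemma Fs_bound: assumes F: "F \<in> Fs" and z: "z \<in> strip" shows "SN (F z) <= bN F"
proof -
  obtain K where K: "!!z. z \<in> strip ==> SN (F z) <= K" using FsD(2)[OF F] by blast
  show ?thesis
  proof (rule s.hol_strip_phragmen_lindelof[OF FsD(1)[OF F] _ _ _ z, of "\<bar>K\<bar>"])
    fix w assume "w \<in> strip"
    then have "SN (F w) <= \<bar>K\<bar> * 1" using K by force
    also have "\<dots> <= \<bar>K\<bar> * (1 + cmod w)" by (intro mult_left_mono) auto
    finally show "SN (F w) <= \<bar>K\<bar> * (1 + cmod w)" .
  next
    fix t
    show "SN (F (bnd 0 t)) <= bN F" using SN0[OF FsD(3)[OF F]] bN_upper(1)[OF Fs_bV[OF F]] order_trans by blast
    show "SN (F (bnd 1 t)) <= bN F" using SN1[OF FsD(4)[OF F]] bN_upper(2)[OF Fs_bV[OF F]] order_trans by blast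
  qed
qed

lemma Fs_add: assumes F: "F \<in> Fs" and H: "H \<in> Fs" shows "F + H \<in> Fs"
  unfolding Fs_iff plus_fun_def
proof (intro conjI allI)
  show "s.hol_strip (%x. F x + H x)" by (rule s.hol_strip_add[OF FsD(1)[OF F] FsD(1)[OF H]])
  have "SN (F z + H z) <= bN F + bN H" if "z \<in> strip" for z
    using s.N_tri[OF s.hol_stripD(1)[OF FsD(1)[OF F] that] s.hol_stripD(1)[OF FsD(1)[OF H] that]]
      Fs_bound[OF F that] Fs_bound[OF H that] by linarith
  then show "\<exists>K. \<forall>z\<in>strip. SN (F z + H z) <= K" by blast
  show "F (bnd 0 t) + H (bnd 0 t) \<in> C0" "F (bnd 1 t) + H (bnd 1 t) \<in> C1" for t
    by (intro c0.mem_add c1.mem_add FsD[OF F] FsD[OF H])+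
  show "ncont_on M0 UNIV (%t. F (bnd 0 t) + H (bnd 0 t))"
    by (rule c0.ncont_on_add[OF FsD(5)[OF F] FsD(3)[OF F] FsD(5)[OF H] FsD(3)[OF H]])
  show "ncont_on M1 UNIV (%t. F (bnd 1 t) + H (bnd 1 t))"
    by (rule c1.ncont_on_add[OF FsD(6)[OF F] FsD(4)[OF F] FsD(6)[OF H] FsD(4)[OF H]])
  show "((%t. M0 (F (bnd 0 t) + H (bnd 0 t))) \<longlongrightarrow> 0) at_infinity"
  proof (rule Lim_null_comparison[OF always_eventually[OF allI]])
    show "norm (M0 (F (bnd 0 t) + H (bnd 0 t))) <= M0 (F (bnd 0 t)) + M0 (H (bnd 0 t))" for t
      using c0.N_tri[OF FsD(3)[OF F] FsD(3)[OF H]] c0.N_nonneg[OF c0.mem_add[OF FsD(3)[OF F] FsD(3)[OF H]]] by simp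
    show "((%t. M0 (F (bnd 0 t)) + M0 (H (bnd 0 t))) \<longlongrightarrow> 0) at_infinity"
      using tendsto_add[OF FsD(7)[OF F] FsD(7)[OF H]] by simp
  qed
  show "((%t. M1 (F (bnd 1 t) + H (bnd 1 t))) \<longlongrightarrow> 0) at_infinity"
  proof (rule Lim_null_comparison[OF always_eventually[OF allI]])
    show "norm (M1 (F (bnd 1 t) + H (bnd 1 t))) <= M1 (F (bnd 1 t)) + M1 (H (bnd 1 t))" for t
      using c1.N_tri[OF FsD(4)[OF F] FsD(4)[OF H]] c1.N_nonneg[OF c1.mem_add[OF FsD(4)[OF F] FsD(4)[OF H]]] by simp
    show "((%t. M1 (F (bnd 1 t)) + M1 (H (bnd 1 t))) \<longlongrightarrow> 0) at_infinity"
      using tendsto_add[OF FsD(8)[OF F] FsD(8)[OF H]] by simp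
  qed
qed

text \<open>A bounded function with bounded continuous boundary values enters \<open>Fspace\<close>
  once a scalar factor damps it at infinity. This admits both difference quotients and scalar
  multiples of a fixed vector.\<close>

lemma Fs_mult:
  assumes f: "s.hol_strip f" and fB: "!!z. z \<in> strip ==> SN (f z) <= B"
    and f0: "!!t. f (bnd 0 t) \<in> C0" "ncont_on M0 UNIV (%t. f (bnd 0 t))" "!!t. M0 (f (bnd 0 t)) <= B"
    and f1: "!!t. f (bnd 1 t) \<in> C1" "ncont_on M1 UNIV (%t. f (bnd 1 t))" "!!t. M1 (f (bnd 1 t)) <= B"
    and u: "continuous_on strip u" "u holomorphic_on ostrip" "!!z. z \<in> strip ==> cmod (u z) <= K"
    and u0: "((%t. u (bnd 0 t)) \<longlongrightarrow> 0) at_infinity" "((%t. u (bnd 1 t)) \<longlongrightarrow> 0) at_infinity"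
  shows "(%z. u z *\<^sub>C f z) \<in> Fs"
  unfolding Fs_iff
proof (intro conjI allI)
  show "s.hol_strip (%z. u z *\<^sub>C f z)" by (rule s.hol_strip_mult[OF f u(1,2)])
  have B: "0 <= B" using order_trans[OF c0.N_nonneg[OF f0(1)] f0(3)] .
  have "SN (u z *\<^sub>C f z) <= K * B" if z: "z \<in> strip" for z
    unfolding s.N_scale[OF s.hol_stripD(1)[OF f z]]
    using u(3)[OF z] fB[OF z] B by (intro mult_mono s.N_nonneg s.hol_stripD(1)[OF f z]) (auto intro: order_trans[OF norm_ge_zero])
  then show "\<exists>K. \<forall>z\<in>strip. SN (u z *\<^sub>C f z) <= K" by blast
  show "u (bnd 0 t) *\<^sub>C f (bnd 0 t) \<in> C0" "u (bnd 1 t) *\<^sub>C f (bnd 1 t) \<in> C1" for t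
    by (intro c0.mem_scale c1.mem_scale f0 f1)+
  have cb: "continuous_on UNIV (%t. u (bnd 0 t))" "continuous_on UNIV (%t. u (bnd 1 t))"
    by (rule continuous_on_compose2[OF u(1)]; auto simp: bnd_def strip_def intro!: continuous_intros)+
  show "ncont_on M0 UNIV (%t. u (bnd 0 t) *\<^sub>C f (bnd 0 t))"
    by (rule c0.ncont_on_mult[OF f0(2,1) cb(1)])
  show "ncont_on M1 UNIV (%t. u (bnd 1 t) *\<^sub>C f (bnd 1 t))"
    by (rule c1.ncont_on_mult[OF f1(2,1) cb(2)])
  show "((%t. M0 (u (bnd 0 t) *\<^sub>C f (bnd 0 t))) \<longlongrightarrow> 0) at_infinity"
  proof (rule Lim_null_comparison[OF always_eventually[OF allI]])
    show "norm (M0 (u (bnd 0 t) *\<^sub>C f (bnd 0 t))) <= cmod (u (bnd 0 t)) * B" for t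
      unfolding c0.N_scale[OF f0(1)] using f0(3)[of t] c0.N_nonneg[OF f0(1)] by (simp add: abs_mult mult_left_mono)
    show "((%t. cmod (u (bnd 0 t)) * B) \<longlongrightarrow> 0) at_infinity"
      using tendsto_mult_right[OF tendsto_norm[OF u0(1)], of B] by simp
  qed
  show "((%t. M1 (u (bnd 1 t) *\<^sub>C f (bnd 1 t))) \<longlongrightarrow> 0) at_infinity"
  proof (rule Lim_null_comparison[OF always_eventually[OF allI]])
    show "norm (M1 (u (bnd 1 t) *\<^sub>C f (bnd 1 t))) <= cmod (u (bnd 1 t)) * B" for t
      unfolding c1.N_scale[OF f1(1)] using f1(3)[of t] c1.N_nonneg[OF f1(1)] by (simp add: abs_mult mult_left_mono)
    show "((%t. cmod (u (bnd 1 t)) * B) \<longlongrightarrow> 0) at_infinity"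
      using tendsto_mult_right[OF tendsto_norm[OF u0(2)], of B] by simp
  qed
qed

lemma Fs_scalar:
  assumes a: "a \<in> C0" "a \<in> C1"
    and u: "continuous_on strip u" "u holomorphic_on ostrip" "!!z. z \<in> strip ==> cmod (u z) <= K"
    and u0: "((%t. u (bnd 0 t)) \<longlongrightarrow> 0) at_infinity" "((%t. u (bnd 1 t)) \<longlongrightarrow> 0) at_infinity"
  shows "(%z. u z *\<^sub>C a) \<in> Fs"
  by (rule Fs_mult[OF s.hol_strip_const[OF S0[OF a(1)]], of "max (SN a) (max (M0 a) (M1 a))", OF _ _ c0.ncont_on_const[OF a(1)] _ _ c1.ncont_on_const[OF a(2)] _ u u0])
     (use a in auto)

lemma Fs_scale: assumes F: "F \<in> Fs" shows "c *\<^sub>C F \<in> Fs"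
  unfolding Fs_iff scaleC_fun_def
proof (intro conjI allI)
  show "s.hol_strip (%x. c *\<^sub>C F x)" by (rule s.hol_strip_scale[OF FsD(1)[OF F]])
  have "SN (c *\<^sub>C F z) <= cmod c * bN F" if "z \<in> strip" for z
    unfolding s.N_scale[OF s.hol_stripD(1)[OF FsD(1)[OF F] that]] by (intro mult_left_mono Fs_bound[OF F that]) auto
  then show "\<exists>K. \<forall>z\<in>strip. SN (c *\<^sub>C F z) <= K" by blast
  show "c *\<^sub>C F (bnd 0 t) \<in> C0" "c *\<^sub>C F (bnd 1 t) \<in> C1" for t
    by (intro c0.mem_scale c1.mem_scale FsD[OF F])+
  show "ncont_on M0 UNIV (%t. c *\<^sub>C F (bnd 0 t))"
    by (rule c0.ncont_on_mult[OF FsD(5)[OF F] FsD(3)[OF F]]) auto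
  show "ncont_on M1 UNIV (%t. c *\<^sub>C F (bnd 1 t))"
    by (rule c1.ncont_on_mult[OF FsD(6)[OF F] FsD(4)[OF F]]) auto
  show "((%t. M0 (c *\<^sub>C F (bnd 0 t))) \<longlongrightarrow> 0) at_infinity"
    unfolding c0.N_scale[OF FsD(3)[OF F]] using tendsto_mult_left[OF FsD(7)[OF F], of "cmod c"] by simp
  show "((%t. M1 (c *\<^sub>C F (bnd 1 t))) \<longlongrightarrow> 0) at_infinity"
    unfolding c1.N_scale[OF FsD(4)[OF F]] using tendsto_mult_left[OF FsD(8)[OF F], of "cmod c"] by simp
qed

lemma Fs_0: "0 \<in> Fs"
  unfolding Fs_iff using s.hol_strip_const[OF s.mem_0] c0.ncont_on_const[OF c0.mem_0] c1.ncont_on_const[OF c1.mem_0]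
  by (auto simp: zero_fun_def s.N_0 c0.N_0 c1.N_0 c0.mem_0 c1.mem_0)

lemma csubspace_Fs: "csubspace Fs"
  unfolding csubspace_def using Fs_0 Fs_add Fs_scale by blast

end

section \<open>Completeness of F\<close>

context bcouple begin

text \<open>Boundary bounds control the sum norm on the whole strip at the same geometric rate, so
  the series converges uniformly both on the lines, in their own norms, and inside.\<close>

lemma Fs_series:
  assumes H: "!!k. H k \<in> Fs" "!!k. bN (H k) <= c * (1/2)^k"
  obtains F where "F \<in> Fs" "!!n z. z \<in> strip ==> SN ((\<Sum>k<n. H k z) - F z) <= 2 * c * (1/2)^n"
proof -
  have lim: "(%n. 2 * c * (1/2)^n) \<longlonglongrightarrow> 0" by real_asymp
  note m0 = FsD(3)[OF H(1)] and m1 = FsD(4)[OF H(1)]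
  note mS = s.hol_stripD(1)[OF FsD(1)[OF H(1)]]
  have b0: "M0 (H k (bnd 0 t)) <= c * (1/2)^k" and b1: "M1 (H k (bnd 1 t)) <= c * (1/2)^k" for k t
    using bN_upper[OF Fs_bV[OF H(1)]] H(2) order_trans by blast+
  have bS: "SN (H k z) <= c * (1/2)^k" if "z \<in> strip" for k z
    using Fs_bound[OF H(1) that] H(2) order_trans by blast
  have "\<exists>s. s \<in> C0 \<and> (\<forall>n. M0 ((\<Sum>k<n. H k (bnd 0 t)) - s) <= 2 * c * (1/2)^n)" for t
    by (rule c0.geometric_series_ex[OF banach0 m0 b0])
  then obtain f0 where f0: "!!t. f0 t \<in> C0" "!!t n. M0 ((\<Sum>k<n. H k (bnd 0 t)) - f0 t) <= 2 * c * (1/2)^n" by metis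
  have "\<exists>s. s \<in> C1 \<and> (\<forall>n. M1 ((\<Sum>k<n. H k (bnd 1 t)) - s) <= 2 * c * (1/2)^n)" for t
    by (rule c1.geometric_series_ex[OF banach1 m1 b1])
  then obtain f1 where f1: "!!t. f1 t \<in> C1" "!!t n. M1 ((\<Sum>k<n. H k (bnd 1 t)) - f1 t) <= 2 * c * (1/2)^n" by metis
  have "\<exists>s. s \<in> S \<and> (\<forall>n. SN ((\<Sum>k<n. H k z) - s) <= 2 * c * (1/2)^n)" if "z \<in> strip" for z
    by (rule s.geometric_series_ex[OF banach_csum mS[OF that] bS[OF that]])
  then obtain f where f: "!!z. z \<in> strip ==> f z \<in> S" "!!z n. z \<in> strip ==> SN ((\<Sum>k<n. H k z) - f z) <= 2 * c * (1/2)^n" by metis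
  \<comment> \<open>On the boundary the limits taken in \<open>C0\<close> and \<open>C1\<close> are
    used, since a limit taken in the sum norm would not directly be known to lie there.\<close>
  define F where "F = (%z. if Re z = 0 then f0 (Im z) else if Re z = 1 then f1 (Im z) else f z)"
  have Fb: "F (bnd 0 t) = f0 t" "F (bnd 1 t) = f1 t" for t by (simp_all add: F_def)
  have s0: "(\<Sum>k<n. H k (bnd 0 t)) \<in> C0" and s1: "(\<Sum>k<n. H k (bnd 1 t)) \<in> C1" for n t
    using c0.mem_sum[of "{..<n}" "%k. H k (bnd 0 t)"] m0 c1.mem_sum[of "{..<n}" "%k. H k (bnd 1 t)"] m1 by blast+
  have FS: "F z \<in> S" "SN ((\<Sum>k<n. H k z) - F z) <= 2 * c * (1/2)^n" if z: "z \<in> strip" for z n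
  proof -
    have "F z \<in> S \<and> SN ((\<Sum>k<n. H k z) - F z) <= 2 * c * (1/2)^n"
      using z
    proof (cases rule: strip_boundary_cases)
      case 1
      have "F (bnd 0 t) \<in> S \<and> SN ((\<Sum>k<n. H k (bnd 0 t)) - F (bnd 0 t)) <= 2 * c * (1/2)^n" for t
        unfolding Fb using S0[OF f0(1)] order_trans[OF SN0[OF c0.mem_diff[OF s0 f0(1)]] f0(2)] by blast
      then show ?thesis using 1 by metis
    next
      case 2
      have "F (bnd 1 t) \<in> S \<and> SN ((\<Sum>k<n. H k (bnd 1 t)) - F (bnd 1 t)) <= 2 * c * (1/2)^n" for t
        unfolding Fb using S1[OF f1(1)] order_trans[OF SN1[OF c1.mem_diff[OF s1 f1(1)]] f1(2)] by blast
      then show ?thesis using 2 by metis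
    next
      case 3
      then have "F z = f z" by (auto simp: F_def ostrip_def)
      then show ?thesis using f[OF z] by simp
    qed
    then show "F z \<in> S" "SN ((\<Sum>k<n. H k z) - F z) <= 2 * c * (1/2)^n" by auto
  qed
  have hol: "s.hol_strip F"
    by (rule s.hol_strip_series[OF banach_csum FsD(1)[OF H(1)] bS FS])
  have Hn: "(\<Sum>k<n. H k) \<in> Fs" for n by (rule csubspace_sum[OF csubspace_Fs H(1)])
  have sum_apply: "(\<Sum>k<n. H k) z = (\<Sum>k<n. H k z)" for n z by (induction n) auto
  note Hn' = FsD[OF Hn, unfolded sum_apply]
  have "F \<in> Fs"
    unfolding Fs_iff
  proof (intro conjI allI hol)
    show "\<exists>K. \<forall>z\<in>strip. SN (F z) <= K"
    proof (intro exI ballI)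
      fix z assume z: "z \<in> strip"
      show "SN (F z) <= 2 * c" using FS(2)[OF z, of 0] s.N_neg[OF FS(1)[OF z]] by simp
    qed
    show "F (bnd 0 t) \<in> C0" "F (bnd 1 t) \<in> C1" for t unfolding Fb using f0(1) f1(1) by blast+
    show "ncont_on M0 UNIV (%t. F (bnd 0 t))"
      unfolding Fb by (rule c0.ncont_on_uniform_limit[OF Hn'(5) s0 f0 lim])
    show "ncont_on M1 UNIV (%t. F (bnd 1 t))"
      unfolding Fb by (rule c1.ncont_on_uniform_limit[OF Hn'(6) s1 f1 lim])
    show "((%t. M0 (F (bnd 0 t))) \<longlongrightarrow> 0) at_infinity"
      unfolding Fb
    proof (rule tendsto_0_uniform_limit[OF c0.N_nonneg[OF f0(1)] _ Hn'(7) lim])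
      show "M0 (f0 t) <= M0 (\<Sum>k<n. H k (bnd 0 t)) + 2 * c * (1/2)^n" for n t
        using c0.N_le_add[OF f0(1) s0] c0.N_comm[OF f0(1) s0] f0(2)[of t n] by (metis add_left_mono order_trans)
    qed
    show "((%t. M1 (F (bnd 1 t))) \<longlongrightarrow> 0) at_infinity"
      unfolding Fb
    proof (rule tendsto_0_uniform_limit[OF c1.N_nonneg[OF f1(1)] _ Hn'(8) lim])
      show "M1 (f1 t) <= M1 (\<Sum>k<n. H k (bnd 1 t)) + 2 * c * (1/2)^n" for n t
        using c1.N_le_add[OF f1(1) s1] c1.N_comm[OF f1(1) s1] f1(2)[of t n] by (metis add_left_mono order_trans)
    qed
  qed
  then show thesis using that FS(2) by blast
qed

end

section \<open>Weak integrals\<close>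

context cnorm begin

lemma bfun_sum:
  assumes "bfun K L" "!!i. i \<in> I ==> f i \<in> C" shows "L (sum f I) = (\<Sum>i\<in>I. L (f i))"
  by (rule clinear_on_sum[OF sub bfunD(1)[OF assms(1)] assms(2)])

text \<open>\<open>N\<close> is not the metric of a type, so the Heine-Cantor theorem is applied to
  the real function \<open>q\<close> on the product \<open>T \<times> T\<close> and compared with
  its zeros on the diagonal.\<close>

lemma ncont_on_uniform:
  fixes f :: "'b::metric_space => 'a"
  assumes T: "compact T" and f: "ncont_on N T f" "!!z. z \<in> T ==> f z \<in> C" and e: "e > 0"
  obtains d where "d > 0" "!!x y. x \<in> T ==> y \<in> T ==> dist x y < d ==> N (f x - f y) < e"
proof -
  define q where "q = (%p. N (f (fst p) - f (snd p)))"
  have f1: "ncont_on N (T \<times> T) (%p. f (fst p))" and f2: "ncont_on N (T \<times> T) (%p. f (snd p))"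
    by (rule ncont_on_compose[OF f(1)]; use f(2) in \<open>auto intro!: continuous_intros\<close>)+
  have "ncont_on N (T \<times> T) (%p. (-1) *\<^sub>C f (snd p))"
    by (rule ncont_on_mult[OF f2]) (use f(2) in auto)
  then have "ncont_on N (T \<times> T) (%p. f (fst p) + (-1) *\<^sub>C f (snd p))"
    by (intro ncont_on_add f1) (use f(2) mem_scale mem_neg in auto)
  then have "continuous_on (T \<times> T) (%p. N (f (fst p) + (-1) *\<^sub>C f (snd p)))"
    by (rule ncont_on_norm) (use f(2) mem_add mem_scale mem_diff in auto)
  then have "uniformly_continuous_on (T \<times> T) q"
    unfolding q_def using compact_uniformly_continuous[OF _ compact_Times[OF T T]] by simp
  then obtain d where d: "d > 0" "!!p p'. p \<in> T \<times> T ==> p' \<in> T \<times> T ==> dist p' p < d ==> dist (q p') (q p) < e"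
    using e unfolding uniformly_continuous_on_def by metis
  show thesis
  proof (rule that[OF d(1)])
    fix x y assume xy: "x \<in> T" "y \<in> T" "dist x y < d"
    have "dist (x, y) (y, y) < d" using xy by (simp add: dist_Pair_Pair)
    then have "dist (q (x, y)) (q (y, y)) < e" using d(2)[of "(y, y)" "(x, y)"] xy by simp
    then show "N (f x - f y) < e" by (simp add: q_def N_0 dist_real_def)
  qed
qed

text \<open>For functionals of norm at most one, the error of the Riemann sums is governed by the
  modulus of continuity of \<open>f\<close> alone. This uniformity makes the vector-valued sums
  Cauchy, and their limit represents all the scalar integrals.\<close>

lemma pettis_integral:
  assumes B: "banach_on C N" and f: "ncont_on N {a..b} f" "!!t. t \<in> {a..b} ==> f t \<in> C" and ab: "a <= (b::real)"
  shows "\<exists>I\<in>C. \<forall>L. bfun 1 L \<longrightarrow> L I = integral {a..b} (%t. L (f t))"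
proof -
  define X where "X = (%m. \<Sum>k<m. of_real ((b - a) / real m) *\<^sub>C f (a + real k * ((b - a) / real m)))"
  have pt: "a + real k * ((b - a) / real m) \<in> {a..b}" if "k < m" for k m
  proof -
    have "real k * ((b - a) / real m) <= real m * ((b - a) / real m)"
      using that ab by (intro mult_right_mono) auto
    then show ?thesis using that ab by auto
  qed
  have XC: "X m \<in> C" for m unfolding X_def by (intro mem_sum mem_scale f(2) pt) simp
  have LX: "L (X m) = (\<Sum>k<m. ((b - a) / real m) *\<^sub>R L (f (a + real k * ((b - a) / real m))))" if L: "bfun 1 L" for L m
  proof -
    have "L (X m) = (\<Sum>k<m. L (of_real ((b - a) / real m) *\<^sub>C f (a + real k * ((b - a) / real m))))"
      unfolding X_def by (rule bfun_sum[OF L]) (intro mem_scale f(2) pt, simp)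
    also have "\<dots> = (\<Sum>k<m. ((b - a) / real m) *\<^sub>R L (f (a + real k * ((b - a) / real m))))"
    proof (rule sum.cong[OF refl])
      fix k assume "k \<in> {..<m}"
      then have k: "k < m" by simp
      show "L (of_real ((b - a) / real m) *\<^sub>C f (a + real k * ((b - a) / real m))) = ((b - a) / real m) *\<^sub>R L (f (a + real k * ((b - a) / real m)))"
        unfolding bfun_scale[OF L f(2)[OF pt[OF k]]] scaleR_conv_of_real ..
    qed
    finally show ?thesis .
  qed
  have Lc: "continuous_on {a..b} (%t. L (f t))" if "bfun 1 L" for L
    by (rule functional_continuous[OF f that])
  have osc: "\<exists>M. \<forall>m\<ge>M. \<forall>L. bfun 1 L \<longrightarrow> cmod (L (X m) - integral {a..b} (%t. L (f t))) <= e * (b - a)" if e: "e > 0" for e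
  proof -
    obtain d where d: "d > 0" "!!x y. x \<in> {a..b} ==> y \<in> {a..b} ==> dist x y < d ==> N (f x - f y) < e"
      using ncont_on_uniform[OF compact_Icc f e] by blast
    have "(%m. (b - a) / real m) \<longlonglongrightarrow> 0" by real_asymp
    then have "eventually (%m. (b - a) / real m < d) sequentially" using d order_tendstoD(2) by blast
    then obtain M where M: "!!m. m >= M ==> (b - a) / real m < d" unfolding eventually_sequentially by blast
    have "cmod (L (X m) - integral {a..b} (%t. L (f t))) <= e * (b - a)" if m: "m >= M + 1" and L: "bfun 1 L" for m L
      unfolding LX[OF L]
    proof (rule riemann_sum_bound[OF Lc[OF L] ab])
      fix x y assume xy: "x \<in> {a..b}" "y \<in> {a..b}" "\<bar>x - y\<bar> <= (b - a) / real m"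
      have "N (f x - f y) < e" by (rule d(2)) (use xy M[of m] m in \<open>auto simp: dist_real_def\<close>)
      then show "cmod (L (f x) - L (f y)) <= e"
        using bfunD(2)[OF L mem_diff[OF f(2) f(2)]] bfun_diff[OF L f(2) f(2)] xy by (metis less_imp_le mult_1 order_trans)
    qed (use m in auto)
    then show ?thesis by blast
  qed
  have "\<exists>I\<in>C. (%n. N (X n - I)) \<longlonglongrightarrow> 0"
  proof (rule banach_onD(2)[OF B XC])
    fix e :: real assume e: "e > 0"
    define e' where "e' = e / (2 * (b - a) + 1)"
    have e': "e' > 0" "2 * (e' * (b - a)) < e" using e ab by (auto simp: e'_def field_simps)
    obtain M where M: "!!m L. m >= M ==> bfun 1 L ==> cmod (L (X m) - integral {a..b} (%t. L (f t))) <= e' * (b - a)"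
      using osc[OF e'(1)] by blast
    have "N (X m - X n) < e" if "m >= M" "n >= M" for m n
    proof -
      have "N (X m - X n) <= 2 * (e' * (b - a))"
      proof (rule N_le_functional[OF mem_diff[OF XC XC]])
        fix L assume L: "bfun 1 L"
        have "L (X m - X n) = (L (X m) - integral {a..b} (%t. L (f t))) - (L (X n) - integral {a..b} (%t. L (f t)))"
          using bfun_diff[OF L XC XC] by simp
        also have "cmod \<dots> <= 2 * (e' * (b - a))"
          using norm_triangle_le_diff[OF add_mono[OF M[OF that(1) L] M[OF that(2) L]]] by simp
        finally show "cmod (L (X m - X n)) <= 2 * (e' * (b - a))" .
      qed
      then show ?thesis using e' by linarith
    qed
    then show "\<exists>M. \<forall>m\<ge>M. \<forall>n\<ge>M. N (X m - X n) < e" by blast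
  qed
  then obtain I where I: "I \<in> C" "(%n. N (X n - I)) \<longlonglongrightarrow> 0" by blast
  have "L I = integral {a..b} (%t. L (f t))" if L: "bfun 1 L" for L
  proof -
    have "(%m. L (X m) - L I) \<longlonglongrightarrow> 0"
      by (rule Lim_null_comparison[OF always_eventually[OF allI] I(2)])
         (use bfunD(2)[OF L mem_diff[OF XC I(1)]] bfun_diff[OF L XC I(1)] in simp)
    then have "(%m. L (X m)) \<longlonglongrightarrow> L I" by (simp add: LIM_zero_iff)
    moreover have "(%m. L (X m)) \<longlonglongrightarrow> integral {a..b} (%t. L (f t))"
      unfolding LX[OF L] by (rule riemann_sum_tendsto[OF Lc[OF L] ab])
    ultimately show ?thesis using LIMSEQ_unique by blast
  qed
  then show ?thesis using I(1) by blast
qed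

end

context ncouple begin

lemma bfun_restrict: assumes "s.bfun 1 L" shows "c0.bfun 1 L" "c1.bfun 1 L"
proof -
  have le: "x \<in> C0 ==> cmod (L x) <= 1 * M0 x" "x \<in> C1 ==> cmod (L x) <= 1 * M1 x" for x
    using s.bfunD(2)[OF assms, of x] S0[of x] SN0[of x] S1[of x] SN1[of x] by auto
  have "clinear_on C0 L" "clinear_on C1 L"
    using s.bfunD(1)[OF assms] S0 S1 unfolding clinear_on_def by blast+
  then show "c0.bfun 1 L" "c1.bfun 1 L" unfolding c0.bfun_def c1.bfun_def using le by blast+
qed

end

section \<open>The lower space lies in the upper space\<close>

context bcouple begin

text \<open>A primitive of \<open>F\<close>, built weakly from the scalar primitives of \<open>L \<circ> F\<close>.\<close>

lemma lower_subset_upper: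
  assumes \<theta>: "0 < \<theta>" "\<theta> < 1" and F: "F \<in> Fs"
  shows "F (of_real \<theta>) \<in> Up \<theta>"
proof -
  define o0 where "o0 = complex_of_real \<theta>"
  have oo: "o0 \<in> ostrip" unfolding o0_def by (rule of_real_ostrip[OF \<theta>])
  then have os: "o0 \<in> strip" using ostrip_subset_strip by blast
  note FS = s.hol_stripD(1)[OF FsD(1)[OF F]]
  define K where "K = bN F"
  have K: "SN (F z) <= K" if "z \<in> strip" for z using Fs_bound[OF F that] by (simp add: K_def)
  have K0: "0 <= K" using order_trans[OF s.N_nonneg[OF FS[OF os]] K[OF os]] .
  \<comment> \<open>The segment from \<open>o0\<close> to \<open>z\<close>, along which
    \<open>F\<close> is integrated; it stays in the strip by convexity.\<close>
  define \<gamma> where "\<gamma> = (%z t. o0 + of_real t * (z - o0))"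
  have \<gamma>: "\<gamma> z t \<in> strip" if "z \<in> strip" "t \<in> {0..1}" for z t
  proof -
    have "\<gamma> z t = (1 - t) *\<^sub>R o0 + t *\<^sub>R z" by (simp add: \<gamma>_def scaleR_conv_of_real algebra_simps)
    then show ?thesis using convexD_alt[OF convex_strip os that(1), of t] that(2) by simp
  qed
  have "\<exists>g. \<forall>z\<in>strip. g z \<in> S \<and> (\<forall>L. s.bfun 1 L \<longrightarrow> L (g z) = integral {0..1} (%t. L ((z - o0) *\<^sub>C F (\<gamma> z t))))"
  proof (rule bchoice, intro ballI)
    fix z assume z: "z \<in> strip"
    have "ncont_on SN {0..1} (%t. (z - o0) *\<^sub>C F (\<gamma> z t))"
      by (rule s.ncont_on_mult[OF s.ncont_on_compose[OF s.hol_stripD(2)[OF FsD(1)[OF F]]]])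
         (use \<gamma>[OF z] FS in \<open>auto simp: \<gamma>_def intro!: continuous_intros\<close>)
    then show "\<exists>y. y \<in> S \<and> (\<forall>L. s.bfun 1 L \<longrightarrow> L y = integral {0..1} (%t. L ((z - o0) *\<^sub>C F (\<gamma> z t))))"
      using s.pettis_integral[OF banach_csum, of 0 1 "%t. (z - o0) *\<^sub>C F (\<gamma> z t)"] s.mem_scale FS \<gamma>[OF z] by auto
  qed
  then obtain g where gS: "!!z. z \<in> strip ==> g z \<in> S"
    and gL: "!!z L. z \<in> strip ==> s.bfun 1 L ==> L (g z) = integral {0..1} (%t. L ((z - o0) *\<^sub>C F (\<gamma> z t)))"
    by blast
  \<comment> \<open>After testing, \<open>g\<close> is an ordinary primitive normalised at
    \<open>o0\<close>. The Lipschitz bound, the derivative and the boundary increments are all read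
    off from this.\<close>
  have prim: "\<exists>p. (\<forall>x\<in>strip. (p has_field_derivative L (F x)) (at x within strip)) \<and> (\<forall>z\<in>strip. L (g z) = p z - p o0)"
    if L: "s.bfun 1 L" for L
  proof -
    note H = s.hol_strip_functional[OF FsD(1)[OF F] L]
    obtain p where p: "!!x. x \<in> strip ==> (p has_field_derivative L (F x)) (at x within strip)"
    proof (rule holomorphic_convex_primitive[OF convex_strip, of "{}" "%z. L (F z)"])
      show "(%z. L (F z)) field_differentiable at x" if "x \<in> interior strip - {}" for x
        using H(2) open_ostrip interior_strip_subset that holomorphic_on_imp_differentiable_at by blast
    qed (use H(1) in auto)
    have "L (g z) = p z - p o0" if z: "z \<in> strip" for z
    proof -
      have I1: "((%t. (z - o0) * L (F (\<gamma> z t))) has_integral p (\<gamma> z 1) - p (\<gamma> z 0)) {0..1}"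
      proof (rule fundamental_theorem_of_calculus)
        fix t :: real assume t: "t \<in> {0..1}"
        have "(\<gamma> z has_vector_derivative (z - o0)) (at t within {0..1})"
          unfolding \<gamma>_def by (auto intro!: derivative_eq_intros)
        moreover have "(p has_field_derivative L (F (\<gamma> z t))) (at (\<gamma> z t) within \<gamma> z ` {0..1})"
          by (rule DERIV_subset[OF p[OF \<gamma>[OF z t]]]) (use \<gamma>[OF z] in auto)
        ultimately have "(p \<circ> \<gamma> z has_vector_derivative (z - o0) * L (F (\<gamma> z t))) (at t within {0..1})"
          by (rule field_vector_diff_chain_within)
        then show "((%t. p (\<gamma> z t)) has_vector_derivative (z - o0) * L (F (\<gamma> z t))) (at t within {0..1})"
          by (simp add: o_def)
      qed simp
      have I2: "integral {0..1} (%t. L ((z - o0) *\<^sub>C F (\<gamma> z t))) = integral {0..1} (%t. (z - o0) * L (F (\<gamma> z t)))"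
        by (rule integral_cong) (use s.bfun_scale[OF L FS[OF \<gamma>[OF z]]] in auto)
      show ?thesis unfolding gL[OF z L] I2 integral_unique[OF I1] by (simp add: \<gamma>_def)
    qed
    then show ?thesis using p by blast
  qed
  have lip: "SN (g w - g z) <= K * cmod (w - z)" if zw: "z \<in> strip" "w \<in> strip" for z w
  proof (rule s.N_le_functional[OF s.mem_diff[OF gS gS]])
    fix L assume L: "s.bfun 1 L"
    obtain p where p: "!!x. x \<in> strip ==> (p has_field_derivative L (F x)) (at x within strip)"
      "!!z. z \<in> strip ==> L (g z) = p z - p o0" using prim[OF L] by blast
    have LK: "cmod (L (F x)) <= K" if "x \<in> strip" for x
      using s.bfunD(2)[OF L FS[OF that]] K[OF that] by simp
    have "cmod (p w - p z) <= K * cmod (w - z)"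
      by (rule field_differentiable_bound[OF convex_strip p(1) LK zw(2,1)])
    then show "cmod (L (g w - g z)) <= K * cmod (w - z)"
      using s.bfun_diff[OF L gS[OF zw(2)] gS[OF zw(1)]] p(2)[OF zw(1)] p(2)[OF zw(2)] by simp
  qed (use zw in auto)
  have der: "has_nderiv SN g z (F z)" if z: "z \<in> ostrip" for z
    unfolding has_nderiv_def
  proof (rule tendstoI)
    fix e :: real assume e: "e > 0"
    have zs: "z \<in> strip" using z ostrip_subset_strip by blast
    obtain r where r: "r > 0" "ball z r \<subseteq> ostrip" using open_ostrip z open_contains_ball by blast
    have "((%w. SN (F w - F z)) \<longlongrightarrow> 0) (at z within strip)"
      using s.hol_stripD(2)[OF FsD(1)[OF F]] zs unfolding ncont_on_def by blast
    then have "eventually (%w. SN (F w - F z) < e/2) (at z within strip)"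
      using order_tendstoD(2) e by (metis half_gt_zero)
    then obtain d where d: "d > 0" "!!w. w \<in> strip ==> w \<noteq> z ==> dist w z < d ==> SN (F w - F z) < e/2"
      unfolding eventually_at by blast
    define \<delta> where "\<delta> = min r d"
    have \<delta>: "\<delta> > 0" using r d by (simp add: \<delta>_def)
    have bs: "w \<in> strip" if "w \<in> ball z \<delta>" for w using that r(2) ostrip_subset_strip by (auto simp: \<delta>_def)
    have bF: "SN (F w - F z) <= e/2" if "w \<in> ball z \<delta>" for w
      using d(2)[OF bs[OF that]] that e by (cases "w = z") (auto simp: \<delta>_def s.N_0 dist_commute less_imp_le)
    have q: "SN (g (z + h) - g z - h *\<^sub>C F z) <= e/2 * cmod h" if h: "cmod h < \<delta>" for h
    proof -
      have zh: "z + h \<in> ball z \<delta>" using h by (simp add: dist_norm)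
      have zb: "z \<in> ball z \<delta>" using \<delta> by simp
      have m: "g (z + h) - g z \<in> S" "h *\<^sub>C F z \<in> S" "g (z + h) \<in> S" "g z \<in> S"
        by (intro s.mem_diff s.mem_scale gS FS bs[OF zh] zs)+
      show ?thesis
      proof (rule s.N_le_functional[OF s.mem_diff[OF m(1,2)]])
        fix L assume L: "s.bfun 1 L"
        obtain p where p: "!!x. x \<in> strip ==> (p has_field_derivative L (F x)) (at x within strip)"
          "!!z. z \<in> strip ==> L (g z) = p z - p o0" using prim[OF L] by blast
        \<comment> \<open>Subtracting the linear part leaves a function whose derivative is at most
          \<open>e / 2\<close> near \<open>z\<close>.\<close>
        have "cmod ((p (z + h) - (z + h) * L (F z)) - (p z - z * L (F z))) <= e/2 * cmod (z + h - z)"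
        proof (rule field_differentiable_bound[OF convex_ball _ _ zh zb])
          fix w assume w: "w \<in> ball z \<delta>"
          have "(p has_field_derivative L (F w)) (at w within ball z \<delta>)"
            by (rule DERIV_subset[OF p(1)[OF bs[OF w]]]) (use bs in auto)
          then show "((%w. p w - w * L (F z)) has_field_derivative L (F w) - L (F z)) (at w within ball z \<delta>)"
            by (auto intro!: derivative_eq_intros)
          show "cmod (L (F w) - L (F z)) <= e/2"
            using s.bfunD(2)[OF L s.mem_diff[OF FS[OF bs[OF w]] FS[OF zs]]] s.bfun_diff[OF L FS[OF bs[OF w]] FS[OF zs]] bF[OF w] by simp
        qed
        moreover have "L (g (z + h) - g z - h *\<^sub>C F z) = (p (z + h) - (z + h) * L (F z)) - (p z - z * L (F z))"
          using s.bfun_diff[OF L m(1,2)] s.bfun_diff[OF L m(3,4)] s.bfun_scale[OF L FS[OF zs]] p(2)[OF zs] p(2)[OF bs[OF zh]]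
          by (simp add: algebra_simps)
        ultimately show "cmod (L (g (z + h) - g z - h *\<^sub>C F z)) <= e/2 * cmod h" by simp
      qed
    qed
    have "dist (SN (g (z + h) - g z - h *\<^sub>C F z) / cmod h) 0 < e" if h: "h \<noteq> 0" "dist h 0 < \<delta>" for h
    proof -
      have hd: "cmod h < \<delta>" using h by simp
      have zh: "z + h \<in> strip" using bs[of "z + h"] hd by (simp add: dist_norm)
      have "g (z + h) - g z - h *\<^sub>C F z \<in> S" by (intro s.mem_diff s.mem_scale gS FS zh zs)
      then have a: "0 <= SN (g (z + h) - g z - h *\<^sub>C F z) / cmod h" by (intro divide_nonneg_nonneg s.N_nonneg) auto
      have b: "SN (g (z + h) - g z - h *\<^sub>C F z) / cmod h <= e/2"
        using q[OF hd] h by (simp add: divide_le_eq)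
      show ?thesis unfolding dist_real_def using a b e by linarith
    qed
    then show "eventually (%h. dist (SN (g (z + h) - g z - h *\<^sub>C F z) / cmod h) 0 < e) (at 0)"
      unfolding eventually_at using \<delta> by blast
  qed
  have hol: "s.hol_strip g"
    unfolding s.hol_strip_def
  proof (intro conjI ballI)
    show "ncont_on SN strip g"
      by (rule s.ncont_on_lipschitz[OF gS]) (use lip in \<open>auto simp: dist_norm\<close>)
    show "\<exists>d\<in>S. has_nderiv SN g z d" if "z \<in> ostrip" for z
      using der[OF that] FS that ostrip_subset_strip by blast
  qed (use gS in auto)
  \<comment> \<open>The increments are recomputed as integrals in the finer norms of
    \<open>C0\<close> and \<open>C1\<close>. Functionals on the sum separate points, so both
    computations agree, which gives membership together with the right bound.\<close>
  have incr: "g (bnd 0 t) - g (bnd 0 t') \<in> C0 \<and> g (bnd 1 t) - g (bnd 1 t') \<in> C1 \<and>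
      M0 (g (bnd 0 t) - g (bnd 0 t')) <= K * (t - t') \<and> M1 (g (bnd 1 t) - g (bnd 1 t')) <= K * (t - t')"
    if tt: "t' <= t" for t t'
  proof -
    have LI: "integral {t'..t} (%r. L (\<i> *\<^sub>C F (bnd j r))) = L (g (bnd j t) - g (bnd j t'))"
      if L: "s.bfun 1 L" and j: "!!r. bnd j r \<in> strip" for L j
    proof -
      obtain p where p: "!!x. x \<in> strip ==> (p has_field_derivative L (F x)) (at x within strip)"
        "!!z. z \<in> strip ==> L (g z) = p z - p o0" using prim[OF L] by blast
      have I1: "((%r. \<i> * L (F (bnd j r))) has_integral p (bnd j t) - p (bnd j t')) {t'..t}"
      proof (rule fundamental_theorem_of_calculus[OF tt])
        fix r :: real assume r: "r \<in> {t'..t}"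
        have "(bnd j has_vector_derivative \<i>) (at r within {t'..t})"
          unfolding bnd_def by (auto intro!: derivative_eq_intros)
        moreover have "(p has_field_derivative L (F (bnd j r))) (at (bnd j r) within bnd j ` {t'..t})"
          by (rule DERIV_subset[OF p(1)[OF j]]) (use j in auto)
        ultimately have "(p \<circ> bnd j has_vector_derivative \<i> * L (F (bnd j r))) (at r within {t'..t})"
          by (rule field_vector_diff_chain_within)
        then show "((%r. p (bnd j r)) has_vector_derivative \<i> * L (F (bnd j r))) (at r within {t'..t})"
          by (simp add: o_def)
      qed
      have I2: "(%r. L (\<i> *\<^sub>C F (bnd j r))) = (%r. \<i> * L (F (bnd j r)))"
        using s.bfun_scale[OF L FS[OF j]] by auto
      show ?thesis
        unfolding I2 integral_unique[OF I1] using s.bfun_diff[OF L gS[OF j] gS[OF j]] p(2)[OF j] by simp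
    qed
    have bound: "N J <= K * (t - t')" if N: "cnorm C N" and J: "J \<in> C" "!!L. cnorm.bfun C N 1 L ==> L J = integral {t'..t} (%r. L (f r))"
      and f: "ncont_on N {t'..t} f" "!!r. f r \<in> C" "!!r. N (f r) <= K" for C :: "'a set" and N J and f :: "real => 'a"
    proof (rule cnorm.N_le_functional[OF N J(1)])
      fix L assume L: "cnorm.bfun C N 1 L"
      have LK: "cmod (L (f r)) <= K" for r
        using cnorm.bfunD(2)[OF N L f(2), of r] f(3)[of r] by simp
      have "cmod (integral {t'..t} (%r. L (f r))) <= K * (t - t')"
        by (rule integral_bound[OF tt cnorm.functional_continuous[OF N f(1,2) L] LK])
      then show "cmod (L J) <= K * (t - t')" using J(2)[OF L] by simp
    qed
    have nc0: "ncont_on M0 {t'..t} (%r. \<i> *\<^sub>C F (bnd 0 r))"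
      by (rule c0.ncont_on_mult[OF c0.ncont_on_compose[OF FsD(5)[OF F], of _ "%r. r"]]) (use FsD(3)[OF F] in auto)
    have nc1: "ncont_on M1 {t'..t} (%r. \<i> *\<^sub>C F (bnd 1 r))"
      by (rule c1.ncont_on_mult[OF c1.ncont_on_compose[OF FsD(6)[OF F], of _ "%r. r"]]) (use FsD(4)[OF F] in auto)
    have f0: "\<i> *\<^sub>C F (bnd 0 r) \<in> C0" "M0 (\<i> *\<^sub>C F (bnd 0 r)) <= K" for r
      using c0.mem_scale[OF FsD(3)[OF F]] c0.N_scale[OF FsD(3)[OF F]] bN_upper(1)[OF Fs_bV[OF F]] by (auto simp: K_def)
    have f1: "\<i> *\<^sub>C F (bnd 1 r) \<in> C1" "M1 (\<i> *\<^sub>C F (bnd 1 r)) <= K" for r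
      using c1.mem_scale[OF FsD(4)[OF F]] c1.N_scale[OF FsD(4)[OF F]] bN_upper(2)[OF Fs_bV[OF F]] by (auto simp: K_def)
    obtain J0 where J0: "J0 \<in> C0" "!!L. c0.bfun 1 L ==> L J0 = integral {t'..t} (%r. L (\<i> *\<^sub>C F (bnd 0 r)))"
      using c0.pettis_integral[OF banach0 nc0 f0(1) tt] by blast
    obtain J1 where J1: "J1 \<in> C1" "!!L. c1.bfun 1 L ==> L J1 = integral {t'..t} (%r. L (\<i> *\<^sub>C F (bnd 1 r)))"
      using c1.pettis_integral[OF banach1 nc1 f1(1) tt] by blast
    have e0: "J0 = g (bnd 0 t) - g (bnd 0 t')"
      by (rule s.functional_eqI[OF S0[OF J0(1)] s.mem_diff[OF gS gS]])
         (simp_all add: J0(2)[OF bfun_restrict(1)] LI)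
    have e1: "J1 = g (bnd 1 t) - g (bnd 1 t')"
      by (rule s.functional_eqI[OF S1[OF J1(1)] s.mem_diff[OF gS gS]])
         (use J1(2)[OF bfun_restrict(2)] LI[of _ 1] in auto)
    show ?thesis
      using J0(1) J1(1) bound[OF couple0 J0 nc0 f0] bound[OF couple1 J1 nc1 f1] unfolding e0 e1 by blast
  qed
  have "lip_on_boundary g K"
    unfolding lip_on_boundary_def
  proof (intro allI)
    fix t t'
    show "g (bnd 0 t) - g (bnd 0 t') \<in> C0 \<and> g (bnd 1 t) - g (bnd 1 t') \<in> C1 \<and>
      M0 (g (bnd 0 t) - g (bnd 0 t')) <= K * \<bar>t - t'\<bar> \<and> M1 (g (bnd 1 t) - g (bnd 1 t')) <= K * \<bar>t - t'\<bar>"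
    proof (cases "t' <= t")
      case True
      then show ?thesis using incr[OF True] by simp
    next
      case False
      then have le: "t <= t'" by simp
      have m: "g (bnd 0 t') - g (bnd 0 t) \<in> C0" "g (bnd 1 t') - g (bnd 1 t) \<in> C1" using incr[OF le] by auto
      show ?thesis
        using incr[OF le] c0.mem_neg[OF m(1)] c1.mem_neg[OF m(2)] c0.N_neg[OF m(1)] c1.N_neg[OF m(2)] le by simp
    qed
  qed
  moreover have "SN (g z) <= K * (1 + cmod z)" if z: "z \<in> strip" for z
  proof -
    have "g o0 = 0"
      by (rule s.functional_eqI[OF gS[OF os] s.mem_0]) (use prim os clinear_on_0[OF s.sub s.bfunD(1)] in fastforce)
    then have "SN (g z) <= K * cmod (z - o0)" using lip[OF os z] by simp
    also have "\<dots> <= K * (1 + cmod z)"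
      using \<theta> K0 norm_triangle_ineq4[of z o0] by (intro mult_left_mono) (auto simp: o0_def)
    finally show ?thesis .
  qed
  ultimately have gG: "g \<in> G" using GI[OF hol] by blast
  have "Gd g (of_real \<theta>) = F (of_real \<theta>)"
    using Gd(3)[OF gG oo FS[OF os] der[OF oo]] by (simp add: o0_def)
  then show ?thesis using upperI[OF gG, of \<theta>] by simp
qed

end

subsection \<open>Pairings with kernels; the bidual embedding\<close>

context predual begin

lemma cnorm_nn: "cnorm W nn"
proof
  show "csubspace W" by (rule w0.sub)
  show "is_norm_on W nn"
    unfolding is_norm_on_def
  proof (intro conjI ballI allI)
    fix x assume x: "x \<in> W"
    show "0 <= nn x" by (rule nn_nonneg[OF x])
    show "(nn x = 0) = (x = 0)"
      using w0.N_nonneg[OF x] w1.N_nonneg[OF x] w0.N_eq_0[OF x] w0.N_0 w1.N_0 by (auto simp: nn_def max_def split: if_splits)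
    show "nn (c *\<^sub>C x) = cmod c * nn x" for c
      unfolding nn_def w0.N_scale[OF x] w1.N_scale[OF x] by (simp add: max_mult_distrib_left)
    fix y assume y: "y \<in> W"
    show "nn (x + y) <= nn x + nn y"
      using w0.N_tri[OF x y] w1.N_tri[OF x y] by (auto simp: nn_def max_def)
  qed
qed

sublocale wn: cnorm W nn by (rule cnorm_nn)

lemma n_le_nn: "n0 \<phi> <= nn \<phi>" "n1 \<phi> <= nn \<phi>" by (auto simp: nn_def)

text \<open>The product rule for the bilinear pairing of the sum \<open>X0 + X1\<close> with
  \<open>W\<close>, which is bounded by \<open>sum_bound\<close>.\<close>

lemma pairing_hol:
  assumes h: "x.s.hol_strip h" and K: "wn.hol_strip K"
  shows "continuous_on strip (%z. h z (K z))" "(%z. h z (K z)) holomorphic_on ostrip"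
proof -
  note hS = x.s.hol_stripD(1)[OF h] and KW = wn.hol_stripD(1)[OF K]
  have lin: "\<xi> (\<phi> - \<psi>) = \<xi> \<phi> - \<xi> \<psi>" "\<xi> (c *\<^sub>C \<phi>) = c * \<xi> \<phi>" if "\<xi> \<in> x.S" "\<phi> \<in> W" "\<psi> \<in> W" for \<xi> \<phi> \<psi> c
    using sum_functional[OF that(1)] clinear_on_diff[OF wn.sub _ that(2,3)] clinear_onD(2)[OF _ that(2)]
    unfolding functional_on_def by auto
  show "continuous_on strip (%z. h z (K z))"
    unfolding continuous_on
  proof
    fix z assume z: "z \<in> strip"
    have ch: "((%w. x.SN (h w - h z)) \<longlongrightarrow> 0) (at z within strip)" and cK: "((%w. nn (K w - K z)) \<longlongrightarrow> 0) (at z within strip)"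
      using x.s.hol_stripD(2)[OF h] wn.hol_stripD(2)[OF K] z unfolding ncont_on_def by auto
    have cN: "((%w. nn (K w)) \<longlongrightarrow> nn (K z)) (at z within strip)"
      using wn.ncont_on_norm[OF wn.hol_stripD(2)[OF K] KW] z unfolding continuous_on by auto
    have "((%w. h w (K w) - h z (K z)) \<longlongrightarrow> 0) (at z within strip)"
    proof (rule Lim_null_comparison)
      show "eventually (%w. norm (h w (K w) - h z (K z)) <= x.SN (h w - h z) * nn (K w) + x.SN (h z) * nn (K w - K z)) (at z within strip)"
        unfolding eventually_at_filter
      proof (intro always_eventually allI impI)
        fix w assume w: "w \<in> strip"
        have "h w (K w) - h z (K z) = (h w - h z) (K w) + h z (K w - K z)"
          using lin(1)[OF hS[OF z] KW[OF w] KW[OF z]] by simp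
        then have "norm (h w (K w) - h z (K z)) <= norm ((h w - h z) (K w)) + norm (h z (K w - K z))"
          by (metis norm_triangle_ineq)
        also have "\<dots> <= x.SN (h w - h z) * nn (K w) + x.SN (h z) * nn (K w - K z)"
          by (intro add_mono sum_bound x.s.mem_diff wn.mem_diff hS KW w z)
        finally show "norm (h w (K w) - h z (K z)) <= x.SN (h w - h z) * nn (K w) + x.SN (h z) * nn (K w - K z)" .
      qed
      have "((%w. x.SN (h w - h z) * nn (K w) + x.SN (h z) * nn (K w - K z)) \<longlongrightarrow> 0 * nn (K z) + x.SN (h z) * 0) (at z within strip)"
        by (intro tendsto_intros ch cN cK)
      then show "((%w. x.SN (h w - h z) * nn (K w) + x.SN (h z) * nn (K w - K z)) \<longlongrightarrow> 0) (at z within strip)" by simp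
    qed
    then show "((%z. h z (K z)) \<longlongrightarrow> h z (K z)) (at z within strip)" by (simp add: LIM_zero_iff)
  qed
  show "(%z. h z (K z)) holomorphic_on ostrip"
    unfolding holomorphic_on_open[OF open_ostrip]
  proof
    fix z assume z: "z \<in> ostrip"
    then have zs: "z \<in> strip" using ostrip_subset_strip by blast
    obtain d where d: "d \<in> x.S" "has_nderiv x.SN h z d" using x.s.hol_stripD(3)[OF h z] by blast
    obtain e where e: "e \<in> W" "has_nderiv nn K z e" using wn.hol_stripD(3)[OF K z] by blast
    have cN: "((%k. nn (K (z + k))) \<longlongrightarrow> nn (K z)) (at 0)" and cK: "((%k. nn (K (z + k) - K z)) \<longlongrightarrow> 0) (at 0)"
    proof -
      have "ncont_on nn ostrip K"
        by (rule wn.ncont_on_compose[OF wn.hol_stripD(2)[OF K], of _ "%z. z"]) (use ostrip_subset_strip KW in auto)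
      have "ncont_on nn ostrip (%w. K w + - K z)"
        by (rule wn.ncont_on_add[OF \<open>ncont_on nn ostrip K\<close> _ wn.ncont_on_const]) (use KW ostrip_subset_strip zs wn.mem_neg in auto)
      then have "continuous_on ostrip (%w. nn (K w + - K z))"
        by (rule wn.ncont_on_norm) (use KW ostrip_subset_strip zs in \<open>auto intro!: wn.mem_diff\<close>)
      then have "isCont (%w. nn (K w - K z)) z" using z open_ostrip by (simp add: continuous_on_eq_continuous_at)
      then show "((%k. nn (K (z + k) - K z)) \<longlongrightarrow> 0) (at 0)" by (simp add: isCont_iff wn.N_0)
      have "continuous_on ostrip (%w. nn (K w))"
        by (rule wn.ncont_on_norm[OF \<open>ncont_on nn ostrip K\<close>]) (use KW ostrip_subset_strip in auto)
      then have "isCont (%w. nn (K w)) z" using z open_ostrip by (simp add: continuous_on_eq_continuous_at)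
      then show "((%k. nn (K (z + k))) \<longlongrightarrow> nn (K z)) (at 0)" by (simp add: isCont_iff)
    qed
    have "((%k. (h (z + k) (K (z + k)) - h z (K z)) / k - (d (K z) + h z e)) \<longlongrightarrow> 0) (at 0)"
    proof (rule Lim_null_comparison)
      let ?R = "%k. (x.SN (h (z + k) - h z - k *\<^sub>C d) / cmod k) * nn (K (z + k)) + x.SN d * nn (K (z + k) - K z)
         + x.SN (h z) * (nn (K (z + k) - K z - k *\<^sub>C e) / cmod k)"
      show "eventually (%k. norm ((h (z + k) (K (z + k)) - h z (K z)) / k - (d (K z) + h z e)) <= ?R k) (at 0)"
        using wn.eventually_ostrip[OF z] eventually_neq_at_within[of 0 0 UNIV]
      proof eventually_elim
        case (elim k)
        then have ks: "z + k \<in> strip" using ostrip_subset_strip by blast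
        have Kd: "K (z + k) - K z \<in> W" "k *\<^sub>C e \<in> W" by (intro wn.mem_diff wn.mem_scale KW ks zs e)+
        \<comment> \<open>Both arguments vary, so the remainder splits into that of
          \<open>h\<close>, a mixed term and that of \<open>K\<close>.\<close>
        have "h (z + k) (K (z + k)) - h z (K z) - k * (d (K z) + h z e)
          = (h (z + k) - h z - k *\<^sub>C d) (K (z + k)) + k * d (K (z + k) - K z) + h z (K (z + k) - K z - k *\<^sub>C e)"
          unfolding lin(1)[OF hS[OF zs] Kd] lin(1)[OF hS[OF zs] KW[OF ks] KW[OF zs]] lin(2)[OF hS[OF zs] e(1) e(1)]
            lin(1)[OF d(1) KW[OF ks] KW[OF zs]] minus_apply scaleC_fun_apply
          by (simp add: algebra_simps)
        then have eq: "norm (h (z + k) (K (z + k)) - h z (K z) - k * (d (K z) + h z e))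
          <= norm ((h (z + k) - h z - k *\<^sub>C d) (K (z + k))) + cmod k * norm (d (K (z + k) - K z)) + norm (h z (K (z + k) - K z - k *\<^sub>C e))"
          by (metis (no_types, lifting) add_right_mono norm_mult norm_triangle_ineq norm_triangle_mono order_refl)
        also have "\<dots> <= x.SN (h (z + k) - h z - k *\<^sub>C d) * nn (K (z + k)) + cmod k * (x.SN d * nn (K (z + k) - K z))
           + x.SN (h z) * nn (K (z + k) - K z - k *\<^sub>C e)"
          by (intro add_mono mult_left_mono sum_bound x.s.mem_diff x.s.mem_scale wn.mem_diff wn.mem_scale hS KW ks zs d e norm_ge_zero)
        also have "\<dots> = cmod k * ?R k" using elim by (simp add: algebra_simps)
        finally have "norm (h (z + k) (K (z + k)) - h z (K z) - k * (d (K z) + h z e)) / cmod k <= ?R k"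
          using elim by (simp add: divide_le_eq mult.commute)
        moreover have "(h (z + k) (K (z + k)) - h z (K z)) / k - (d (K z) + h z e) = (h (z + k) (K (z + k)) - h z (K z) - k * (d (K z) + h z e)) / k"
          using elim by (simp add: diff_divide_distrib)
        ultimately show ?case by (simp only: norm_divide)
      qed
      have "(?R \<longlongrightarrow> 0 * nn (K z) + x.SN d * 0 + x.SN (h z) * 0) (at 0)"
        using d(2) e(2) unfolding has_nderiv_def by (intro tendsto_intros cN cK)
      then show "(?R \<longlongrightarrow> 0) (at 0)" by simp
    qed
    then show "\<exists>f'. ((%z. h z (K z)) has_field_derivative f') (at z)"
      unfolding DERIV_def by (auto simp: LIM_zero_iff)
  qed
qed

text \<open>The normalisation concerns the boundary integrals, each in the norm of its own line. The
  pointwise bound \<open>B\<close> is qualitative and may change from kernel to kernel.\<close>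

definition kern :: "(complex => 'w) => bool" where
  "kern K \<longleftrightarrow> wn.hol_strip K \<and> (\<exists>B. \<forall>z\<in>strip. nn (K z) <= B) \<and>
     (\<forall>T\<ge>0. integral {-T..T} (%s. n0 (K (bnd 0 s))) <= 1 \<and> integral {-T..T} (%s. n1 (K (bnd 1 s))) <= 1)"

lemma kern_continuous:
  assumes "wn.hol_strip K"
  shows "continuous_on UNIV (%s. n0 (K (bnd 0 s)))" "continuous_on UNIV (%s. n1 (K (bnd 1 s)))"
proof -
  note KW = wn.hol_stripD(1)[OF assms]
  have c: "continuous_on UNIV (bnd j)" for j unfolding bnd_def by (intro continuous_intros)
  have 0: "ncont_on n0 strip K" "ncont_on n1 strip K"
    unfolding ncont_on_def
  proof (safe)
    fix z assume z: "z \<in> strip"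
    have t: "((%w. nn (K w - K z)) \<longlongrightarrow> 0) (at z within strip)"
      using wn.hol_stripD(2)[OF assms] z unfolding ncont_on_def by blast
    show "((%w. n0 (K w - K z)) \<longlongrightarrow> 0) (at z within strip)"
      by (rule Lim_null_comparison[OF _ t], unfold eventually_at_filter, intro always_eventually allI impI)
         (use w0.N_nonneg[OF wn.mem_diff[OF KW KW[OF z]]] n_le_nn in simp)
    show "((%w. n1 (K w - K z)) \<longlongrightarrow> 0) (at z within strip)"
      by (rule Lim_null_comparison[OF _ t], unfold eventually_at_filter, intro always_eventually allI impI)
         (use w1.N_nonneg[OF wn.mem_diff[OF KW KW[OF z]]] n_le_nn in simp)
  qed
  show "continuous_on UNIV (%s. n0 (K (bnd 0 s)))"
    by (rule w0.ncont_on_norm[OF w0.ncont_on_compose[OF 0(1) c]]) (use KW in auto)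
  show "continuous_on UNIV (%s. n1 (K (bnd 1 s)))"
    by (rule w1.ncont_on_norm[OF w1.ncont_on_compose[OF 0(2) c]]) (use KW bnd_strip in auto)
qed

lemma pairing_bounded:
  assumes h: "x.s.hol_strip h" "!!z. z \<in> strip ==> x.SN (h z) <= B" and K: "kern K"
  shows "\<exists>B'. \<forall>z\<in>strip. cmod (h z (K z)) <= B'"
proof -
  obtain C where C: "!!z. z \<in> strip ==> nn (K z) <= C" using K unfolding kern_def by blast
  have KW: "z \<in> strip ==> K z \<in> W" for z using K wn.hol_stripD(1) unfolding kern_def by blast
  note hS = x.s.hol_stripD(1)[OF h(1)]
  have "cmod (h z (K z)) <= B * C" if z: "z \<in> strip" for z
  proof -
    have "cmod (h z (K z)) <= x.SN (h z) * nn (K z)" by (rule sum_bound[OF hS[OF z] KW[OF z]])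
    also have "\<dots> <= B * C"
      by (rule mult_mono[OF h(2)[OF z] C[OF z] order_trans[OF x.s.N_nonneg[OF hS[OF z]] h(2)[OF z]] nn_nonneg[OF KW[OF z]]])
    finally show ?thesis .
  qed
  then show ?thesis by blast
qed

text \<open>Boundary sup norms of \<open>h\<close> are played against boundary integrals of
  \<open>K\<close>. The resulting constant is common to all kernels, as a normal family argument
  with varying kernels requires.\<close>

lemma pairing_estimate:
  assumes h: "x.s.hol_strip h" "!!z. z \<in> strip ==> x.SN (h z) <= B" and K: "kern K"
    and h0: "!!t. h (bnd 0 t) \<in> X0" "!!t. m0 (h (bnd 0 t)) <= M"
    and h1: "!!t. h (bnd 1 t) \<in> X1" "!!t. m1 (h (bnd 1 t)) <= M" and z0: "z0 \<in> ostrip"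
  shows "cmod (h z0 (K z0)) <= M * (1 / Re z0 + 1 / (1 - Re z0))"
proof -
  have Kh: "wn.hol_strip K" using K unfolding kern_def by blast
  note KW = wn.hol_stripD(1)[OF Kh]
  obtain B' where B': "!!z. z \<in> strip ==> cmod (h z (K z)) <= B'" using pairing_bounded[OF h K] by blast
  have M0: "0 <= M" using order_trans[OF w0.dnorm_nonneg[OF h0(1)] h0(2)] .
  show ?thesis
  proof (rule strip_L1_bound[OF pairing_hol[OF h(1) Kh] B' z0])
    show "continuous_on UNIV (%s. M * n0 (K (bnd 0 s)))" "continuous_on UNIV (%s. M * n1 (K (bnd 1 s)))"
      by (intro continuous_intros kern_continuous[OF Kh])+
    fix s
    show "cmod (h (bnd 0 s) (K (bnd 0 s))) <= M * n0 (K (bnd 0 s))"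
      by (rule order_trans[OF w0.dnorm_bound[OF h0(1) KW[OF bnd_strip(1)]] mult_right_mono[OF h0(2) w0.N_nonneg[OF KW[OF bnd_strip(1)]]]])
    show "cmod (h (bnd 1 s) (K (bnd 1 s))) <= M * n1 (K (bnd 1 s))"
      by (rule order_trans[OF w1.dnorm_bound[OF h1(1) KW[OF bnd_strip(2)]] mult_right_mono[OF h1(2) w1.N_nonneg[OF KW[OF bnd_strip(2)]]]])
  next
    fix T :: real assume T: "T >= 0"
    have "integral {-T..T} (%s. n0 (K (bnd 0 s))) <= 1" "integral {-T..T} (%s. n1 (K (bnd 1 s))) <= 1"
      using K T unfolding kern_def by blast+
    then show "integral {-T..T} (%s. M * n0 (K (bnd 0 s))) <= M" "integral {-T..T} (%s. M * n1 (K (bnd 1 s))) <= M"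
      using mult_left_mono[OF _ M0] by fastforce+
  qed auto
qed

end

section \<open>Difference quotients in the imaginary direction\<close>

context ncouple begin

text \<open>The steps are purely imaginary, so boundary points move along their own line and the
  quotients are bounded there in the norms of \<open>C0\<close> and \<open>C1\<close>.\<close>

definition dq :: "nat => (complex => 'a) => complex => 'a" where
  "dq n g z = (of_real (Suc n) / \<i>) *\<^sub>C (g (z + \<i> * of_real (1 / Suc n)) - g z)"

lemma dq_props:
  assumes g: "g \<in> G"
  shows "s.hol_strip (dq n g)" "z \<in> strip ==> SN (dq n g z) <= GN g"
    "dq n g (bnd 0 t) \<in> C0" "M0 (dq n g (bnd 0 t)) <= GN g" "dq n g (bnd 1 t) \<in> C1" "M1 (dq n g (bnd 1 t)) <= GN g"
proof -
  have nm: "cmod (of_real (Suc n) / \<i>) = real (Suc n)" by (simp only: norm_divide norm_ii norm_of_real) simp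
  have one: "real (Suc n) * (x * \<bar>1 / real (Suc n)\<bar>) = x" for x by simp
  note gs = G_shift(1)[OF g, of "1 / Suc n"]
  show "s.hol_strip (dq n g)"
    unfolding dq_def by (intro s.hol_strip_scale s.hol_strip_diff G_hol[OF gs] G_hol[OF g])
  have sh: "bnd 0 t + \<i> * of_real s = bnd 0 (t + s)" "bnd 1 t + \<i> * of_real s = bnd 1 (t + s)" for t s
    by (auto simp: bnd_def algebra_simps)
  show "SN (dq n g z) <= GN g" if z: "z \<in> strip"
  proof -
    have m: "g (z + \<i> * of_real (1 / Suc n)) - g z \<in> S" by (intro s.mem_diff G_mem[OF gs z] G_mem[OF g z])
    have "SN (dq n g z) <= real (Suc n) * (GN g * \<bar>1 / real (Suc n)\<bar>)"
      unfolding dq_def s.N_scale[OF m] nm by (intro mult_left_mono G_diff_imag[OF g z]) simp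
    then show ?thesis unfolding one .
  qed
  have b: "g (bnd 0 (t + 1 / Suc n)) - g (bnd 0 t) \<in> C0" "g (bnd 1 (t + 1 / Suc n)) - g (bnd 1 t) \<in> C1"
    "M0 (g (bnd 0 (t + 1 / Suc n)) - g (bnd 0 t)) <= GN g * \<bar>t + 1 / Suc n - t\<bar>"
    "M1 (g (bnd 1 (t + 1 / Suc n)) - g (bnd 1 t)) <= GN g * \<bar>t + 1 / Suc n - t\<bar>"
    using Gnorm_lip[OF g] unfolding lip_on_boundary_def by blast+
  have b': "M0 (g (bnd 0 (t + 1 / Suc n)) - g (bnd 0 t)) <= GN g * \<bar>1 / Suc n\<bar>"
    "M1 (g (bnd 1 (t + 1 / Suc n)) - g (bnd 1 t)) <= GN g * \<bar>1 / Suc n\<bar>"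
    using b(3,4) by simp_all
  show "dq n g (bnd 0 t) \<in> C0" "dq n g (bnd 1 t) \<in> C1"
    unfolding dq_def sh by (intro c0.mem_scale c1.mem_scale b)+
  have "M0 (dq n g (bnd 0 t)) <= real (Suc n) * (GN g * \<bar>1 / real (Suc n)\<bar>)"
    unfolding dq_def sh c0.N_scale[OF b(1)] nm by (intro mult_left_mono b') simp
  then show "M0 (dq n g (bnd 0 t)) <= GN g" unfolding one .
  have "M1 (dq n g (bnd 1 t)) <= real (Suc n) * (GN g * \<bar>1 / real (Suc n)\<bar>)"
    unfolding dq_def sh c1.N_scale[OF b(2)] nm by (intro mult_left_mono b') simp
  then show "M1 (dq n g (bnd 1 t)) <= GN g" unfolding one .
qed

lemma dq_tendsto:
  assumes g: "g \<in> G" and z: "z \<in> ostrip"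
  shows "(%n. SN (dq n g z - Gd g z)) \<longlonglongrightarrow> 0"
proof -
  have zs: "z \<in> strip" using z ostrip_subset_strip by blast
  have "((%n. \<i> * of_real (1 / Suc n)) \<longlongrightarrow> \<i> * of_real 0) sequentially"
    by (intro tendsto_intros LIMSEQ_Suc lim_1_over_n)
  then have f: "filterlim (%n. \<i> * of_real (1 / Suc n)) (at 0) sequentially"
    unfolding filterlim_at by (auto intro!: always_eventually simp del: of_nat_Suc)
  have "(%n. SN (g (z + \<i> * of_real (1 / Suc n)) - g z - (\<i> * of_real (1 / Suc n)) *\<^sub>C Gd g z) / cmod (\<i> * of_real (1 / Suc n))) \<longlonglongrightarrow> 0"
    using filterlim_compose[OF Gd(2)[OF g z, unfolded has_nderiv_def] f] .
  moreover have "SN (g (z + \<i> * of_real (1 / Suc n)) - g z - (\<i> * of_real (1 / Suc n)) *\<^sub>C Gd g z) / cmod (\<i> * of_real (1 / Suc n))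
     = SN (dq n g z - Gd g z)" for n
  proof -
    define r where "r = real (Suc n)"
    have r: "r > 0" by (simp add: r_def)
    define Y where "Y = g (z + \<i> * of_real (1 / r)) - g z - (\<i> * of_real (1 / r)) *\<^sub>C Gd g z"
    have zs': "z + \<i> * of_real (1 / r) \<in> strip" using zs by (auto simp: strip_def)
    have Y: "Y \<in> S" unfolding Y_def by (intro s.mem_diff s.mem_scale G_mem[OF g] zs zs' Gd(1)[OF g z])
    have "dq n g z - Gd g z = (of_real r / \<i>) *\<^sub>C Y"
      unfolding dq_def Y_def r_def[symmetric] using r by (simp add: cvec.scale_right_diff_distrib scaleC_scaleC scaleC_one)
    then have "SN (dq n g z - Gd g z) = cmod (of_real r / \<i>) * SN Y" by (simp only: s.N_scale[OF Y])
    also have "\<dots> = SN Y / cmod (\<i> * of_real (1 / r))" using r by (simp add: norm_divide norm_mult)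
    finally show ?thesis unfolding Y_def r_def by simp
  qed
  ultimately show ?thesis by simp
qed

end

context predual begin

text \<open>A vertical shift produces a representative whose derivative at \<open>z0\<close> is
  \<open>\<xi>\<close>. Its difference quotients obey the kernel estimate and converge to
  \<open>\<xi>\<close> in the sum norm, which suffices in the pairing.\<close>

lemma pairing_upper:
  assumes \<beta>: "0 < \<beta>" "\<beta> < 1" and \<xi>: "\<xi> \<in> x.Up \<beta>" and K: "kern K"
  shows "cmod (\<xi> (K (of_real \<beta> + \<i> * of_real t))) <= x.UpN \<beta> \<xi> * (1 / \<beta> + 1 / (1 - \<beta>))"
proof -
  define z0 where "z0 = of_real \<beta> + \<i> * of_real t"
  define c where "c = 1 / \<beta> + 1 / (1 - \<beta>)"
  have z0: "z0 \<in> ostrip" "Re z0 = \<beta>" using \<beta> by (auto simp: z0_def ostrip_def)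
  have z0s: "z0 \<in> strip" using z0(1) ostrip_subset_strip by blast
  have c: "c > 0" using \<beta> by (simp add: c_def add_pos_pos)
  have KW: "K z0 \<in> W" using K wn.hol_stripD(1) z0s unfolding kern_def by blast
  have "cmod (\<xi> (K z0)) <= (x.UpN \<beta> \<xi> + e) * c" if e: "e > 0" for e
  proof -
    obtain g where g: "g \<in> x.G" "x.Gd g (of_real \<beta>) = \<xi>" "x.GN g < x.UpN \<beta> \<xi> + e"
      using x.upper_approx[OF \<xi> e] .
    define h where "h = (%z. g (z + \<i> * of_real (- t)))"
    have "z0 + \<i> * of_real (- t) = of_real \<beta>" by (simp add: z0_def)
    then have h: "h \<in> x.G" "x.GN h <= x.GN g" "x.Gd h z0 = \<xi>"
      using x.G_shift(1,2)[OF g(1), of "-t"] x.G_shift(3)[OF g(1) z0(1), of "-t"] g(2) unfolding h_def by simp_all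
    have le: "cmod (x.dq n h z0 (K z0)) <= x.GN h * c" for n
      using pairing_estimate[OF x.dq_props(1,2)[OF h(1)] K x.dq_props(3-6)[OF h(1)] z0(1)] z0(2) by (simp add: c_def)
    have "(%n. x.dq n h z0 (K z0) - \<xi> (K z0)) \<longlonglongrightarrow> 0"
    proof (rule Lim_null_comparison[OF always_eventually[OF allI]])
      fix n
      have "x.dq n h z0 - \<xi> \<in> x.S"
        using x.s.mem_diff[OF x.s.hol_stripD(1)[OF x.dq_props(1)[OF h(1)] z0s] x.Gd(1)[OF h(1) z0(1)]] h(3) by simp
      from sum_bound[OF this KW]
      show "norm (x.dq n h z0 (K z0) - \<xi> (K z0)) <= x.SN (x.dq n h z0 - \<xi>) * nn (K z0)" by simp
    next
      show "(%n. x.SN (x.dq n h z0 - \<xi>) * nn (K z0)) \<longlonglongrightarrow> 0"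
        using tendsto_mult_right[OF x.dq_tendsto[OF h(1) z0(1)], of "nn (K z0)"] h(3) by simp
    qed
    then have "(%n. x.dq n h z0 (K z0)) \<longlonglongrightarrow> \<xi> (K z0)" by (simp add: LIM_zero_iff)
    from tendsto_norm[OF this] have "cmod (\<xi> (K z0)) <= x.GN h * c"
      by (rule tendsto_upperbound) (use le in auto)
    also have "\<dots> <= (x.UpN \<beta> \<xi> + e) * c" using h(2) g(3) c by (intro mult_right_mono) auto
    finally show ?thesis .
  qed
  then have e: "cmod (\<xi> (K z0)) / c <= x.UpN \<beta> \<xi> + e" if "e > 0" for e using that c by (simp add: pos_divide_le_eq)
  have "cmod (\<xi> (K z0)) / c <= x.UpN \<beta> \<xi>" by (rule field_le_epsilon) (rule e)
  then show ?thesis using c unfolding z0_def c_def by (simp add: pos_divide_le_eq)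
qed

end

section \<open>The couple and its embedding into the bidual couple\<close>

locale interp =
  fixes A0 A1 :: "'v::cvec set" and N0 N1 :: "'v => real"
  assumes couple: "banach_couple A0 N0 A1 N1"
    and dense0: "ndense A0 N0 (A0 \<inter> A1)" and dense1: "ndense A1 N1 (A0 \<inter> A1)"
begin

sublocale a: bcouple A0 N0 A1 N1
proof
  have b: "banach_on A0 N0" "banach_on A1 N1" using couple unfolding banach_couple_def by auto
  then show "csubspace A0" "is_norm_on A0 N0" "csubspace A1" "is_norm_on A1 N1" "banach_on A0 N0" "banach_on A1 N1"
    unfolding banach_on_def by auto
  show "!!x. x \<in> csum A0 A1 ==> sumnorm A0 N0 A1 N1 x = 0 ==> x = 0"
    using couple unfolding banach_couple_def by blast
qed

definition D where "D = A0 \<inter> A1"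
definition W where "W = dual_on D N0 \<inter> dual_on D N1"
definition n0 where "n0 = dnorm D N0"
definition n1 where "n1 = dnorm D N1"

lemma DD: "d \<in> D ==> d \<in> A0" "d \<in> D ==> d \<in> A1" "d \<in> D ==> d \<in> a.S"
  using a.S0 by (auto simp: D_def)

lemma csubspace_D: "csubspace D"
  unfolding D_def using a.c0.sub a.c1.sub by (auto simp: csubspace_def)

sublocale d0: cnorm D N0
  by (rule cnorm.intro[OF csubspace_D]) (use a.c0.nrm in \<open>auto simp: is_norm_on_def D_def\<close>)
sublocale d1: cnorm D N1
  by (rule cnorm.intro[OF csubspace_D]) (use a.c1.nrm in \<open>auto simp: is_norm_on_def D_def\<close>)

sublocale p: predual W n0 n1
proof (rule predual.intro)
  have c: "cnorm (dual_on D N0) n0" "cnorm (dual_on D N1) n1"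
    unfolding n0_def n1_def by (rule d0.cnorm_dual d1.cnorm_dual)+
  have "csubspace W"
    using cnorm.sub[OF c(1)] cnorm.sub[OF c(2)] by (auto simp: W_def csubspace_def)
  moreover have "is_norm_on W n0" "is_norm_on W n1"
    using cnorm.nrm[OF c(1)] cnorm.nrm[OF c(2)] by (auto simp: W_def is_norm_on_def)
  ultimately show "cnorm W n0" "cnorm W n1" by (auto intro: cnorm.intro)
qed

text \<open>Each of the two closures stays inside its own dual, so closing does not enlarge the
  intersection. This identifies the space on which the dual couple of the theorem is
  defined.\<close>

lemma Bsp_Int: "Bsp A0 N0 A1 N1 0 \<inter> Bsp A0 N0 A1 N1 1 = W"
proof -
  have "dnorm D N0 (x - x) = 0" "dnorm D N1 (x - x) = 0" for x
    using cnorm.N_0[OF d0.cnorm_dual] cnorm.N_0[OF d1.cnorm_dual] by auto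
  then show ?thesis unfolding Bsp_def Let_def ncl_def W_def D_def[symmetric] by force
qed

lemma Bdual_eq: "Bdual A0 N0 A1 N1 0 = dual_on W n0" "Bdual A0 N0 A1 N1 1 = dual_on W n1"
  "Bdnorm A0 N0 A1 N1 0 = dnorm W n0" "Bdnorm A0 N0 A1 N1 1 = dnorm W n1"
  unfolding Bdual_def Bdnorm_def Bsp_Int Bnorm_def n0_def n1_def D_def by simp_all

lemma W_bound: assumes "\<phi> \<in> W" "d \<in> D" shows "cmod (\<phi> d) <= n0 \<phi> * N0 d" "cmod (\<phi> d) <= n1 \<phi> * N1 d"
  using d0.dnorm_bound[OF _ assms(2)] d1.dnorm_bound[OF _ assms(2)] assms(1) unfolding W_def n0_def n1_def by auto

lemma W_lin: assumes "\<phi> \<in> W" shows "clinear_on D \<phi>"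
  using assms unfolding W_def dual_on_def by blast

text \<open>If \<open>d\<close> lies in \<open>D\<close>, then both parts of a decomposition
  \<open>d = u + v\<close> lie in \<open>D\<close> as well, so the two bounds on
  \<open>\<phi>\<close> can be applied to the parts.\<close>

lemma W_sum_bound:
  assumes \<phi>: "\<phi> \<in> W" and d: "d \<in> D"
  shows "cmod (\<phi> d) <= p.nn \<phi> * a.SN d"
proof (rule field_le_epsilon)
  fix e :: real assume e: "e > 0"
  have nn: "0 <= p.nn \<phi>" by (rule p.nn_nonneg[OF \<phi>])
  then have e': "e / (p.nn \<phi> + 1) > 0" using e by simp
  obtain u v where uv: "u \<in> A0" "v \<in> A1" "d = u + v" "N0 u + N1 v < a.SN d + e / (p.nn \<phi> + 1)"
    using a.sumnorm_decomp[OF DD(3)[OF d] e'] .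
  have "u = d - v" "v = d - u" using uv(3) by auto
  then have uvD: "u \<in> D" "v \<in> D"
    using uv(1,2) a.c1.mem_diff[OF DD(2)[OF d] uv(2)] a.c0.mem_diff[OF DD(1)[OF d] uv(1)] by (auto simp: D_def)
  have "cmod (\<phi> d) <= cmod (\<phi> u) + cmod (\<phi> v)"
    using clinear_onD(1)[OF W_lin[OF \<phi>] uvD] uv(3) norm_triangle_ineq by simp
  also have "\<dots> <= p.nn \<phi> * N0 u + p.nn \<phi> * N1 v"
    using W_bound(1)[OF \<phi> uvD(1)] W_bound(2)[OF \<phi> uvD(2)]
      mult_right_mono[OF p.n_le_nn(1)[of \<phi>] d0.N_nonneg[OF uvD(1)]] mult_right_mono[OF p.n_le_nn(2)[of \<phi>] d1.N_nonneg[OF uvD(2)]] by linarith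
  also have "\<dots> = p.nn \<phi> * (N0 u + N1 v)" by (simp add: distrib_left)
  also have "\<dots> <= p.nn \<phi> * (a.SN d + e / (p.nn \<phi> + 1))" using uv(4) nn by (intro mult_left_mono) auto
  also have "\<dots> <= p.nn \<phi> * a.SN d + e" using nn e by (intro scale_epsilon) auto
  finally show "cmod (\<phi> d) <= p.nn \<phi> * a.SN d + e" .
qed

lemma dense0': assumes "x \<in> A0" "e > 0" obtains d where "d \<in> D" "N0 (x - d) < e"
  using dense0 assms unfolding ndense_def ncl_def D_def by blast

lemma dense1': assumes "x \<in> A1" "e > 0" obtains d where "d \<in> D" "N1 (x - d) < e"
  using dense1 assms unfolding ndense_def ncl_def D_def by blast

lemma dense_sum:
  assumes x: "x \<in> a.S" and e: "e > 0"
  obtains d where "d \<in> D" "a.SN (x - d) < e"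
proof -
  obtain u v where uv: "u \<in> A0" "v \<in> A1" "x = u + v" using x unfolding csum_def by blast
  have e2: "e/2 > 0" using e by simp
  obtain d where d: "d \<in> D" "N0 (u - d) < e/2" using dense0'[OF uv(1) e2] .
  obtain d' where d': "d' \<in> D" "N1 (v - d') < e/2" using dense1'[OF uv(2) e2] .
  have e: "x - (d + d') = (u - d) + (v - d')" using uv(3) by simp
  have "a.SN (x - (d + d')) < e"
    unfolding e using a.sumnorm_le[OF a.c0.mem_diff[OF uv(1) DD(1)[OF d(1)]] a.c1.mem_diff[OF uv(2) DD(2)[OF d'(1)]]] d d' by simp
  then show thesis using that[of "d + d'"] csubspace_add[OF csubspace_D d(1) d'(1)] by blast
qed

lemma dense_sum_seq:
  assumes x: "x \<in> a.S"
  obtains d where "!!n. d n \<in> D" "(%n. a.SN (x - d n)) \<longlonglongrightarrow> 0"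
proof -
  have "\<exists>d. d \<in> D \<and> a.SN (x - d) < 1 / Suc n" for n
    using dense_sum[OF x, of "1 / Suc n"] by (metis of_nat_0_less_iff zero_less_Suc zero_less_divide_1_iff)
  then obtain d where d: "!!n. d n \<in> D" "!!n. a.SN (x - d n) < 1 / Suc n" by metis
  have "(%n. a.SN (x - d n)) \<longlonglongrightarrow> 0"
    by (rule tendsto_sandwich[OF always_eventually[OF allI] always_eventually[OF allI] tendsto_const LIMSEQ_Suc[OF lim_1_over_n]])
       (use a.s.N_nonneg[OF a.s.mem_diff[OF x DD(3)[OF d(1)]]] d(2) less_imp_le in auto)
  then show thesis using that d(1) by blast
qed

abbreviation R where "R \<equiv> Rmap A0 N0 A1 N1"

text \<open>The quantitative form of the continuous extension hidden in \<open>extval\<close>.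
  Linearity and norm bounds of \<open>R\<close> are derived from it without returning to the
  description by \<open>THE\<close>.\<close>

lemma R_char:
  assumes x: "x \<in> a.S" and \<phi>: "\<phi> \<in> W" and d: "d \<in> D"
  shows "cmod (\<phi> d - R x \<phi>) <= p.nn \<phi> * a.SN (x - d)"
proof -
  have nn: "0 <= p.nn \<phi>" by (rule p.nn_nonneg[OF \<phi>])
  obtain u where u: "!!n. u n \<in> D" "(%n. a.SN (x - u n)) \<longlonglongrightarrow> 0" by (rule dense_sum_seq[OF x]) blast
  have le: "cmod (\<phi> d - \<phi> d') <= p.nn \<phi> * (a.SN (x - d) + a.SN (x - d'))" if dd: "d \<in> D" "d' \<in> D" for d d'
  proof -
    have "cmod (\<phi> d - \<phi> d') = cmod (\<phi> (d - d'))" using clinear_on_diff[OF csubspace_D W_lin[OF \<phi>] dd] by simp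
    also have "\<dots> <= p.nn \<phi> * a.SN (d - d')" by (rule W_sum_bound[OF \<phi> csubspace_diff[OF csubspace_D dd]])
    also have "\<dots> <= p.nn \<phi> * (a.SN (x - d) + a.SN (x - d'))"
      using a.s.N_via[OF DD(3)[OF dd(1)] x DD(3)[OF dd(2)]] a.s.N_comm[OF DD(3)[OF dd(1)] x] nn
      by (intro mult_left_mono) auto
    finally show ?thesis .
  qed
  have "Cauchy (%n. \<phi> (u n))"
    unfolding Cauchy_altdef2
  proof (intro allI impI)
    fix e :: real assume e: "e > 0"
    have "(%n. p.nn \<phi> * a.SN (x - u n)) \<longlonglongrightarrow> 0" using tendsto_mult_left[OF u(2), of "p.nn \<phi>"] by simp
    then have "eventually (%n. p.nn \<phi> * a.SN (x - u n) < e/2) sequentially" using order_tendstoD(2) e by (metis half_gt_zero)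
    then obtain M where M: "!!n. n >= M ==> p.nn \<phi> * a.SN (x - u n) < e/2" unfolding eventually_sequentially by blast
    have "dist (\<phi> (u n)) (\<phi> (u M)) < e" if "n >= M" for n
      using le[OF u(1)[of n] u(1)[of M]] M[OF that] M[of M] by (simp add: dist_norm distrib_left)
    then show "\<exists>M. \<forall>n\<ge>M. dist (\<phi> (u n)) (\<phi> (u M)) < e" by blast
  qed
  then obtain c where c: "(%n. \<phi> (u n)) \<longlonglongrightarrow> c" using Cauchy_convergent convergent_def by blast
  have cb: "cmod (\<phi> d - c) <= p.nn \<phi> * a.SN (x - d)" if d: "d \<in> D" for d
  proof (rule tendsto_le[OF trivial_limit_sequentially])
    show "(%n. p.nn \<phi> * (a.SN (x - d) + a.SN (x - u n))) \<longlonglongrightarrow> p.nn \<phi> * a.SN (x - d)"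
      using tendsto_mult_left[OF tendsto_add[OF tendsto_const u(2)], of "p.nn \<phi>" "a.SN (x - d)"] by simp
    show "(%n. cmod (\<phi> d - \<phi> (u n))) \<longlonglongrightarrow> cmod (\<phi> d - c)" by (intro tendsto_intros c)
    show "eventually (%n. cmod (\<phi> d - \<phi> (u n)) <= p.nn \<phi> * (a.SN (x - d) + a.SN (x - u n))) sequentially"
      using le[OF d u(1)] by auto
  qed
  have "extval A0 N0 A1 N1 \<phi> x = c"
    unfolding extval_def D_def[symmetric]
  proof (rule the_equality)
    show "\<forall>e>0. \<exists>\<delta>>0. \<forall>d\<in>D. a.SN (x - d) < \<delta> \<longrightarrow> cmod (\<phi> d - c) < e"
    proof (intro allI impI)
      fix e :: real assume e: "e > 0"
      have "cmod (\<phi> d - c) < e" if "d \<in> D" "a.SN (x - d) < e / (p.nn \<phi> + 1)" for d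
      proof -
        have "cmod (\<phi> d - c) <= p.nn \<phi> * (e / (p.nn \<phi> + 1))"
          using order_trans[OF cb[OF that(1)] mult_left_mono[OF less_imp_le[OF that(2)] nn]] .
        also have "\<dots> < e" using e nn by (simp add: field_simps)
        finally show ?thesis .
      qed
      then show "\<exists>\<delta>>0. \<forall>d\<in>D. a.SN (x - d) < \<delta> \<longrightarrow> cmod (\<phi> d - c) < e"
        using e nn by (intro exI[of _ "e / (p.nn \<phi> + 1)"]) auto
    qed
  next
    fix c' assume c': "\<forall>e>0. \<exists>\<delta>>0. \<forall>d\<in>D. a.SN (x - d) < \<delta> \<longrightarrow> cmod (\<phi> d - c') < e"
    have "(%n. \<phi> (u n)) \<longlonglongrightarrow> c'"
    proof (rule tendstoI)
      fix e :: real assume e: "e > 0"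
      obtain \<delta> where \<delta>: "\<delta> > 0" "!!d. d \<in> D ==> a.SN (x - d) < \<delta> ==> cmod (\<phi> d - c') < e" using c' e by blast
      have "eventually (%n. a.SN (x - u n) < \<delta>) sequentially" using order_tendstoD(2)[OF u(2) \<delta>(1)] .
      then show "eventually (%n. dist (\<phi> (u n)) c' < e) sequentially"
        by (rule eventually_mono) (use \<delta>(2) u(1) in \<open>auto simp: dist_norm\<close>)
    qed
    then show "c' = c" using c LIMSEQ_unique by blast
  qed
  then have "R x \<phi> = c" unfolding Rmap_def Bsp_Int using \<phi> by simp
  then show ?thesis using cb[OF d] by simp
qed

lemma R_supp: "\<phi> \<notin> W ==> R x \<phi> = 0"
  unfolding Rmap_def Bsp_Int by simp

lemma R_lim:
  assumes x: "x \<in> a.S" and \<phi>: "\<phi> \<in> W" and u: "!!n. u n \<in> D" "(%n. a.SN (x - u n)) \<longlonglongrightarrow> 0"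
  shows "(%n. \<phi> (u n)) \<longlonglongrightarrow> R x \<phi>"
proof -
  have "(%n. \<phi> (u n) - R x \<phi>) \<longlonglongrightarrow> 0"
    by (rule Lim_null_comparison[OF always_eventually[OF allI[OF R_char[OF x \<phi> u(1)]]]])
       (use tendsto_mult_left[OF u(2), of "p.nn \<phi>"] in simp)
  then show ?thesis by (simp add: LIM_zero_iff)
qed

lemma R_add: assumes x: "x \<in> a.S" and y: "y \<in> a.S" shows "R (x + y) = R x + R y"
proof
  fix \<phi>
  show "R (x + y) \<phi> = (R x + R y) \<phi>"
  proof (cases "\<phi> \<in> W")
    case \<phi>: True
    obtain u where u: "!!n. u n \<in> D" "(%n. a.SN (x - u n)) \<longlonglongrightarrow> 0" by (rule dense_sum_seq[OF x]) blast
    obtain v where v: "!!n. v n \<in> D" "(%n. a.SN (y - v n)) \<longlonglongrightarrow> 0" by (rule dense_sum_seq[OF y]) blast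
    have uv: "u n + v n \<in> D" for n by (rule csubspace_add[OF csubspace_D u(1) v(1)])
    have "(%n. a.SN (x + y - (u n + v n))) \<longlonglongrightarrow> 0"
    proof (rule Lim_null_comparison[OF always_eventually[OF allI]])
      fix n
      have m: "x - u n \<in> a.S" "y - v n \<in> a.S" by (intro a.s.mem_diff x y DD(3) u v)+
      have e: "x + y - (u n + v n) = (x - u n) + (y - v n)" by simp
      show "norm (a.SN (x + y - (u n + v n))) <= a.SN (x - u n) + a.SN (y - v n)"
        unfolding e using a.s.N_tri[OF m] a.s.N_nonneg[OF a.s.mem_add[OF m]] by simp
    qed (use tendsto_add[OF u(2) v(2)] in simp)
    from R_lim[OF a.s.mem_add[OF x y] \<phi> uv this]
    have "(%n. \<phi> (u n) + \<phi> (v n)) \<longlonglongrightarrow> R (x + y) \<phi>"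
      using clinear_onD(1)[OF W_lin[OF \<phi>] u(1) v(1)] by simp
    then show ?thesis using tendsto_add[OF R_lim[OF x \<phi> u] R_lim[OF y \<phi> v]] LIMSEQ_unique by simp
  qed (simp add: R_supp)
qed

lemma R_scale: assumes x: "x \<in> a.S" shows "R (c *\<^sub>C x) = c *\<^sub>C R x"
proof
  fix \<phi>
  show "R (c *\<^sub>C x) \<phi> = (c *\<^sub>C R x) \<phi>"
  proof (cases "\<phi> \<in> W")
    case \<phi>: True
    obtain u where u: "!!n. u n \<in> D" "(%n. a.SN (x - u n)) \<longlonglongrightarrow> 0" by (rule dense_sum_seq[OF x]) blast
    have cu: "c *\<^sub>C u n \<in> D" for n by (rule csubspace_scale[OF csubspace_D u(1)])
    have "a.SN (c *\<^sub>C x - c *\<^sub>C u n) = cmod c * a.SN (x - u n)" for n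
      unfolding cvec.scale_right_diff_distrib[symmetric] by (rule a.s.N_scale[OF a.s.mem_diff[OF x DD(3)[OF u(1)]]])
    then have "(%n. a.SN (c *\<^sub>C x - c *\<^sub>C u n)) \<longlonglongrightarrow> 0"
      using tendsto_mult_left[OF u(2), of "cmod c"] by simp
    from R_lim[OF a.s.mem_scale[OF x] \<phi> cu this]
    have "(%n. c * \<phi> (u n)) \<longlonglongrightarrow> R (c *\<^sub>C x) \<phi>"
      using clinear_onD(2)[OF W_lin[OF \<phi>] u(1)] by simp
    then show ?thesis using tendsto_mult_left[OF R_lim[OF x \<phi> u], of c] LIMSEQ_unique by (simp add: scaleC_fun_apply)
  qed (simp add: R_supp scaleC_fun_apply)
qed

lemma R_diff: assumes x: "x \<in> a.S" and y: "y \<in> a.S" shows "R (x - y) = R x - R y"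
  using R_add[OF x a.s.mem_neg[OF y]] R_scale[OF y, of "-1"] by simp

lemma R_D: assumes d: "d \<in> D" and \<phi>: "\<phi> \<in> W" shows "R d \<phi> = \<phi> d"
  using R_char[OF DD(3)[OF d] \<phi> d] a.s.N_0 by simp

lemma R_linear_\<phi>: assumes x: "x \<in> a.S" shows "functional_on W (R x)"
  unfolding functional_on_def clinear_on_def
proof (intro conjI allI ballI impI R_supp)
  obtain u where u: "!!n. u n \<in> D" "(%n. a.SN (x - u n)) \<longlonglongrightarrow> 0" by (rule dense_sum_seq[OF x]) blast
  fix \<phi> assume \<phi>: "\<phi> \<in> W"
  note l1 = R_lim[OF x \<phi> u]
  show "R x (c *\<^sub>C \<phi>) = c * R x \<phi>" for c
    using R_lim[OF x p.wn.mem_scale[OF \<phi>] u, of c] tendsto_mult_left[OF l1, of c] LIMSEQ_unique by (simp add: scaleC_fun_apply)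
  fix \<psi> assume \<psi>: "\<psi> \<in> W"
  show "R x (\<phi> + \<psi>) = R x \<phi> + R x \<psi>"
    using R_lim[OF x p.wn.mem_add[OF \<phi> \<psi>] u] tendsto_add[OF l1 R_lim[OF x \<psi> u]] LIMSEQ_unique by simp
qed

text \<open>The approximant is chosen in the norm of \<open>A0\<close>, so its own norm is close to
  \<open>N0 x\<close>; the error in the sum norm is no larger and disappears in the limit.\<close>

lemma R_A0: assumes x: "x \<in> A0" shows "R x \<in> p.X0" "p.m0 (R x) <= N0 x"
proof -
  have "cmod (R x \<phi>) <= N0 x * n0 \<phi>" if \<phi>: "\<phi> \<in> W" for \<phi>
  proof -
    have "cmod (R x \<phi>) <= n0 \<phi> * (N0 x + e) + p.nn \<phi> * e" if e: "e > 0" for e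
    proof -
      obtain d where d: "d \<in> D" "N0 (x - d) < e" using dense0'[OF x e] .
      have "N0 d <= N0 x + e"
        using a.c0.N_le_add[OF DD(1)[OF d(1)] x] a.c0.N_comm[OF DD(1)[OF d(1)] x] d(2) by simp
      then have 1: "cmod (\<phi> d) <= n0 \<phi> * (N0 x + e)"
        using order_trans[OF W_bound(1)[OF \<phi> d(1)] mult_left_mono[OF _ p.w0.N_nonneg[OF \<phi>]]] by blast
      have "a.SN (x - d) <= e" using a.SN0[OF a.c0.mem_diff[OF x DD(1)[OF d(1)]]] d(2) by simp
      then have "cmod (\<phi> d - R x \<phi>) <= p.nn \<phi> * e"
        using order_trans[OF R_char[OF a.S0[OF x] \<phi> d(1)] mult_left_mono[OF _ p.nn_nonneg[OF \<phi>]]] by blast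
      then show ?thesis using 1 norm_triangle_ineq2[of "R x \<phi>" "\<phi> d"] by (simp add: norm_minus_commute)
    qed
    moreover have "((%e. n0 \<phi> * (N0 x + e) + p.nn \<phi> * e) \<longlongrightarrow> n0 \<phi> * (N0 x + 0) + p.nn \<phi> * 0) (at_right 0)"
      by (intro tendsto_intros)
    ultimately have "cmod (R x \<phi>) <= n0 \<phi> * (N0 x + 0) + p.nn \<phi> * 0"
      by (intro tendsto_lowerbound[OF _ _ trivial_limit_at_right_real]) (auto simp: eventually_at_filter)
    then show ?thesis by (simp add: mult.commute)
  qed
  then show "R x \<in> p.X0" "p.m0 (R x) <= N0 x"
    using R_linear_\<phi>[OF a.S0[OF x]] p.w0.dnorm_le[of "R x" "N0 x"] a.c0.N_nonneg[OF x] unfolding dual_on_iff by blast+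
qed

lemma R_A1: assumes x: "x \<in> A1" shows "R x \<in> p.X1" "p.m1 (R x) <= N1 x"
proof -
  have "cmod (R x \<phi>) <= N1 x * n1 \<phi>" if \<phi>: "\<phi> \<in> W" for \<phi>
  proof -
    have "cmod (R x \<phi>) <= n1 \<phi> * (N1 x + e) + p.nn \<phi> * e" if e: "e > 0" for e
    proof -
      obtain d where d: "d \<in> D" "N1 (x - d) < e" using dense1'[OF x e] .
      have "N1 d <= N1 x + e"
        using a.c1.N_le_add[OF DD(2)[OF d(1)] x] a.c1.N_comm[OF DD(2)[OF d(1)] x] d(2) by simp
      then have 1: "cmod (\<phi> d) <= n1 \<phi> * (N1 x + e)"
        using order_trans[OF W_bound(2)[OF \<phi> d(1)] mult_left_mono[OF _ p.w1.N_nonneg[OF \<phi>]]] by blast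
      have "a.SN (x - d) <= e" using a.SN1[OF a.c1.mem_diff[OF x DD(2)[OF d(1)]]] d(2) by simp
      then have "cmod (\<phi> d - R x \<phi>) <= p.nn \<phi> * e"
        using order_trans[OF R_char[OF a.S1[OF x] \<phi> d(1)] mult_left_mono[OF _ p.nn_nonneg[OF \<phi>]]] by blast
      then show ?thesis using 1 norm_triangle_ineq2[of "R x \<phi>" "\<phi> d"] by (simp add: norm_minus_commute)
    qed
    moreover have "((%e. n1 \<phi> * (N1 x + e) + p.nn \<phi> * e) \<longlongrightarrow> n1 \<phi> * (N1 x + 0) + p.nn \<phi> * 0) (at_right 0)"
      by (intro tendsto_intros)
    ultimately have "cmod (R x \<phi>) <= n1 \<phi> * (N1 x + 0) + p.nn \<phi> * 0"
      by (intro tendsto_lowerbound[OF _ _ trivial_limit_at_right_real]) (auto simp: eventually_at_filter)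
    then show ?thesis by (simp add: mult.commute)
  qed
  then show "R x \<in> p.X1" "p.m1 (R x) <= N1 x"
    using R_linear_\<phi>[OF a.S1[OF x]] p.w1.dnorm_le[of "R x" "N1 x"] a.c1.N_nonneg[OF x] unfolding dual_on_iff by blast+
qed

lemma R_sum: assumes x: "x \<in> a.S" shows "R x \<in> p.x.S" "p.x.SN (R x) <= a.SN x"
proof -
  have *: "R x \<in> p.x.S \<and> p.x.SN (R x) <= a.SN x + e" if e: "e > 0" for e
  proof -
    obtain u v where uv: "u \<in> A0" "v \<in> A1" "x = u + v" "N0 u + N1 v < a.SN x + e"
      using a.sumnorm_decomp[OF x e] .
    have "R x = R u + R v" using R_add[OF a.S0[OF uv(1)] a.S1[OF uv(2)]] uv(3) by simp
    then show ?thesis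
      using csumI[OF R_A0(1)[OF uv(1)] R_A1(1)[OF uv(2)]] p.x.sumnorm_le[OF R_A0(1)[OF uv(1)] R_A1(1)[OF uv(2)]]
        R_A0(2)[OF uv(1)] R_A1(2)[OF uv(2)] uv(4) by auto
  qed
  show "R x \<in> p.x.S" using *[of 1] by simp
  show "p.x.SN (R x) <= a.SN x" by (rule field_le_epsilon) (use * in blast)
qed

lemma R_nderiv:
  assumes f: "!!z. z \<in> strip ==> f z \<in> a.S" and z: "z \<in> ostrip" and d: "d \<in> a.S" "has_nderiv a.SN f z d"
  shows "has_nderiv p.x.SN (%z. R (f z)) z (R d)"
  unfolding has_nderiv_def
proof (rule Lim_null_comparison[OF _ d(2)[unfolded has_nderiv_def]])
  have zs: "z \<in> strip" using z ostrip_subset_strip by blast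
  show "eventually (%h. norm (p.x.SN (R (f (z + h)) - R (f z) - h *\<^sub>C R d) / cmod h) <= a.SN (f (z + h) - f z - h *\<^sub>C d) / cmod h) (at 0)"
    using a.s.eventually_ostrip[OF z]
  proof eventually_elim
    case (elim h)
    then have hs: "z + h \<in> strip" using ostrip_subset_strip by blast
    have m: "f (z + h) - f z \<in> a.S" "h *\<^sub>C d \<in> a.S" "f (z + h) - f z - h *\<^sub>C d \<in> a.S"
      by (intro a.s.mem_diff a.s.mem_scale f hs zs d)+
    have e: "R (f (z + h)) - R (f z) - h *\<^sub>C R d = R (f (z + h) - f z - h *\<^sub>C d)"
      using R_diff[OF m(1,2)] R_diff[OF f[OF hs] f[OF zs]] R_scale[OF d(1)] by simp
    show ?case unfolding e using R_sum[OF m(3)] p.x.s.N_nonneg[OF R_sum(1)[OF m(3)]] by (simp add: divide_right_mono)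
  qed
qed

lemma R_hol: assumes f: "a.s.hol_strip f" shows "p.x.s.hol_strip (%z. R (f z))"
  unfolding p.x.s.hol_strip_def
proof (intro conjI ballI)
  note fS = a.s.hol_stripD(1)[OF f]
  show "z \<in> strip ==> R (f z) \<in> p.x.S" for z by (rule R_sum(1)[OF fS])
  show "ncont_on p.x.SN strip (%z. R (f z))"
    unfolding ncont_on_def
  proof
    fix z assume z: "z \<in> strip"
    have t: "((%w. a.SN (f w - f z)) \<longlongrightarrow> 0) (at z within strip)"
      using a.s.hol_stripD(2)[OF f] z unfolding ncont_on_def by blast
    show "((%w. p.x.SN (R (f w) - R (f z))) \<longlongrightarrow> 0) (at z within strip)"
    proof (rule Lim_null_comparison[OF _ t], unfold eventually_at_filter, intro always_eventually allI impI)
      fix w assume w: "w \<in> strip"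
      have m: "f w - f z \<in> a.S" by (intro a.s.mem_diff fS w z)
      show "norm (p.x.SN (R (f w) - R (f z))) <= a.SN (f w - f z)"
        unfolding R_diff[OF fS[OF w] fS[OF z], symmetric] using R_sum[OF m] p.x.s.N_nonneg[OF R_sum(1)[OF m]] by simp
    qed
  qed
  fix z assume z: "z \<in> ostrip"
  obtain d where d: "d \<in> a.S" "has_nderiv a.SN f z d" using a.s.hol_stripD(3)[OF f z] by blast
  then show "\<exists>d\<in>p.x.S. has_nderiv p.x.SN (%z. R (f z)) z d"
    using R_nderiv[OF fS z d] R_sum(1)[OF d(1)] by blast
qed

lemma R_G:
  assumes g: "g \<in> a.G"
  shows "(%z. R (g z)) \<in> p.x.G" "p.x.GN (%z. R (g z)) <= a.GN g"
    "z \<in> ostrip ==> p.x.Gd (%z. R (g z)) z = R (a.Gd g z)"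
proof -
  note gS = a.G_mem[OF g]
  obtain K where K: "!!z. z \<in> strip ==> a.SN (g z) <= K * (1 + cmod z)" using a.G_growth[OF g] by blast
  have gr: "p.x.SN (R (g z)) <= K * (1 + cmod z)" if "z \<in> strip" for z
    using order_trans[OF R_sum(2)[OF gS[OF that]] K[OF that]] .
  have "p.x.lip_on_boundary (%z. R (g z)) (a.GN g)"
    unfolding p.x.lip_on_boundary_def
  proof (intro allI)
    fix t t'
    have b: "g (bnd 0 t) - g (bnd 0 t') \<in> A0" "g (bnd 1 t) - g (bnd 1 t') \<in> A1"
       "N0 (g (bnd 0 t) - g (bnd 0 t')) <= a.GN g * \<bar>t - t'\<bar>" "N1 (g (bnd 1 t) - g (bnd 1 t')) <= a.GN g * \<bar>t - t'\<bar>"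
      using a.Gnorm_lip[OF g] unfolding a.lip_on_boundary_def by blast+
    have e: "R (g (bnd 0 t)) - R (g (bnd 0 t')) = R (g (bnd 0 t) - g (bnd 0 t'))"
      "R (g (bnd 1 t)) - R (g (bnd 1 t')) = R (g (bnd 1 t) - g (bnd 1 t'))"
      by (rule R_diff[symmetric]; rule gS; rule bnd_strip)+
    show "R (g (bnd 0 t)) - R (g (bnd 0 t')) \<in> p.X0 \<and> R (g (bnd 1 t)) - R (g (bnd 1 t')) \<in> p.X1 \<and>
      p.m0 (R (g (bnd 0 t)) - R (g (bnd 0 t'))) <= a.GN g * \<bar>t - t'\<bar> \<and> p.m1 (R (g (bnd 1 t)) - R (g (bnd 1 t'))) <= a.GN g * \<bar>t - t'\<bar>"
      unfolding e using R_A0[OF b(1)] R_A1[OF b(2)] b(3,4) by auto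
  qed
  then show *: "(%z. R (g z)) \<in> p.x.G" "p.x.GN (%z. R (g z)) <= a.GN g"
    using p.x.GI[OF R_hol[OF a.G_hol[OF g]] gr] by blast+
  assume z: "z \<in> ostrip"
  show "p.x.Gd (%z. R (g z)) z = R (a.Gd g z)"
    by (rule p.x.Gd(3)[OF *(1) z R_sum(1)[OF a.Gd(1)[OF g z]] R_nderiv[OF gS z a.Gd(1,2)[OF g z]]])
qed

end

subsection \<open>Gaussian kernels\<close>

text \<open>Some constant that admits a primitive running from \<open>0\<close> to \<open>1\<close>;
  fixing it once makes it common to all widths \<open>b\<close>.\<close>

definition gauss_const :: real where
  "gauss_const = (SOME c. c > 0 \<and> (\<exists>\<Phi>. mono \<Phi> \<and> (\<forall>x. (\<Phi> has_real_derivative c * exp (- x\<^sup>2)) (at x)) \<and>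
     (\<Phi> \<longlongrightarrow> 0) at_bot \<and> (\<Phi> \<longlongrightarrow> 1) at_top))"

definition gauss :: "real => real => real" where
  "gauss b x = gauss_const * sqrt b * exp (- b * x\<^sup>2)"

text \<open>The left endpoints of an equidistant partition of \<open>{-T..T}\<close> into
  \<open>m\<close> intervals.\<close>

definition node :: "real => nat => nat => real" where
  "node T m k = - T + real k * (2 * T / real m)"

lemma gauss_const:
  "gauss_const > 0 \<and> (\<exists>\<Phi>. mono \<Phi> \<and> (\<forall>x. (\<Phi> has_real_derivative gauss_const * exp (- x\<^sup>2)) (at x)) \<and>
     (\<Phi> \<longlongrightarrow> 0) at_bot \<and> (\<Phi> \<longlongrightarrow> 1) at_top)"
  unfolding gauss_const_def by (rule someI_ex, rule gaussian_primitive) blast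

lemma gauss_nonneg: "0 <= b ==> 0 <= gauss b x"
  using gauss_const by (simp add: gauss_def)

text \<open>The derivative is bounded by means of |z| <= 1 + z^2 and u exp(-u) <= 1. A constant
  independent of the position lets one partition serve all translates of the Gaussian.\<close>

lemma gauss_lipschitz:
  assumes b: "b > 0"
  shows "\<bar>gauss b x - gauss b y\<bar> <= gauss_const * sqrt b * (2 * (b + 1)) * \<bar>x - y\<bar>"
proof -
  have "norm (gauss b x - gauss b y) <= gauss_const * sqrt b * (2 * (b + 1)) * norm (x - y)"
  proof (rule field_differentiable_bound[of UNIV])
    fix z :: real
    show "(gauss b has_field_derivative gauss_const * sqrt b * (exp (- b * z\<^sup>2) * (- b * (2 * z)))) (at z within UNIV)"
      unfolding gauss_def by (auto intro!: derivative_eq_intros)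
    have e: "b * z\<^sup>2 * exp (- (b * z\<^sup>2)) <= 1"
    proof -
      have "b * z\<^sup>2 <= exp (b * z\<^sup>2)" using exp_ge_add_one_self[of "b * z\<^sup>2"] by linarith
      then show ?thesis by (simp add: exp_minus field_simps)
    qed
    have "\<bar>z\<bar> <= 1 + z\<^sup>2"
      using zero_le_power2[of "\<bar>z\<bar> - 1"] by (simp add: power2_diff)
    then have "exp (- (b * z\<^sup>2)) * (b * \<bar>z\<bar>) <= exp (- (b * z\<^sup>2)) * (b * (1 + z\<^sup>2))"
      using b by (intro mult_left_mono) auto
    also have "\<dots> = b * exp (- (b * z\<^sup>2)) + b * z\<^sup>2 * exp (- (b * z\<^sup>2))" by (simp add: algebra_simps)
    also have "\<dots> <= b * 1 + 1" using b by (intro add_mono mult_left_mono e) auto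
    finally have "exp (- (b * z\<^sup>2)) * (b * \<bar>z\<bar>) <= b + 1" by simp
    then have "norm (exp (- b * z\<^sup>2) * (- b * (2 * z))) <= 2 * (b + 1)"
      using b by (simp add: abs_mult)
    then have "(gauss_const * sqrt b) * norm (exp (- b * z\<^sup>2) * (- b * (2 * z))) <= (gauss_const * sqrt b) * (2 * (b + 1))"
      using gauss_const b by (intro mult_left_mono) auto
    then show "norm (gauss_const * sqrt b * (exp (- b * z\<^sup>2) * (- b * (2 * z)))) <= gauss_const * sqrt b * (2 * (b + 1))"
      using gauss_const b by (simp add: abs_mult)
  qed auto
  then show ?thesis by simp
qed

text \<open>The sums approximate the mass that a Gaussian centred at \<open>t\<close> puts on
  \<open>{-T..T}\<close>, a difference of two values of the primitive. The threshold for
  \<open>m\<close> does not depend on \<open>t\<close>.\<close>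

lemma gauss_sums:
  obtains \<Phi> :: "real => real" where "!!x. 0 <= \<Phi> x" "!!x. \<Phi> x <= 1" "mono \<Phi>" "(\<Phi> \<longlongrightarrow> 0) at_bot" "(\<Phi> \<longlongrightarrow> 1) at_top"
    "!!b T e. b > 0 ==> T >= 0 ==> e > 0 ==> \<exists>M. \<forall>m\<ge>M. \<forall>t.
       \<bar>(\<Sum>k<m. (2 * T / real m) * gauss b (t - node T m k)) - (\<Phi> (sqrt b * (t + T)) - \<Phi> (sqrt b * (t - T)))\<bar> <= e"
proof -
  obtain \<Phi> where \<Phi>: "mono \<Phi>" "!!x. (\<Phi> has_real_derivative gauss_const * exp (- x\<^sup>2)) (at x)" "(\<Phi> \<longlongrightarrow> 0) at_bot" "(\<Phi> \<longlongrightarrow> 1) at_top"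
    using gauss_const by blast
  show thesis
  proof (rule that[of \<Phi>, OF _ _ \<Phi>(1,3,4)])
    fix x
    show "0 <= \<Phi> x"
      by (rule tendsto_upperbound[OF \<Phi>(3)], rule eventually_mono[OF eventually_le_at_bot[of x]]) (use \<Phi>(1) in \<open>auto simp: mono_def\<close>)
    show "\<Phi> x <= 1"
      by (rule tendsto_lowerbound[OF \<Phi>(4)], rule eventually_mono[OF eventually_ge_at_top[of x]]) (use \<Phi>(1) in \<open>auto simp: mono_def\<close>)
  next
    fix b T e :: real assume b: "b > 0" and T: "T >= 0" and e: "e > 0"
    define L where "L = gauss_const * sqrt b * (2 * (b + 1))"
    have L: "L >= 0" using gauss_const b by (simp add: L_def)
    have "(%m. L * (2 * T / real m) * (2 * T)) \<longlonglongrightarrow> 0" by real_asymp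
    then have "eventually (%m. L * (2 * T / real m) * (2 * T) < e) sequentially" using e order_tendstoD(2) by blast
    then obtain M where M: "!!m. m >= M ==> L * (2 * T / real m) * (2 * T) < e" unfolding eventually_sequentially by blast
    show "\<exists>M. \<forall>m\<ge>M. \<forall>t. \<bar>(\<Sum>k<m. (2 * T / real m) * gauss b (t - node T m k)) - (\<Phi> (sqrt b * (t + T)) - \<Phi> (sqrt b * (t - T)))\<bar> <= e"
    proof (intro exI[of _ "M + 1"] allI impI)
      fix m t assume m: "m >= M + 1"
      have gc: "continuous_on {-T..T} (%s. gauss b (t - s))" unfolding gauss_def by (intro continuous_intros)
      have I: "((%s. gauss b (t - s)) has_integral (- \<Phi> (sqrt b * (t - T)) - - \<Phi> (sqrt b * (t - - T)))) {-T..T}"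
      proof (rule fundamental_theorem_of_calculus)
        fix s
        have "((%s. - \<Phi> (sqrt b * (t - s))) has_real_derivative gauss b (t - s)) (at s within {-T..T})"
          unfolding gauss_def
          by (rule derivative_eq_intros DERIV_chain2[OF \<Phi>(2)] refl | use b in \<open>simp add: power_mult_distrib\<close>)+
        then show "((%s. - \<Phi> (sqrt b * (t - s))) has_vector_derivative gauss b (t - s)) (at s within {-T..T})"
          by (simp add: has_real_derivative_iff_has_vector_derivative)
      qed (use T in simp)
      have "norm ((\<Sum>k<m. ((T - - T) / real m) *\<^sub>R gauss b (t - (- T + real k * ((T - - T) / real m)))) - integral {-T..T} (%s. gauss b (t - s)))
         <= (L * (2 * T / real m)) * (T - - T)"
      proof (rule riemann_sum_bound[OF gc])
        fix x y assume "\<bar>x - y\<bar> <= (T - - T) / real m"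
        then have "\<bar>(t - x) - (t - y)\<bar> <= 2 * T / real m" by simp
        then have "L * \<bar>(t - x) - (t - y)\<bar> <= L * (2 * T / real m)" using L by (rule mult_left_mono)
        then show "norm (gauss b (t - x) - gauss b (t - y)) <= L * (2 * T / real m)"
          using gauss_lipschitz[OF b, of "t - x" "t - y"] unfolding L_def[symmetric] by simp
      qed (use T m in auto)
      then show "\<bar>(\<Sum>k<m. (2 * T / real m) * gauss b (t - node T m k)) - (\<Phi> (sqrt b * (t + T)) - \<Phi> (sqrt b * (t - T)))\<bar> <= e"
        using M[of m] m unfolding integral_unique[OF I] node_def by simp
    qed
  qed
qed

lemma gauss_sum_le:
  assumes "b > 0" "T >= 0" "e > 0"
  shows "\<exists>M. \<forall>m\<ge>M. \<forall>t. (\<Sum>k<m. (2 * T / real m) * gauss b (t - node T m k)) <= 1 + e"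
proof -
  obtain \<Phi> :: "real => real" where \<Phi>: "!!x. 0 <= \<Phi> x" "!!x. \<Phi> x <= 1"
    "!!b T e. b > 0 ==> T >= 0 ==> e > 0 ==> \<exists>M. \<forall>m\<ge>M. \<forall>t.
       \<bar>(\<Sum>k<m. (2 * T / real m) * gauss b (t - node T m k)) - (\<Phi> (sqrt b * (t + T)) - \<Phi> (sqrt b * (t - T)))\<bar> <= e"
    by (rule gauss_sums) blast
  obtain M where M: "!!m t. m >= M ==>
       \<bar>(\<Sum>k<m. (2 * T / real m) * gauss b (t - node T m k)) - (\<Phi> (sqrt b * (t + T)) - \<Phi> (sqrt b * (t - T)))\<bar> <= e"
    using \<Phi>(3)[OF assms] by blast
  have "(\<Sum>k<m. (2 * T / real m) * gauss b (t - node T m k)) <= 1 + e" if "m >= M" for m t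
    using M[OF that, of t] \<Phi>(2)[of "sqrt b * (t + T)"] \<Phi>(1)[of "sqrt b * (t - T)"] by linarith
  then show ?thesis by blast
qed

section \<open>Approximation by Gaussian sums\<close>

context cnorm begin

text \<open>Compactness handles a middle interval, and beyond \<open>r\<close> both values are
  small. The margin \<open>1\<close>, together with steps below \<open>1\<close>, ensures that two
  close points lie both in the interval or both beyond \<open>r\<close>.\<close>

lemma ncont_on_uniform_UNIV:
  fixes f :: "real => 'a"
  assumes f: "ncont_on N UNIV f" "!!t. f t \<in> C" and lim: "((%t. N (f t)) \<longlongrightarrow> 0) at_infinity" and e: "e > 0"
  obtains d where "d > 0" "!!s t. \<bar>s - t\<bar> < d ==> N (f s - f t) <= e"
proof -
  have "eventually (%t. N (f t) < e/2) at_infinity" using order_tendstoD(2)[OF lim, of "e/2"] e by simp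
  then obtain r where r: "!!t. r <= \<bar>t\<bar> ==> N (f t) < e/2" unfolding eventually_at_infinity by auto
  have fr: "ncont_on N {-(r+1)..r+1} f"
    by (rule ncont_on_compose[OF f(1), of _ "%t. t"]) (use f in auto)
  obtain d where d: "d > 0" "!!x y. x \<in> {-(r+1)..r+1} ==> y \<in> {-(r+1)..r+1} ==> dist x y < d ==> N (f x - f y) < e"
    using ncont_on_uniform[OF compact_Icc fr f(2) e] by blast
  show thesis
  proof (rule that[of "min d 1"])
    fix s t :: real assume st: "\<bar>s - t\<bar> < min d 1"
    show "N (f s - f t) <= e"
    proof (cases "s \<in> {-(r+1)..r+1} \<and> t \<in> {-(r+1)..r+1}")
      case True
      then show ?thesis using d(2)[of s t] st by (simp add: dist_real_def)
    next
      case False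
      then have "r <= \<bar>s\<bar>" "r <= \<bar>t\<bar>" using st by auto
      then show ?thesis using N_minus[OF f(2)[of s] f(2)[of t]] r[of s] r[of t] by linarith
    qed
  qed (use d in simp)
qed

text \<open>An approximate identity with sums in place of integrals. The order of choices matters:
  \<open>b\<close> concentrates the Gaussian, then \<open>T\<close> captures nearly all its mass
  wherever \<open>f\<close> is not small, then \<open>m\<close> makes the sums accurate for all
  \<open>t\<close> at once.\<close>

lemma gauss_approx:
  fixes f :: "real => 'a"
  assumes f: "ncont_on N UNIV f" "!!t. f t \<in> C" and lim: "((%t. N (f t)) \<longlongrightarrow> 0) at_infinity" and \<epsilon>: "\<epsilon> > 0"
  shows "\<exists>b0>0. \<forall>b\<ge>b0. \<exists>T0>0. \<forall>T\<ge>T0. \<exists>M. \<forall>m\<ge>M. \<forall>t.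
     N ((\<Sum>k<m. of_real ((2 * T / real m) * gauss b (t - node T m k)) *\<^sub>C f (node T m k)) - f t) <= \<epsilon>"
proof -
  define \<eta> where "\<eta> = \<epsilon> / 4"
  have \<eta>: "\<eta> > 0" using \<epsilon> by (simp add: \<eta>_def)
  obtain B where B: "!!t. N (f t) <= B" using bounded_of_tendsto_0[OF ncont_on_norm[OF f] lim] by blast
  have B0: "0 <= B" using N_nonneg[OF f(2)[of 0]] B[of 0] by linarith
  obtain \<delta> where \<delta>: "\<delta> > 0" "!!s t. \<bar>s - t\<bar> < \<delta> ==> N (f s - f t) <= \<eta>"
    using ncont_on_uniform_UNIV[OF f lim \<eta>] by blast
  have "eventually (%t. N (f t) < \<eta>) at_infinity" using order_tendstoD(2)[OF lim \<eta>] .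
  then obtain r where r: "!!t. r <= \<bar>t\<bar> ==> N (f t) < \<eta>" unfolding eventually_at_infinity by auto
  \<comment> \<open>At distance at least \<open>\<delta>\<close> from the centre, the Gaussian with
    parameter \<open>b\<close> is at most \<open>\<kappa> b\<close> times the one with parameter
    \<open>1\<close>. So the far nodes are dominated by a sum of bounded total weight.\<close>
  define \<kappa> where "\<kappa> = (%b. sqrt b * exp (- (b - 1) * \<delta>\<^sup>2))"
  have "((%b. 4 * B * \<kappa> b) \<longlongrightarrow> 0) at_top" unfolding \<kappa>_def using \<delta>(1) by real_asymp
  then have "eventually (%b. 4 * B * \<kappa> b < \<eta>) at_top" using \<eta> order_tendstoD(2) by blast
  then obtain b1 where b1: "!!b. b >= b1 ==> 4 * B * \<kappa> b < \<eta>" unfolding eventually_at_top_linorder by blast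
  obtain \<Phi> :: "real => real" where \<Phi>: "!!x. 0 <= \<Phi> x" "!!x. \<Phi> x <= 1" "mono \<Phi>" "(\<Phi> \<longlongrightarrow> 0) at_bot" "(\<Phi> \<longlongrightarrow> 1) at_top"
    "!!b T e. b > 0 ==> T >= 0 ==> e > 0 ==> \<exists>M. \<forall>m\<ge>M. \<forall>t.
       \<bar>(\<Sum>k<m. (2 * T / real m) * gauss b (t - node T m k)) - (\<Phi> (sqrt b * (t + T)) - \<Phi> (sqrt b * (t - T)))\<bar> <= e"
    by (rule gauss_sums) blast
  define \<eta>' where "\<eta>' = min 1 (\<eta> / (3 * (B + 1)))"
  have \<eta>': "\<eta>' > 0" "\<eta>' <= 1" using \<eta> B0 by (auto simp: \<eta>'_def)
  have \<eta>'B: "3 * \<eta>' * B <= \<eta>"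
  proof -
    have "3 * \<eta>' * B <= 3 * (\<eta> / (3 * (B + 1))) * (B + 1)"
      using B0 \<eta>' \<eta> by (intro mult_mono) (auto simp: \<eta>'_def)
    also have "\<dots> = \<eta>" using B0 by (simp add: field_simps)
    finally show ?thesis .
  qed
  have "eventually (%x. \<Phi> x > 1 - \<eta>') at_top" using order_tendstoD(1)[OF \<Phi>(5)] \<eta>' by simp
  then obtain x1 where x1: "!!x. x >= x1 ==> \<Phi> x > 1 - \<eta>'" unfolding eventually_at_top_linorder by blast
  have "eventually (%x. \<Phi> x < \<eta>') at_bot" using order_tendstoD(2)[OF \<Phi>(4)] \<eta>' by simp
  then obtain x2 where x2: "!!x. x <= x2 ==> \<Phi> x < \<eta>'" unfolding eventually_at_bot_linorder by blast
  show ?thesis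
  proof (rule exI[of _ "max 1 b1"], rule conjI[OF _ allI[OF impI]])
    fix b assume "max 1 b1 <= b"
    then have b: "b >= 1" "4 * B * \<kappa> b < \<eta>" using b1 by auto
    then have b0: "b > 0" "sqrt b >= 1" by auto
    define T0 where "T0 = \<bar>r\<bar> + \<bar>x1\<bar> + \<bar>x2\<bar> + 1"
    show "\<exists>T0>0. \<forall>T\<ge>T0. \<exists>M. \<forall>m\<ge>M. \<forall>t.
     N ((\<Sum>k<m. of_real ((2 * T / real m) * gauss b (t - node T m k)) *\<^sub>C f (node T m k)) - f t) <= \<epsilon>"
    proof (intro exI[of _ T0] conjI allI impI)
      fix T assume T: "T0 <= T"
      then have Tp: "T >= 0" by (simp add: T0_def)
      obtain M where M: "!!m t. m >= M ==>
         \<bar>(\<Sum>k<m. (2 * T / real m) * gauss b (t - node T m k)) - (\<Phi> (sqrt b * (t + T)) - \<Phi> (sqrt b * (t - T)))\<bar> <= \<eta>'"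
        using \<Phi>(6)[OF b0(1) Tp \<eta>'(1)] by blast
      obtain M1 where M1: "!!m t. m >= M1 ==>
         \<bar>(\<Sum>k<m. (2 * T / real m) * gauss 1 (t - node T m k)) - (\<Phi> (sqrt 1 * (t + T)) - \<Phi> (sqrt 1 * (t - T)))\<bar> <= 1"
        using \<Phi>(6)[of 1 T 1] Tp by auto
      show "\<exists>M. \<forall>m\<ge>M. \<forall>t. N ((\<Sum>k<m. of_real ((2 * T / real m) * gauss b (t - node T m k)) *\<^sub>C f (node T m k)) - f t) <= \<epsilon>"
      proof (intro exI[of _ "max M M1"] allI impI)
        fix m t assume m: "max M M1 <= m"
        define w where "w = (%k. (2 * T / real m) * gauss b (t - node T m k))"
        define w1 where "w1 = (%k. (2 * T / real m) * gauss 1 (t - node T m k))"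
        define W where "W = (\<Sum>k<m. w k)"
        have w0: "w k >= 0" "w1 k >= 0" for k using gauss_nonneg b0 Tp by (auto simp: w_def w1_def)
        have WI: "\<bar>W - (\<Phi> (sqrt b * (t + T)) - \<Phi> (sqrt b * (t - T)))\<bar> <= \<eta>'"
          using M[of m t] m unfolding W_def w_def by simp
        have W2: "W <= 2" "0 <= W"
        proof -
          show "W <= 2" using WI \<Phi>(2)[of "sqrt b * (t + T)"] \<Phi>(1)[of "sqrt b * (t - T)"] \<eta>'(2) by linarith
          show "0 <= W" unfolding W_def by (intro sum_nonneg w0)
        qed
        have W1: "(\<Sum>k<m. w1 k) <= 2"
          using M1[of m t] m \<Phi>(2)[of "sqrt 1 * (t + T)"] \<Phi>(1)[of "sqrt 1 * (t - T)"] unfolding w1_def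
          by (smt (verit) max.bounded_iff)
        \<comment> \<open>The defect splits into the weighted oscillation of \<open>f\<close> around
          \<open>t\<close> and the deviation of the total weight from \<open>1\<close>.\<close>
        have e: "(\<Sum>k<m. of_real (w k) *\<^sub>C f (node T m k)) - f t
           = (\<Sum>k<m. of_real (w k) *\<^sub>C (f (node T m k) - f t)) + of_real (W - 1) *\<^sub>C f t"
          unfolding W_def by (simp add: cvec.scale_right_diff_distrib sum_subtractf cvec.scale_sum_left
            cvec.scale_left_diff_distrib scaleC_one)
        have m1: "of_real (w k) *\<^sub>C (f (node T m k) - f t) \<in> C" for k by (intro mem_scale mem_diff f)
        have tm: "N (of_real (w k) *\<^sub>C (f (node T m k) - f t)) <= \<eta> * w k + 2 * B * \<kappa> b * w1 k" for k
        proof -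
          have N: "N (of_real (w k) *\<^sub>C (f (node T m k) - f t)) = w k * N (f (node T m k) - f t)"
            using N_scale[OF mem_diff[OF f(2) f(2)]] w0(1) by simp
          show ?thesis
          proof (cases "\<bar>node T m k - t\<bar> < \<delta>")
            case True
            have "w k * N (f (node T m k) - f t) <= w k * \<eta>" by (intro mult_left_mono \<delta>(2) True w0)
            moreover have "0 <= 2 * B * \<kappa> b * w1 k" using B0 b0 w0 by (simp add: \<kappa>_def)
            ultimately show ?thesis unfolding N using mult.commute[of "w k" \<eta>] by linarith
          next
            case False
            define x where "x = t - node T m k"
            have x: "\<delta> <= \<bar>x\<bar>" using False by (simp add: x_def abs_minus_commute)
            then have "\<delta>\<^sup>2 <= x\<^sup>2" using \<delta>(1) by (metis less_imp_le power2_abs power_mono)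
            then have "(b - 1) * \<delta>\<^sup>2 <= (b - 1) * x\<^sup>2" using b(1) by (intro mult_left_mono) auto
            then have "exp (- (b - 1) * x\<^sup>2) <= exp (- (b - 1) * \<delta>\<^sup>2)" by (simp add: algebra_simps)
            then have "gauss_const * sqrt b * exp (- (b - 1) * x\<^sup>2) * exp (- x\<^sup>2) <= gauss_const * sqrt b * exp (- (b - 1) * \<delta>\<^sup>2) * exp (- x\<^sup>2)"
              using gauss_const b0 by (intro mult_right_mono mult_left_mono) auto
            moreover have "exp (- b * x\<^sup>2) = exp (- (b - 1) * x\<^sup>2) * exp (- x\<^sup>2)"
              by (simp add: exp_add[symmetric] algebra_simps)
            ultimately have "gauss b x <= \<kappa> b * gauss 1 x" unfolding gauss_def \<kappa>_def by (simp add: mult_ac)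
            then have "w k <= (2 * T / real m) * (\<kappa> b * gauss 1 x)"
              unfolding w_def x_def using Tp by (intro mult_left_mono) auto
            then have wk: "w k <= \<kappa> b * w1 k" unfolding w1_def x_def by (simp add: mult_ac)
            have "N (f (node T m k) - f t) <= 2 * B"
              using N_minus[OF f(2)[of "node T m k"] f(2)[of t]] B[of "node T m k"] B[of t] by linarith
            then have "w k * N (f (node T m k) - f t) <= (\<kappa> b * w1 k) * (2 * B)"
              by (intro mult_mono wk) (use b0 w0 N_nonneg[OF mem_diff[OF f(2) f(2)]] in \<open>auto simp: \<kappa>_def\<close>)
            moreover have "0 <= \<eta> * w k" using \<eta> w0 by simp
            moreover have "(\<kappa> b * w1 k) * (2 * B) = 2 * B * \<kappa> b * w1 k" by simp
            ultimately show ?thesis unfolding N by linarith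
          qed
        qed
        have "N (\<Sum>k<m. of_real (w k) *\<^sub>C (f (node T m k) - f t)) <= (\<Sum>k<m. \<eta> * w k + 2 * B * \<kappa> b * w1 k)"
          using order_trans[OF N_sum[OF m1] sum_mono[OF tm]] .
        also have "\<dots> = \<eta> * W + 2 * B * \<kappa> b * (\<Sum>k<m. w1 k)"
          by (simp add: sum.distrib sum_distrib_left W_def)
        also have "\<dots> <= \<eta> * 2 + 2 * B * \<kappa> b * 2"
          using \<eta> B0 b0 W2 W1 by (intro add_mono mult_left_mono) (auto simp: \<kappa>_def)
        also have "\<dots> <= 3 * \<eta>" using b(2) by simp
        finally have s1: "N (\<Sum>k<m. of_real (w k) *\<^sub>C (f (node T m k) - f t)) <= 3 * \<eta>" .
        \<comment> \<open>Either \<open>f t\<close> is already small, or \<open>t\<close> is far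
          enough from the ends of the interval for the total weight to be close to
          \<open>1\<close>.\<close>
        have s2: "N (of_real (W - 1) *\<^sub>C f t) <= \<eta>"
        proof (cases "r <= \<bar>t\<bar>")
          case True
          have "\<bar>W - 1\<bar> * N (f t) <= 1 * \<eta>"
            using W2 r[OF True] N_nonneg[OF f(2)] by (intro mult_mono) auto
          then show ?thesis unfolding N_scale[OF f(2)] by (simp del: of_real_diff)
        next
          case False
          have T1: "t + T >= \<bar>x1\<bar>" "t - T <= - \<bar>x2\<bar>" using False T by (auto simp: T0_def)
          have "1 * (t + T) <= sqrt b * (t + T)" using b0 T1 by (intro mult_right_mono) auto
          then have "x1 <= sqrt b * (t + T)" using T1(1) abs_ge_self[of x1] unfolding mult_1 by (meson order_trans)
          then have "\<Phi> (sqrt b * (t + T)) > 1 - \<eta>'" by (rule x1)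
          moreover have "1 * (T - t) <= sqrt b * (T - t)" using b0 T1 by (intro mult_right_mono) auto
          then have "sqrt b * (t - T) <= t - T" by (simp add: algebra_simps)
          then have "sqrt b * (t - T) <= x2" using T1(2) abs_ge_minus_self[of x2] by (smt (verit))
          then have "\<Phi> (sqrt b * (t - T)) < \<eta>'" by (rule x2)
          ultimately have "\<bar>W - 1\<bar> <= 3 * \<eta>'"
            using WI \<Phi>(2)[of "sqrt b * (t + T)"] \<Phi>(1)[of "sqrt b * (t - T)"] by linarith
          then have "\<bar>W - 1\<bar> * N (f t) <= 3 * \<eta>' * B"
            by (intro mult_mono B) (use \<eta>' N_nonneg[OF f(2)] in auto)
          then show ?thesis unfolding N_scale[OF f(2)] using \<eta>'B by (simp del: of_real_diff)
        qed
        have sC: "(\<Sum>k<m. of_real (w k) *\<^sub>C (f (node T m k) - f t)) \<in> C" by (rule mem_sum[OF m1])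
        have "N ((\<Sum>k<m. of_real (w k) *\<^sub>C f (node T m k)) - f t) <= 3 * \<eta> + \<eta>"
          unfolding e by (rule order_trans[OF N_tri[OF sC mem_scale[OF f(2)]] add_mono[OF s1 s2]])
        then show "N ((\<Sum>k<m. of_real ((2 * T / real m) * gauss b (t - node T m k)) *\<^sub>C f (node T m k)) - f t) <= \<epsilon>"
          unfolding w_def \<eta>_def by simp
      qed
    qed (simp add: T0_def)
  qed simp
qed

end

lemma (in cnorm) dnorm_approx:
  assumes f: "f \<in> dual_on C N" and e: "e > 0"
  obtains x where "x \<in> C" "N x <= 1" "dnorm C N f <= cmod (f x) + e"
proof -
  have "\<exists>x. x \<in> C \<and> N x <= 1 \<and> dnorm C N f <= cmod (f x) + e"
  proof (rule ccontr)
    assume "\<not> ?thesis"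
    then have n: "cmod (f x) <= dnorm C N f - e" if "x \<in> C" "N x <= 1" for x
      using that by (meson diff_le_eq add.commute le_diff_eq linorder_le_cases)
    have "dnorm C N f <= dnorm C N f - e"
      unfolding dnorm_def[of C N f]
    proof (rule cSup_least)
      show "{cmod (f x) |x. x \<in> C \<and> N x <= 1} \<noteq> {}" using mem_0 N_0 by force
    qed (use n in \<open>auto simp: dnorm_def\<close>)
    then show False using e by simp
  qed
  then show thesis using that by blast
qed

lemma sum_fun_eval: "(\<Sum>i\<in>I. f i) x = (\<Sum>i\<in>I. f i x)"
  by (induction I rule: infinite_finite_induct) auto

lemma convex_abs_Re: "convex {u::complex. \<bar>Re u\<bar> <= 1}"
proof -
  have "{u::complex. \<bar>Re u\<bar> <= 1} = {u. - 1 <= Re u} \<inter> {u. Re u <= 1}" by auto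
  then show ?thesis using convex_Int[OF convex_halfspace_Re_ge convex_halfspace_Re_le] by simp
qed

section \<open>Complex Gaussians\<close>

text \<open>The analytic continuation of \<open>gauss\<close> with its first two derivatives. The
  sign in the exponent makes it a real Gaussian on the imaginary axis, where the differences of
  points of one vertical line lie.\<close>

definition cgauss :: "nat => real => complex => complex" where
  "cgauss i b u = of_real (gauss_const * sqrt b) * exp (of_real b * u\<^sup>2) *
     (if i = 0 then 1 else if i = 1 then 2 * of_real b * u else 2 * of_real b + 4 * (of_real b)\<^sup>2 * u\<^sup>2)"

lemma cgauss_imag: "cgauss 0 b (\<i> * of_real x) = of_real (gauss b x)"
  by (simp add: cgauss_def gauss_def power_mult_distrib exp_of_real[symmetric])

lemma cgauss_deriv:
  "i <= 1 ==> (cgauss i b has_field_derivative cgauss (Suc i) b u) (at u within A)"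
proof -
  have "i = 0 \<or> i = 1" if "i <= 1" using that by auto
  moreover have "(cgauss 0 b has_field_derivative cgauss (Suc 0) b u) (at u within A)"
    unfolding cgauss_def by (auto intro!: derivative_eq_intros simp: algebra_simps)
  moreover have "(cgauss 1 b has_field_derivative cgauss (Suc 1) b u) (at u within A)"
    unfolding cgauss_def by (auto intro!: derivative_eq_intros simp: algebra_simps power2_eq_square)
  ultimately show "i <= 1 ==> ?thesis" by auto
qed

lemma cgauss_hol: "i <= 1 ==> cgauss i b holomorphic_on A"
  unfolding holomorphic_on_def field_differentiable_def using cgauss_deriv by blast

lemma cgauss_norm:
  assumes "b > 0"
  shows "cmod (cgauss i b u) = gauss_const * sqrt b * cmod (exp (of_real b * u\<^sup>2)) *
     cmod (if i = 0 then 1 else if i = 1 then 2 * of_real b * u else 2 * of_real b + 4 * (of_real b)\<^sup>2 * u\<^sup>2)"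
proof -
  have "\<bar>gauss_const * sqrt b\<bar> = gauss_const * sqrt b" using gauss_const assms by simp
  then show ?thesis unfolding cgauss_def norm_mult norm_of_real by simp
qed

text \<open>Differences of points of the strip satisfy \<open>\<bar>Re u\<bar> <= 1\<close>, where
  the real part of \<open>u\<close> costs at most the factor \<open>exp b\<close>.\<close>

lemma cgauss_decay:
  assumes b: "b > 0" and i: "i <= 1" and u: "\<bar>Re u\<bar> <= 1"
  shows "cmod (cgauss i b u) <= gauss_const * sqrt b * exp b * (2 * b + 1) * ((2 + \<bar>Im u\<bar>) * exp (- b * (Im u)\<^sup>2))"
proof -
  have "(Re u)\<^sup>2 <= 1" using u by (simp add: abs_square_le_1)
  then have "b * ((Re u)\<^sup>2 - (Im u)\<^sup>2) <= b + - b * (Im u)\<^sup>2" using b by (simp add: algebra_simps)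
  then have ex: "cmod (exp (of_real b * u\<^sup>2)) <= exp b * exp (- b * (Im u)\<^sup>2)"
    unfolding norm_exp_mult_square exp_add[symmetric] by simp
  have cu: "cmod u <= 1 + \<bar>Im u\<bar>" using cmod_le[of u] u by linarith
  have fac: "cmod (if i = 0 then 1 else if i = 1 then 2 * of_real b * u else 2 * of_real b + 4 * (of_real b)\<^sup>2 * u\<^sup>2)
    <= (2 * b + 1) * (2 + \<bar>Im u\<bar>)"
  proof -
    have 1: "1 * 1 <= (2 * b + 1) * (2 + \<bar>Im u\<bar>)" using b by (intro mult_mono) auto
    have 2: "2 * b * cmod u <= (2 * b + 1) * (2 + \<bar>Im u\<bar>)" using b cu by (intro mult_mono) auto
    have "i = 0 \<or> i = 1" using i by auto
    then show ?thesis using 1 2 b by (auto simp: norm_mult)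
  qed
  have "cmod (cgauss i b u) <= gauss_const * sqrt b * (exp b * exp (- b * (Im u)\<^sup>2)) * ((2 * b + 1) * (2 + \<bar>Im u\<bar>))"
    unfolding cgauss_norm[OF b]
    using gauss_const b by (intro mult_mono mult_left_mono ex fac) auto
  then show ?thesis by (simp add: mult_ac)
qed

lemma cgauss_bound_obtain:
  assumes b: "b > 0"
  obtains E where "E >= 0" "!!i u. i <= 2 ==> \<bar>Re u\<bar> <= 1 ==> cmod (cgauss i b u) <= E"
proof -
  define P where "P = (%y::real. gauss_const * sqrt b * exp b * exp (- b * y\<^sup>2) * (1 + 2 * b * (1 + \<bar>y\<bar>) + (2 * b + 4 * b\<^sup>2 * (1 + \<bar>y\<bar>)\<^sup>2)))"
  have c: "continuous_on UNIV P" unfolding P_def by (intro continuous_intros)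
  have "(P \<longlongrightarrow> 0) at_top" "(P \<longlongrightarrow> 0) at_bot" unfolding P_def using b by real_asymp+
  then have "(P \<longlongrightarrow> 0) at_infinity" unfolding at_infinity_eq_at_top_bot by (rule filterlim_sup)
  then obtain E where E: "!!y. P y <= E" using bounded_of_tendsto_0[OF c] by blast
  have P0: "0 <= P y" for y using gauss_const b unfolding P_def by (intro mult_nonneg_nonneg add_nonneg_nonneg) auto
  show thesis
  proof (rule that[of E])
    show "0 <= E" using order_trans[OF P0 E] .
    fix i :: nat and u assume i: "i <= 2" and u: "\<bar>Re u\<bar> <= 1"
    have "(Re u)\<^sup>2 <= 1" using u by (simp add: abs_square_le_1)
    then have "b * ((Re u)\<^sup>2 - (Im u)\<^sup>2) <= b + - b * (Im u)\<^sup>2" using b by (simp add: algebra_simps)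
    then have ex: "cmod (exp (of_real b * u\<^sup>2)) <= exp b * exp (- b * (Im u)\<^sup>2)"
      unfolding norm_exp_mult_square exp_add[symmetric] by simp
    have cu: "cmod u <= 1 + \<bar>Im u\<bar>" using cmod_le[of u] u by linarith
    then have cu2: "(cmod u)\<^sup>2 <= (1 + \<bar>Im u\<bar>)\<^sup>2" by (intro power_mono) auto
    have 1: "2 * b * cmod u <= 2 * b * (1 + \<bar>Im u\<bar>)" using b cu by (intro mult_left_mono) auto
    have 2: "4 * b\<^sup>2 * (cmod u)\<^sup>2 <= 4 * b\<^sup>2 * (1 + \<bar>Im u\<bar>)\<^sup>2" using b cu2 by (intro mult_left_mono) auto
    have 3: "cmod (2 * of_real b + 4 * (of_real b)\<^sup>2 * u\<^sup>2) <= 2 * b + 4 * b\<^sup>2 * (cmod u)\<^sup>2"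
      using norm_triangle_ineq[of "2 * complex_of_real b" "4 * (of_real b)\<^sup>2 * u\<^sup>2"] b by (simp add: norm_mult norm_power)
    have nn: "0 <= 2 * b * (1 + \<bar>Im u\<bar>)" "0 <= 4 * b\<^sup>2 * (1 + \<bar>Im u\<bar>)\<^sup>2" using b by auto
    have fac: "cmod (if i = 0 then 1 else if i = 1 then 2 * of_real b * u else 2 * of_real b + 4 * (of_real b)\<^sup>2 * u\<^sup>2)
      <= 1 + 2 * b * (1 + \<bar>Im u\<bar>) + (2 * b + 4 * b\<^sup>2 * (1 + \<bar>Im u\<bar>)\<^sup>2)"
    proof -
      have "cmod (2 * of_real b * u) = 2 * b * cmod u" using b by (simp add: norm_mult)
      then have F: "cmod (2 * of_real b * u) <= 1 + 2 * b * (1 + \<bar>Im u\<bar>) + (2 * b + 4 * b\<^sup>2 * (1 + \<bar>Im u\<bar>)\<^sup>2)"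
        "cmod (1::complex) <= 1 + 2 * b * (1 + \<bar>Im u\<bar>) + (2 * b + 4 * b\<^sup>2 * (1 + \<bar>Im u\<bar>)\<^sup>2)"
        "cmod (2 * of_real b + 4 * (of_real b)\<^sup>2 * u\<^sup>2) <= 1 + 2 * b * (1 + \<bar>Im u\<bar>) + (2 * b + 4 * b\<^sup>2 * (1 + \<bar>Im u\<bar>)\<^sup>2)"
        using 1 2 3 nn b norm_one[where 'a = complex] by linarith+
      show ?thesis by (cases "i = 0"; cases "i = 1"; simp only: if_P if_not_P simp_thms if_True if_False zero_neq_one one_neq_zero; rule F)
    qed
    have "cmod (cgauss i b u) <= gauss_const * sqrt b * (exp b * exp (- b * (Im u)\<^sup>2)) * (1 + 2 * b * (1 + \<bar>Im u\<bar>) + (2 * b + 4 * b\<^sup>2 * (1 + \<bar>Im u\<bar>)\<^sup>2))"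
      unfolding cgauss_norm[OF b]
      using gauss_const b by (intro mult_mono mult_left_mono ex fac) auto
    also have "\<dots> = P (Im u)" unfolding P_def by (simp add: mult.assoc)
    finally show "cmod (cgauss i b u) <= E" using E[of "Im u"] by linarith
  qed
qed

lemma cgauss_bounded:
  assumes "b > 0"
  shows "\<exists>E\<ge>0. \<forall>i\<le>2. \<forall>u. \<bar>Re u\<bar> <= 1 \<longrightarrow> cmod (cgauss i b u) <= E"
proof (rule cgauss_bound_obtain[OF assms])
  fix E :: real assume "0 <= E" "!!i u. i <= 2 ==> \<bar>Re u\<bar> <= 1 ==> cmod (cgauss i b u) <= E"
  then show ?thesis by blast
qed

text \<open>\<open>l\<close> is a functional on bounded boundary functions that annihilates the boundary values of
  all \<open>F\<close> vanishing at \<open>\<theta>\<close>. Restricting it to one boundary line and testing against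
  Gaussians times \<open>Q\<close> (which vanishes at \<open>\<theta>\<close>) yields the same functional on either line, up to
  sign, and therefore one that is continuous for both norms.\<close>

locale annihilator = interp A0 A1 N0 N1
  for A0 A1 :: "'v::cvec set" and N0 N1 :: "'v => real" +
  fixes \<theta> :: real and l :: "(complex => 'v) => complex" and b :: real
  assumes \<theta>: "0 < \<theta>" "\<theta> < 1" and l_lin: "clinear_on a.bV l" and l_le: "!!u. u \<in> a.bV ==> cmod (l u) <= a.bN u"
    and l_ann: "!!F. F \<in> a.Fs ==> F (of_real \<theta>) = 0 ==> l F = 0" and b: "b > 0"
begin

definition e0 :: "(complex => 'v) => complex => 'v" where "e0 u = (%z. if Re z = 0 then u z else 0)"
definition e1 :: "(complex => 'v) => complex => 'v" where "e1 u = (%z. if Re z = 1 then u z else 0)"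

lemma e_bnd: "e0 u (bnd 0 t) = u (bnd 0 t)" "e0 u (bnd 1 t) = 0" "e1 u (bnd 0 t) = 0" "e1 u (bnd 1 t) = u (bnd 1 t)"
  using bnd_simps(1)[of t] bnd_simps(2)[of t] unfolding e0_def e1_def by (simp_all del: bnd_simps)

lemma e0_bV:
  assumes "!!t. u (bnd 0 t) \<in> A0" "!!t. N0 (u (bnd 0 t)) <= B"
  shows "e0 u \<in> a.bV" "cmod (l (e0 u)) <= B"
proof -
  have "0 <= B" using order_trans[OF a.c0.N_nonneg[OF assms(1)] assms(2)] .
  then have "e0 u \<in> a.bV" "a.bN (e0 u) <= B"
    using a.bVI[of "e0 u" B] assms unfolding e_bnd by (auto simp: a.c1.mem_0 a.c1.N_0)
  then show "e0 u \<in> a.bV" "cmod (l (e0 u)) <= B" using l_le[of "e0 u"] by auto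
qed

lemma e1_bV:
  assumes "!!t. u (bnd 1 t) \<in> A1" "!!t. N1 (u (bnd 1 t)) <= B"
  shows "e1 u \<in> a.bV" "cmod (l (e1 u)) <= B"
proof -
  have "0 <= B" using order_trans[OF a.c1.N_nonneg[OF assms(1)] assms(2)] .
  then have "e1 u \<in> a.bV" "a.bN (e1 u) <= B"
    using a.bVI[of "e1 u" B] assms unfolding e_bnd by (auto simp: a.c0.mem_0 a.c0.N_0)
  then show "e1 u \<in> a.bV" "cmod (l (e1 u)) <= B" using l_le[of "e1 u"] by auto
qed

lemma l_split:
  assumes u: "u \<in> a.bV" shows "l u = l (e0 u) + l (e1 u)" "e0 u \<in> a.bV" "e1 u \<in> a.bV"
proof -
  show E0: "e0 u \<in> a.bV"
    by (rule e0_bV(1)[where B = "a.bN u"]) (use a.bVD(1)[OF u] a.bN_upper(1)[OF u] in auto)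
  show E1: "e1 u \<in> a.bV"
    by (rule e1_bV(1)[where B = "a.bN u"]) (use a.bVD(2)[OF u] a.bN_upper(2)[OF u] in auto)
  note E = E0 E1
  have E2: "e0 u + e1 u \<in> a.bV" by (rule csubspace_add[OF a.csubspace_bV E])
  \<comment> \<open>The remainder vanishes on both lines, so its seminorm is \<open>0\<close> and
    \<open>l\<close> cannot see it.\<close>
  have z: "(u - (e0 u + e1 u)) (bnd 0 t) = 0" "(u - (e0 u + e1 u)) (bnd 1 t) = 0" for t
    unfolding minus_apply plus_fun_apply e_bnd by simp_all
  have "a.bN (u - (e0 u + e1 u)) <= 0"
    by (rule a.bN_le) (simp_all only: z a.c0.N_0 a.c1.N_0 order_refl)
  then have "cmod (l (u - (e0 u + e1 u))) <= 0"
    using l_le[OF csubspace_diff[OF a.csubspace_bV u E2]] by linarith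
  then have "l (u - (e0 u + e1 u)) = 0" by (simp only: norm_le_zero_iff)
  then show "l u = l (e0 u) + l (e1 u)"
    using clinear_on_diff[OF a.csubspace_bV l_lin u E2] clinear_onD(1)[OF l_lin E] by simp
qed

section \<open>Scalar multipliers and the functionals they induce\<close>

text \<open>Scalar multipliers whose product with a fixed vector of \<open>D\<close> belongs to
  \<open>Fspace\<close> and vanishes at \<open>\<theta>\<close>, so that \<open>l\<close>
  annihilates the product.\<close>

definition tf :: "(complex => complex) => bool" where
  "tf q \<longleftrightarrow> continuous_on strip q \<and> q holomorphic_on ostrip \<and> (\<exists>B. \<forall>z\<in>strip. cmod (q z) <= B) \<and>
    ((%t. q (bnd 0 t)) \<longlongrightarrow> 0) at_infinity \<and> ((%t. q (bnd 1 t)) \<longlongrightarrow> 0) at_infinity \<and> q (of_real \<theta>) = 0"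

lemma tf_combine: assumes "tf q" "tf r" shows "tf (%z. q z - c * r z)"
proof -
  obtain B B' where B: "!!z. z \<in> strip ==> cmod (q z) <= B" "!!z. z \<in> strip ==> cmod (r z) <= B'"
    using assms unfolding tf_def by blast
  have "cmod (q z - c * r z) <= B + cmod c * B'" if "z \<in> strip" for z
    using norm_triangle_ineq4[of "q z" "c * r z"] B(1)[OF that] mult_left_mono[OF B(2)[OF that], of "cmod c"] by (simp add: norm_mult)
  then have "\<exists>K. \<forall>z\<in>strip. cmod (q z - c * r z) <= K" by blast
  moreover have l: "((%t. q (bnd 0 t)) \<longlongrightarrow> 0) at_infinity" "((%t. r (bnd 0 t)) \<longlongrightarrow> 0) at_infinity"
      "((%t. q (bnd 1 t)) \<longlongrightarrow> 0) at_infinity" "((%t. r (bnd 1 t)) \<longlongrightarrow> 0) at_infinity"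
    using assms unfolding tf_def by blast+
  have "((%t. q (bnd 0 t) - c * r (bnd 0 t)) \<longlongrightarrow> 0 - c * 0) at_infinity" "((%t. q (bnd 1 t) - c * r (bnd 1 t)) \<longlongrightarrow> 0 - c * 0) at_infinity"
    by (intro tendsto_diff tendsto_mult_left l)+
  moreover have "continuous_on strip (%z. q z - c * r z)" "(%z. q z - c * r z) holomorphic_on ostrip" "q (of_real \<theta>) - c * r (of_real \<theta>) = 0"
    using assms unfolding tf_def by (auto intro!: continuous_intros holomorphic_intros)
  ultimately show ?thesis
    unfolding tf_def mult_zero_right diff_zero by blast
qed

definition \<Psi> :: "(complex => complex) => 'v => complex" where
  "\<Psi> q = (%a. if a \<in> D then l (e0 (%z. q z *\<^sub>C a)) else 0)"

lemma tf_bound: "tf q ==> \<exists>B. \<forall>t. cmod (q (bnd 0 t)) <= B \<and> cmod (q (bnd 1 t)) <= B"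
  unfolding tf_def using bnd_strip(1,2) by (meson bspec)

lemma e0_scal:
  assumes "x \<in> A0" "!!t. cmod (q (bnd 0 t)) <= B"
  shows "e0 (%z. q z *\<^sub>C x) \<in> a.bV" "cmod (l (e0 (%z. q z *\<^sub>C x))) <= B * N0 x"
proof -
  have m: "q (bnd 0 t) *\<^sub>C x \<in> A0" for t by (rule a.c0.mem_scale[OF assms(1)])
  have n: "N0 (q (bnd 0 t) *\<^sub>C x) <= B * N0 x" for t
    unfolding a.c0.N_scale[OF assms(1)] by (rule mult_right_mono[OF assms(2) a.c0.N_nonneg[OF assms(1)]])
  show "e0 (%z. q z *\<^sub>C x) \<in> a.bV" by (rule e0_bV(1)[where u = "%z. q z *\<^sub>C x", OF m n])
  show "cmod (l (e0 (%z. q z *\<^sub>C x))) <= B * N0 x" by (rule e0_bV(2)[where u = "%z. q z *\<^sub>C x", OF m n])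
qed

lemma e1_scal:
  assumes "x \<in> A1" "!!t. cmod (q (bnd 1 t)) <= B"
  shows "e1 (%z. q z *\<^sub>C x) \<in> a.bV" "cmod (l (e1 (%z. q z *\<^sub>C x))) <= B * N1 x"
proof -
  have m: "q (bnd 1 t) *\<^sub>C x \<in> A1" for t by (rule a.c1.mem_scale[OF assms(1)])
  have n: "N1 (q (bnd 1 t) *\<^sub>C x) <= B * N1 x" for t
    unfolding a.c1.N_scale[OF assms(1)] by (rule mult_right_mono[OF assms(2) a.c1.N_nonneg[OF assms(1)]])
  show "e1 (%z. q z *\<^sub>C x) \<in> a.bV" by (rule e1_bV(1)[where u = "%z. q z *\<^sub>C x", OF m n])
  show "cmod (l (e1 (%z. q z *\<^sub>C x))) <= B * N1 x" by (rule e1_bV(2)[where u = "%z. q z *\<^sub>C x", OF m n])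
qed

text \<open>\<open>l\<close> annihilates the whole product, so the contributions of the two boundary
  lines cancel.\<close>

lemma \<Psi>_alt:
  assumes q: "tf q" and x: "x \<in> D" shows "l (e0 (%z. q z *\<^sub>C x)) = - l (e1 (%z. q z *\<^sub>C x))"
proof -
  obtain K where K: "!!z. z \<in> strip ==> cmod (q z) <= K" using q unfolding tf_def by blast
  have F: "(%z. q z *\<^sub>C x) \<in> a.Fs"
    by (rule a.Fs_scalar[OF DD(1,2)[OF x] _ _ K]) (use q in \<open>auto simp: tf_def\<close>)
  have "l (%z. q z *\<^sub>C x) = 0" by (rule l_ann[OF F]) (use q in \<open>simp add: tf_def\<close>)
  then show ?thesis using l_split(1)[OF a.Fs_bV[OF F]] by (simp add: add_eq_0_iff)
qed

lemma e0_lin: "e0 (%z. f z + g z) = e0 f + e0 g" "e0 (%z. c *\<^sub>C f z) = c *\<^sub>C e0 f" "e0 (%z. f z - g z) = e0 f - e0 g"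
  "e0 (%z. \<Sum>i\<in>I. h i z) = (\<Sum>i\<in>I. e0 (h i))"
proof -
  show "e0 (%z. \<Sum>i\<in>I. h i z) = (\<Sum>i\<in>I. e0 (h i))"
    by (induction I rule: infinite_finite_induct) (auto simp: e0_def fun_eq_iff sum_fun_eval)
qed (auto simp: e0_def fun_eq_iff scaleC_fun_def)

lemma e1_lin: "e1 (%z. f z - g z) = e1 f - e1 g" "e1 (%z. c *\<^sub>C f z) = c *\<^sub>C e1 f" "e1 (%z. \<Sum>i\<in>I. h i z) = (\<Sum>i\<in>I. e1 (h i))"
proof -
  show "e1 (%z. \<Sum>i\<in>I. h i z) = (\<Sum>i\<in>I. e1 (h i))"
    by (induction I rule: infinite_finite_induct) (auto simp: e1_def fun_eq_iff sum_fun_eval)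
qed (auto simp: e1_def fun_eq_iff scaleC_fun_def)

text \<open>Computed on the left line, the functional is bounded by \<open>N0\<close>. By the
  cancellation it can also be computed on the right line, which bounds it by \<open>N1\<close>. Both
  bounds need only the boundary values of \<open>q\<close>.\<close>

lemma \<Psi>_W:
  assumes q: "tf q" and B: "!!t. cmod (q (bnd 0 t)) <= B" "!!t. cmod (q (bnd 1 t)) <= B"
  shows "\<Psi> q \<in> W" "p.nn (\<Psi> q) <= B"
proof -
  have B0: "0 <= B" using order_trans[OF norm_ge_zero B(1)] .
  have f: "functional_on D (\<Psi> q)"
    unfolding functional_on_def clinear_on_def
  proof (intro conjI allI ballI impI)
    show "x \<notin> D ==> \<Psi> q x = 0" for x by (simp add: \<Psi>_def)
    fix x assume x: "x \<in> D"
    note E = e0_scal(1)[where q = q and B = B, OF DD(1)[OF x] B(1)]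
    show "\<Psi> q (c *\<^sub>C x) = c * \<Psi> q x" for c
    proof -
      have "e0 (%z. q z *\<^sub>C c *\<^sub>C x) = c *\<^sub>C e0 (%z. q z *\<^sub>C x)"
        unfolding e0_lin(2)[symmetric] by (simp add: scaleC_scaleC mult.commute)
      then show ?thesis using x csubspace_scale[OF csubspace_D x] clinear_onD(2)[OF l_lin E] by (simp add: \<Psi>_def)
    qed
    fix y assume y: "y \<in> D"
    have "e0 (%z. q z *\<^sub>C (x + y)) = e0 (%z. q z *\<^sub>C x) + e0 (%z. q z *\<^sub>C y)"
      unfolding e0_lin(1)[symmetric] by (simp add: scaleC_add_right)
    then show "\<Psi> q (x + y) = \<Psi> q x + \<Psi> q y"
      using x y csubspace_add[OF csubspace_D x y] clinear_onD(1)[OF l_lin E e0_scal(1)[where q = q and B = B, OF DD(1)[OF y] B(1)]] by (simp add: \<Psi>_def)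
  qed
  have b0: "cmod (\<Psi> q x) <= B * N0 x" if x: "x \<in> D" for x
    using e0_scal(2)[where q = q and B = B, OF DD(1)[OF x] B(1)] x by (simp add: \<Psi>_def)
  have b1: "cmod (\<Psi> q x) <= B * N1 x" if x: "x \<in> D" for x
    using e1_scal(2)[where q = q and B = B, OF DD(2)[OF x] B(2)] \<Psi>_alt[OF q x] x by (simp add: \<Psi>_def)
  show "\<Psi> q \<in> W" unfolding W_def Int_iff dual_on_iff by (intro conjI f exI[of _ B] ballI b0 b1)
  show "p.nn (\<Psi> q) <= B"
    using d0.dnorm_le[OF b0 B0] d1.dnorm_le[OF b1 B0] unfolding p.nn_def by (simp add: n0_def n1_def)
qed

lemma \<Psi>_combine:
  assumes q: "tf q" and r: "tf r" shows "\<Psi> (%z. q z - c * r z) = \<Psi> q - c *\<^sub>C \<Psi> r"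
proof
  fix x
  obtain B where B: "!!t. cmod (q (bnd 0 t)) <= B" "!!t. cmod (q (bnd 1 t)) <= B" using tf_bound[OF q] by blast
  obtain B' where B': "!!t. cmod (r (bnd 0 t)) <= B'" "!!t. cmod (r (bnd 1 t)) <= B'" using tf_bound[OF r] by blast
  show "\<Psi> (%z. q z - c * r z) x = (\<Psi> q - c *\<^sub>C \<Psi> r) x"
  proof (cases "x \<in> D")
    case x: True
    note E = e0_scal(1)[where q = q and B = B, OF DD(1)[OF x] B(1)] and E' = e0_scal(1)[where q = r and B = B', OF DD(1)[OF x] B'(1)]
    have "e0 (%z. (q z - c * r z) *\<^sub>C x) = e0 (%z. q z *\<^sub>C x) - c *\<^sub>C e0 (%z. r z *\<^sub>C x)"
      unfolding e0_lin(2)[symmetric] e0_lin(3)[symmetric] by (simp add: cvec.scale_left_diff_distrib scaleC_scaleC)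
    then show ?thesis
      using x clinear_on_diff[OF a.csubspace_bV l_lin E csubspace_scale[OF a.csubspace_bV E']] clinear_onD(2)[OF l_lin E']
      by (simp add: \<Psi>_def scaleC_fun_apply)
  qed (simp add: \<Psi>_def scaleC_fun_apply)
qed

text \<open>On \<open>D\<close> this is the definition. Both sides are continuous in the norm of
  \<open>A0\<close>, so density extends it, and vectors of \<open>A0\<close> may then be placed at
  the nodes of boundary sums.\<close>

lemma R_\<Psi>0:
  assumes q: "tf q" and x: "x \<in> A0" shows "R x (\<Psi> q) = l (e0 (%z. q z *\<^sub>C x))"
proof -
  obtain B where B: "!!t. cmod (q (bnd 0 t)) <= B" "!!t. cmod (q (bnd 1 t)) <= B" using tf_bound[OF q] by blast
  have B0: "0 <= B" using order_trans[OF norm_ge_zero B(1)] .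
  note W = \<Psi>_W[OF q B]
  have "cmod (R x (\<Psi> q) - l (e0 (%z. q z *\<^sub>C x))) <= 0"
  proof (rule field_le_epsilon)
    fix e :: real assume e: "e > 0"
    define e' where "e' = e / (2 * B + 1)"
    have e': "e' > 0" "2 * B * e' <= e" using e B0 by (auto simp: e'_def field_simps)
    obtain d where d: "d \<in> D" "N0 (x - d) < e'" using dense0'[OF x e'(1)] .
    have xd: "x - d \<in> A0" by (intro a.c0.mem_diff x DD(1)[OF d(1)])
    have "e0 (%z. q z *\<^sub>C (x - d)) = e0 (%z. q z *\<^sub>C x) - e0 (%z. q z *\<^sub>C d)"
      unfolding e0_lin(3)[symmetric] by (simp add: cvec.scale_right_diff_distrib)
    then have "l (e0 (%z. q z *\<^sub>C x)) - \<Psi> q d = l (e0 (%z. q z *\<^sub>C (x - d)))"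
      using d(1) clinear_on_diff[OF a.csubspace_bV l_lin e0_scal(1)[where q = q and B = B, OF x B(1)] e0_scal(1)[where q = q and B = B, OF DD(1)[OF d(1)] B(1)]] by (simp add: \<Psi>_def)
    then have 1: "cmod (l (e0 (%z. q z *\<^sub>C x)) - \<Psi> q d) <= B * e'"
      using e0_scal(2)[where q = q and B = B, OF xd B(1)] mult_left_mono[OF less_imp_le[OF d(2)] B0] by simp
    have "cmod (\<Psi> q d - R x (\<Psi> q)) <= p.nn (\<Psi> q) * a.SN (x - d)" by (rule R_char[OF a.S0[OF x] W(1) d(1)])
    also have "\<dots> <= B * e'"
      using a.SN0[OF xd] d(2) a.s.N_nonneg[OF a.S0[OF xd]] B0 by (intro mult_mono W(2)) auto
    finally have 2: "cmod (\<Psi> q d - R x (\<Psi> q)) <= B * e'" .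
    have "cmod (R x (\<Psi> q) - l (e0 (%z. q z *\<^sub>C x))) <= cmod (l (e0 (%z. q z *\<^sub>C x)) - \<Psi> q d) + cmod (\<Psi> q d - R x (\<Psi> q))"
      using norm_triangle_ineq[of "l (e0 (%z. q z *\<^sub>C x)) - \<Psi> q d" "\<Psi> q d - R x (\<Psi> q)"] by (simp add: norm_minus_commute)
    then show "cmod (R x (\<Psi> q) - l (e0 (%z. q z *\<^sub>C x))) <= 0 + e" using 1 2 e'(2) by linarith
  qed
  then show ?thesis by simp
qed

lemma R_\<Psi>1:
  assumes q: "tf q" and x: "x \<in> A1" shows "R x (\<Psi> q) = - l (e1 (%z. q z *\<^sub>C x))"
proof -
  obtain B where B: "!!t. cmod (q (bnd 0 t)) <= B" "!!t. cmod (q (bnd 1 t)) <= B" using tf_bound[OF q] by blast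
  have B0: "0 <= B" using order_trans[OF norm_ge_zero B(1)] .
  note W = \<Psi>_W[OF q B]
  have "cmod (R x (\<Psi> q) - - l (e1 (%z. q z *\<^sub>C x))) <= 0"
  proof (rule field_le_epsilon)
    fix e :: real assume e: "e > 0"
    define e' where "e' = e / (2 * B + 1)"
    have e': "e' > 0" "2 * B * e' <= e" using e B0 by (auto simp: e'_def field_simps)
    obtain d where d: "d \<in> D" "N1 (x - d) < e'" using dense1'[OF x e'(1)] .
    have xd: "x - d \<in> A1" by (intro a.c1.mem_diff x DD(2)[OF d(1)])
    have "e1 (%z. q z *\<^sub>C (x - d)) = e1 (%z. q z *\<^sub>C x) - e1 (%z. q z *\<^sub>C d)"
      unfolding e1_lin(1)[symmetric] by (simp add: cvec.scale_right_diff_distrib)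
    then have "- l (e1 (%z. q z *\<^sub>C x)) - \<Psi> q d = - l (e1 (%z. q z *\<^sub>C (x - d)))"
      using d(1) \<Psi>_alt[OF q d(1)] clinear_on_diff[OF a.csubspace_bV l_lin e1_scal(1)[where q = q and B = B, OF x B(2)] e1_scal(1)[where q = q and B = B, OF DD(2)[OF d(1)] B(2)]] by (simp add: \<Psi>_def)
    then have 1: "cmod (- l (e1 (%z. q z *\<^sub>C x)) - \<Psi> q d) <= B * e'"
      using e1_scal(2)[where q = q and B = B, OF xd B(2)] mult_left_mono[OF less_imp_le[OF d(2)] B0] by simp
    have "cmod (\<Psi> q d - R x (\<Psi> q)) <= p.nn (\<Psi> q) * a.SN (x - d)" by (rule R_char[OF a.S1[OF x] W(1) d(1)])
    also have "\<dots> <= B * e'"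
      using a.SN1[OF xd] d(2) a.s.N_nonneg[OF a.S1[OF xd]] B0 by (intro mult_mono W(2)) auto
    finally have 2: "cmod (\<Psi> q d - R x (\<Psi> q)) <= B * e'" .
    have "cmod (R x (\<Psi> q) - - l (e1 (%z. q z *\<^sub>C x))) <= cmod (- l (e1 (%z. q z *\<^sub>C x)) - \<Psi> q d) + cmod (\<Psi> q d - R x (\<Psi> q))"
      using norm_triangle_ineq[of "- l (e1 (%z. q z *\<^sub>C x)) - \<Psi> q d" "\<Psi> q d - R x (\<Psi> q)"]
        norm_minus_commute[of "- l (e1 (%z. q z *\<^sub>C x))" "R x (\<Psi> q)"] unfolding diff_add_cancel add_diff_eq by linarith
    then show "cmod (R x (\<Psi> q) - - l (e1 (%z. q z *\<^sub>C x))) <= 0 + e" using 1 2 e'(2) by linarith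
  qed
  then show ?thesis by (simp add: add_eq_0_iff)
qed

section \<open>The kernel\<close>

text \<open>A factor with a zero at \<open>\<theta>\<close>, modulus at most \<open>1\<close> on the
  strip and a bounded inverse on the boundary. The shift by \<open>2\<close> keeps the pole off the
  strip.\<close>

definition Q :: "complex => complex" where "Q z = (z - of_real \<theta>) / (z + 2)"

definition ker :: "nat => complex => complex => complex" where "ker i w = (%z. Q z * cgauss i b (z - w))"

definition K :: "complex => 'v => complex" where "K w = \<Psi> (ker 0 w)"

lemma strip_nz: "z \<in> strip ==> z + 2 \<noteq> 0"
  by (auto simp: strip_def complex_eq_iff)

lemma Q_le: assumes z: "z \<in> strip" shows "cmod (Q z) <= 1"
proof -
  have "(Re z - \<theta>)\<^sup>2 <= (Re z + 2)\<^sup>2"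
    using z \<theta> by (intro power2_le_iff_abs_le[THEN iffD2]) (auto simp: strip_def)
  then have "cmod (z - of_real \<theta>) <= cmod (z + 2)" by (simp add: cmod_def)
  then show ?thesis using strip_nz[OF z] by (simp add: Q_def norm_divide divide_le_eq)
qed

lemma Q_bnd: "Q (bnd 0 t) \<noteq> 0" "Q (bnd 1 t) \<noteq> 0"
proof -
  have "bnd 0 t - of_real \<theta> \<noteq> 0" "bnd 1 t - of_real \<theta> \<noteq> 0" using \<theta> by (auto simp: complex_eq_iff)
  then show "Q (bnd 0 t) \<noteq> 0" "Q (bnd 1 t) \<noteq> 0" using strip_nz[OF bnd_strip(1)] strip_nz[OF bnd_strip(2)] by (auto simp: Q_def)
qed

lemma strip_diff: "z \<in> strip ==> w \<in> strip ==> \<bar>Re (z - w)\<bar> <= 1"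
  by (auto simp: strip_def)

lemma ker_le: "z \<in> strip ==> cmod (ker i w z) <= cmod (cgauss i b (z - w))"
  unfolding ker_def norm_mult using Q_le by (simp add: mult_left_le_one_le)

lemma decay_at_infinity: "((%t. c * ((2 + \<bar>t - y\<bar>) * exp (- b * (t - y)\<^sup>2))) \<longlongrightarrow> 0) at_infinity" for c y :: real
  unfolding at_infinity_eq_at_top_bot using b by (intro filterlim_sup) real_asymp+

lemma tf_ker: assumes i: "i <= 1" and w: "w \<in> strip" shows "tf (ker i w)"
  unfolding tf_def
proof (intro conjI)
  have Qh: "Q holomorphic_on strip" unfolding Q_def by (intro holomorphic_intros) (use strip_nz in auto)
  have g: "(%z. cgauss i b (z - w)) holomorphic_on strip"
    by (rule holomorphic_on_compose[of "%z. z - w" strip "cgauss i b", unfolded o_def]) (intro holomorphic_intros, rule cgauss_hol[OF i])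
  have h: "ker i w holomorphic_on strip" unfolding ker_def by (intro holomorphic_intros Qh g)
  show "continuous_on strip (ker i w)" using h holomorphic_on_imp_continuous_on by blast
  show "ker i w holomorphic_on ostrip" using h ostrip_subset_strip holomorphic_on_subset by blast
  obtain E where E: "!!i u. i <= 2 ==> \<bar>Re u\<bar> <= 1 ==> cmod (cgauss i b u) <= E" using cgauss_bounded[OF b] by blast
  have "cmod (ker i w z) <= E" if "z \<in> strip" for z
    by (rule order_trans[OF ker_le[OF that] E]) (use i strip_diff[OF that w] in auto)
  then show "\<exists>B. \<forall>z\<in>strip. cmod (ker i w z) <= B" by blast
  define c where "c = gauss_const * sqrt b * exp b * (2 * b + 1)"
  have le: "cmod (ker i w (bnd j t)) <= c * ((2 + \<bar>t - Im w\<bar>) * exp (- b * (t - Im w)\<^sup>2))" if j: "bnd j t \<in> strip" for j t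
    using order_trans[OF ker_le[OF j] cgauss_decay[OF b i strip_diff[OF j w]]] by (simp add: c_def)
  show "((%t. ker i w (bnd 0 t)) \<longlongrightarrow> 0) at_infinity"
    by (rule Lim_null_comparison[OF always_eventually[OF allI] decay_at_infinity]) (rule le, simp)
  show "((%t. ker i w (bnd 1 t)) \<longlongrightarrow> 0) at_infinity"
    by (rule Lim_null_comparison[OF always_eventually[OF allI] decay_at_infinity]) (rule le, rule bnd_strip)
  show "ker i w (of_real \<theta>) = 0" by (simp add: ker_def Q_def)
qed

text \<open>\<open>\<Psi>\<close> turns bounds on multipliers into bounds in the intersection norm.
  The mean value and Taylor estimates for the scalar Gaussian therefore give Lipschitz continuity
  and differentiability of \<open>K\<close>.\<close>

lemma K_hol: "p.wn.hol_strip K" "\<exists>B. \<forall>z\<in>strip. p.nn (K z) <= B"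
proof -
  obtain E where E0: "E >= 0" and E: "!!i u. i <= 2 ==> \<bar>Re u\<bar> <= 1 ==> cmod (cgauss i b u) <= E" using cgauss_bounded[OF b] by blast
  have tk: "tf (ker 0 w)" if "w \<in> strip" for w using tf_ker[OF _ that] by simp
  have kE: "cmod (ker i w z) <= E" if "z \<in> strip" "w \<in> strip" "i <= 2" for i z w
    using order_trans[OF ker_le[OF that(1)] E[OF that(3) strip_diff[OF that(1,2)]]] .
  have KW: "K w \<in> W" and KE: "p.nn (K w) <= E" if "w \<in> strip" for w
    unfolding K_def using \<Psi>_W[OF tk[OF that] kE[OF bnd_strip(1) that] kE[OF bnd_strip(2) that]] by auto
  show "\<exists>B. \<forall>z\<in>strip. p.nn (K z) <= B" using KE by blast
  have lip: "p.nn (K w - K z) <= E * dist w z" if zw: "z \<in> strip" "w \<in> strip" for z w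
  proof -
    have g: "cmod (ker 0 w u - 1 * ker 0 z u) <= E * dist w z" if u: "u \<in> strip" for u
    proof -
      have "cmod (cgauss 0 b (u - w) - cgauss 0 b (u - z)) <= E * cmod ((u - w) - (u - z))"
        by (rule field_differentiable_bound[OF convex_abs_Re cgauss_deriv]) (use E[of "Suc 0"] strip_diff[OF u zw(1)] strip_diff[OF u zw(2)] in auto)
      then have "cmod (Q u) * cmod (cgauss 0 b (u - w) - cgauss 0 b (u - z)) <= 1 * (E * cmod ((u - w) - (u - z)))"
        by (intro mult_mono Q_le u) auto
      moreover have "ker 0 w u - 1 * ker 0 z u = Q u * (cgauss 0 b (u - w) - cgauss 0 b (u - z))"
        by (simp add: ker_def algebra_simps)
      ultimately show ?thesis by (simp add: norm_mult dist_norm norm_minus_commute)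
    qed
    have "K w - K z = \<Psi> (%u. ker 0 w u - 1 * ker 0 z u)"
      unfolding K_def \<Psi>_combine[OF tk[OF zw(2)] tk[OF zw(1)]] by (simp add: scaleC_one)
    then show ?thesis
      using \<Psi>_W(2)[OF tf_combine[OF tk[OF zw(2)] tk[OF zw(1)], of 1] g[OF bnd_strip(1)] g[OF bnd_strip(2)]] by simp
  qed
  show "p.wn.hol_strip K"
    unfolding p.wn.hol_strip_def
  proof (intro conjI ballI)
    show "z \<in> strip ==> K z \<in> W" for z by (rule KW)
    show "ncont_on p.nn strip K" by (rule p.wn.ncont_on_lipschitz[OF KW lip])
    fix z assume z: "z \<in> ostrip"
    then have zs: "z \<in> strip" using ostrip_subset_strip by blast
    obtain e where e: "e > 0" "ball z e \<subseteq> ostrip" using open_ostrip z open_contains_ball by blast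
    have t1: "tf (ker 1 z)" using tf_ker[OF _ zs] by simp
    \<comment> \<open>The minus sign comes from differentiating \<open>z - w\<close> with respect to
      \<open>w\<close>.\<close>
    have dW: "(-1) *\<^sub>C \<Psi> (ker 1 z) \<in> W"
      using \<Psi>_W(1)[OF t1 kE[OF bnd_strip(1) zs] kE[OF bnd_strip(2) zs]] p.wn.mem_scale p.wn.mem_neg by simp
    have "has_nderiv p.nn K z ((-1) *\<^sub>C \<Psi> (ker 1 z))"
    proof (rule p.wn.nderiv_from_quadratic[where r = "e/2" and c = E])
      fix k :: complex assume k: "cmod k <= e/2"
      have zk: "z + k \<in> strip" using k e ostrip_subset_strip by (auto simp: dist_norm subset_iff)
      show "K (z + k) \<in> W" by (rule KW[OF zk])
      define r where "r = (%u. (ker 0 (z + k) u - 1 * ker 0 z u) - (- k) * ker 1 z u)"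
      have tr: "tf r" unfolding r_def by (intro tf_combine tk zk zs t1)
      have g: "cmod (r u) <= E * (cmod k)\<^sup>2" if u: "u \<in> strip" for u
      proof -
        have "cmod (cgauss 0 b (u - (z + k)) - (\<Sum>i\<le>1. cgauss i b (u - z) * ((u - (z + k)) - (u - z)) ^ i / fact i))
          <= E * cmod ((u - (z + k)) - (u - z)) ^ Suc 1 / fact 1"
          by (rule field_Taylor[where f = "%i. cgauss i b" and n = 1, OF convex_abs_Re cgauss_deriv]) (use E[of "Suc 1"] strip_diff[OF u zs] strip_diff[OF u zk] in auto)
        then have "cmod (cgauss 0 b (u - (z + k)) - (cgauss 0 b (u - z) - k * cgauss 1 b (u - z))) <= E * (cmod k)\<^sup>2"
          by (simp add: algebra_simps power2_eq_square)
        then have "cmod (Q u) * cmod (cgauss 0 b (u - (z + k)) - (cgauss 0 b (u - z) - k * cgauss 1 b (u - z))) <= 1 * (E * (cmod k)\<^sup>2)"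
          by (intro mult_mono Q_le u) auto
        moreover have "r u = Q u * (cgauss 0 b (u - (z + k)) - (cgauss 0 b (u - z) - k * cgauss 1 b (u - z)))"
          by (simp add: r_def ker_def algebra_simps)
        ultimately show ?thesis by (simp add: norm_mult)
      qed
      have "\<Psi> r = K (z + k) - K z - (- k) *\<^sub>C \<Psi> (ker 1 z)"
        unfolding r_def K_def \<Psi>_combine[OF tf_combine[OF tk[OF zk] tk[OF zs]] t1] \<Psi>_combine[OF tk[OF zk] tk[OF zs]] by (simp add: scaleC_one)
      then have "\<Psi> r = K (z + k) - K z - k *\<^sub>C (-1) *\<^sub>C \<Psi> (ker 1 z)" by (simp add: scaleC_scaleC)
      then show "p.nn (K (z + k) - K z - k *\<^sub>C (-1) *\<^sub>C \<Psi> (ker 1 z)) <= E * (cmod k)\<^sup>2"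
        using \<Psi>_W(2)[OF tr g[OF bnd_strip(1)] g[OF bnd_strip(2)]] by simp
    qed (use e dW in auto)
    then show "\<exists>d\<in>W. has_nderiv p.nn K z d" using dW by blast
  qed
qed

lemma ker_bnd: "ker 0 (bnd j s) (bnd j t) = Q (bnd j t) * of_real (gauss b (t - s))"
proof -
  have "bnd j t - bnd j s = \<i> * of_real (t - s)" by (simp add: bnd_def algebra_simps)
  then show ?thesis by (simp only: ker_def cgauss_imag)
qed

text \<open>A finite sum of pairings along the left line is a single value of \<open>l\<close>, so a
  sup bound on one boundary function bounds the whole sum.\<close>

lemma sum0:
  assumes x: "!!k. k < m ==> x k \<in> A0"
  shows "e0 (%z. \<Sum>k<m. (c k * ker 0 (bnd 0 (s k)) z) *\<^sub>C x k) \<in> a.bV"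
    "(\<Sum>k<m. c k * R (x k) (K (bnd 0 (s k)))) = l (e0 (%z. \<Sum>k<(m::nat). (c k * ker 0 (bnd 0 (s k)) z) *\<^sub>C x k))"
proof -
  have t: "tf (ker 0 (bnd 0 (s k)))" for k by (rule tf_ker) auto
  have E: "e0 (%z. ker 0 (bnd 0 (s k)) z *\<^sub>C x k) \<in> a.bV" if "k < m" for k
  proof -
    obtain B where B: "!!t. cmod (ker 0 (bnd 0 (s k)) (bnd 0 t)) <= B" "!!t. cmod (ker 0 (bnd 0 (s k)) (bnd 1 t)) <= B"
      using tf_bound[OF t[of k]] by blast
    show ?thesis by (rule e0_scal(1)[where q = "ker 0 (bnd 0 (s k))", OF x[OF that] B(1)])
  qed
  have e: "e0 (%z. \<Sum>k<m. (c k * ker 0 (bnd 0 (s k)) z) *\<^sub>C x k) = (\<Sum>k<m. c k *\<^sub>C e0 (%z. ker 0 (bnd 0 (s k)) z *\<^sub>C x k))"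
    unfolding e0_lin(4) e0_lin(2)[symmetric] by (simp add: scaleC_scaleC)
  have cE: "c k *\<^sub>C e0 (%z. ker 0 (bnd 0 (s k)) z *\<^sub>C x k) \<in> a.bV" if "k \<in> {..<m}" for k
    by (rule csubspace_scale[OF a.csubspace_bV E]) (use that in simp)
  show "e0 (%z. \<Sum>k<m. (c k * ker 0 (bnd 0 (s k)) z) *\<^sub>C x k) \<in> a.bV"
    unfolding e by (rule csubspace_sum[OF a.csubspace_bV cE])
  have l: "l (\<Sum>k<m. c k *\<^sub>C e0 (%z. ker 0 (bnd 0 (s k)) z *\<^sub>C x k)) = (\<Sum>k<m. l (c k *\<^sub>C e0 (%z. ker 0 (bnd 0 (s k)) z *\<^sub>C x k)))"
    by (rule clinear_on_sum[OF a.csubspace_bV l_lin cE])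
  show "(\<Sum>k<m. c k * R (x k) (K (bnd 0 (s k)))) = l (e0 (%z. \<Sum>k<m. (c k * ker 0 (bnd 0 (s k)) z) *\<^sub>C x k))"
    unfolding e l
    by (rule sum.cong[OF refl]) (use clinear_onD(2)[OF l_lin E] R_\<Psi>0[OF t x] in \<open>simp add: K_def\<close>)
qed

lemma sum1:
  assumes x: "!!k. k < m ==> x k \<in> A1"
  shows "e1 (%z. \<Sum>k<m. (c k * ker 0 (bnd 1 (s k)) z) *\<^sub>C x k) \<in> a.bV"
    "(\<Sum>k<m. c k * R (x k) (K (bnd 1 (s k)))) = - l (e1 (%z. \<Sum>k<(m::nat). (c k * ker 0 (bnd 1 (s k)) z) *\<^sub>C x k))"
proof -
  have t: "tf (ker 0 (bnd 1 (s k)))" for k by (rule tf_ker[OF _ bnd_strip(2)]) auto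
  have E: "e1 (%z. ker 0 (bnd 1 (s k)) z *\<^sub>C x k) \<in> a.bV" if "k < m" for k
  proof -
    obtain B where B: "!!t. cmod (ker 0 (bnd 1 (s k)) (bnd 0 t)) <= B" "!!t. cmod (ker 0 (bnd 1 (s k)) (bnd 1 t)) <= B"
      using tf_bound[OF t[of k]] by blast
    show ?thesis by (rule e1_scal(1)[where q = "ker 0 (bnd 1 (s k))", OF x[OF that] B(2)])
  qed
  have e: "e1 (%z. \<Sum>k<m. (c k * ker 0 (bnd 1 (s k)) z) *\<^sub>C x k) = (\<Sum>k<m. c k *\<^sub>C e1 (%z. ker 0 (bnd 1 (s k)) z *\<^sub>C x k))"
    unfolding e1_lin(3) e1_lin(2)[symmetric] by (simp add: scaleC_scaleC)
  have cE: "c k *\<^sub>C e1 (%z. ker 0 (bnd 1 (s k)) z *\<^sub>C x k) \<in> a.bV" if "k \<in> {..<m}" for k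
    by (rule csubspace_scale[OF a.csubspace_bV E]) (use that in simp)
  show "e1 (%z. \<Sum>k<m. (c k * ker 0 (bnd 1 (s k)) z) *\<^sub>C x k) \<in> a.bV"
    unfolding e by (rule csubspace_sum[OF a.csubspace_bV cE])
  have l: "l (\<Sum>k<m. c k *\<^sub>C e1 (%z. ker 0 (bnd 1 (s k)) z *\<^sub>C x k)) = (\<Sum>k<m. l (c k *\<^sub>C e1 (%z. ker 0 (bnd 1 (s k)) z *\<^sub>C x k)))"
    by (rule clinear_on_sum[OF a.csubspace_bV l_lin cE])
  show "(\<Sum>k<m. c k * R (x k) (K (bnd 1 (s k)))) = - l (e1 (%z. \<Sum>k<m. (c k * ker 0 (bnd 1 (s k)) z) *\<^sub>C x k))"
    unfolding e l sum_negf[symmetric]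
    by (rule sum.cong[OF refl]) (use clinear_onD(2)[OF l_lin E] R_\<Psi>1[OF t x] in \<open>simp add: K_def\<close>)
qed

end

lemma (in interp) R_bound:
  assumes x: "x \<in> a.S" and \<phi>: "\<phi> \<in> W" shows "cmod (R x \<phi>) <= a.SN x * p.nn \<phi>"
  by (rule order_trans[OF p.sum_bound[OF R_sum(1)[OF x] \<phi>] mult_right_mono[OF R_sum(2)[OF x] p.nn_nonneg[OF \<phi>]]])

lemma (in cnorm) dnorm_approx_ex:
  assumes f: "f \<in> dual_on C N" and e: "e > 0"
  shows "\<exists>x. x \<in> C \<and> N x <= 1 \<and> dnorm C N f <= cmod (f x) + e"
  by (rule dnorm_approx[OF assms]) (intro exI conjI)

lemma cnj_sgn: "cnj (sgn v) * v = of_real (cmod v)" "cmod (cnj (sgn v)) <= 1"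
proof -
  have "cnj (sgn v) * v = (v * cnj v) / of_real (cmod v)" by (simp add: sgn_eq)
  also have "\<dots> = of_real (cmod v)" unfolding complex_norm_square[symmetric] by (simp add: power2_eq_square)
  finally show "cnj (sgn v) * v = of_real (cmod v)" .
  show "cmod (cnj (sgn v)) <= 1" by (simp add: norm_sgn)
qed

lemma node_sum_tendsto:
  fixes f :: "real => 'a::banach"
  assumes c: "continuous_on UNIV f" and T: "T >= 0"
  shows "(%m. \<Sum>k<m. (2 * T / real m) *\<^sub>R f (node T m k)) \<longlonglongrightarrow> integral {-T..T} f"
proof -
  have e: "T - - T = 2 * T" by simp
  show ?thesis
    using riemann_sum_tendsto[of "-T" T f, unfolded e] continuous_on_subset[OF c] T unfolding node_def by simp
qed

section \<open>Integrability of the kernel on the boundary\<close>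

context annihilator
begin

text \<open>A Riemann sum of the dual norms is tested with nearly norming vectors at the nodes, with
  phases aligned. By \<open>test\<close> it is controlled by the sup norm of one boundary function,
  which is at most the total Gaussian weight, since \<open>Q\<close> has modulus at most
  \<open>1\<close> on the line.\<close>

lemma kernel_integral_le:
  assumes Nj: "cnorm D Nj" and KD: "!!s. K (bnd j s) \<in> dual_on D Nj"
    and cont: "continuous_on UNIV (%s. dnorm D Nj (K (bnd j s)))" and QB: "!!t. cmod (Q (bnd j t)) <= 1"
    and test: "!!(m::nat) c s x B. (!!k. k < m ==> x k \<in> D) ==>
      (!!t. Nj (\<Sum>k<m. (c k * ker 0 (bnd j (s k)) (bnd j t)) *\<^sub>C x k) <= B) ==> cmod (\<Sum>k<m. c k * K (bnd j (s k)) (x k)) <= B"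
    and T: "T >= 0"
  shows "integral {-T..T} (%s. dnorm D Nj (K (bnd j s))) <= 1"
proof (rule field_le_epsilon)
  interpret c: cnorm D Nj by (rule Nj)
  fix e :: real assume e: "e > 0"
  \<comment> \<open>One share \<open>e'\<close> pays for the Gaussian weight, the other, multiplied
    by the length \<open>2 * T\<close>, for the nearly norming vectors.\<close>
  define e' where "e' = e / (1 + 2 * T)"
  have "e' * (1 + 2 * T) = e" "e' > 0" using e T by (simp_all add: e'_def)
  then have e': "e' > 0" "e' + 2 * T * e' = e" by (simp_all add: algebra_simps)
  obtain M where M: "!!m t. m >= M ==> (\<Sum>k<m. (2 * T / real m) * gauss b (t - node T m k)) <= 1 + e'"
    using gauss_sum_le[OF b T e'(1)] by blast
  have "(\<Sum>k<m. (2 * T / real m) *\<^sub>R dnorm D Nj (K (bnd j (node T m k)))) <= 1 + e" if m: "m >= M" for m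
  proof -
    define s where "s = node T m"
    define h where "h = 2 * T / real m"
    have h: "h >= 0" "real m * h <= 2 * T" using T by (auto simp: h_def)
    have "\<forall>k. \<exists>x. x \<in> D \<and> Nj x <= 1 \<and> dnorm D Nj (K (bnd j (s k))) <= cmod (K (bnd j (s k)) x) + e'"
      using c.dnorm_approx_ex[OF KD e'(1)] by blast
    then obtain x where x: "!!k. x k \<in> D" "!!k. Nj (x k) <= 1" "!!k. dnorm D Nj (K (bnd j (s k))) <= cmod (K (bnd j (s k)) (x k)) + e'"
      by metis
    define v where "v = (%k. K (bnd j (s k)) (x k))"
    define c where "c = (%k. of_real h * cnj (sgn (v k)))"
    have "cmod (\<Sum>k<m. c k * K (bnd j (s k)) (x k)) <= 1 + e'"
    proof (rule test)
      fix t
      have "Nj (\<Sum>k<m. (c k * ker 0 (bnd j (s k)) (bnd j t)) *\<^sub>C x k) <= (\<Sum>k<m. Nj ((c k * ker 0 (bnd j (s k)) (bnd j t)) *\<^sub>C x k))"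
        by (rule c.N_sum) (rule c.mem_scale[OF x(1)])
      also have "\<dots> <= (\<Sum>k<m. h * gauss b (t - s k))"
      proof (rule sum_mono)
        fix k
        have g: "0 <= gauss b (t - s k)" using gauss_nonneg b by simp
        have "Nj ((c k * ker 0 (bnd j (s k)) (bnd j t)) *\<^sub>C x k) = cmod (c k * ker 0 (bnd j (s k)) (bnd j t)) * Nj (x k)"
          by (rule c.N_scale[OF x(1)])
        also have "\<dots> = (h * gauss b (t - s k)) * (cmod (cnj (sgn (v k))) * (cmod (Q (bnd j t)) * Nj (x k)))"
          using h g by (simp add: c_def ker_bnd norm_mult)
        also have "\<dots> <= (h * gauss b (t - s k)) * (1 * (1 * 1))"
          by (intro mult_left_mono mult_mono cnj_sgn(2) QB x(2) mult_nonneg_nonneg h g c.N_nonneg x(1)) auto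
        finally show "Nj ((c k * ker 0 (bnd j (s k)) (bnd j t)) *\<^sub>C x k) <= h * gauss b (t - s k)" by simp
      qed
      also have "\<dots> <= 1 + e'" using M[OF m, of t] by (simp add: h_def s_def)
      finally show "Nj (\<Sum>k<m. (c k * ker 0 (bnd j (s k)) (bnd j t)) *\<^sub>C x k) <= 1 + e'" .
    qed (rule x(1))
    moreover have "(\<Sum>k<m. c k * K (bnd j (s k)) (x k)) = of_real (\<Sum>k<m. h * cmod (v k))"
    proof -
      have vk: "K (bnd j (s k)) (x k) = v k" for k by (simp add: v_def)
      show ?thesis unfolding of_real_sum c_def vk mult.assoc of_real_mult cnj_sgn(1) ..
    qed
    moreover have "0 <= (\<Sum>k<m. h * cmod (v k))" using h by (intro sum_nonneg) auto
    ultimately have 1: "(\<Sum>k<m. h * cmod (v k)) <= 1 + e'" by (simp only: norm_of_real abs_of_nonneg)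
    have "(\<Sum>k<m. h * dnorm D Nj (K (bnd j (s k)))) <= (\<Sum>k<m. h * (cmod (v k) + e'))"
      unfolding v_def by (intro sum_mono mult_left_mono x(3) h)
    also have "\<dots> = (\<Sum>k<m. h * cmod (v k)) + real m * h * e'" by (simp add: distrib_left sum.distrib)
    also have "\<dots> <= (1 + e') + 2 * T * e'" using 1 h(2) e'(1) by (intro add_mono mult_right_mono) auto
    finally show ?thesis using e'(2) unfolding h_def s_def by simp
  qed
  then show "integral {-T..T} (%s. dnorm D Nj (K (bnd j s))) <= 1 + e"
    by (intro LIMSEQ_le_const2[OF node_sum_tendsto[OF cont T]]) blast
qed

lemma K_W: "z \<in> strip ==> K z \<in> W"
  using p.wn.hol_stripD(1)[OF K_hol(1)] .

lemma K_kern: "p.kern K"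
  unfolding p.kern_def
proof (intro conjI allI impI K_hol)
  fix T :: real assume T: "0 <= T"
  show "integral {-T..T} (%s. n0 (K (bnd 0 s))) <= 1"
    unfolding n0_def
  proof (rule kernel_integral_le[OF d0.cnorm_axioms _ _ Q_le[OF bnd_strip(1)] _ T])
    show "K (bnd 0 s) \<in> dual_on D N0" for s using K_W[OF bnd_strip(1)] unfolding W_def by blast
    show "continuous_on UNIV (%s. dnorm D N0 (K (bnd 0 s)))" using p.kern_continuous(1)[OF K_hol(1)] unfolding n0_def .
    fix m :: nat and c s and x :: "nat => 'v" and B
    assume x: "!!k. k < m ==> x k \<in> D" and le: "!!t. N0 (\<Sum>k<m. (c k * ker 0 (bnd 0 (s k)) (bnd 0 t)) *\<^sub>C x k) <= B"
    have xA: "!!k. k < m ==> x k \<in> A0" using x DD(1) by blast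
    have "(\<Sum>k<m. c k * K (bnd 0 (s k)) (x k)) = (\<Sum>k<m. c k * R (x k) (K (bnd 0 (s k))))"
      by (rule sum.cong[OF refl]) (use R_D[OF x K_W[OF bnd_strip(1)]] in simp)
    also have "\<dots> = l (e0 (%z. \<Sum>k<m. (c k * ker 0 (bnd 0 (s k)) z) *\<^sub>C x k))" by (rule sum0(2)[OF xA])
    finally show "cmod (\<Sum>k<m. c k * K (bnd 0 (s k)) (x k)) <= B"
      using e0_bV(2)[where u = "%z. \<Sum>k<m. (c k * ker 0 (bnd 0 (s k)) z) *\<^sub>C x k", OF a.c0.mem_sum[OF a.c0.mem_scale[OF xA]] le] by simp
  qed
  show "integral {-T..T} (%s. n1 (K (bnd 1 s))) <= 1"
    unfolding n1_def
  proof (rule kernel_integral_le[OF d1.cnorm_axioms _ _ Q_le[OF bnd_strip(2)] _ T])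
    show "K (bnd 1 s) \<in> dual_on D N1" for s using K_W[OF bnd_strip(2)] unfolding W_def by blast
    show "continuous_on UNIV (%s. dnorm D N1 (K (bnd 1 s)))" using p.kern_continuous(2)[OF K_hol(1)] unfolding n1_def .
    fix m :: nat and c s and x :: "nat => 'v" and B
    assume x: "!!k. k < m ==> x k \<in> D" and le: "!!t. N1 (\<Sum>k<m. (c k * ker 0 (bnd 1 (s k)) (bnd 1 t)) *\<^sub>C x k) <= B"
    have xA: "!!k. k < m ==> x k \<in> A1" using x DD(2) by blast
    have "(\<Sum>k<m. c k * K (bnd 1 (s k)) (x k)) = (\<Sum>k<m. c k * R (x k) (K (bnd 1 (s k))))"
      by (rule sum.cong[OF refl]) (use R_D[OF x K_W[OF bnd_strip(2)]] in simp)
    also have "\<dots> = - l (e1 (%z. \<Sum>k<m. (c k * ker 0 (bnd 1 (s k)) z) *\<^sub>C x k))" by (rule sum1(2)[OF xA])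
    finally show "cmod (\<Sum>k<m. c k * K (bnd 1 (s k)) (x k)) <= B"
      using e1_bV(2)[where u = "%z. \<Sum>k<m. (c k * ker 0 (bnd 1 (s k)) z) *\<^sub>C x k", OF a.c1.mem_sum[OF a.c1.mem_scale[OF xA]] le] by simp
  qed
qed

section \<open>Recovering the functional from its kernel\<close>

text \<open>A Riemann sum for the convolution of a Gaussian with \<open>f\<close> cut off to
  \<open>{-T..T}\<close>.\<close>

definition smear :: "(real => 'v) => real => real => nat => real => 'v" where
  "smear f c T m t = (\<Sum>k<m. of_real ((2 * T / real m) * gauss c (t - node T m k)) *\<^sub>C f (node T m k))"

text \<open>Dividing by \<open>Q\<close> compensates the factor \<open>Q\<close> inside
  \<open>ker\<close>, so smearing the quotient with the kernel reproduces \<open>F\<close> on the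
  line.\<close>

definition quot :: "(complex => 'v) => nat => real => 'v" where
  "quot F j t = (1 / Q (bnd j t)) *\<^sub>C F (bnd j t)"

lemma Q_quot: "Q (bnd j t) \<noteq> 0 ==> Q (bnd j t) *\<^sub>C quot F j t = F (bnd j t)"
  by (simp add: quot_def scaleC_scaleC scaleC_one)

lemma Q_bnd_continuous: "continuous_on UNIV (%t. 1 / Q (bnd 0 t))" "continuous_on UNIV (%t. 1 / Q (bnd 1 t))"
proof -
  have "bnd 0 t + 2 \<noteq> 0" "bnd 1 t + 2 \<noteq> 0" for t using strip_nz[OF bnd_strip(1)] strip_nz[OF bnd_strip(2)] by blast+
  then show "continuous_on UNIV (%t. 1 / Q (bnd 0 t))" "continuous_on UNIV (%t. 1 / Q (bnd 1 t))"
    using Q_bnd unfolding Q_def bnd_def by (auto intro!: continuous_intros)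
qed

lemma inv_Q_bound: "\<exists>C\<ge>0. \<forall>t. cmod (1 / Q (bnd 0 t)) <= C \<and> cmod (1 / Q (bnd 1 t)) <= C"
proof -
  define d where "d = min \<theta> (1 - \<theta>)"
  have d: "d > 0" using \<theta> by (simp add: d_def)
  have *: "cmod (1 / Q z) <= 1 + 3 / d" if z: "d <= cmod (z - of_real \<theta>)" for z
  proof -
    have nz: "z - of_real \<theta> \<noteq> 0" using z d by auto
    have "1 / Q z = 1 + (2 + of_real \<theta>) / (z - of_real \<theta>)" using nz by (simp add: Q_def field_simps)
    moreover have "cmod ((2 + of_real \<theta>) / (z - of_real \<theta>)) <= 3 / d"
    proof -
      have "cmod (2 + of_real \<theta>) <= 3" using norm_triangle_ineq[of 2 "complex_of_real \<theta>"] \<theta> by simp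
      then show ?thesis unfolding norm_divide using z d by (intro frac_le) auto
    qed
    ultimately show ?thesis using norm_triangle_ineq[of 1 "(2 + of_real \<theta>) / (z - of_real \<theta>)"] by simp
  qed
  have "d <= cmod (bnd 0 t - of_real \<theta>)" "d <= cmod (bnd 1 t - of_real \<theta>)" for t
    using abs_Re_le_cmod[of "bnd 0 t - of_real \<theta>"] abs_Re_le_cmod[of "bnd 1 t - of_real \<theta>"] \<theta> by (auto simp: d_def)
  then have "\<forall>t. cmod (1 / Q (bnd 0 t)) <= 1 + 3 / d \<and> cmod (1 / Q (bnd 1 t)) <= 1 + 3 / d" using * by blast
  moreover have "0 <= 1 + 3 / d" using d by simp
  ultimately show ?thesis by blast
qed

lemma quot_approx:
  assumes F: "F \<in> a.Fs" and \<epsilon>: "\<epsilon> > 0"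
  shows "\<exists>b0>0. \<forall>c\<ge>b0. \<exists>T0>0. \<forall>T\<ge>T0. \<exists>M. \<forall>m\<ge>M. \<forall>t. N0 (smear (quot F 0) c T m t - quot F 0 t) <= \<epsilon>"
    "\<exists>b0>0. \<forall>c\<ge>b0. \<exists>T0>0. \<forall>T\<ge>T0. \<exists>M. \<forall>m\<ge>M. \<forall>t. N1 (smear (quot F 1) c T m t - quot F 1 t) <= \<epsilon>"
proof -
  note f = a.FsD[OF F]
  obtain C where C: "C >= 0" "!!t. cmod (1 / Q (bnd 0 t)) <= C" "!!t. cmod (1 / Q (bnd 1 t)) <= C" using inv_Q_bound by blast
  show "\<exists>b0>0. \<forall>c\<ge>b0. \<exists>T0>0. \<forall>T\<ge>T0. \<exists>M. \<forall>m\<ge>M. \<forall>t. N0 (smear (quot F 0) c T m t - quot F 0 t) <= \<epsilon>"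
    unfolding smear_def
  proof (rule a.c0.gauss_approx[OF _ _ _ \<epsilon>])
    show m: "quot F 0 t \<in> A0" for t unfolding quot_def by (rule a.c0.mem_scale[OF f(3)])
    show "ncont_on N0 UNIV (quot F 0)"
      using a.c0.ncont_on_mult[OF f(5) f(3) Q_bnd_continuous(1)] unfolding quot_def .
    show "((%t. N0 (quot F 0 t)) \<longlongrightarrow> 0) at_infinity"
    proof (rule Lim_null_comparison[OF always_eventually[OF allI]])
      fix t
      have "N0 (quot F 0 t) = cmod (1 / Q (bnd 0 t)) * N0 (F (bnd 0 t))" unfolding quot_def by (rule a.c0.N_scale[OF f(3)])
      also have "\<dots> <= C * N0 (F (bnd 0 t))" by (rule mult_right_mono[OF C(2) a.c0.N_nonneg[OF f(3)]])
      finally show "norm (N0 (quot F 0 t)) <= C * N0 (F (bnd 0 t))" using a.c0.N_nonneg[OF m] by simp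
    qed (use tendsto_mult_left[OF f(7), of C] in simp)
  qed
  show "\<exists>b0>0. \<forall>c\<ge>b0. \<exists>T0>0. \<forall>T\<ge>T0. \<exists>M. \<forall>m\<ge>M. \<forall>t. N1 (smear (quot F 1) c T m t - quot F 1 t) <= \<epsilon>"
    unfolding smear_def
  proof (rule a.c1.gauss_approx[OF _ _ _ \<epsilon>])
    show m: "quot F 1 t \<in> A1" for t unfolding quot_def by (rule a.c1.mem_scale[OF f(4)])
    show "ncont_on N1 UNIV (quot F 1)"
      using a.c1.ncont_on_mult[OF f(6) f(4) Q_bnd_continuous(2)] unfolding quot_def .
    show "((%t. N1 (quot F 1 t)) \<longlongrightarrow> 0) at_infinity"
    proof (rule Lim_null_comparison[OF always_eventually[OF allI]])
      fix t
      have "N1 (quot F 1 t) = cmod (1 / Q (bnd 1 t)) * N1 (F (bnd 1 t))" unfolding quot_def by (rule a.c1.N_scale[OF f(4)])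
      also have "\<dots> <= C * N1 (F (bnd 1 t))" by (rule mult_right_mono[OF C(3) a.c1.N_nonneg[OF f(4)]])
      finally show "norm (N1 (quot F 1 t)) <= C * N1 (F (bnd 1 t))" using a.c1.N_nonneg[OF m] by simp
    qed (use tendsto_mult_left[OF f(8), of C] in simp)
  qed
qed

lemma smear_ker: "(\<Sum>k<m. (of_real (2 * T / real m) * ker 0 (bnd j (node T m k)) (bnd j t)) *\<^sub>C f (node T m k)) = Q (bnd j t) *\<^sub>C smear f b T m t"
  unfolding smear_def cvec.scale_sum_right scaleC_scaleC ker_bnd by (simp add: mult_ac)

lemma pairing_line:
  assumes F: "F \<in> a.Fs" and j: "!!t. bnd j t \<in> strip" "continuous_on UNIV (%t. 1 / Q (bnd j t))"
  shows "R (quot F j t) (K (bnd j t)) = (1 / Q (bnd j t)) * R (F (bnd j t)) (K (bnd j t))"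
    "continuous_on UNIV (%t. R (quot F j t) (K (bnd j t)))"
proof -
  note h = a.FsD(1)[OF F]
  show *: "R (quot F j t) (K (bnd j t)) = (1 / Q (bnd j t)) * R (F (bnd j t)) (K (bnd j t))" for t
    unfolding quot_def R_scale[OF a.s.hol_stripD(1)[OF h j(1)]] by (rule scaleC_fun_apply)
  have "continuous_on UNIV (bnd j)" unfolding bnd_def by (intro continuous_intros)
  then have "continuous_on UNIV (%t. R (F (bnd j t)) (K (bnd j t)))"
    by (rule continuous_on_compose2[OF p.pairing_hol(1)[OF R_hol[OF h] K_hol(1)]]) (use j(1) in blast)
  then show "continuous_on UNIV (%t. R (quot F j t) (K (bnd j t)))"
    unfolding * by (intro continuous_on_mult j(2))
qed

text \<open>Before the limit in \<open>m\<close>, the Riemann sum of the pairing is the value of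
  \<open>l\<close> at \<open>Q\<close> times the smeared quotient, cut off to the left line; by
  hypothesis this is uniformly close to \<open>F\<close> there.\<close>

lemma line0:
  assumes F: "F \<in> a.Fs" and T: "T >= 0" and ap: "!!m t. m >= M ==> N0 (smear (quot F 0) b T m t - quot F 0 t) <= \<epsilon>"
  shows "cmod (integral {-T..T} (%s. R (quot F 0 s) (K (bnd 0 s))) - l (e0 F)) <= \<epsilon>"
proof -
  have q: "quot F 0 t \<in> A0" for t unfolding quot_def by (rule a.c0.mem_scale[OF a.FsD(3)[OF F]])
  have *: "cmod ((\<Sum>k<m. (2 * T / real m) *\<^sub>R R (quot F 0 (node T m k)) (K (bnd 0 (node T m k)))) - l (e0 F)) <= \<epsilon>" if m: "m >= M" for m
  proof -
    define S where "S = (%z. \<Sum>k<m. (of_real (2 * T / real m) * ker 0 (bnd 0 (node T m k)) z) *\<^sub>C quot F 0 (node T m k))"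
    have s: "e0 S \<in> a.bV" "(\<Sum>k<m. of_real (2 * T / real m) * R (quot F 0 (node T m k)) (K (bnd 0 (node T m k)))) = l (e0 S)"
      unfolding S_def by (rule sum0[OF q])+
    have sm: "smear (quot F 0) b T m t - quot F 0 t \<in> A0" for t
      unfolding smear_def by (intro a.c0.mem_diff a.c0.mem_sum a.c0.mem_scale q)
    have d: "S (bnd 0 t) - F (bnd 0 t) = Q (bnd 0 t) *\<^sub>C (smear (quot F 0) b T m t - quot F 0 t)" for t
      unfolding S_def smear_ker cvec.scale_right_diff_distrib Q_quot[OF Q_bnd(1)] ..
    have "cmod (l (e0 (%z. S z - F z))) <= \<epsilon>"
    proof (rule e0_bV(2))
      show "S (bnd 0 t) - F (bnd 0 t) \<in> A0" for t unfolding d by (rule a.c0.mem_scale[OF sm])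
      show "N0 (S (bnd 0 t) - F (bnd 0 t)) <= \<epsilon>" for t
        unfolding d a.c0.N_scale[OF sm]
        using mult_right_mono[OF Q_le[OF bnd_strip(1)] a.c0.N_nonneg[OF sm], of t t] ap[OF m, of t] by simp
    qed
    then show ?thesis
      using clinear_on_diff[OF a.csubspace_bV l_lin s(1) l_split(2)[OF a.Fs_bV[OF F]]] s(2)
      unfolding e0_lin(3) scaleR_conv_of_real by simp
  qed
  have "(%m. cmod ((\<Sum>k<m. (2 * T / real m) *\<^sub>R R (quot F 0 (node T m k)) (K (bnd 0 (node T m k)))) - l (e0 F)))
    \<longlonglongrightarrow> cmod (integral {-T..T} (%s. R (quot F 0 s) (K (bnd 0 s))) - l (e0 F))"
    by (intro tendsto_norm tendsto_diff tendsto_const node_sum_tendsto T pairing_line(2)[OF F bnd_strip(1) Q_bnd_continuous(1)])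
  then show ?thesis by (rule LIMSEQ_le_const2) (use * in blast)
qed

text \<open>The sign differs from that on the left line because there the kernel represents
  \<open>l\<close>, and here its negative.\<close>

lemma line1:
  assumes F: "F \<in> a.Fs" and T: "T >= 0" and ap: "!!m t. m >= M ==> N1 (smear (quot F 1) b T m t - quot F 1 t) <= \<epsilon>"
  shows "cmod (integral {-T..T} (%s. R (quot F 1 s) (K (bnd 1 s))) + l (e1 F)) <= \<epsilon>"
proof -
  have q: "quot F 1 t \<in> A1" for t unfolding quot_def by (rule a.c1.mem_scale[OF a.FsD(4)[OF F]])
  have *: "cmod ((\<Sum>k<m. (2 * T / real m) *\<^sub>R R (quot F 1 (node T m k)) (K (bnd 1 (node T m k)))) + l (e1 F)) <= \<epsilon>" if m: "m >= M" for m
  proof -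
    define S where "S = (%z. \<Sum>k<m. (of_real (2 * T / real m) * ker 0 (bnd 1 (node T m k)) z) *\<^sub>C quot F 1 (node T m k))"
    have s: "e1 S \<in> a.bV" "(\<Sum>k<m. of_real (2 * T / real m) * R (quot F 1 (node T m k)) (K (bnd 1 (node T m k)))) = - l (e1 S)"
      unfolding S_def by (rule sum1[OF q])+
    have sm: "smear (quot F 1) b T m t - quot F 1 t \<in> A1" for t
      unfolding smear_def by (intro a.c1.mem_diff a.c1.mem_sum a.c1.mem_scale q)
    have d: "S (bnd 1 t) - F (bnd 1 t) = Q (bnd 1 t) *\<^sub>C (smear (quot F 1) b T m t - quot F 1 t)" for t
      unfolding S_def smear_ker cvec.scale_right_diff_distrib Q_quot[OF Q_bnd(2)] ..
    have "cmod (l (e1 (%z. S z - F z))) <= \<epsilon>"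
    proof (rule e1_bV(2))
      show "S (bnd 1 t) - F (bnd 1 t) \<in> A1" for t unfolding d by (rule a.c1.mem_scale[OF sm])
      show "N1 (S (bnd 1 t) - F (bnd 1 t)) <= \<epsilon>" for t
        unfolding d a.c1.N_scale[OF sm]
        using mult_right_mono[OF Q_le[OF bnd_strip(2)] a.c1.N_nonneg[OF sm], of t t] ap[OF m, of t] by simp
    qed
    moreover have "l (e1 (%z. S z - F z)) = l (e1 S) - l (e1 F)"
      unfolding e1_lin(1) by (rule clinear_on_diff[OF a.csubspace_bV l_lin s(1) l_split(3)[OF a.Fs_bV[OF F]]])
    moreover have "cmod (- l (e1 S) + l (e1 F)) = cmod (l (e1 S) - l (e1 F))" by (simp add: norm_minus_commute)
    ultimately show ?thesis unfolding scaleR_conv_of_real s(2) by simp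
  qed
  have "(%m. cmod ((\<Sum>k<m. (2 * T / real m) *\<^sub>R R (quot F 1 (node T m k)) (K (bnd 1 (node T m k)))) + l (e1 F)))
    \<longlonglongrightarrow> cmod (integral {-T..T} (%s. R (quot F 1 s) (K (bnd 1 s))) + l (e1 F))"
    by (intro tendsto_norm tendsto_add tendsto_const node_sum_tendsto T pairing_line(2)[OF F bnd_strip(2) Q_bnd_continuous(2)])
  then show ?thesis by (rule LIMSEQ_le_const2) (use * in blast)
qed

text \<open>Cauchy's formula at \<open>\<theta>\<close> identifies the difference of the two line
  integrals with 2 pi f(\<theta>), while these integrals recover the two parts of \<open>l F\<close>
  up to sign. The three errors come from the two lines and the horizontal sides.\<close>

lemma functional_le_pairing:
  assumes F: "F \<in> a.Fs" and B': "!!z. z \<in> strip ==> a.SN (F z) * (1 + cmod z) <= B'" and \<epsilon>: "\<epsilon> > 0"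
    and ap0: "\<exists>T0>0. \<forall>T\<ge>T0. \<exists>M. \<forall>m\<ge>M. \<forall>t. N0 (smear (quot F 0) b T m t - quot F 0 t) <= \<epsilon>"
    and ap1: "\<exists>T0>0. \<forall>T\<ge>T0. \<exists>M. \<forall>m\<ge>M. \<forall>t. N1 (smear (quot F 1) b T m t - quot F 1 t) <= \<epsilon>"
  shows "cmod (l F) <= 24 * cmod (R (F (of_real \<theta>)) (K (of_real \<theta>))) + 3 * \<epsilon>"
proof -
  note h = a.FsD(1)[OF F]
  note FS = a.s.hol_stripD(1)[OF h]
  obtain BK where BK: "!!z. z \<in> strip ==> p.nn (K z) <= BK" using K_hol(2) by blast
  \<comment> \<open>The factor \<open>w + 2\<close> cancels the denominator of \<open>Q\<close>, so
    on the boundary \<open>f w / (w - \<theta>)\<close> is the pairing of the quotient with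
    \<open>K\<close>. Its linear growth is absorbed by the decay expressed by
    \<open>B'\<close>.\<close>
  define f where "f = (%w. (w + 2) * R (F w) (K w))"
  have ph: "continuous_on strip (%w. R (F w) (K w))" "(%w. R (F w) (K w)) holomorphic_on ostrip"
    using p.pairing_hol[OF R_hol[OF h] K_hol(1)] by auto
  have fh: "continuous_on strip f" "f holomorphic_on ostrip" unfolding f_def by (intro continuous_intros holomorphic_intros ph)+
  have fB: "cmod (f w) <= 2 * B' * BK" if w: "w \<in> strip" for w
  proof -
    have nn: "0 <= a.SN (F w)" "0 <= p.nn (K w)" using a.s.N_nonneg[OF FS[OF w]] p.nn_nonneg[OF K_W[OF w]] .
    have "cmod (w + 2) <= cmod w + 2" using norm_triangle_ineq[of w 2] by simp
    moreover have "cmod w + 2 <= 2 * (1 + cmod w)" by simp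
    ultimately have c: "cmod (w + 2) <= 2 * (1 + cmod w)" by (rule order_trans)
    have "cmod (f w) = cmod (w + 2) * cmod (R (F w) (K w))" by (simp add: f_def norm_mult)
    also have "\<dots> <= (2 * (1 + cmod w)) * (a.SN (F w) * p.nn (K w))"
      using c by (intro mult_mono R_bound FS K_W w) auto
    also have "\<dots> = 2 * ((a.SN (F w) * (1 + cmod w)) * p.nn (K w))" by simp
    also have "\<dots> <= 2 * (B' * BK)"
    proof (intro mult_left_mono mult_mono B' BK w)
      show "0 <= B'" by (rule order_trans[OF _ B'[OF w]]) (use nn in auto)
    qed (use nn in auto)
    finally show ?thesis by simp
  qed
  have \<theta>o: "of_real \<theta> \<in> ostrip" using \<theta> by (simp add: ostrip_def)
  obtain T0 where T0: "T0 > 0" "!!T. T >= T0 ==> \<exists>M. \<forall>m\<ge>M. \<forall>t. N0 (smear (quot F 0) b T m t - quot F 0 t) <= \<epsilon>" using ap0 by blast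
  obtain T1 where T1: "T1 > 0" "!!T. T >= T1 ==> \<exists>M. \<forall>m\<ge>M. \<forall>t. N1 (smear (quot F 1) b T m t - quot F 1 t) <= \<epsilon>" using ap1 by blast
  \<comment> \<open>Large enough for both approximations, and for the horizontal sides to contribute
    at most \<open>\<epsilon>\<close>.\<close>
  define T where "T = max T0 (max T1 (2 * (2 * \<bar>B' * BK\<bar>) / \<epsilon>))"
  have T: "T > 0" "T >= T0" "T >= T1" "2 * (2 * \<bar>B' * BK\<bar>) / \<epsilon> <= T" using T0(1) by (auto simp: T_def)
  have "2 * (2 * B' * BK) / T <= \<epsilon>"
  proof -
    have "2 * (2 * \<bar>B' * BK\<bar>) <= \<epsilon> * T" using T(4) \<epsilon> by (simp add: pos_divide_le_eq mult.commute)
    then have "2 * (2 * B' * BK) <= \<epsilon> * T" using abs_ge_self[of "B' * BK"] by linarith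
    then show ?thesis using T(1) by (simp add: pos_divide_le_eq)
  qed
  moreover have "T > \<bar>Im (complex_of_real \<theta>)\<bar>" using T(1) by simp
  note strip_cauchy_formula[OF fh fB \<theta>o this]
  moreover have i: "f (bnd j s) / (bnd j s - of_real \<theta>) = R (quot F j s) (K (bnd j s))"
    if "!!t. bnd j t \<in> strip" "continuous_on UNIV (%t. 1 / Q (bnd j t))" for j s
    unfolding pairing_line(1)[OF F that] by (simp add: f_def Q_def)
  obtain M0' where M0: "!!m t. m >= M0' ==> N0 (smear (quot F 0) b T m t - quot F 0 t) <= \<epsilon>" using T0(2)[OF T(2)] by blast
  obtain M1' where M1: "!!m t. m >= M1' ==> N1 (smear (quot F 1) b T m t - quot F 1 t) <= \<epsilon>" using T1(2)[OF T(3)] by blast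
  define I0 where "I0 = integral {-T..T} (%s. R (quot F 0 s) (K (bnd 0 s)))"
  define I1 where "I1 = integral {-T..T} (%s. R (quot F 1 s) (K (bnd 1 s)))"
  ultimately have c: "cmod (2 * pi * f (of_real \<theta>) - (I1 - I0)) <= \<epsilon>"
    unfolding I0_def I1_def i[OF bnd_strip(1) Q_bnd_continuous(1)] i[OF bnd_strip(2) Q_bnd_continuous(2)] by simp
  have l0': "cmod (I0 - l (e0 F)) <= \<epsilon>" unfolding I0_def by (rule line0[OF F less_imp_le[OF T(1)] M0])
  have l1': "cmod (I1 + l (e1 F)) <= \<epsilon>" unfolding I1_def by (rule line1[OF F less_imp_le[OF T(1)] M1])
  have tri: "cmod (- x + y + z - w) <= cmod x + cmod y + cmod z + cmod w" for x y z w :: complex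
    using norm_triangle_ineq4[of "- x + y + z" w] norm_triangle_ineq[of "- x + y" z] norm_triangle_ineq[of "- x" y] norm_minus_cancel[of x]
    by linarith
  have lF: "l F = - (2 * pi * f (of_real \<theta>)) + (2 * pi * f (of_real \<theta>) - (I1 - I0)) + (I1 + l (e1 F)) - (I0 - l (e0 F))"
    unfolding l_split(1)[OF a.Fs_bV[OF F]] by simp
  have "cmod (l F) <= cmod (2 * pi * f (of_real \<theta>)) + \<epsilon> + \<epsilon> + \<epsilon>"
    unfolding lF by (rule order_trans[OF tri]) (intro add_mono order_refl c l0' l1')
  \<comment> \<open>The constant \<open>24\<close> is \<open>8 * 3\<close>, from 2 pi <= 8 and
    |\<theta> + 2| <= 3.\<close>
  moreover have "cmod (2 * pi * f (of_real \<theta>)) <= 24 * cmod (R (F (of_real \<theta>)) (K (of_real \<theta>)))"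
  proof -
    have "cmod (of_real \<theta> + 2) <= 3" using norm_triangle_ineq[of "complex_of_real \<theta>" 2] \<theta> by simp
    moreover have "2 * pi <= 8" using pi_less_4 by simp
    ultimately have "(2 * pi) * cmod (of_real \<theta> + 2) <= 8 * 3" by (intro mult_mono) auto
    then have "(2 * pi) * cmod (of_real \<theta> + 2) * cmod (R (F (of_real \<theta>)) (K (of_real \<theta>))) <= 8 * 3 * cmod (R (F (of_real \<theta>)) (K (of_real \<theta>)))"
      by (rule mult_right_mono) simp
    then show ?thesis by (simp add: f_def norm_mult)
  qed
  ultimately show ?thesis by simp
qed

end

section \<open>Existence of detecting kernels\<close>

context interp
begin

text \<open>Hahn-Banach modulo the elements of \<open>Fspace\<close> that vanish at
  \<open>\<theta>\<close> gives \<open>l\<close> with value \<open>\<eta>\<close> at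
  \<open>F\<close>. A sufficiently narrow Gaussian loses at most 3 \<eta> / 8 of it, so the pairing
  at \<open>\<theta>\<close> still has modulus at least \<eta> / 48.\<close>

theorem exists_kernel:
  assumes \<theta>: "0 < \<theta>" "\<theta> < 1" and F: "F \<in> a.Fs" and B': "!!z. z \<in> strip ==> a.SN (F z) * (1 + cmod z) <= B'"
    and \<eta>: "\<eta> > 0" and far: "!!H. H \<in> a.Fs ==> H (of_real \<theta>) = F (of_real \<theta>) ==> \<eta> <= a.bN H"
  shows "\<exists>K. p.kern K \<and> \<eta> <= 48 * cmod (R (F (of_real \<theta>)) (K (of_real \<theta>)))"
proof -
  define M where "M = {H \<in> a.Fs. H (of_real \<theta>) = 0}"
  have M: "csubspace M" "M \<subseteq> a.bV"
    using a.csubspace_Fs a.Fs_bV unfolding M_def csubspace_def by (auto simp: scaleC_fun_def)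
  have dist: "\<eta> <= a.bN (F - H)" if H: "H \<in> M" for H
    by (rule far) (use H csubspace_diff[OF a.csubspace_Fs F] in \<open>auto simp: M_def\<close>)
  have "\<exists>l. clinear_on a.bV l \<and> (\<forall>u\<in>a.bV. cmod (l u) <= a.bN u) \<and> (\<forall>H\<in>M. l H = 0) \<and> l F = of_real \<eta>"
  proof (rule hahn_banach_dist[OF a.csubspace_bV a.seminorm_bV M a.Fs_bV[OF F] less_imp_le[OF \<eta>]])
    fix H assume "H \<in> M"
    then show "\<eta> <= a.bN (F - H)" by (rule dist)
  qed blast
  then obtain l where l: "clinear_on a.bV l" "!!u. u \<in> a.bV ==> cmod (l u) <= a.bN u" "!!H. H \<in> M ==> l H = 0" "l F = of_real \<eta>"
    by blast
  have ann: "annihilator A0 A1 N0 N1 \<theta> l c" if c: "c > 0" for c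
    by (intro annihilator.intro interp_axioms annihilator_axioms.intro \<theta> l c) (simp_all add: l(3) M_def)
  \<comment> \<open>\<open>quot\<close> and \<open>smear\<close> do not involve the Gaussian
    parameter of the locale. This instance, with parameter \<open>1\<close>, serves to find the
    parameter of the second one.\<close>
  interpret x: annihilator A0 A1 N0 N1 \<theta> l 1 by (rule ann) simp
  have \<epsilon>: "\<eta> / 8 > 0" using \<eta> by simp
  obtain b0 where b0: "b0 > 0" "!!c. c >= b0 ==> \<exists>T0>0. \<forall>T\<ge>T0. \<exists>M. \<forall>m\<ge>M. \<forall>t. N0 (x.smear (x.quot F 0) c T m t - x.quot F 0 t) <= \<eta> / 8"
    using x.quot_approx(1)[OF F \<epsilon>] by blast
  obtain b1 where b1: "b1 > 0" "!!c. c >= b1 ==> \<exists>T0>0. \<forall>T\<ge>T0. \<exists>M. \<forall>m\<ge>M. \<forall>t. N1 (x.smear (x.quot F 1) c T m t - x.quot F 1 t) <= \<eta> / 8"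
    using x.quot_approx(2)[OF F \<epsilon>] by blast
  interpret y: annihilator A0 A1 N0 N1 \<theta> l "max b0 b1" by (rule ann) (use b0(1) in simp)
  have "cmod (l F) <= 24 * cmod (R (F (of_real \<theta>)) (y.K (of_real \<theta>))) + 3 * (\<eta> / 8)"
    by (rule y.functional_le_pairing[OF F B' \<epsilon> b0(2) b1(2)]) simp_all
  then have "\<eta> <= 48 * cmod (R (F (of_real \<theta>)) (y.K (of_real \<theta>)))" using l(4) \<eta> by simp
  then show ?thesis using y.K_kern by blast
qed

end

subsection \<open>Norm continuity on a vertical line\<close>

text \<open>For each function and tolerance, the points with a neighbourhood of small oscillation
  form an open set. It is dense: near a point whose value almost attains the supremum over an open
  set, lower semicontinuity keeps the values almost as large. Baire's theorem intersects countably
  many such sets.\<close>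

lemma lsc_dense_continuity:
  fixes f :: "nat => real => real"
  assumes lsc: "!!n c. closed {t. f n t <= c}" and bd: "!!n t. f n t <= B n"
  shows "closure {t. \<forall>n. isCont (f n) t} = UNIV"
proof -
  define Os where "Os = (%n k. \<Union>{U. open U \<and> (\<forall>x\<in>U. \<forall>y\<in>U. \<bar>f n x - f n y\<bar> <= 1 / real (Suc k))})"
  have op: "open (Os n k)" for n k unfolding Os_def by auto
  have dense: "UNIV \<subseteq> closure (Os n k)" for n k
  proof
    fix x :: real
    show "x \<in> closure (Os n k)"
      unfolding closure_iff_nhds_not_empty
    proof (intro allI impI)
      fix A V assume V: "V \<subseteq> A" "open V" "x \<in> V"
      define s where "s = (SUP t\<in>V. f n t)"
      have bdd: "bdd_above (f n ` V)" using bd by (intro bdd_aboveI2)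
      have "\<exists>t\<in>V. s - 1 / real (Suc k) < f n t"
        using less_cSUP_iff[OF _ bdd, of "s - 1 / real (Suc k)"] V(3) unfolding s_def by fastforce
      then obtain t where t: "t \<in> V" "s - 1 / real (Suc k) < f n t" by blast
      define U where "U = V \<inter> - {t. f n t <= s - 1 / real (Suc k)}"
      have "open U" unfolding U_def using V(2) lsc by (intro open_Int open_Compl)
      moreover have "\<bar>f n x - f n y\<bar> <= 1 / real (Suc k)" if "x \<in> U" "y \<in> U" for x y
      proof -
        have "f n x <= s" "f n y <= s" using that cSUP_upper[OF _ bdd] unfolding s_def U_def by auto
        moreover have "s - 1 / real (Suc k) < f n x" "s - 1 / real (Suc k) < f n y" using that unfolding U_def by auto
        ultimately show ?thesis by linarith
      qed
      ultimately have "U \<subseteq> Os n k" unfolding Os_def by blast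
      moreover have "t \<in> U" using t unfolding U_def by auto
      ultimately show "Os n k \<inter> A \<noteq> {}" using t(1) V(1) by blast
    qed
  qed
  have "(UNIV::real set) \<subseteq> closure (\<Inter>(range (%(n, k). Os n k)))"
  proof (rule Baire)
    fix T assume "T \<in> range (%(n, k). Os n k)"
    then obtain n k where T: "T = Os n k" by auto
    show "openin (top_of_set UNIV) T \<and> UNIV \<subseteq> closure T" unfolding T using op[of n k] dense[of n k] by simp
  qed auto
  moreover have "\<Inter>(range (%(n, k). Os n k)) \<subseteq> {t. \<forall>n. isCont (f n) t}"
  proof (intro subsetI CollectI allI)
    fix t n assume "t \<in> \<Inter>(range (%(n, k). Os n k))"
    then have t: "t \<in> Os n k" for k by auto
    show "isCont (f n) t"
      unfolding isCont_def tendsto_iff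
    proof (intro allI impI)
      fix e :: real assume "e > 0"
      then obtain k where k: "1 / real (Suc k) < e" using nat_approx_posE by blast
      obtain U where U: "open U" "t \<in> U" "!!x y. x \<in> U ==> y \<in> U ==> \<bar>f n x - f n y\<bar> <= 1 / real (Suc k)"
        using t[of k] unfolding Os_def by blast
      have "eventually (%x. x \<in> U) (at t)" using U(1,2) eventually_at_topological by blast
      then show "eventually (%x. dist (f n x) (f n t) < e) (at t)"
      proof eventually_elim
        case (elim x)
        show ?case using U(3)[OF elim U(2)] k by (simp add: dist_real_def)
      qed
    qed
  qed
  ultimately show ?thesis using closure_mono by blast
qed

lemma csubspace_ncl:
  assumes U: "csubspace U" and N: "seminorm_on U N" and E: "csubspace E" "E \<subseteq> U"
  shows "csubspace (ncl U N E)"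
  unfolding csubspace_def
proof (intro conjI ballI allI)
  have N0: "N 0 = 0" by (rule seminorm_0[OF U N])
  have tri: "!!x y. x \<in> U ==> y \<in> U ==> N (x + y) <= N x + N y" and sc: "!!c x. x \<in> U ==> N (c *\<^sub>C x) = cmod c * N x"
    and nn: "!!x. x \<in> U ==> 0 <= N x"
    using N unfolding seminorm_on_def by blast+
  have "\<forall>e>0. \<exists>y\<in>E. N (0 - y) < e" using csubspace_0[OF E(1)] N0 by (intro allI impI bexI[of _ 0]) auto
  then show "0 \<in> ncl U N E" unfolding ncl_def using csubspace_0[OF U] by blast
  fix x assume x: "x \<in> ncl U N E"
  then have xU: "x \<in> U" and xe: "!!e. e > 0 ==> \<exists>y\<in>E. N (x - y) < e" unfolding ncl_def by blast+
  show "x + y \<in> ncl U N E" if "y \<in> ncl U N E" for y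
  proof -
    have yU: "y \<in> U" and ye: "!!e. e > 0 ==> \<exists>z\<in>E. N (y - z) < e" using that unfolding ncl_def by blast+
    have "\<exists>z\<in>E. N (x + y - z) < e" if e: "e > 0" for e
    proof -
      obtain a b where ab: "a \<in> E" "b \<in> E" "N (x - a) < e / 2" "N (y - b) < e / 2" using xe[of "e/2"] ye[of "e/2"] e by auto
      have m: "x - a \<in> U" "y - b \<in> U" using csubspace_diff[OF U] xU yU ab E(2) by blast+
      have "x + y - (a + b) = (x - a) + (y - b)" by simp
      then have "N (x + y - (a + b)) <= N (x - a) + N (y - b)" using tri[OF m] by (simp only:)
      then have "N (x + y - (a + b)) < e" using ab(3,4) by linarith
      then show ?thesis using csubspace_add[OF E(1) ab(1,2)] by blast
    qed
    then show ?thesis unfolding ncl_def using csubspace_add[OF U xU yU] by blast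
  qed
  show "c *\<^sub>C x \<in> ncl U N E" for c
  proof -
    have "\<exists>z\<in>E. N (c *\<^sub>C x - z) < e" if e: "e > 0" for e
    proof -
      have "e / (cmod c + 1) > 0" using e by (simp add: add_nonneg_pos)
      then obtain a where a: "a \<in> E" "N (x - a) < e / (cmod c + 1)" using xe by blast
      have m: "x - a \<in> U" using csubspace_diff[OF U] xU a E(2) by blast
      have "N (c *\<^sub>C x - c *\<^sub>C a) = cmod c * N (x - a)" unfolding cvec.scale_right_diff_distrib[symmetric] by (rule sc[OF m])
      also have "\<dots> <= cmod c * (e / (cmod c + 1))" using a(2) by (intro mult_left_mono) auto
      also have "\<dots> < e"
      proof -
        have p: "0 < cmod c + 1" by (simp add: add_nonneg_pos)
        show ?thesis unfolding times_divide_eq_right pos_divide_less_eq[OF p] using e by (simp add: algebra_simps)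
      qed
      finally show ?thesis using csubspace_scale[OF E(1) a(1)] by blast
    qed
    then show ?thesis unfolding ncl_def using csubspace_scale[OF U xU] by blast
  qed
qed

lemma rational_near: fixes x e :: real assumes "e > 0" shows "\<exists>q::rat. \<bar>of_rat q - x\<bar> < e"
proof -
  obtain r where "r \<in> \<rat>" "x < r" "r < x + e" using Rats_dense_in_real[of x "x + e"] assms by auto
  moreover then obtain q where "r = of_rat q" by (auto elim: Rats_cases)
  ultimately have "\<bar>of_rat q - x\<bar> < e" by auto
  then show ?thesis ..
qed

section \<open>The derivative along a vertical line\<close>

locale orbit = interp A0 A1 N0 N1
  for A0 A1 :: "'v::cvec set" and N0 N1 :: "'v => real" +
  fixes g :: "complex => 'v" and \<beta> :: real
  assumes g: "g \<in> a.G" and \<beta>: "0 < \<beta>" "\<beta> < 1"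
begin

abbreviation U where "U \<equiv> p.x.Up \<beta>"
abbreviation nu where "nu \<equiv> p.x.UpN \<beta>"

definition pt :: "real => complex" where "pt t = of_real \<beta> + \<i> * of_real t"
definition v :: "real => ('v => complex) => complex" where "v t = R (a.Gd g (pt t))"

lemmas U_sub = p.x.upper_seminorm(1)[OF \<beta>] and nu_semi = p.x.upper_seminorm(2)[OF \<beta>]
lemmas U_add = csubspace_add[OF U_sub] and U_diff = csubspace_diff[OF U_sub] and U_scale = csubspace_scale[OF U_sub]
  and U_sum = csubspace_sum[OF U_sub] and U_0 = csubspace_0[OF U_sub]

lemma nu: "x \<in> U ==> 0 <= nu x" "x \<in> U ==> y \<in> U ==> nu (x + y) <= nu x + nu y" "x \<in> U ==> nu (c *\<^sub>C x) = cmod c * nu x"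
  using nu_semi unfolding seminorm_on_def by blast+

lemma nu_0: "nu 0 = 0" by (rule seminorm_0[OF U_sub nu_semi])

lemma nu_comm: "x \<in> U ==> y \<in> U ==> nu (x - y) = nu (y - x)" by (rule seminorm_diff_commute[OF U_sub nu_semi])

lemma nu_via: "x \<in> U ==> y \<in> U ==> z \<in> U ==> nu (x - z) <= nu (x - y) + nu (y - z)"
  using nu(2)[of "x - y" "y - z"] U_diff by simp

lemma nu_sum: "(!!i. i \<in> I ==> f i \<in> U) ==> nu (sum f I) <= (\<Sum>i\<in>I. nu (f i))"
proof (induction I rule: infinite_finite_induct)
  case (insert x F)
  have "sum f F \<in> U" by (rule U_sum) (rule insert.prems, simp)
  then have "nu (f x + sum f F) <= nu (f x) + nu (sum f F)" by (intro nu(2) insert.prems insertI1)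
  moreover have "nu (sum f F) <= (\<Sum>i\<in>F. nu (f i))" by (rule insert.IH) (rule insert.prems, simp)
  ultimately show ?case unfolding sum.insert[OF insert.hyps] by linarith
qed (simp_all add: nu_0)

lemma U_functional: assumes "x \<in> U" shows "functional_on W x"
proof -
  obtain h where "h \<in> p.x.G" "p.x.Gd h (of_real \<beta>) = x" using assms unfolding upper_def by blast
  then have "x \<in> p.x.S" using p.x.Gd(1) p.x.of_real_ostrip[OF \<beta>] by blast
  then show ?thesis by (rule p.sum_functional)
qed

lemma U_supp: "x \<in> U ==> \<phi> \<notin> W ==> x \<phi> = 0"
  using U_functional unfolding functional_on_def by blast

lemma pt_ostrip: "pt t \<in> ostrip" using \<beta> by (simp add: pt_def ostrip_def)

text \<open>A vertical translate of \<open>g\<close> represents the derivative at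
  \<open>pt t\<close> as one at \<open>\<beta>\<close>, so all values of \<open>v\<close> lie in one
  space under one bound.\<close>

lemma v_mem: "a.Gd g (pt t) \<in> a.Up \<beta>" "v t \<in> U" "nu (v t) <= a.GN g"
proof -
  note h = a.G_shift[OF g, where s = t]
  have e: "a.Gd g (pt t) = a.Gd (%z. g (z + \<i> * of_real t)) (of_real \<beta>)"
    unfolding pt_def by (rule h(3)[OF a.of_real_ostrip[OF \<beta>], symmetric])
  show "a.Gd g (pt t) \<in> a.Up \<beta>" unfolding e by (rule a.upperI[OF h(1)])
  have e2: "v t = p.x.Gd (%z. R (g (z + \<i> * of_real t))) (of_real \<beta>)"
    unfolding v_def e by (rule R_G(3)[OF h(1) a.of_real_ostrip[OF \<beta>], symmetric])
  show "v t \<in> U" unfolding e2 by (rule p.x.upperI[OF R_G(1)[OF h(1)]])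
  show "nu (v t) <= a.GN g"
    unfolding e2 using p.x.upper_norm_le[OF R_G(1)[OF h(1)], of \<beta>] R_G(2)[OF h(1)] h(2) by linarith
qed

lemma scalar_derivative:
  assumes \<phi>: "\<phi> \<in> W" and z: "z \<in> ostrip"
  shows "((%z. R (g z) \<phi>) has_field_derivative R (a.Gd g z) \<phi>) (at z)"
proof -
  have L: "p.x.s.bfun (p.nn \<phi>) (%\<xi>. \<xi> \<phi>)"
    unfolding p.x.s.bfun_def clinear_on_def using p.sum_bound[OF _ \<phi>] by (simp add: scaleC_fun_apply mult.commute)
  note h = R_G(1)[OF g]
  show ?thesis
    using p.x.s.functional_derivative[OF p.x.G_mem[OF h] z p.x.Gd(1,2)[OF h z] L] unfolding R_G(3)[OF g z] .
qed

lemma v_continuous: assumes \<phi>: "\<phi> \<in> W" shows "continuous_on UNIV (%t. v t \<phi>)"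
proof -
  have h: "(%z. R (g z) \<phi>) holomorphic_on ostrip"
    unfolding holomorphic_on_open[OF open_ostrip] using scalar_derivative[OF \<phi>] by blast
  have "continuous_on ostrip (deriv (%z. R (g z) \<phi>))"
    using holomorphic_deriv[OF h open_ostrip] holomorphic_on_imp_continuous_on by blast
  moreover have "continuous_on UNIV pt" unfolding pt_def by (intro continuous_intros)
  ultimately have "continuous_on UNIV (%t. deriv (%z. R (g z) \<phi>) (pt t))"
    by (rule continuous_on_compose2) (use pt_ostrip in blast)
  then show ?thesis unfolding v_def using DERIV_imp_deriv[OF scalar_derivative[OF \<phi> pt_ostrip]] by simp
qed

text \<open>The fundamental theorem of calculus along the line, tested against
  \<open>\<phi>\<close>: a difference quotient is the mean of \<open>v\<close> over its
  step.\<close>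

lemma dq_average:
  assumes \<phi>: "\<phi> \<in> W"
  shows "R (a.dq n g (pt t)) \<phi> = of_nat (Suc n) * integral {t..t + 1 / real (Suc n)} (%s. v s \<phi>)"
proof -
  define \<delta> where "\<delta> = 1 / real (Suc n)"
  have \<delta>: "\<delta> > 0" by (simp add: \<delta>_def)
  have gS: "g (pt s) \<in> a.S" for s using a.G_mem[OF g] pt_ostrip ostrip_subset_strip by blast
  have d: "((%s. R (g (pt s)) \<phi>) has_vector_derivative \<i> * v s \<phi>) (at s within {t..t+\<delta>})" for s
  proof -
    have "(pt has_vector_derivative \<i>) (at s within {t..t+\<delta>})"
      unfolding pt_def by (auto intro!: derivative_eq_intros)
    from field_vector_diff_chain_within[OF this has_field_derivative_at_within[OF scalar_derivative[OF \<phi> pt_ostrip]]]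
    show ?thesis unfolding v_def o_def .
  qed
  have "((%s. \<i> * v s \<phi>) has_integral (R (g (pt (t + \<delta>))) \<phi> - R (g (pt t)) \<phi>)) {t..t+\<delta>}"
    by (rule fundamental_theorem_of_calculus) (use \<delta> d in auto)
  then have i: "\<i> * integral {t..t+\<delta>} (%s. v s \<phi>) = R (g (pt (t + \<delta>))) \<phi> - R (g (pt t)) \<phi>"
    using integral_unique by (metis integral_mult_right)
  have p: "pt t + \<i> * of_real (1 / real (Suc n)) = pt (t + \<delta>)" unfolding pt_def \<delta>_def by (simp add: algebra_simps del: of_nat_Suc)
  have c: "(x / \<i>) * (\<i> * y) = x * y" for x y :: complex by (metis complex_i_not_zero mult.assoc nonzero_divide_eq_eq)
  have "R (a.dq n g (pt t)) \<phi> = (of_real (real (Suc n)) / \<i>) * (R (g (pt (t + \<delta>))) \<phi> - R (g (pt t)) \<phi>)"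
    unfolding a.dq_def p R_scale[OF a.s.mem_diff[OF gS gS]] R_diff[OF gS gS] scaleC_fun_apply minus_apply ..
  also have "\<dots> = of_nat (Suc n) * integral {t..t+\<delta>} (%s. v s \<phi>)"
    unfolding i[symmetric] c of_real_of_nat_eq ..
  finally show ?thesis unfolding \<delta>_def .
qed

text \<open>The mean of \<open>v\<close> is available only through its tests, so it is reached as a
  weak-star limit of finite means of nearby values, and balls of \<open>U\<close> are closed under
  such limits.\<close>

lemma dq_close:
  assumes close: "!!s. s \<in> {t..t + 1 / real (Suc n)} ==> nu (v s - v t) <= e"
  shows "R (a.dq n g (pt t)) - v t \<in> U" "nu (R (a.dq n g (pt t)) - v t) <= e"
proof -
  define \<delta> where "\<delta> = 1 / real (Suc n)"
  have \<delta>: "\<delta> > 0" by (simp add: \<delta>_def)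
  \<comment> \<open>Using \<open>Suc m\<close> nodes keeps the mean from being empty.\<close>
  define \<xi> where "\<xi> = (%m. \<Sum>k<Suc m. (1 / of_nat (Suc m)) *\<^sub>C (v (t + real k * (\<delta> / real (Suc m))) - v t))"
  have m: "(1 / of_nat (Suc m)) *\<^sub>C (v s - v t) \<in> U" for m s by (intro U_scale U_diff v_mem)
  have \<xi>U: "\<xi> m \<in> U" for m unfolding \<xi>_def by (rule U_sum[OF m])
  have \<xi>e: "nu (\<xi> m) <= e" for m
  proof -
    have "nu (\<xi> m) <= (\<Sum>k<Suc m. nu ((1 / of_nat (Suc m)) *\<^sub>C (v (t + real k * (\<delta> / real (Suc m))) - v t)))"
      unfolding \<xi>_def by (rule nu_sum[OF m])
    also have "\<dots> <= (\<Sum>k<Suc m. (1 / real (Suc m)) * e)"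
    proof (rule sum_mono)
      fix k assume k: "k \<in> {..<Suc m}"
      have "real k * (\<delta> / real (Suc m)) <= real (Suc m) * (\<delta> / real (Suc m))" using k \<delta> by (intro mult_right_mono) auto
      then have "t + real k * (\<delta> / real (Suc m)) \<in> {t..t + \<delta>}" using \<delta> by simp
      then have "nu (v (t + real k * (\<delta> / real (Suc m))) - v t) <= e" using close unfolding \<delta>_def by blast
      then have "(1 / real (Suc m)) * nu (v (t + real k * (\<delta> / real (Suc m))) - v t) <= (1 / real (Suc m)) * e"
        by (rule mult_left_mono) simp
      then show "nu ((1 / of_nat (Suc m)) *\<^sub>C (v (t + real k * (\<delta> / real (Suc m))) - v t)) <= (1 / real (Suc m)) * e"
        unfolding nu(3)[OF U_diff[OF v_mem(2) v_mem(2)]] norm_divide norm_of_nat norm_one .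
    qed
    also have "\<dots> = e" by (simp del: of_nat_Suc)
    finally show ?thesis .
  qed
  have lim: "(%m. \<xi> m \<phi>) \<longlonglongrightarrow> (R (a.dq n g (pt t)) - v t) \<phi>" if \<phi>: "\<phi> \<in> W" for \<phi>
  proof -
    have e: "t + \<delta> - t = \<delta>" by simp
    have r: "(%m. \<Sum>k<m. (\<delta> / real m) *\<^sub>R v (t + real k * (\<delta> / real m)) \<phi>) \<longlonglongrightarrow> integral {t..t + \<delta>} (%s. v s \<phi>)"
      using riemann_sum_tendsto[of t "t + \<delta>" "%s. v s \<phi>", unfolded e] continuous_on_subset[OF v_continuous[OF \<phi>]] \<delta> by simp
    have "(%m. of_nat (Suc n) * (\<Sum>k<Suc m. (\<delta> / real (Suc m)) *\<^sub>R v (t + real k * (\<delta> / real (Suc m))) \<phi>) - v t \<phi>)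
      \<longlonglongrightarrow> of_nat (Suc n) * integral {t..t + \<delta>} (%s. v s \<phi>) - v t \<phi>"
      by (intro tendsto_diff tendsto_mult_left tendsto_const LIMSEQ_Suc[OF r])
    moreover have "of_nat (Suc n) * (\<Sum>k<Suc m. (\<delta> / real (Suc m)) *\<^sub>R v (t + real k * (\<delta> / real (Suc m))) \<phi>) - v t \<phi> = \<xi> m \<phi>" for m
    proof -
      have c: "of_nat (Suc n) * ((\<delta> / real (Suc m)) *\<^sub>R x) = (1 / of_nat (Suc m)) * x" for x :: complex
        unfolding scaleR_conv_of_real \<delta>_def by (simp del: of_nat_Suc)
      have "\<xi> m \<phi> = (\<Sum>k<Suc m. (1 / of_nat (Suc m)) * (v (t + real k * (\<delta> / real (Suc m))) \<phi> - v t \<phi>))"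
        unfolding \<xi>_def sum_fun_eval scaleC_fun_apply minus_apply ..
      also have "\<dots> = (\<Sum>k<Suc m. (1 / of_nat (Suc m)) * v (t + real k * (\<delta> / real (Suc m))) \<phi>) - (\<Sum>k<Suc m. (1 / of_nat (Suc m)) * v t \<phi>)"
        unfolding right_diff_distrib sum_subtractf ..
      also have "(\<Sum>k<Suc m. (1 / of_nat (Suc m)) * v t \<phi>) = v t \<phi>" by (simp del: of_nat_Suc)
      finally show ?thesis unfolding sum_distrib_left c ..
    qed
    ultimately show ?thesis unfolding minus_apply dq_average[OF \<phi>] \<delta>_def[symmetric] by simp
  qed
  have supp: "(R (a.dq n g (pt t)) - v t) \<phi> = 0" if "\<phi> \<notin> W" for \<phi> using R_supp[OF that] U_supp[OF v_mem(2) that] by simp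
  show "R (a.dq n g (pt t)) - v t \<in> U" by (rule p.upper_weak_star_closed(1)[OF \<beta> \<xi>U \<xi>e lim supp])
  show "nu (R (a.dq n g (pt t)) - v t) <= e" by (rule p.upper_weak_star_closed(2)[OF \<beta> \<xi>U \<xi>e lim supp])
qed

text \<open>Lower semicontinuity of the distance to \<open>s\<close>, from the weak-star continuity
  of \<open>v\<close> and the weak-star closed balls.\<close>

lemma closed_sublevel: assumes s: "s \<in> U" shows "closed {t. nu (v t - s) <= c}"
  unfolding closed_sequential_limits
proof (intro allI impI)
  fix x t assume x: "(\<forall>n. x n \<in> {t. nu (v t - s) <= c}) \<and> x \<longlonglongrightarrow> t"
  have lim: "(%n. (v (x n) - s) \<phi>) \<longlonglongrightarrow> (v t - s) \<phi>" if "\<phi> \<in> W" for \<phi>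
  proof -
    have "isCont (%t. v t \<phi>) t" using v_continuous[OF that] by (simp add: continuous_on_eq_continuous_at)
    then have "(%n. v (x n) \<phi>) \<longlonglongrightarrow> v t \<phi>" using x isCont_tendsto_compose by blast
    then show ?thesis unfolding minus_apply by (intro tendsto_diff tendsto_const)
  qed
  have le: "nu (v (x n) - s) <= c" for n using x by blast
  have "nu (v t - s) <= c"
    by (rule p.upper_weak_star_closed(2)[OF \<beta> U_diff[OF v_mem(2) s] le lim U_supp[OF U_diff[OF v_mem(2) s]]])
  then show "t \<in> {t. nu (v t - s) <= c}" by simp
qed

section \<open>Rational combinations and weak LUR\<close>

text \<open>Combinations are indexed by lists so that those with rational coefficients form a
  countable type, which \<open>from_nat\<close> can enumerate for Baire's theorem.\<close>

definition comb :: "(complex \<times> rat) list => ('v => complex) => complex" where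
  "comb xs = (\<Sum>(c, q)\<leftarrow>xs. c *\<^sub>C v (of_rat q))"

definition rcomb :: "(rat \<times> rat \<times> rat) list => ('v => complex) => complex" where
  "rcomb xs = comb (map (%(x, y, q). (Complex (of_rat x) (of_rat y), q)) xs)"

lemma comb_mem:
  assumes V: "csubspace V" and v: "!!q. v q \<in> V" shows "comb xs \<in> V"
  unfolding comb_def
proof (induction xs)
  case (Cons a xs)
  obtain c q where a: "a = (c, q)" by (cases a)
  show ?case unfolding a list.map sum_list.Cons prod.case by (rule csubspace_add[OF V csubspace_scale[OF V v] Cons])
qed (use csubspace_0[OF V] in \<open>simp only: list.map sum_list.Nil\<close>)

lemma comb_simps: "comb [] = 0" "comb ((c, q) # xs) = c *\<^sub>C v (of_rat q) + comb xs" "comb (xs @ ys) = comb xs + comb ys"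
  "comb (map (%(c, q). (k * c, q)) xs) = k *\<^sub>C comb xs"
proof -
  show "comb (map (%(c, q). (k * c, q)) xs) = k *\<^sub>C comb xs"
    unfolding comb_def
  proof (induction xs)
    case (Cons a xs)
    obtain c q where a: "a = (c, q)" by (cases a)
    show ?case unfolding a list.map sum_list.Cons prod.case Cons scaleC_add_right scaleC_scaleC ..
  qed (simp only: list.map sum_list.Nil cvec.scale_zero_right)
qed (simp_all only: comb_def list.map sum_list.Nil sum_list.Cons prod.case map_append sum_list_append)

lemma csubspace_comb: "csubspace (range comb)"
  unfolding csubspace_def
proof (intro conjI ballI allI)
  show "0 \<in> range comb" using comb_simps(1) by (metis rangeI)
  fix x c assume "x \<in> range comb"
  then obtain xs where x: "x = comb xs" by blast
  show "c *\<^sub>C x \<in> range comb" unfolding x comb_simps(4)[symmetric] by (rule rangeI)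
  fix y assume "y \<in> range comb"
  then obtain ys where y: "y = comb ys" by blast
  show "x + y \<in> range comb" unfolding x y comb_simps(3)[symmetric] by (rule rangeI)
qed

lemma rcomb_dense: "e > 0 ==> \<exists>ys. nu (comb xs - rcomb ys) < e"
proof (induction xs arbitrary: e)
  case Nil
  then show ?case by (intro exI[of _ "[]"]) (simp only: rcomb_def list.map comb_simps diff_self nu_0)
next
  case (Cons p xs)
  obtain c q where p: "p = (c, q)" by (cases p)
  obtain ys where ys: "nu (comb xs - rcomb ys) < e / 2" using Cons.IH[OF half_gt_zero[OF Cons.prems]] by blast
  \<comment> \<open>The modulus of a coefficient changes by at most \<open>2 * d\<close>, so by the
    uniform bound on \<open>v\<close> one term changes by at most \<open>e / 2\<close>; the rest of
    the list has the other half.\<close>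
  define d where "d = e / (4 * (a.GN g + 1))"
  have G0: "0 <= a.GN g" by (rule a.Gnorm_nonneg[OF g])
  have d: "d > 0" using Cons.prems G0 by (simp add: d_def)
  have ne: "4 * (a.GN g + 1) \<noteq> 0" using G0 by simp
  have de: "d * (4 * (a.GN g + 1)) = e" unfolding d_def by (rule nonzero_divide_eq_eq[OF ne, THEN iffD1, OF refl, symmetric])
  obtain x y where xy: "\<bar>of_rat x - Re c\<bar> < d" "\<bar>of_rat y - Im c\<bar> < d" using rational_near[OF d] by meson
  have "cmod (c - Complex (of_rat x) (of_rat y)) <= 2 * d"
    using cmod_le[of "c - Complex (of_rat x) (of_rat y)"] xy by simp
  then have "cmod (c - Complex (of_rat x) (of_rat y)) * nu (v (of_rat q)) <= 2 * d * (a.GN g + 1)"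
    using v_mem(3)[of "of_rat q"] nu(1)[OF v_mem(2)] d by (intro mult_mono) auto
  also have "\<dots> = (d * (4 * (a.GN g + 1))) / 2" by (simp add: algebra_simps)
  also have "\<dots> = e / 2" unfolding de ..
  finally have 1: "nu ((c - Complex (of_rat x) (of_rat y)) *\<^sub>C v (of_rat q)) <= e / 2" unfolding nu(3)[OF v_mem(2)] .
  have r: "rcomb ((x, y, q) # ys) = Complex (of_rat x) (of_rat y) *\<^sub>C v (of_rat q) + rcomb ys" by (simp only: rcomb_def list.map comb_simps prod.case)
  have e: "comb (p # xs) - rcomb ((x, y, q) # ys) = (c - Complex (of_rat x) (of_rat y)) *\<^sub>C v (of_rat q) + (comb xs - rcomb ys)"
    unfolding p comb_simps(2) r cvec.scale_left_diff_distrib by simp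
  have "nu (comb (p # xs) - rcomb ((x, y, q) # ys)) < e"
    unfolding e using nu(2)[OF U_scale[OF v_mem(2)] U_diff[OF comb_mem[OF U_sub v_mem(2)] comb_mem[OF U_sub v_mem(2)]]] 1 ys
    unfolding rcomb_def by (smt (verit) field_sum_of_halves)
  then show ?case by blast
qed

lemma rcomb_U: "rcomb ys \<in> U" unfolding rcomb_def by (rule comb_mem[OF U_sub v_mem(2)])

definition Z where "Z = ncl U nu (R ` a.Up \<beta>)"

lemma Z: "csubspace Z" "Z \<subseteq> U" "v t \<in> Z" "seminorm_on Z nu"
proof -
  note aU = a.upper_seminorm(1)[OF \<beta>]
  have S: "x \<in> a.S" if x: "x \<in> a.Up \<beta>" for x
  proof -
    obtain h where "h \<in> a.G" "a.Gd h (of_real \<beta>) = x" using x unfolding upper_def by blast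
    then show ?thesis using a.Gd(1) a.of_real_ostrip[OF \<beta>] by blast
  qed
  have E: "csubspace (R ` a.Up \<beta>)"
    unfolding csubspace_def
  proof (intro conjI ballI allI)
    have "R 0 = 0" using R_scale[OF a.s.mem_0, of 0] by simp
    then show "0 \<in> R ` a.Up \<beta>" using csubspace_0[OF aU] by (metis imageI)
    fix x c assume "x \<in> R ` a.Up \<beta>"
    then obtain x' where x: "x = R x'" "x' \<in> a.Up \<beta>" by blast
    show "c *\<^sub>C x \<in> R ` a.Up \<beta>" unfolding x(1) R_scale[OF S[OF x(2)], symmetric] by (rule imageI[OF csubspace_scale[OF aU x(2)]])
    fix y assume "y \<in> R ` a.Up \<beta>"
    then obtain y' where y: "y = R y'" "y' \<in> a.Up \<beta>" by blast
    show "x + y \<in> R ` a.Up \<beta>" unfolding x(1) y(1) R_add[OF S[OF x(2)] S[OF y(2)], symmetric] by (rule imageI[OF csubspace_add[OF aU x(2) y(2)]])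
  qed
  have EU: "R ` a.Up \<beta> \<subseteq> U"
  proof
    fix x assume "x \<in> R ` a.Up \<beta>"
    then obtain x' where x: "x = R x'" "x' \<in> a.Up \<beta>" by blast
    obtain h where h: "h \<in> a.G" "a.Gd h (of_real \<beta>) = x'" using x(2) unfolding upper_def by blast
    show "x \<in> U" using p.x.upperI[OF R_G(1)[OF h(1)], of \<beta>] unfolding R_G(3)[OF h(1) a.of_real_ostrip[OF \<beta>]] h(2) x(1) .
  qed
  show "csubspace Z" unfolding Z_def by (rule csubspace_ncl[OF U_sub nu_semi E EU])
  show ZU: "Z \<subseteq> U" unfolding Z_def ncl_def by blast
  have "v t \<in> R ` a.Up \<beta>" unfolding v_def by (rule imageI[OF v_mem(1)])
  then have "\<forall>e>0. \<exists>y\<in>R ` a.Up \<beta>. nu (v t - y) < e" using nu_0 by (intro allI impI bexI[of _ "v t"]) auto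
  then show "v t \<in> Z" unfolding Z_def ncl_def using v_mem(2) by blast
  show "seminorm_on Z nu" using nu_semi ZU unfolding seminorm_on_def by blast
qed

text \<open>Where the norm of \<open>v\<close> is continuous, values at rational points tending to
  \<open>t\<close> and their midpoints with \<open>v t\<close> have norms tending to that of
  \<open>v t\<close>. Weak LUR then yields weak convergence to \<open>v t\<close>, so no bounded
  functional separates \<open>v t\<close> from the span.\<close>

lemma approx_comb:
  assumes wlur: "weakly_LUR Z nu" and cont: "isCont (%t. nu (v t - 0)) t" and e: "e > 0"
  shows "\<exists>xs. nu (v t - comb xs) < e"
proof (rule ccontr)
  assume n: "\<nexists>xs. nu (v t - comb xs) < e"
  have far: "e <= nu (v t - m)" if m: "m \<in> range comb" for m
  proof -
    obtain xs where "m = comb xs" using m by blast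
    then show ?thesis using n by (metis not_less)
  qed
  have sub: "range comb \<subseteq> Z" using comb_mem[OF Z(1) Z(3)] by blast
  have "\<exists>L. clinear_on Z L \<and> (\<forall>x\<in>Z. cmod (L x) <= nu x) \<and> (\<forall>m\<in>range comb. L m = 0) \<and> L (v t) = of_real e"
  proof (rule hahn_banach_dist[OF Z(1) Z(4) csubspace_comb sub Z(3) less_imp_le[OF e]])
    fix m assume "m \<in> range comb" then show "e <= nu (v t - m)" by (rule far)
  qed blast
  then obtain L where L: "clinear_on Z L" "!!x. x \<in> Z ==> cmod (L x) <= nu x" "!!m. m \<in> range comb ==> L m = 0" "L (v t) = of_real e"
    by blast
  have "\<forall>n. \<exists>q::rat. \<bar>of_rat q - t\<bar> < 1 / real (Suc n)" using rational_near by simp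
  then obtain q :: "nat => rat" where q: "!!n. \<bar>of_rat (q n) - t\<bar> < 1 / real (Suc n)" by metis
  have qt: "(%n. of_rat (q n)) \<longlonglongrightarrow> t"
    unfolding LIM_zero_iff[of _ t, symmetric] by (rule Lim_null_comparison[OF _ LIMSEQ_Suc[OF lim_1_over_n]]) (use q in \<open>auto intro!: always_eventually less_imp_le simp del: of_nat_Suc\<close>)
  define x where "x = (%n. v (of_rat (q n)))"
  have xU: "x n \<in> U" for n unfolding x_def by (rule v_mem(2))
  have l1: "(%n. nu (x n)) \<longlonglongrightarrow> nu (v t)" using isCont_tendsto_compose[OF cont qt] by (simp add: x_def)
  have half: "nu ((1/2) *\<^sub>C (x n + v t)) = nu (x n + v t) / 2" for n
    unfolding nu(3)[OF U_add[OF xU v_mem(2)]] by (simp add: norm_divide)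
  have l2: "(%n. nu ((1/2) *\<^sub>C (x n + v t))) \<longlonglongrightarrow> nu (v t)"
  proof (rule tendstoI)
    fix d :: real assume d: "d > 0"
    have neg: "- v t \<in> U" by (rule csubspace_neg[OF U_sub v_mem(2)])
    have two: "nu (v t - - v t) = 2 * nu (v t)"
    proof -
      have "v t - - v t = 2 *\<^sub>C v t" using scaleC_add_left[of 1 1 "v t"] by (simp add: scaleC_one)
      then show ?thesis using nu(3)[OF v_mem(2), of 2 t] by simp
    qed
    \<comment> \<open>Lower semicontinuity of the distance to \<open>- v t\<close> bounds
      \<open>nu (x n + v t)\<close> from below; the triangle inequality gives the matching upper
      bound.\<close>
    have "open (- {s. nu (v s - - v t) <= 2 * nu (v t) - 2 * d})" by (rule open_Compl[OF closed_sublevel[OF neg]])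
    moreover have "t \<in> - {s. nu (v s - - v t) <= 2 * nu (v t) - 2 * d}" using two d by simp
    ultimately have "eventually (%n. of_rat (q n) \<in> - {s. nu (v s - - v t) <= 2 * nu (v t) - 2 * d}) sequentially"
      using qt topological_tendstoD by blast
    moreover have "eventually (%n. nu (x n) < nu (v t) + d) sequentially" using order_tendstoD(2)[OF l1] d by simp
    ultimately show "eventually (%n. dist (nu ((1/2) *\<^sub>C (x n + v t))) (nu (v t)) < d) sequentially"
    proof eventually_elim
      case (elim n)
      have "nu (x n + v t) > 2 * nu (v t) - 2 * d" using elim(1) by (simp add: x_def)
      moreover have "nu (x n + v t) <= nu (x n) + nu (v t)" by (rule nu(2)[OF xU v_mem(2)])
      ultimately have "\<bar>nu (x n + v t) / 2 - nu (v t)\<bar> < d" using elim(2) d by (simp add: abs_less_iff)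
      then show ?case unfolding half dist_real_def .
    qed
  qed
  have "(%n. (nu (x n))\<^sup>2 / 2 + (nu (v t))\<^sup>2 / 2 - (nu ((1/2) *\<^sub>C (x n + v t)))\<^sup>2) \<longlonglongrightarrow> (nu (v t))\<^sup>2 / 2 + (nu (v t))\<^sup>2 / 2 - (nu (v t))\<^sup>2"
    by (intro tendsto_diff tendsto_add tendsto_divide tendsto_power tendsto_const l1 l2) simp
  moreover have "x n \<in> Z" for n unfolding x_def by (rule Z(3))
  ultimately have "weakly_conv Z nu x (v t)" using wlur Z(3) unfolding weakly_LUR_def by simp
  then have "(%n. L (x n)) \<longlonglongrightarrow> L (v t)"
    unfolding weakly_conv_def using L(1,2) by (metis mult_1)
  moreover have "L (x n) = 0" for n
  proof -
    have "x n = comb [(1, q n)]" by (simp only: comb_simps x_def scaleC_one add_0_right)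
    then show ?thesis using L(3) by simp
  qed
  ultimately have "(%n. 0) \<longlonglongrightarrow> L (v t)" by simp
  then have "L (v t) = 0" using LIMSEQ_unique tendsto_const by blast
  then show False using L(4) e by simp
qed

definition good :: "real set" where "good = {t. \<forall>e>0. \<exists>d>0. \<forall>s. \<bar>s - t\<bar> < d \<longrightarrow> nu (v s - v t) < e}"

text \<open>At a common continuity point, \<open>v t\<close> is close to some rational combination
  by \<open>approx_comb\<close>. Continuity of the distance to that combination keeps
  \<open>v s\<close> close to it as well, hence close to \<open>v t\<close>.\<close>

lemma good_dense:
  assumes wlur: "weakly_LUR Z nu" shows "closure good = UNIV"
proof -
  define f where "f = (%n t. nu (v t - rcomb (from_nat n)))"
  have d: "closure {t. \<forall>n. isCont (f n) t} = UNIV"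
  proof (rule lsc_dense_continuity)
    show "closed {t. f n t <= c}" for n c unfolding f_def by (rule closed_sublevel[OF rcomb_U])
    show "f n t <= a.GN g + nu (rcomb (from_nat n))" for n t
      using nu_via[OF v_mem(2)[of t] U_0 rcomb_U[of "from_nat n"]] v_mem(3)[of t] nu_comm[OF U_0 rcomb_U[of "from_nat n"]] unfolding f_def diff_zero by linarith
  qed
  have "{t. \<forall>n. isCont (f n) t} \<subseteq> good"
    unfolding good_def
  proof (intro subsetI CollectI allI impI)
    fix t e :: real assume t: "t \<in> {t. \<forall>n. isCont (f n) t}" and e: "e > 0"
    have c: "isCont (%t. nu (v t - rcomb ys)) t" for ys
    proof -
      have "isCont (f (to_nat ys)) t" using t by blast
      then show ?thesis unfolding f_def by simp
    qed
    \<comment> \<open>The empty combination covers the norm itself, as \<open>approx_comb\<close>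
      asks.\<close>
    have c0: "isCont (%t. nu (v t - 0)) t" using c[of "[]"] by (simp only: rcomb_def list.map comb_simps)
    have e4: "e / 4 > 0" using e by simp
    obtain xs where xs: "nu (v t - comb xs) < e / 4" using approx_comb[OF wlur c0 e4] by blast
    obtain ys where ys: "nu (comb xs - rcomb ys) < e / 4" using rcomb_dense[OF e4] by blast
    have ty: "nu (v t - rcomb ys) < e / 2"
      using nu_via[OF v_mem(2)[of t] comb_mem[OF U_sub v_mem(2), of xs] rcomb_U[of ys]] xs ys by simp
    obtain d where d: "d > 0" "!!s. \<bar>s - t\<bar> < d ==> \<bar>nu (v s - rcomb ys) - nu (v t - rcomb ys)\<bar> < e / 2 - nu (v t - rcomb ys)"
      using c[of ys] ty unfolding continuous_at_eps_delta dist_real_def by (meson diff_gt_0_iff_gt)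
    have "nu (v s - v t) < e" if s: "\<bar>s - t\<bar> < d" for s
      using nu_via[OF v_mem(2)[of s] rcomb_U[of ys] v_mem(2)[of t]] nu_comm[OF rcomb_U[of ys] v_mem(2)[of t]] d(2)[OF s] ty by linarith
    then show "\<exists>d>0. \<forall>s. \<bar>s - t\<bar> < d \<longrightarrow> nu (v s - v t) < e" using d(1) by blast
  qed
  then show ?thesis using d closure_mono by blast
qed

lemma dq_converges:
  assumes t: "t \<in> good" and e: "e > 0"
  shows "\<exists>M. \<forall>n\<ge>M. R (a.dq n g (pt t)) - v t \<in> U \<and> nu (R (a.dq n g (pt t)) - v t) <= e"
proof -
  obtain d where d: "d > 0" "!!s. \<bar>s - t\<bar> < d ==> nu (v s - v t) < e" using t e unfolding good_def by blast
  obtain M where M: "1 / real (Suc M) < d" using nat_approx_posE[OF d(1)] .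
  have "R (a.dq n g (pt t)) - v t \<in> U \<and> nu (R (a.dq n g (pt t)) - v t) <= e" if n: "n >= M" for n
  proof -
    have "1 / real (Suc n) <= 1 / real (Suc M)" using n by (intro divide_left_mono) auto
    then have "nu (v s - v t) <= e" if "s \<in> {t..t + 1 / real (Suc n)}" for s using that M by (intro less_imp_le d(2)) auto
    then show ?thesis using dq_close by blast
  qed
  then show ?thesis by blast
qed

section \<open>Damped difference quotients in F\<close>

text \<open>The Lipschitz constant found here grows with \<open>n\<close>; this is harmless, since
  \<open>Fspace\<close> asks for continuity of each quotient separately.\<close>

lemma dq_boundary_continuous: "ncont_on N0 UNIV (%t. a.dq n g (bnd 0 t))" "ncont_on N1 UNIV (%t. a.dq n g (bnd 1 t))"
proof -
  define c where "c = complex_of_real (real (Suc n)) / \<i>"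
  define \<delta> where "\<delta> = 1 / real (Suc n)"
  have c: "cmod c = real (Suc n)" unfolding c_def norm_divide norm_of_real by simp
  have dq: "a.dq n g (bnd j t) = c *\<^sub>C (g (bnd j (t + \<delta>)) - g (bnd j t))" for j t
    unfolding a.dq_def c_def \<delta>_def by (simp add: bnd_def algebra_simps del: of_nat_Suc divide_i)
  have diff: "a.dq n g (bnd j w) - a.dq n g (bnd j z) = c *\<^sub>C ((g (bnd j (w + \<delta>)) - g (bnd j (z + \<delta>))) - (g (bnd j w) - g (bnd j z)))" for j w z
    unfolding dq cvec.scale_right_diff_distrib by simp
  have b: "g (bnd 0 t) - g (bnd 0 t') \<in> A0" "g (bnd 1 t) - g (bnd 1 t') \<in> A1"
    "N0 (g (bnd 0 t) - g (bnd 0 t')) <= a.GN g * \<bar>t - t'\<bar>" "N1 (g (bnd 1 t) - g (bnd 1 t')) <= a.GN g * \<bar>t - t'\<bar>" for t t'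
    using a.Gnorm_lip[OF g] unfolding a.lip_on_boundary_def by blast+
  have e: "\<bar>(w + \<delta>) - (z + \<delta>)\<bar> = \<bar>w - z\<bar>" for w z :: real by simp
  show "ncont_on N0 UNIV (%t. a.dq n g (bnd 0 t))"
  proof (rule a.c0.ncont_on_lipschitz)
    show "a.dq n g (bnd 0 t) \<in> A0" for t by (rule a.dq_props(3)[OF g])
    fix z w :: real
    have "N0 ((g (bnd 0 (w + \<delta>)) - g (bnd 0 (z + \<delta>))) - (g (bnd 0 w) - g (bnd 0 z))) <= a.GN g * \<bar>w - z\<bar> + a.GN g * \<bar>w - z\<bar>"
      using a.c0.N_minus[OF b(1)[of "w + \<delta>" "z + \<delta>"] b(1)[of w z]] b(3)[of "w + \<delta>" "z + \<delta>"] b(3)[of w z] unfolding e by linarith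
    then have "real (Suc n) * N0 ((g (bnd 0 (w + \<delta>)) - g (bnd 0 (z + \<delta>))) - (g (bnd 0 w) - g (bnd 0 z))) <= real (Suc n) * (a.GN g * \<bar>w - z\<bar> + a.GN g * \<bar>w - z\<bar>)"
      by (rule mult_left_mono) simp
    also have "\<dots> = (real (Suc n) * (2 * a.GN g)) * dist w z" by (simp add: dist_real_def algebra_simps)
    finally show "N0 (a.dq n g (bnd 0 w) - a.dq n g (bnd 0 z)) <= (real (Suc n) * (2 * a.GN g)) * dist w z"
      unfolding diff a.c0.N_scale[OF a.c0.mem_diff[OF b(1) b(1)]] c .
  qed
  show "ncont_on N1 UNIV (%t. a.dq n g (bnd 1 t))"
  proof (rule a.c1.ncont_on_lipschitz)
    show "a.dq n g (bnd 1 t) \<in> A1" for t by (rule a.dq_props(5)[OF g])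
    fix z w :: real
    have "N1 ((g (bnd 1 (w + \<delta>)) - g (bnd 1 (z + \<delta>))) - (g (bnd 1 w) - g (bnd 1 z))) <= a.GN g * \<bar>w - z\<bar> + a.GN g * \<bar>w - z\<bar>"
      using a.c1.N_minus[OF b(2)[of "w + \<delta>" "z + \<delta>"] b(2)[of w z]] b(4)[of "w + \<delta>" "z + \<delta>"] b(4)[of w z] unfolding e by linarith
    then have "real (Suc n) * N1 ((g (bnd 1 (w + \<delta>)) - g (bnd 1 (z + \<delta>))) - (g (bnd 1 w) - g (bnd 1 z))) <= real (Suc n) * (a.GN g * \<bar>w - z\<bar> + a.GN g * \<bar>w - z\<bar>)"
      by (rule mult_left_mono) simp
    also have "\<dots> = (real (Suc n) * (2 * a.GN g)) * dist w z" by (simp add: dist_real_def algebra_simps)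
    finally show "N1 (a.dq n g (bnd 1 w) - a.dq n g (bnd 1 z)) <= (real (Suc n) * (2 * a.GN g)) * dist w z"
      unfolding diff a.c1.N_scale[OF a.c1.mem_diff[OF b(2) b(2)]] c .
  qed
qed

definition \<Phi> :: "real => nat => complex => 'v" where
  "\<Phi> \<theta> n = (%z. exp ((z - of_real \<theta>)\<^sup>2) *\<^sub>C a.dq n g z)"

lemma exp_strip:
  assumes \<theta>: "0 < \<theta>" "\<theta> < 1" and z: "z \<in> strip"
  shows "cmod (exp ((z - of_real \<theta>)\<^sup>2)) <= exp 1 * exp (- (Im z)\<^sup>2)"
proof -
  have "\<bar>Re z - \<theta>\<bar> <= 1" using z \<theta> by (auto simp: strip_def)
  then have "(Re z - \<theta>)\<^sup>2 <= 1" by (simp add: abs_square_le_1)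
  then show ?thesis using norm_exp_mult_square[of 1 "z - of_real \<theta>"] unfolding exp_add[symmetric] by simp
qed

lemma \<Phi>_Fs: assumes \<theta>: "0 < \<theta>" "\<theta> < 1" shows "\<Phi> \<theta> n \<in> a.Fs"
  unfolding \<Phi>_def
proof (rule a.Fs_mult[OF a.dq_props(1)[OF g], where B = "a.GN g" and K = "exp 1"])
  show "a.SN (a.dq n g z) <= a.GN g" if "z \<in> strip" for z by (rule a.dq_props(2)[OF g that])
  show "cmod (exp ((z - of_real \<theta>)\<^sup>2)) <= exp 1" if "z \<in> strip" for z
    using order_trans[OF exp_strip[OF \<theta> that], of "exp 1"] by simp
  have l: "((%t. exp 1 * exp (- t\<^sup>2)) \<longlongrightarrow> (0::real)) at_infinity"
    unfolding at_infinity_eq_at_top_bot by (intro filterlim_sup) real_asymp+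
  show "((%t. exp ((bnd 0 t - of_real \<theta>)\<^sup>2)) \<longlongrightarrow> 0) at_infinity"
    by (rule Lim_null_comparison[OF always_eventually[OF allI] l]) (use exp_strip[OF \<theta> bnd_strip(1)] in simp)
  show "((%t. exp ((bnd 1 t - of_real \<theta>)\<^sup>2)) \<longlongrightarrow> 0) at_infinity"
    by (rule Lim_null_comparison[OF always_eventually[OF allI] l]) (use exp_strip[OF \<theta> bnd_strip(2)] in simp)
  show "continuous_on strip (%z. exp ((z - of_real \<theta>)\<^sup>2))" by (intro continuous_intros)
  show "(%z. exp ((z - of_real \<theta>)\<^sup>2)) holomorphic_on ostrip" by (intro holomorphic_intros)
qed (rule a.dq_props[OF g] dq_boundary_continuous)+

text \<open>The decay by one power of \<open>1 + cmod z\<close> that \<open>exists_kernel\<close>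
  requires, uniformly in \<open>n\<close>. The Gaussian factor pays for it through 1 + y^2 <=
  exp(y^2).\<close>

lemma \<Phi>_decay:
  assumes \<theta>: "0 < \<theta>" "\<theta> < 1" and z: "z \<in> strip"
  shows "a.SN (\<Phi> \<theta> n z) * (1 + cmod z) <= 3 * exp 1 * a.GN g"
proof -
  define y where "y = Im z"
  have G0: "0 <= a.GN g" by (rule a.Gnorm_nonneg[OF g])
  note dS = a.s.hol_stripD(1)[OF a.dq_props(1)[OF g] z]
  have "\<bar>y\<bar> <= 1 + y\<^sup>2" using zero_le_power2[of "\<bar>y\<bar> - 1"] by (simp add: power2_diff)
  moreover have "1 + y\<^sup>2 <= exp (y\<^sup>2)" using exp_ge_add_one_self[of "y\<^sup>2"] by simp
  moreover have "cmod z <= 1 + \<bar>y\<bar>" using cmod_le[of z] z by (auto simp: strip_def y_def)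
  ultimately have 1: "1 + cmod z <= 3 * exp (y\<^sup>2)" using zero_le_power2[of y] by linarith
  have "a.SN (\<Phi> \<theta> n z) = cmod (exp ((z - of_real \<theta>)\<^sup>2)) * a.SN (a.dq n g z)" unfolding \<Phi>_def by (rule a.s.N_scale[OF dS])
  also have "\<dots> <= (exp 1 * exp (- y\<^sup>2)) * a.GN g"
    unfolding y_def by (intro mult_mono exp_strip \<theta> z a.dq_props(2)[OF g] a.s.N_nonneg dS) auto
  finally have "a.SN (\<Phi> \<theta> n z) * (1 + cmod z) <= ((exp 1 * exp (- y\<^sup>2)) * a.GN g) * (3 * exp (y\<^sup>2))"
    using G0 by (intro mult_mono 1) auto
  also have "\<dots> = 3 * exp 1 * a.GN g * (exp (- y\<^sup>2) * exp (y\<^sup>2))" by simp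
  also have "exp (- y\<^sup>2) * exp (y\<^sup>2) = 1" unfolding exp_add[symmetric] by simp
  finally show ?thesis by simp
qed

lemma \<Phi>_\<theta>: "\<Phi> \<theta> n (of_real \<theta>) = a.dq n g (of_real \<theta>)"
  by (simp add: \<Phi>_def scaleC_one)

section \<open>The Cauchy property of the quotients and the conclusion\<close>

text \<open>Otherwise there are pairs of quotients with indices tending to infinity that stay
  \<open>\<eta>\<close> apart at \<open>\<theta>\<close>, and kernels that detect this. The same
  pairings tend to \<open>0\<close> at the good points of the line \<open>Re z = \<beta>\<close>,
  and their common bound lets \<open>strip_normal_family\<close> carry this over to
  \<open>\<theta>\<close>.\<close>

lemma dq_cauchy:
  assumes wlur: "weakly_LUR Z nu" and \<theta>: "0 < \<theta>" "\<theta> < 1" and \<eta>: "\<eta> > 0"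
  shows "\<exists>n0. \<forall>n\<ge>n0. \<forall>m\<ge>n0. \<exists>H\<in>a.Fs. H (of_real \<theta>) = a.dq n g (of_real \<theta>) - a.dq m g (of_real \<theta>) \<and> a.bN H < \<eta>"
proof (rule ccontr)
  assume "\<not> ?thesis"
  then have "\<forall>k. \<exists>n m. n >= k \<and> m >= k \<and> (\<forall>H\<in>a.Fs. H (of_real \<theta>) = a.dq n g (of_real \<theta>) - a.dq m g (of_real \<theta>) \<longrightarrow> \<eta> <= a.bN H)"
    by (meson not_less)
  then obtain p q where pq: "!!k::nat. p k >= k" "!!k. q k >= k"
    "!!k H. H \<in> a.Fs ==> H (of_real \<theta>) = a.dq (p k) g (of_real \<theta>) - a.dq (q k) g (of_real \<theta>) ==> \<eta> <= a.bN H"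
    by metis
  have G0: "0 <= a.GN g" by (rule a.Gnorm_nonneg[OF g])
  define F where "F = (%k. \<Phi> \<theta> (p k) - \<Phi> \<theta> (q k))"
  have F: "F k \<in> a.Fs" for k unfolding F_def by (rule csubspace_diff[OF a.csubspace_Fs \<Phi>_Fs[OF \<theta>] \<Phi>_Fs[OF \<theta>]])
  have F\<theta>: "F k (of_real \<theta>) = a.dq (p k) g (of_real \<theta>) - a.dq (q k) g (of_real \<theta>)" for k
    unfolding F_def minus_apply \<Phi>_\<theta> ..
  have FB: "a.SN (F k z) * (1 + cmod z) <= 6 * exp 1 * a.GN g" if z: "z \<in> strip" for k z
  proof -
    have m: "\<Phi> \<theta> n z \<in> a.S" for n by (rule a.s.hol_stripD(1)[OF a.FsD(1)[OF \<Phi>_Fs[OF \<theta>]] z])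
    have "a.SN (F k z) <= a.SN (\<Phi> \<theta> (p k) z) + a.SN (\<Phi> \<theta> (q k) z)" unfolding F_def minus_apply by (rule a.s.N_minus[OF m m])
    then have "a.SN (F k z) * (1 + cmod z) <= (a.SN (\<Phi> \<theta> (p k) z) + a.SN (\<Phi> \<theta> (q k) z)) * (1 + cmod z)"
      by (rule mult_right_mono) simp
    also have "\<dots> = a.SN (\<Phi> \<theta> (p k) z) * (1 + cmod z) + a.SN (\<Phi> \<theta> (q k) z) * (1 + cmod z)" by (rule distrib_right)
    also have "\<dots> <= 3 * exp 1 * a.GN g + 3 * exp 1 * a.GN g" by (intro add_mono \<Phi>_decay \<theta> z)
    finally show ?thesis by simp
  qed
  have "\<exists>K. p.kern K \<and> \<eta> <= 48 * cmod (R (F k (of_real \<theta>)) (K (of_real \<theta>)))" for k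
  proof (rule exists_kernel[OF \<theta> F FB \<eta>])
    fix H assume "H \<in> a.Fs" "H (of_real \<theta>) = F k (of_real \<theta>)"
    then show "\<eta> <= a.bN H" using pq(3) F\<theta> by simp
  qed
  then obtain K where K: "!!k. p.kern (K k)" "!!k. \<eta> <= 48 * cmod (R (F k (of_real \<theta>)) (K k (of_real \<theta>)))" by metis
  \<comment> \<open>The pairings are formed with the undamped quotients: these are bounded, agree
    with \<open>F k\<close> at \<open>\<theta>\<close>, and can be compared directly with
    \<open>v\<close> on the line \<open>Re z = \<beta>\<close>.\<close>
  define d where "d = (%k z. a.dq (p k) g z - a.dq (q k) g z)"
  define h where "h = (%k z. R (d k z))"
  define f where "f = (%k z. h k z (K k z))"
  have dh: "a.s.hol_strip (d k)" for k unfolding d_def by (rule a.s.hol_strip_diff[OF a.dq_props(1)[OF g] a.dq_props(1)[OF g]])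
  have hh: "p.x.s.hol_strip (h k)" for k unfolding h_def by (rule R_hol[OF dh])
  have Kh: "p.wn.hol_strip (K k)" for k using K(1) unfolding p.kern_def by blast
  note dqS = a.s.hol_stripD(1)[OF a.dq_props(1)[OF g]]
  have dB: "a.SN (d k z) <= 2 * a.GN g" if z: "z \<in> strip" for k z
    using a.s.N_minus[OF dqS[OF z] dqS[OF z], of "p k" "q k"] a.dq_props(2)[OF g z, of "p k"] a.dq_props(2)[OF g z, of "q k"] unfolding d_def by linarith
  have d0: "d k (bnd 0 t) \<in> A0" "N0 (d k (bnd 0 t)) <= 2 * a.GN g" for k t
    using a.c0.mem_diff[OF a.dq_props(3)[OF g] a.dq_props(3)[OF g]] a.c0.N_minus[OF a.dq_props(3)[OF g] a.dq_props(3)[OF g], of "p k" t "q k" t]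
      a.dq_props(4)[OF g, of "p k" t] a.dq_props(4)[OF g, of "q k" t] unfolding d_def by (blast, linarith)
  have d1: "d k (bnd 1 t) \<in> A1" "N1 (d k (bnd 1 t)) <= 2 * a.GN g" for k t
    using a.c1.mem_diff[OF a.dq_props(5)[OF g] a.dq_props(5)[OF g]] a.c1.N_minus[OF a.dq_props(5)[OF g] a.dq_props(5)[OF g], of "p k" t "q k" t]
      a.dq_props(6)[OF g, of "p k" t] a.dq_props(6)[OF g, of "q k" t] unfolding d_def by (blast, linarith)
  have hB: "p.x.SN (h k z) <= 2 * a.GN g" if z: "z \<in> strip" for k z
    unfolding h_def using R_sum(2)[OF a.s.hol_stripD(1)[OF dh z]] dB[OF z] by (rule order_trans)
  have h0: "h k (bnd 0 t) \<in> p.X0" "p.m0 (h k (bnd 0 t)) <= 2 * a.GN g" for k t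
    unfolding h_def by (rule R_A0(1)[OF d0(1)], rule order_trans[OF R_A0(2)[OF d0(1)] d0(2)])
  have h1: "h k (bnd 1 t) \<in> p.X1" "p.m1 (h k (bnd 1 t)) <= 2 * a.GN g" for k t
    unfolding h_def by (rule R_A1(1)[OF d1(1)], rule order_trans[OF R_A1(2)[OF d1(1)] d1(2)])
  have \<theta>o: "of_real \<theta> \<in> ostrip" by (rule a.of_real_ostrip[OF \<theta>])
  show False
  proof (rule strip_normal_family[where f = f and C = "2 * a.GN g" and \<beta> = \<beta> and T = good and z = "of_real \<theta>"])
    show "f k holomorphic_on ostrip" for k unfolding f_def by (rule p.pairing_hol(2)[OF hh Kh])
    show "cmod (f k z) <= 2 * a.GN g * (1 / Re z + 1 / (1 - Re z))" if "z \<in> ostrip" for k z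
      unfolding f_def by (rule p.pairing_estimate[OF hh hB K(1) h0 h1 that])
    show "(%k. f k (of_real \<beta> + \<i> * of_real t)) \<longlonglongrightarrow> 0" if t: "t \<in> good" for t
    proof (rule tendstoI)
      fix e :: real assume e: "e > 0"
      define c where "c = 1 / \<beta> + 1 / (1 - \<beta>)"
      have c: "c > 0" using \<beta> by (simp add: c_def add_pos_pos)
      \<comment> \<open>The \<open>3\<close> leaves a strict margin: two errors \<open>e'\<close>
        times \<open>c\<close> amount to 2 e / 3.\<close>
      define e' where "e' = e / (3 * c)"
      have e': "e' > 0" using e c by (simp add: e'_def)
      obtain M where M: "!!n. n >= M ==> R (a.dq n g (pt t)) - v t \<in> U \<and> nu (R (a.dq n g (pt t)) - v t) <= e'"
        using dq_converges[OF t e'] by blast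
      have "dist (f k (of_real \<beta> + \<i> * of_real t)) 0 < e" if k: "k >= M" for k
      proof -
        have z: "pt t \<in> strip" using pt_ostrip ostrip_subset_strip by blast
        have m: "R (a.dq (p k) g (pt t)) - v t \<in> U" "nu (R (a.dq (p k) g (pt t)) - v t) <= e'"
          "R (a.dq (q k) g (pt t)) - v t \<in> U" "nu (R (a.dq (q k) g (pt t)) - v t) <= e'"
          using M[OF order_trans[OF k pq(1)[of k]]] M[OF order_trans[OF k pq(2)[of k]]] by blast+
        \<comment> \<open>Both quotients are close to the same \<open>v t\<close>, which
          cancels.\<close>
        have hk: "h k (pt t) = (R (a.dq (p k) g (pt t)) - v t) - (R (a.dq (q k) g (pt t)) - v t)"
          unfolding h_def d_def R_diff[OF dqS[OF z] dqS[OF z]] by simp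
        have hU: "h k (pt t) \<in> U" unfolding hk by (rule U_diff[OF m(1,3)])
        have hnu: "nu (h k (pt t)) <= 2 * e'"
          using nu_via[OF m(1) U_0 m(3)] nu_comm[OF U_0 m(3)] m(2,4) unfolding hk diff_zero by linarith
        have "cmod (f k (of_real \<beta> + \<i> * of_real t)) <= nu (h k (pt t)) * c"
          using p.pairing_upper[OF \<beta> hU K(1)[of k], of t] unfolding f_def c_def pt_def .
        also have "\<dots> <= 2 * e' * c" using c by (intro mult_right_mono hnu) auto
        also have "\<dots> < e" using e c by (simp add: e'_def)
        finally show ?thesis by simp
      qed
      then show "eventually (%k. dist (f k (of_real \<beta> + \<i> * of_real t)) 0 < e) sequentially"
        using eventually_sequentially by blast
    qed
    fix r :: "nat => nat" assume "(%n. f (r n) (of_real \<theta>)) \<longlonglongrightarrow> 0"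
    then have l: "(%n. 48 * cmod (f (r n) (of_real \<theta>))) \<longlonglongrightarrow> 48 * cmod 0" by (intro tendsto_mult_left tendsto_norm)
    have le: "\<eta> <= 48 * cmod (f k (of_real \<theta>))" for k
      using K(2)[of k] unfolding f_def h_def d_def F\<theta> .
    have "\<eta> <= 48 * cmod 0"
      by (rule LIMSEQ_le_const[OF l], rule exI[of _ 0], intro allI impI, rule le)
    then show False using \<eta> by simp
  qed (use \<beta> good_dense[OF wlur] \<theta>o in auto)
qed

text \<open>The Cauchy property is summed as a telescoping series in \<open>Fspace\<close> with
  geometrically small norms. Adding the first damped quotient gives an element whose value at
  \<open>\<theta>\<close> is the limit of the quotients in the sum norm, that is, the
  derivative.\<close>

theorem derivative_in_lower:
  assumes wlur: "weakly_LUR Z nu" and \<theta>: "0 < \<theta>" "\<theta> < 1"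
  shows "a.Gd g (of_real \<theta>) \<in> lower A0 N0 A1 N1 \<theta>"
proof -
  have \<theta>o: "of_real \<theta> \<in> ostrip" by (rule a.of_real_ostrip[OF \<theta>])
  then have \<theta>s: "of_real \<theta> \<in> strip" using ostrip_subset_strip by blast
  have "\<forall>k::nat. \<exists>n0. \<forall>n\<ge>n0. \<forall>m\<ge>n0. \<exists>H\<in>a.Fs. H (of_real \<theta>) = a.dq n g (of_real \<theta>) - a.dq m g (of_real \<theta>) \<and> a.bN H < (1/2)^k"
    using dq_cauchy[OF wlur \<theta>] by simp
  then obtain \<nu> where \<nu>: "!!k n m. n >= \<nu> k ==> m >= \<nu> k ==>
      \<exists>H\<in>a.Fs. H (of_real \<theta>) = a.dq n g (of_real \<theta>) - a.dq m g (of_real \<theta>) \<and> a.bN H < (1/2)^k"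
    by metis
  \<comment> \<open>The summand \<open>k\<close> makes the indices strictly increasing, and the sum
    keeps each of them beyond \<open>\<nu> k\<close>.\<close>
  define \<mu> where "\<mu> = (%k. k + (\<Sum>i\<le>k. \<nu> i))"
  have "\<nu> k <= (\<Sum>i\<le>k. \<nu> i)" for k by (rule member_le_sum) auto
  then have \<mu>1: "\<nu> k <= \<mu> k" for k unfolding \<mu>_def by (rule trans_le_add2)
  have \<mu>2: "\<mu> k < \<mu> (Suc k)" for k unfolding \<mu>_def by simp
  have "\<exists>H. H \<in> a.Fs \<and> H (of_real \<theta>) = a.dq (\<mu> (Suc k)) g (of_real \<theta>) - a.dq (\<mu> k) g (of_real \<theta>) \<and> a.bN H <= 1 * (1/2)^k" for k
  proof -
    obtain H where H: "H \<in> a.Fs" "H (of_real \<theta>) = a.dq (\<mu> (Suc k)) g (of_real \<theta>) - a.dq (\<mu> k) g (of_real \<theta>)" "a.bN H < (1/2)^k"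
      using \<nu>[OF order_trans[OF \<mu>1[of k] less_imp_le[OF \<mu>2[of k]]] \<mu>1[of k]] by blast
    show ?thesis by (rule exI[of _ H]) (use H in simp)
  qed
  then have "\<forall>k. \<exists>H. H \<in> a.Fs \<and> H (of_real \<theta>) = a.dq (\<mu> (Suc k)) g (of_real \<theta>) - a.dq (\<mu> k) g (of_real \<theta>) \<and> a.bN H <= 1 * (1/2)^k" by blast
  from choice[OF this] obtain H where H: "!!k. H k \<in> a.Fs" "!!k. H k (of_real \<theta>) = a.dq (\<mu> (Suc k)) g (of_real \<theta>) - a.dq (\<mu> k) g (of_real \<theta>)"
    "!!k. a.bN (H k) <= 1 * (1/2)^k"
    by blast
  show ?thesis
  proof (rule a.Fs_series[of H 1, OF H(1,3)])
    fix F assume F: "F \<in> a.Fs" and conv: "!!n z. z \<in> strip ==> a.SN ((\<Sum>k<n. H k z) - F z) <= 2 * 1 * (1/2)^n"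
    define x where "x = a.dq (\<mu> 0) g (of_real \<theta>) + F (of_real \<theta>)"
    note dqS = a.s.hol_stripD(1)[OF a.dq_props(1)[OF g] \<theta>s]
    have xS: "x \<in> a.S" unfolding x_def by (rule a.s.mem_add[OF dqS a.s.hol_stripD(1)[OF a.FsD(1)[OF F] \<theta>s]])
    have tele: "(\<Sum>k<n. H k (of_real \<theta>)) = a.dq (\<mu> n) g (of_real \<theta>) - a.dq (\<mu> 0) g (of_real \<theta>)" for n
      unfolding H(2) by (rule sum_lessThan_telescope)
    have le: "a.SN (a.dq (\<mu> n) g (of_real \<theta>) - x) <= 2 * (1/2)^n" for n
    proof -
      have "a.dq (\<mu> n) g (of_real \<theta>) - x = (\<Sum>k<n. H k (of_real \<theta>)) - F (of_real \<theta>)" unfolding tele x_def by simp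
      then show ?thesis using conv[OF \<theta>s, of n] by simp
    qed
    have l: "(%n. 2 * (1/2)^n) \<longlonglongrightarrow> (0::real)" using tendsto_mult_left[OF LIMSEQ_realpow_zero[of "1/2::real"], of 2] by simp
    have 1: "(%n. a.SN (a.dq (\<mu> n) g (of_real \<theta>) - x)) \<longlonglongrightarrow> 0"
      by (rule Lim_null_comparison[OF always_eventually[OF allI] l]) (use le a.s.N_nonneg[OF a.s.mem_diff[OF dqS xS]] in simp)
    have "strict_mono \<mu>" using \<mu>2 by (rule strict_mono_Suc_iff[THEN iffD2, OF allI])
    from LIMSEQ_subseq_LIMSEQ[OF a.dq_tendsto[OF g \<theta>o] this]
    have 2: "(%n. a.SN (a.dq (\<mu> n) g (of_real \<theta>) - a.Gd g (of_real \<theta>))) \<longlonglongrightarrow> 0" unfolding o_def .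
    have "a.Gd g (of_real \<theta>) = x" by (rule a.s.N_limit_unique[OF dqS a.Gd(1)[OF g \<theta>o] xS 2 1])
    also have "x = (\<Phi> \<theta> (\<mu> 0) + F) (of_real \<theta>)" unfolding x_def plus_fun_apply \<Phi>_\<theta> ..
    finally show ?thesis unfolding lower_def using a.Fs_add[OF \<Phi>_Fs[OF \<theta>] F] by blast
  qed
qed

end

text \<open>Each element of the upper space is the derivative of some \<open>g\<close>, so one orbit
  at a time gives the first inclusion; the converse comes from the primitives of elements of
  \<open>Fspace\<close>.\<close>

theorem (in interp) upper_eq_lower:
  assumes \<beta>: "0 < \<beta>" "\<beta> < 1" and wlur: "weakly_LUR (ncl (p.x.Up \<beta>) (p.x.UpN \<beta>) (R ` a.Up \<beta>)) (p.x.UpN \<beta>)"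
    and \<theta>: "0 < \<theta>" "\<theta> < 1"
  shows "a.Up \<theta> = lower A0 N0 A1 N1 \<theta>"
proof
  show "a.Up \<theta> \<subseteq> lower A0 N0 A1 N1 \<theta>"
  proof
    fix x assume "x \<in> a.Up \<theta>"
    then obtain g where g: "x = a.Gd g (of_real \<theta>)" "g \<in> a.G" unfolding upper_def by blast
    interpret o: orbit A0 A1 N0 N1 g \<beta>
      by (intro orbit.intro interp_axioms orbit_axioms.intro g \<beta>)
    show "x \<in> lower A0 N0 A1 N1 \<theta>" unfolding g(1) by (rule o.derivative_in_lower[OF wlur[folded o.Z_def] \<theta>])
  qed
  show "lower A0 N0 A1 N1 \<theta> \<subseteq> a.Up \<theta>"
    unfolding lower_def using a.lower_subset_upper[OF \<theta>] by blast
qed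

theorem theorem1:
  fixes A0 A1 :: "'v::cvec set" and N0 N1 :: "'v \<Rightarrow> real" and \<beta> :: real
  assumes couple: "banach_couple A0 N0 A1 N1"
    and dense0: "ndense A0 N0 (A0 \<inter> A1)"
    and dense1: "ndense A1 N1 (A0 \<inter> A1)"
    and beta: "0 < \<beta>" "\<beta> < 1"
    and wLUR: "weakly_LUR
       (ncl (upper (Bdual A0 N0 A1 N1 0) (Bdnorm A0 N0 A1 N1 0)
                   (Bdual A0 N0 A1 N1 1) (Bdnorm A0 N0 A1 N1 1) \<beta>)
            (upper_norm (Bdual A0 N0 A1 N1 0) (Bdnorm A0 N0 A1 N1 0)
                        (Bdual A0 N0 A1 N1 1) (Bdnorm A0 N0 A1 N1 1) \<beta>)
            (Rmap A0 N0 A1 N1 ` upper A0 N0 A1 N1 \<beta>))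
       (upper_norm (Bdual A0 N0 A1 N1 0) (Bdnorm A0 N0 A1 N1 0)
                   (Bdual A0 N0 A1 N1 1) (Bdnorm A0 N0 A1 N1 1) \<beta>)"
  shows "\<forall>\<theta>. 0 < \<theta> \<and> \<theta> < 1 \<longrightarrow> upper A0 N0 A1 N1 \<theta> = lower A0 N0 A1 N1 \<theta>"
proof (intro allI impI)
  fix \<theta> :: real assume \<theta>: "0 < \<theta> \<and> \<theta> < 1"
  interpret i: interp A0 A1 N0 N1 by (rule interp.intro[OF couple dense0 dense1])
  show "upper A0 N0 A1 N1 \<theta> = lower A0 N0 A1 N1 \<theta>"
    using i.upper_eq_lower[OF beta wLUR[unfolded i.Bdual_eq]] \<theta> by blast
qed

end
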